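(* Let $X=(X_t)_{t\ge 0}$, $X_0=0$, be a real-valued Lévy process such that neither $X$ nor $-X$ is a subordinator and $X$ is not a compound Poisson process, and suppose that $X$ has no positive jumps. Let $\overline X_t=\sup_{s\le t}X_s$, $g_t=\sup\{s\le t: X_s=\overline X_t\text{ or }X_{s-}=\overline X_t\}$, let $p_t^+$ be the restriction of the law of $X_t$ to $[0,\infty)$, and let $c=\Phi(1)$, where $\Phi$ is the Laplace exponent of the first passage process $T_x=\inf\{t:X_t>x\}$, $x\ge 0$. Let $\tau$ be the ladder time process of $X$, $\mathtt d$ its drift, and $n$ the excursion measure of $\overline X-X$, with excursion lifetime $\zeta$. (1) If $0$ is regular for $(-\infty,0)$, then for $t>0$ the couple $(g_t,\overline X_t)$ has law $$\mathbb P(g_t\in ds,\overline X_t\in dx)=c\,x\,p_s^+(dx)\,n(t-s<\zeta)\,s^{-1}\mathbf 1_{(0,t]}(s)\,ds=c\,n(t-s<\zeta)\,\mathbf 1_{(0,t]}(s)\,\mathbb P(\tau_{cx}\in ds)\,dx.$$ In particular, the density of the law of $\overline X_t$ is given by the function $x\mapsto\int_0^t c\,n(t-s<\zeta)\,\mathbb P(\tau_{cx}\in ds)$. (2) If $0$ is not regular for $(-\infty,0)$, then for all $t>0$, $$\mathbb P(g_t\in ds,\overline X_t\in dx)=c\,x\,n(t-s<\zeta)\,s^{-1}\mathbf 1_{(0,t]}(s)\,p_s^+(dx)\,ds+\mathtt d\,c\,x\,t^{-1}p_t^+(dx)\,\delta_{\{t\}}(ds).$$ Moreover, the following identity between measures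 on $[0,\infty)^3$ holds: $$\mathbb P(g_t\in ds,\overline X_t\in dx)\,dt=c\,n(t-s<\zeta)\,\mathbf 1_{(0,t]}(s)\,\mathbb P(\tau_{cx}\in ds)\,dx\,dt+\mathtt d\,c\,\mathbb P(\tau_{cx}\in dt)\,\delta_{\{t\}}(ds)\,dx.$$
   Context: A Lévy process has càdlàg paths and stationary independent increments; a subordinator is a Lévy process with nondecreasing paths (possibly killed, i.e. sent to $+\infty$ at an independent exponential time, when so specified). The point $0$ is regular for an open half-line $B$ if $\inf\{t>0:X_t\in B\}=0$ a.s. Under the present assumptions $0$ is always regular for $(0,\infty)$. Laplace exponent: $\mathbb E(e^{-qT_x})=e^{-x\Phi(q)}$ for $q>0$ (with $e^{-q\cdot\infty}=0$). Local time and ladder time: $L$ is the local time at $0$ of $\overline X-X$, the unique continuous increasing additive functional with $L_0=0$ a.s., such that the support of $dL_t$ is the closure of $\{t:\overline X_t=X_t\}$, normalized by $\mathbb E\left(\int_0^\infty e^{-t}dL_t\right)=1$. The ladder time process is $\tau_t=\inf\{s:L_s>t\}$ (with $\tau_t=+\infty$ for $t\ge L_\infty$), a possibly killed subordinator; here $T_x=\tau_{cx}$. Its drift coefficient is $\mathtt d\ge0$, so $\int_0^t\mathbf 1_{\{X_s=\overline X_s\}}ds=\mathtt dL_t$. Excursion measure: excursions are càdlàg paths $\varepsilon$ with lifetime $\zeta$ and $\varepsilon_t>0$ for $0<t<\zeta$. Let $G$ be the set of left endpoints of the excursion intervals of $\overline X-X$ away from $0$; for $s\in G$, $\varepsilon^s_u=(\overline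 X-X)_{s+u}$ for $0\le u<\zeta(\varepsilon^s)=\inf\{u>s:\overline X_u=X_u\}-s$, and $\varepsilon^s_u=0$ afterwards. The Itô measure $n$ is characterized by $$\mathbb E\Big(\sum_{s\in G}F(s,\omega,\varepsilon^s)\Big)=\mathbb E\Big(\int_0^\infty dL_s\int F(s,\omega,\varepsilon)\,n(d\varepsilon)\Big)$$ for all nonnegative $F$ that are measurable for the product of the predictable $\sigma$-field and the Borel $\sigma$-field on excursions. *)

theory Defs
  imports "HOL-Probability.Probability"
begin

text \<open>A process indexed by \<open>[0,\<infinity>)\<close> is a function \<open>real \<Rightarrow> 'a \<Rightarrow> real\<close>; its values at negative
  times are never used. Random times are \<open>ereal\<close>-valued, and the infimum of the empty set is \<open>\<infinity>\<close>.\<close>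


section \<open>Levy processes\<close>

definition left_lim :: "(real \<Rightarrow> real) \<Rightarrow> real \<Rightarrow> real" where
  "left_lim f t = Lim (at_left t) f"

definition cadlag :: "(real \<Rightarrow> real) \<Rightarrow> bool" where
  "cadlag f \<longleftrightarrow>
     (\<forall>t\<ge>0. continuous (at_right t) f) \<and> (\<forall>t>0. \<exists>l. (f \<longlongrightarrow> l) (at_left t))"

definition independent_increments :: "'a measure \<Rightarrow> (real \<Rightarrow> 'a \<Rightarrow> real) \<Rightarrow> bool" where
  "independent_increments M X \<longleftrightarrow>
     (\<forall>(m::nat) t. 0 \<le> t 0 \<and> (\<forall>k<m. t k \<le> t (Suc k)) \<longrightarrow>
        prob_space.indep_vars M (\<lambda>_. borel)
          (\<lambda>k \<omega>. if k = 0 then X (t 0) \<omega> else X (t k) \<omega> - X (t (k - 1)) \<omega>) {..m})"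

definition stationary_increments :: "'a measure \<Rightarrow> (real \<Rightarrow> 'a \<Rightarrow> real) \<Rightarrow> bool" where
  "stationary_increments M X \<longleftrightarrow>
     (\<forall>s\<ge>0. \<forall>h\<ge>0.
        distr M borel (\<lambda>\<omega>. X (s + h) \<omega> - X s \<omega>) = distr M borel (\<lambda>\<omega>. X h \<omega> - X 0 \<omega>))"

definition levy_process :: "'a measure \<Rightarrow> (real \<Rightarrow> 'a \<Rightarrow> real) \<Rightarrow> bool" where
  "levy_process M X \<longleftrightarrow>
     (\<forall>t\<ge>0. X t \<in> borel_measurable M) \<and>
     (AE \<omega> in M. X 0 \<omega> = 0) \<and>
     (\<forall>\<omega>\<in>space M. cadlag (\<lambda>t. X t \<omega>)) \<and>
     independent_increments M X \<and> stationary_increments M X"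

definition subordinator :: "'a measure \<Rightarrow> (real \<Rightarrow> 'a \<Rightarrow> real) \<Rightarrow> bool" where
  "subordinator M X \<longleftrightarrow>
     levy_process M X \<and> (AE \<omega> in M. mono_on {0..} (\<lambda>t. X t \<omega>))"

definition poisson_process :: "'a measure \<Rightarrow> real \<Rightarrow> (real \<Rightarrow> 'a \<Rightarrow> nat) \<Rightarrow> bool" where
  "poisson_process M r N \<longleftrightarrow>
     levy_process M (\<lambda>t \<omega>. real (N t \<omega>)) \<and>
     (\<forall>t>0. distr M (count_space UNIV) (N t) = measure_pmf (poisson_pmf (r * t)))"

definition compound_poisson :: "'a measure \<Rightarrow> (real \<Rightarrow> 'a \<Rightarrow> real) \<Rightarrow> bool" where
  "compound_poisson M X \<longleftrightarrow>
     (\<exists>r N (\<xi> :: nat \<Rightarrow> 'a \<Rightarrow> real).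
        0 < r \<and> poisson_process M r N \<and>
        prob_space.indep_vars M (\<lambda>_. borel) \<xi> UNIV \<and>
        (\<forall>k. distr M borel (\<xi> k) = distr M borel (\<xi> 0)) \<and>
        prob_space.indep_set M
          (sets (vimage_algebra (space M) (\<lambda>\<omega>. \<lambda>t\<in>{0..}. N t \<omega>)
             (Pi\<^sub>M {0..} (\<lambda>_. count_space UNIV))))
          (sets (vimage_algebra (space M) (\<lambda>\<omega> k. \<xi> k \<omega>) (Pi\<^sub>M UNIV (\<lambda>_. borel)))) \<and>
        (AE \<omega> in M. \<forall>t\<ge>0. X t \<omega> = (\<Sum>k<N t \<omega>. \<xi> k \<omega>)))"

definition no_positive_jumps :: "'a measure \<Rightarrow> (real \<Rightarrow> 'a \<Rightarrow> real) \<Rightarrow> bool" where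
  "no_positive_jumps M X \<longleftrightarrow> (AE \<omega> in M. \<forall>t>0. X t \<omega> \<le> left_lim (\<lambda>s. X s \<omega>) t)"

definition regular_for :: "'a measure \<Rightarrow> (real \<Rightarrow> 'a \<Rightarrow> real) \<Rightarrow> real set \<Rightarrow> bool" where
  "regular_for M X B \<longleftrightarrow> (AE \<omega> in M. (INF t\<in>{t. 0 < t \<and> X t \<omega> \<in> B}. ereal t) = 0)"


section \<open>Supremum, reflected process, first passage\<close>

definition running_sup :: "(real \<Rightarrow> 'a \<Rightarrow> real) \<Rightarrow> real \<Rightarrow> 'a \<Rightarrow> real" where
  "running_sup X t \<omega> = (SUP s\<in>{0..t}. X s \<omega>)"

definition last_sup_time :: "(real \<Rightarrow> 'a \<Rightarrow> real) \<Rightarrow> real \<Rightarrow> 'a \<Rightarrow> real" where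
  "last_sup_time X t \<omega> =
     Sup {s. 0 \<le> s \<and> s \<le> t \<and>
             (X s \<omega> = running_sup X t \<omega> \<or>
              0 < s \<and> left_lim (\<lambda>u. X u \<omega>) s = running_sup X t \<omega>)}"

definition sup_law :: "'a measure \<Rightarrow> (real \<Rightarrow> 'a \<Rightarrow> real) \<Rightarrow> real \<Rightarrow> (real \<times> real) measure" where
  "sup_law M X t =
     distr M (borel \<Otimes>\<^sub>M borel) (\<lambda>\<omega>. (last_sup_time X t \<omega>, running_sup X t \<omega>))"

definition pos_law :: "'a measure \<Rightarrow> (real \<Rightarrow> 'a \<Rightarrow> real) \<Rightarrow> real \<Rightarrow> real measure" where
  "pos_law M X t = density (distr M borel (X t)) (indicator {0..})"

definition reflected :: "(real \<Rightarrow> 'a \<Rightarrow> real) \<Rightarrow> real \<Rightarrow> 'a \<Rightarrow> real" where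
  "reflected X t \<omega> = running_sup X t \<omega> - X t \<omega>"

definition zero_set :: "(real \<Rightarrow> 'a \<Rightarrow> real) \<Rightarrow> 'a \<Rightarrow> real set" where
  "zero_set X \<omega> = {t. 0 \<le> t \<and> running_sup X t \<omega> = X t \<omega>}"

definition first_passage :: "(real \<Rightarrow> 'a \<Rightarrow> real) \<Rightarrow> real \<Rightarrow> 'a \<Rightarrow> ereal" where
  "first_passage X x \<omega> = (INF t\<in>{t. 0 \<le> t \<and> x < X t \<omega>}. ereal t)"

definition exp_time :: "real \<Rightarrow> ereal \<Rightarrow> real" where
  "exp_time q u = (if u = \<infinity> then 0 else exp (- (q * real_of_ereal u)))"

definition laplace_exponent :: "'a measure \<Rightarrow> (real \<Rightarrow> 'a \<Rightarrow> ereal) \<Rightarrow> (real \<Rightarrow> real) \<Rightarrow> bool" where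
  "laplace_exponent M T \<Phi> \<longleftrightarrow>
     (\<forall>q>0. \<forall>x\<ge>0. (\<integral>\<omega>. exp_time q (T x \<omega>) \<partial>M) = exp (- (x * \<Phi> q)))"

text \<open>The restriction to \<open>[0,\<infinity>)\<close> of the law of a random time.\<close>

definition finite_law :: "'a measure \<Rightarrow> ('a \<Rightarrow> ereal) \<Rightarrow> real measure" where
  "finite_law M T =
     distr (restrict_space M {\<omega>\<in>space M. T \<omega> < \<infinity>}) borel (\<lambda>\<omega>. real_of_ereal (T \<omega>))"


section \<open>Local time and ladder time process\<close>

text \<open>The natural filtration, augmented by the null sets belonging to \<open>M\<close> itself, so that no
  completeness of \<open>M\<close> is needed.\<close>

definition filt :: "'a measure \<Rightarrow> (real \<Rightarrow> 'a \<Rightarrow> real) \<Rightarrow> real \<Rightarrow> 'a measure" where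
  "filt M X t =
     sigma (space M) ({X s -` B \<inter> space M | s B. s \<in> {0..t} \<and> B \<in> sets borel} \<union> null_sets M)"

definition path_from :: "(real \<Rightarrow> 'a \<Rightarrow> real) \<Rightarrow> real \<Rightarrow> 'a \<Rightarrow> (real \<Rightarrow> real)" where
  "path_from Y s \<omega> = (\<lambda>u\<in>{0..}. Y (s + u) \<omega>)"

text \<open>\<open>L\<^sub>s\<^sub>+\<^sub>t = L\<^sub>s + L\<^sub>t \<circ> \<theta>\<^sub>s\<close>. Since the underlying space need not carry shift operators, \<open>L\<close> is
  written as a functional \<open>\<Lambda>\<close> of the path of \<open>Y\<close>, and the shift acts on that path.\<close>

definition additive_functional ::
    "'a measure \<Rightarrow> (real \<Rightarrow> 'a \<Rightarrow> real) \<Rightarrow> (real \<Rightarrow> 'a \<Rightarrow> real) \<Rightarrow> bool" where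
  "additive_functional M Y L \<longleftrightarrow>
     (\<exists>\<Lambda> :: real \<Rightarrow> (real \<Rightarrow> real) \<Rightarrow> real.
        (\<forall>t\<ge>0. \<Lambda> t \<in> borel_measurable (Pi\<^sub>M {0..} (\<lambda>_. borel))) \<and>
        (AE \<omega> in M. \<forall>t\<ge>0.
           L t \<omega> = \<Lambda> t (path_from Y 0 \<omega>) \<and>
           (\<forall>s\<ge>0. L (s + t) \<omega> = L s \<omega> + \<Lambda> t (path_from Y s \<omega>))))"

definition stieltjes :: "(real \<Rightarrow> 'a \<Rightarrow> real) \<Rightarrow> 'a \<Rightarrow> real measure" where
  "stieltjes L \<omega> = interval_measure (\<lambda>t. L (max 0 t) \<omega>)"

definition measure_support :: "'b::topological_space measure \<Rightarrow> 'b set" where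
  "measure_support \<mu> = {x. \<forall>U. open U \<and> x \<in> U \<longrightarrow> 0 < emeasure \<mu> U}"

definition sup_local_time ::
    "'a measure \<Rightarrow> (real \<Rightarrow> 'a \<Rightarrow> real) \<Rightarrow> (real \<Rightarrow> 'a \<Rightarrow> real) \<Rightarrow> bool" where
  "sup_local_time M X L \<longleftrightarrow>
     (\<forall>t\<ge>0. L t \<in> borel_measurable (filt M X t)) \<and>
     (\<forall>\<omega>\<in>space M. continuous_on {0..} (\<lambda>t. L t \<omega>) \<and> mono_on {0..} (\<lambda>t. L t \<omega>)) \<and>
     (AE \<omega> in M. L 0 \<omega> = 0) \<and>
     additive_functional M (reflected X) L \<and>
     (AE \<omega> in M. measure_support (stieltjes L \<omega>) = closure (zero_set X \<omega>)) \<and>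
     (\<integral>\<^sup>+\<omega>. (\<integral>\<^sup>+t\<in>{0..}. ennreal (exp (- t)) \<partial>stieltjes L \<omega>) \<partial>M) = 1"

definition ladder_time :: "(real \<Rightarrow> 'a \<Rightarrow> real) \<Rightarrow> real \<Rightarrow> 'a \<Rightarrow> ereal" where
  "ladder_time L u \<omega> = (INF s\<in>{s. 0 \<le> s \<and> u < L s \<omega>}. ereal s)"

text \<open>\<open>d\<close> is the drift in the Levy--Khintchine formula of a possibly killed subordinator
  (killing rate \<open>k\<close>, Levy measure \<open>\<pi>\<close>).\<close>

definition drift_coefficient :: "'a measure \<Rightarrow> (real \<Rightarrow> 'a \<Rightarrow> ereal) \<Rightarrow> real \<Rightarrow> bool" where
  "drift_coefficient M T d \<longleftrightarrow>
     0 \<le> d \<and>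
     (\<exists>(k::real) (\<pi> :: real measure).
        0 \<le> k \<and> sets \<pi> = sets borel \<and> emeasure \<pi> {..0} = 0 \<and>
        (\<integral>\<^sup>+y. ennreal (min 1 y) \<partial>\<pi>) < \<infinity> \<and>
        laplace_exponent M T (\<lambda>q. k + d * q + (\<integral>y. (1 - exp (- (q * y))) \<partial>\<pi>)))"


section \<open>Excursion measure\<close>

definition lifetime :: "(real \<Rightarrow> real) \<Rightarrow> ereal" where
  "lifetime \<epsilon> = (INF t\<in>{t. 0 < t \<and> \<epsilon> t = 0}. ereal t)"

definition excursions :: "(real \<Rightarrow> real) set" where
  "excursions =
     {\<epsilon> \<in> extensional {0..}. cadlag \<epsilon> \<and> 0 < lifetime \<epsilon> \<and>
        (\<forall>t>0. ereal t < lifetime \<epsilon> \<longrightarrow> 0 < \<epsilon> t) \<and>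
        (\<forall>t\<ge>0. lifetime \<epsilon> \<le> ereal t \<longrightarrow> \<epsilon> t = 0)}"

text \<open>On cadlag paths the Borel field is generated by the coordinates.\<close>

definition excursion_space :: "(real \<Rightarrow> real) measure" where
  "excursion_space = restrict_space (Pi\<^sub>M {0..} (\<lambda>_. borel)) excursions"

definition next_zero :: "(real \<Rightarrow> 'a \<Rightarrow> real) \<Rightarrow> real \<Rightarrow> 'a \<Rightarrow> ereal" where
  "next_zero X s \<omega> = (INF u\<in>{u. s < u \<and> running_sup X u \<omega> = X u \<omega>}. ereal u)"

text \<open>Excursion intervals are the connected components of the complement of the closure of the
  zero set; the reflected process need not vanish at their left endpoints, as it may jump there.\<close>

definition left_endpoints :: "(real \<Rightarrow> 'a \<Rightarrow> real) \<Rightarrow> 'a \<Rightarrow> real set" where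
  "left_endpoints X \<omega> = {s \<in> closure (zero_set X \<omega>). ereal s < next_zero X s \<omega>}"

definition excursion_at :: "(real \<Rightarrow> 'a \<Rightarrow> real) \<Rightarrow> real \<Rightarrow> 'a \<Rightarrow> (real \<Rightarrow> real)" where
  "excursion_at X s \<omega> =
     (\<lambda>u\<in>{0..}. if ereal (s + u) < next_zero X s \<omega> then reflected X (s + u) \<omega> else 0)"

definition predictable :: "'a measure \<Rightarrow> (real \<Rightarrow> 'a \<Rightarrow> real) \<Rightarrow> (real \<times> 'a) measure" where
  "predictable M X =
     sigma ({0..} \<times> space M)
       ({{0} \<times> A | A. A \<in> sets (filt M X 0)} \<union>
        {{s<..t} \<times> A | s t A. 0 \<le> s \<and> s < t \<and> A \<in> sets (filt M X s)})"

definition excursion_measure ::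
    "'a measure \<Rightarrow> (real \<Rightarrow> 'a \<Rightarrow> real) \<Rightarrow> (real \<Rightarrow> 'a \<Rightarrow> real) \<Rightarrow> (real \<Rightarrow> real) measure \<Rightarrow> bool"
where
  "excursion_measure M X L n \<longleftrightarrow>
     sets n = sets excursion_space \<and>
     (\<forall>F :: (real \<times> 'a) \<times> (real \<Rightarrow> real) \<Rightarrow> ennreal.
        F \<in> borel_measurable (predictable M X \<Otimes>\<^sub>M excursion_space) \<longrightarrow>
        (\<integral>\<^sup>+\<omega>. (\<integral>\<^sup>+s. F ((s, \<omega>), excursion_at X s \<omega>) \<partial>count_space (left_endpoints X \<omega>)) \<partial>M) =
        (\<integral>\<^sup>+\<omega>. (\<integral>\<^sup>+s\<in>{0..}. (\<integral>\<^sup>+\<epsilon>. F ((s, \<omega>), \<epsilon>) \<partial>n) \<partial>stieltjes L \<omega>) \<partial>M))"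

definition lifetime_tail :: "(real \<Rightarrow> real) measure \<Rightarrow> real \<Rightarrow> ennreal" where
  "lifetime_tail n r = emeasure n {\<epsilon> \<in> space n. ereal r < lifetime \<epsilon>}"

end

theory Submission
  imports Defs "HOL-Real_Asymp.Real_Asymp"
begin

text \<open>Write \<open>S\<close> for the running supremum, \<open>R = S - X\<close> and \<open>T x\<close> for the first passage time above \<open>x\<close>.
  A continuous additive functional \<open>A\<close> that grows only when \<open>R = 0\<close> satisfies \<open>A = a S\<close>: by the strong Markov
  property \<open>A (T x)\<close> has independent increments in \<open>x\<close>, the normalised exponentials of it form a martingale
  without quadratic variation, so \<open>A (T x)\<close> is deterministic and linear. Hence \<open>L = c S\<close> and the ladder
  time at \<open>c x\<close> is \<open>T x\<close>; likewise the time spent at the supremum is \<open>a S\<close> for some \<open>a\<close>.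

  The compensation formula, applied to the only excursion straddling \<open>t\<close>, gives the part of the law carried
  by \<open>R t \<noteq> 0\<close> in terms of \<open>T x\<close>, and Kendall's identity \<open>P (T x \<in> ds) dx = (x / s) P (X s \<in> dx) ds\<close>, obtained from
  Laplace transforms, gives the other form. On \<open>R t = 0\<close>, time reversal replaces the event by \<open>X \<ge> 0\<close> on \<open>[0, t]\<close>,
  which is null in the regular case. Otherwise \<open>P (X t \<in> dx, R t = 0) = a (x / t) P (X t \<in> dx)\<close> holds for almost
  all \<open>t\<close> by the occupation formula, and for all \<open>t\<close> since after reversal both sides are left continuous.
  Total mass one gives \<open>\<Phi> q / q = c N q + a\<close> with \<open>N q \<longlonglongrightarrow> 0\<close>, and Levy--Khintchine gives
  \<open>\<Phi> q / (c q) \<longlonglongrightarrow> d\<close>, so \<open>a = c d\<close>.\<close>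

text \<open>A monotone functional leaves no room for a nontrivial martingale:
  \<open>exp (- A)\<close> decreases in the level and its normalising factor increases, so the
  product is continuous of bounded variation and its sums of squared increments vanish on fine
  grids, while their expectation is the same for every grid. Passage times may be infinite; these
  expectations are therefore restricted to paths that pass one fixed final level, and that level
  must be common to the whole grid for the sum to telescope. There are no shift operators, and
  \<Lambda> is measurable for each fixed time only. Random times are approached from the right
  through dyadic times, and path properties are read off rational times. The derivative of \<Phi>
  behind Kendall's identity enters as a constant \<open>C q\<close>: the resolvent of rate
  \<open>q\<close> has density \<open>C q * exp (- (x * \<Phi> q))\<close> on the positive
  half-line, and \<open>C q\<close> is the limit of difference quotients of \<Phi> from the left.
  The fixed time \<open>t\<close> is delicate because the indicator of R t = 0 has no continuity in
  \<open>t\<close>; the event that X stays nonnegative on [0, t], produced by reversal, decreases in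
  \<open>t\<close>.\<close>

abbreviation (input) "ind \<equiv> indicator"

abbreviation borel2 :: "(real \<times> real) measure" where
  "borel2 \<equiv> borel \<Otimes>\<^sub>M borel"

abbreviation lebesgue_nn :: "(real \<Rightarrow> ennreal) \<Rightarrow> ennreal" (binder "\<L> " 10) where
  "lebesgue_nn \<equiv> integral\<^sup>N lborel"

abbreviation expm :: "real \<Rightarrow> ennreal" where
  "expm x \<equiv> ennreal (exp (- x))"

section \<open>Paths without positive jumps\<close>

lemma cadlag_right:
  assumes "cadlag f" "0 \<le> t" shows "(f \<longlongrightarrow> f t) (at_right t)"
  using assms by (auto simp: cadlag_def continuous_within)

lemma cadlag_left:
  assumes "cadlag f" "0 < t" shows "(f \<longlongrightarrow> left_lim f t) (at_left t)"
proof -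
  from assms obtain l where l: "(f \<longlongrightarrow> l) (at_left t)" by (auto simp: cadlag_def)
  then have "left_lim f t = l" unfolding left_lim_def by (intro tendsto_Lim) auto
  with l show ?thesis by simp
qed

lemma left_lim_unique:
  fixes t :: real
  assumes "(f \<longlongrightarrow> l) (at_left t)" shows "left_lim f t = l"
  unfolding left_lim_def using assms by (intro tendsto_Lim) auto

text \<open>Compactness for cadlag functions: near each point the function is controlled by its
  value, its left limit and right continuity, so local bounds from \<open>T\<close> exist and
  Bolzano's principle glues them. Finitely many bounds combine to their maximum, which again lies in
  \<open>T\<close>. With \<open>T = UNIV\<close> this gives boundedness; with \<open>T\<close> the
  reals below the supremum it gives attainment.\<close>

lemma cadlag_uniform_bound:
  fixes T :: "real set"
  assumes f: "cadlag f" and r: "0 \<le> r" "r \<le> t" and T: "T \<noteq> {}"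
    and A: "\<And>u. r \<le> u ==> u \<le> t ==> \<exists>k\<in>T. f u < k"
    and B: "\<And>u. r < u ==> u \<le> t ==> \<exists>k\<in>T. left_lim f u < k"
  shows "\<exists>k\<in>T. \<forall>u\<in>{r..t}. f u \<le> k"
proof -
  define P where "P = (\<lambda>a b. \<exists>k\<in>T. \<forall>v. a \<le> v \<and> v \<le> b \<and> r \<le> v \<and> v \<le> t \<longrightarrow> f v \<le> k)"
  have "P r t"
  proof (rule Bolzano[OF r(2)])
    fix a b c assume "P a b" "P b c" "a \<le> b" "b \<le> c"
    then obtain k l where k: "k \<in> T" "\<And>v. a \<le> v ==> v \<le> b ==> r \<le> v ==> v \<le> t ==> f v \<le> k"
      and l: "l \<in> T" "\<And>v. b \<le> v ==> v \<le> c ==> r \<le> v ==> v \<le> t ==> f v \<le> l"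
      unfolding P_def by blast
    have "f v \<le> max k l" if "a \<le> v" "v \<le> c" "r \<le> v" "v \<le> t" for v
      using k(2)[of v] l(2)[of v] that by (cases "v \<le> b") (auto simp: max_def)
    moreover have "max k l \<in> T" using k l by (auto simp: max_def)
    ultimately show "P a c" unfolding P_def by blast
  next
    fix x assume x: "r \<le> x" "x \<le> t"
    obtain k where k: "k \<in> T" "f x < k" using A x by blast
    have "eventually (\<lambda>v. f v < k) (at_right x)"
      using cadlag_right[OF f, of x] r x k by (auto intro: order_tendstoD)
    then obtain b where b: "b > x" "\<And>v. x < v ==> v < b ==> f v < k"
      by (auto simp: eventually_at_right_field)
    \<comment> \<open>At \<open>x = r\<close> nothing of the interval lies to the left, so any bound
      will do there.\<close>
    have "\<exists>a<x. \<exists>l\<in>T. \<forall>v. a < v \<and> v < x \<and> r \<le> v \<longrightarrow> f v \<le> l"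
    proof (cases "r < x")
      case True
      obtain l where l: "l \<in> T" "left_lim f x < l" using B True x by blast
      have "eventually (\<lambda>v. f v < l) (at_left x)"
        using cadlag_left[OF f, of x] r True l by (auto intro: order_tendstoD)
      then obtain a where "a < x" "\<And>v. a < v ==> v < x ==> f v < l"
        by (auto simp: eventually_at_left_field)
      then show ?thesis using l by (intro exI[of _ a]) (auto intro!: bexI[of _ l] less_imp_le)
    next
      case False
      then show ?thesis using k by (intro exI[of _ "x - 1"]) (auto intro!: bexI[of _ k])
    qed
    then obtain a l where a: "a < x" and l: "l \<in> T" "\<And>v. a < v ==> v < x ==> r \<le> v ==> f v \<le> l"
      by blast
    show "\<exists>d>0. \<forall>a b. a \<le> x \<and> x \<le> b \<and> b - a < d \<longrightarrow> P a b"
    proof (intro exI[of _ "min (x - a) (b - x)"] conjI allI impI)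
      show "0 < min (x - a) (b - x)" using a b by auto
      fix a' b' assume h: "a' \<le> x \<and> x \<le> b' \<and> b' - a' < min (x - a) (b - x)"
      have "f v \<le> max k l" if "a' \<le> v" "v \<le> b'" "r \<le> v" for v
      proof -
        consider "v < x" | "v = x" | "x < v" by linarith
        then show ?thesis
        proof cases
          case 1 then show ?thesis using l(2)[of v] h that by auto
        next
          case 2 then show ?thesis using k by auto
        next
          case 3 then show ?thesis using b(2)[of v] h that by auto
        qed
      qed
      moreover have "max k l \<in> T" using k l by (auto simp: max_def)
      ultimately show "P a' b'" unfolding P_def by blast
    qed
  qed
  then show ?thesis unfolding P_def by (metis atLeastAtMost_iff)
qed

lemma cadlag_bdd_above:
  assumes "cadlag f" "0 \<le> r" shows "bdd_above (f ` {r..t})"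
proof (cases "r \<le> t")
  case True
  have "\<exists>k\<in>UNIV. \<forall>u\<in>{r..t}. f u \<le> k"
    by (rule cadlag_uniform_bound[OF assms(1,2) True]) (auto intro: gt_ex)
  then show ?thesis by (auto simp: bdd_above_def)
qed auto

text \<open>A cadlag function may approach its supremum only from the left of a jump, hence the
  alternative with \<open>left_lim\<close>. If neither form of attainment occurred, the compactness
  lemma would give a bound strictly below the supremum.\<close>

lemma cadlag_sup_attained:
  assumes f: "cadlag f" and r: "0 \<le> r" "r \<le> t"
  obtains u where "r \<le> u" "u \<le> t"
    "f u = (SUP s\<in>{r..t}. f s) \<or> r < u \<and> left_lim f u = (SUP s\<in>{r..t}. f s)"
proof (rule ccontr)
  note bdd = cadlag_bdd_above[OF f r(1), of t]
  let ?S = "SUP s\<in>{r..t}. f s"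
  assume "\<not> thesis"
  then have n: "\<And>u. r \<le> u ==> u \<le> t ==> f u \<noteq> ?S" "\<And>u. r < u ==> u \<le> t ==> left_lim f u \<noteq> ?S"
    using that[of u for u] by (blast intro: less_imp_le)+
  have le: "f u \<le> ?S" if "r \<le> u" "u \<le> t" for u
    using that bdd by (intro cSUP_upper) auto
  have le2: "left_lim f u \<le> ?S" if "r < u" "u \<le> t" for u
  proof (rule tendsto_upperbound[OF cadlag_left[OF f]])
    show "0 < u" using that r by auto
    have "eventually (\<lambda>v. v \<in> {r<..<u}) (at_left u)"
      using that by (intro eventually_at_leftI[of r]) auto
    then show "\<forall>\<^sub>F v in at_left u. f v \<le> ?S"
      by eventually_elim (use that in \<open>auto intro: le\<close>)
  qed auto
  have "\<exists>k\<in>{..<?S}. \<forall>u\<in>{r..t}. f u \<le> k"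
  proof (rule cadlag_uniform_bound[OF f r])
    show "{..<?S} \<noteq> {}" by (auto intro: lt_ex)
    show "\<exists>k\<in>{..<?S}. f u < k" if "r \<le> u" "u \<le> t" for u
      using le[OF that] n(1)[OF that] dense[of "f u" ?S] by force
    show "\<exists>k\<in>{..<?S}. left_lim f u < k" if "r < u" "u \<le> t" for u
      using le2[OF that] n(2)[OF that] dense[of "left_lim f u" ?S] by force
  qed
  then obtain k where "k < ?S" "\<And>u. u \<in> {r..t} ==> f u \<le> k" by auto
  moreover from this have "?S \<le> k" using r by (intro cSUP_least) auto
  ultimately show False by simp
qed

lemma cadlag_le_left_lim:
  assumes "cadlag f" "0 \<le> r" "r < u" "\<And>v. r < v ==> v < u ==> f v \<le> k"
  shows "left_lim f u \<le> k"
proof (rule tendsto_upperbound[OF cadlag_left[OF assms(1)]])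
  have "eventually (\<lambda>v. v \<in> {r<..<u}) (at_left u)"
    using assms by (intro eventually_at_leftI[of r]) auto
  then show "\<forall>\<^sub>F v in at_left u. f v \<le> k"
    by eventually_elim (use assms in auto)
qed (use assms in auto)

lemma cadlag_right_rat:
  assumes "cadlag f" "0 \<le> u" "y < f u" "u < t"
  shows "\<exists>s\<in>\<rat>. u < s \<and> s < t \<and> y < f s"
proof -
  have "eventually (\<lambda>v. y < f v) (at_right u)"
    using cadlag_right[OF assms(1,2)] assms by (auto intro: order_tendstoD)
  then obtain b where b: "b > u" "\<And>v. u < v ==> v < b ==> y < f v"
    by (auto simp: eventually_at_right_field)
  obtain q where "q \<in> \<rat>" "u < q" "q < min b t"
    using Rats_dense_in_real[of u "min b t"] b assms by auto
  then show ?thesis using b by auto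
qed

lemma running_sup_upper:
  assumes "cadlag (\<lambda>t. X t w)" "0 \<le> s" "s \<le> t" shows "X s w \<le> running_sup X t w"
  unfolding running_sup_def using cadlag_bdd_above[OF assms(1), of 0 t] assms(2,3)
  by (intro cSUP_upper) auto

lemma running_sup_mono:
  assumes "cadlag (\<lambda>t. X t w)" "0 \<le> s" "s \<le> t"
  shows "running_sup X s w \<le> running_sup X t w"
  unfolding running_sup_def using cadlag_bdd_above[OF assms(1), of 0 t] assms(2,3)
  by (intro cSUP_subset_mono) auto

lemma less_running_sup_iff:
  assumes "cadlag (\<lambda>t. X t w)" "0 \<le> t"
  shows "y < running_sup X t w \<longleftrightarrow> (\<exists>s. 0 \<le> s \<and> s \<le> t \<and> y < X s w)"
  unfolding running_sup_def using cadlag_bdd_above[OF assms(1), of 0 t] assms(2)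
  by (subst less_cSUP_iff) (auto simp: Bex_def)

text \<open>Right continuity moves a witness \<open>s < t\<close> to a rational one on its right,
  still below \<open>t\<close>. The endpoint has no room on its right and stays as a separate case.
  Countably many times make suprema measurable.\<close>

lemma less_SUP_rat_iff:
  assumes "cadlag (\<lambda>t. X t w)" "0 \<le> r" "r \<le> t"
  shows "y < (SUP s\<in>{r..t}. X s w) \<longleftrightarrow> y < X t w \<or> (\<exists>s\<in>\<rat>. r \<le> s \<and> s < t \<and> y < X s w)"
proof -
  have "y < (SUP s\<in>{r..t}. X s w) \<longleftrightarrow> (\<exists>s. r \<le> s \<and> s \<le> t \<and> y < X s w)"
    using cadlag_bdd_above[OF assms(1,2), of t] assms(3) by (subst less_cSUP_iff) (auto simp: Bex_def)
  also have "\<dots> \<longleftrightarrow> y < X t w \<or> (\<exists>s\<in>\<rat>. r \<le> s \<and> s < t \<and> y < X s w)"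
  proof
    assume "\<exists>s. r \<le> s \<and> s \<le> t \<and> y < X s w"
    then obtain s where s: "r \<le> s" "s \<le> t" "y < X s w" by auto
    show "y < X t w \<or> (\<exists>s\<in>\<rat>. r \<le> s \<and> s < t \<and> y < X s w)"
    proof (cases "s = t")
      case True
      then show ?thesis using s by auto
    next
      case False
      have "\<exists>q\<in>\<rat>. s < q \<and> q < t \<and> y < X q w"
        using cadlag_right_rat[OF assms(1), of s y t] s assms False by auto
      then show ?thesis using s by force
    qed
  qed (use assms in auto)
  finally show ?thesis .
qed

lemma ereal_INF_less_iff:
  "(INF t\<in>{t. P t}. ereal t) < z \<longleftrightarrow> (\<exists>t. P t \<and> ereal t < z)"
  by (auto simp: INF_less_iff)

lemma first_passage_less_iff:
  "first_passage X x w < z \<longleftrightarrow> (\<exists>t\<ge>0. x < X t w \<and> ereal t < z)"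
  unfolding first_passage_def ereal_INF_less_iff by auto

lemma first_passage_less_rat_iff:
  assumes "cadlag (\<lambda>t. X t w)"
  shows "first_passage X x w < ereal z \<longleftrightarrow> (\<exists>t\<in>\<rat>. 0 \<le> t \<and> t < z \<and> x < X t w)"
proof
  assume "first_passage X x w < ereal z"
  then obtain t where t: "t \<ge> 0" "x < X t w" "t < z" by (auto simp: first_passage_less_iff)
  with cadlag_right_rat[OF assms, of t x z] show "\<exists>t\<in>\<rat>. 0 \<le> t \<and> t < z \<and> x < X t w"
    by (meson le_less_trans less_imp_le)
qed (auto simp: first_passage_less_iff)

lemma first_passage_nonneg [simp]: "0 \<le> first_passage X x w"
  unfolding first_passage_def by (intro INF_greatest) auto

lemma first_passage_mono: "x \<le> y ==> first_passage X x w \<le> first_passage X y w"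
  unfolding first_passage_def by (intro INF_superset_mono) auto

lemma before_first_passage:
  "0 \<le> t ==> ereal t < first_passage X x w ==> X t w \<le> x"
  using first_passage_less_iff[of X x w "first_passage X x w"] by force

text \<open>The almost sure path properties, isolated for one \<open>w\<close>: the arguments in
  this locale are deterministic, and \<open>snp_AE\<close> provides it for almost every
  path.\<close>

locale snp =
  fixes X :: "real => 'a => real" and w :: 'a
  assumes cad: "cadlag (\<lambda>t. X t w)" and X0: "X 0 w = 0"
    and npj: "\<And>t. 0 < t ==> X t w \<le> left_lim (\<lambda>s. X s w) t"
begin

abbreviation "S t \<equiv> running_sup X t w"
abbreviation "T x \<equiv> first_passage X x w"

lemma S0 [simp]: "S 0 = 0"
  by (simp add: running_sup_def X0)

lemma S_nonneg: "0 \<le> t ==> 0 \<le> S t"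
  using running_sup_upper[of X w, OF cad, of 0 t] X0 by simp

text \<open>Without positive jumps a value above \<open>y\<close> is announced from the left:
  otherwise the left limit would be at most \<open>y\<close>.\<close>

lemma left_exceed:
  assumes "0 < s" "y < X s w" "0 \<le> r" "r < s"
  shows "\<exists>u. r < u \<and> u < s \<and> y < X u w"
proof (rule ccontr)
  assume "\<not> ?thesis"
  then have "left_lim (\<lambda>s. X s w) s \<le> y"
    using assms by (intro cadlag_le_left_lim[OF cad, of r]) (auto simp: not_less, meson not_le)
  then show False using npj[OF assms(1)] assms(2) by simp
qed

lemma SUP_less_rat_iff:
  assumes "0 \<le> r" "r < t"
  shows "y < (SUP s\<in>{r..t}. X s w) \<longleftrightarrow> (\<exists>s\<in>\<rat>. r \<le> s \<and> s < t \<and> y < X s w)"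
proof -
  have "\<exists>s\<in>\<rat>. r \<le> s \<and> s < t \<and> y < X s w" if y: "y < X t w"
  proof -
    obtain u where u: "r < u" "u < t" "y < X u w" using left_exceed[of t y r] y assms by force
    then show ?thesis using cadlag_right_rat[OF cad, of u y t] assms
      by (metis (no_types, lifting) dual_order.trans less_imp_le less_le_trans)
  qed
  then show ?thesis using less_SUP_rat_iff[of X w r t y, OF cad] assms by auto
qed

lemma less_S_rat_iff:
  assumes "0 < t" shows "y < S t \<longleftrightarrow> (\<exists>s\<in>\<rat>. 0 \<le> s \<and> s < t \<and> y < X s w)"
  using SUP_less_rat_iff[of 0 t y] assms by (simp add: running_sup_def)

text \<open>The strict equivalence rests on the absence of positive jumps: a level exceeded by time
  \<open>t\<close> is already exceeded strictly before \<open>t\<close>.\<close>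

lemma T_less_iff:
  assumes "0 \<le> x" "0 \<le> t" shows "T x < ereal t \<longleftrightarrow> x < S t"
proof (cases "t = 0")
  case True
  then show ?thesis using assms first_passage_nonneg[of X x w] by (auto simp: not_less zero_ereal_def)
next
  case False
  then show ?thesis using less_S_rat_iff[of t x] first_passage_less_rat_iff[of X w, OF cad, of x t] assms by auto
qed

lemma T_ge_iff: "0 \<le> x ==> 0 \<le> t ==> ereal t \<le> T x \<longleftrightarrow> S t \<le> x"
  using T_less_iff[of x t] by (auto simp: not_less[symmetric])

lemma S_mono: "0 \<le> s ==> s \<le> t ==> S s \<le> S t"
  using running_sup_mono[of X w, OF cad] .

lemma X_le_S: "0 \<le> s ==> s \<le> t ==> X s w \<le> S t"
  using running_sup_upper[of X w, OF cad] .

text \<open>Levels are passed by creeping. Up to time \<open>t\<close> the supremum is at most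
  \<open>x\<close> by \<open>T_ge_iff\<close>; a value below \<open>x\<close> at \<open>t\<close>
  would persist on the right, although levels above \<open>x\<close> are reached just after
  \<open>t\<close>.\<close>

lemma T_value:
  assumes "0 \<le> x" "T x = ereal t" shows "0 \<le> t" "X t w = x" "S t = x"
proof -
  show t: "0 \<le> t" using first_passage_nonneg[of X x w] assms by auto
  have S: "S t \<le> x" using T_ge_iff[of x t] assms t by simp
  have "x \<le> X t w"
  proof (rule ccontr)
    assume "\<not> x \<le> X t w"
    then have "eventually (\<lambda>v. X v w < x) (at_right t)"
      using cadlag_right[OF cad t] by (auto intro: order_tendstoD)
    then obtain b where b: "b > t" "\<And>v. t < v ==> v < b ==> X v w < x"
      by (auto simp: eventually_at_right_field)
    have "T x < ereal b" using assms b by simp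
    then obtain u where u: "u \<ge> 0" "x < X u w" "u < b" by (auto simp: first_passage_less_iff)
    have "X u w \<le> x" if "u \<le> t" using X_le_S[OF u(1) that] S by simp
    then show False using b(2)[of u] u by (cases "u \<le> t") auto
  qed
  then show "X t w = x" "S t = x" using S X_le_S[of t t] t by auto
qed

text \<open>Upper bounds near \<open>t\<close> come from right continuity of the path, lower bounds
  from \<open>less_S_rat_iff\<close>, which already finds the level before time
  \<open>t\<close>.\<close>

lemma S_continuous: "continuous_on {0..} (\<lambda>t. S t)"
proof -
  have "continuous (at t within {0..}) (\<lambda>t. S t)" if t: "0 \<le> t" for t
    unfolding continuous_within
  proof (rule order_tendstoI)
    fix a assume a: "a < S t"
    show "\<forall>\<^sub>F x in at t within {0..}. a < S x"
    proof (cases "t = 0")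
      case True
      then show ?thesis using a S_nonneg by (auto simp: eventually_at_topological intro!: exI[of _ UNIV] intro: less_le_trans)
    next
      case False
      then obtain s where "0 \<le> s" "s < t" "a < X s w" using less_S_rat_iff[of t a] a t by auto
      then have "a < S v" if "s < v" "0 \<le> v" for v using X_le_S[of s v] that by auto
      then show ?thesis using \<open>s < t\<close> unfolding eventually_at_topological
        by (intro exI[of _ "{s<..}"]) auto
    qed
  next
    fix a assume a: "S t < a"
    obtain b where b: "S t < b" "b < a" using dense a by blast
    have "X t w < b" using X_le_S[of t t] b t by auto
    then have "eventually (\<lambda>v. X v w < b) (at_right t)"
      using cadlag_right[OF cad t] by (auto intro: order_tendstoD)
    then obtain e where e: "e > t" "\<And>v. t < v ==> v < e ==> X v w < b"
      by (auto simp: eventually_at_right_field)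
    have "S v < a" if v: "0 \<le> v" "v < e" for v
    proof -
      have "S v \<le> b" unfolding running_sup_def
      proof (rule cSUP_least)
        fix u assume "u \<in> {0..v}"
        then show "X u w \<le> b" using e(2)[of u] X_le_S[of u t] b v by (cases "u \<le> t") auto
      qed (use v in auto)
      then show ?thesis using b by simp
    qed
    then show "\<forall>\<^sub>F x in at t within {0..}. S x < a"
      using e unfolding eventually_at_topological by (intro exI[of _ "{..<e}"]) auto
  qed
  then show ?thesis by (auto simp: continuous_on_eq_continuous_within)
qed

end

section \<open>Markov properties\<close>

text \<open>Independence of increments is formulated along monotone sequences indexed by naturals.
  This lists a finite set of times in increasing order, with \<open>p\<close> giving the position of
  a time.\<close>

lemma finite_grid:
  fixes K :: "real set"
  assumes "finite K" "K \<noteq> {}"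
  shows "\<exists>p m (t :: nat => real). (\<forall>i\<in>K. p i \<le> m \<and> t (p i) = i) \<and> (\<forall>i\<le>m. t i \<in> K) \<and>
    (\<forall>i\<le>m. \<forall>j\<le>m. t i \<le> t j \<longleftrightarrow> i \<le> j)"
proof -
  define xs where "xs = sorted_list_of_set K"
  have xs: "set xs = K" "sorted_wrt (<) xs" "xs \<noteq> []"
    using assms by (auto simp: xs_def strict_sorted_iff)
  have less: "xs ! i < xs ! j" if "i < j" "j \<le> length xs - 1" for i j
    using sorted_wrt_nth_less[OF xs(2), of i j] that xs(3) by (cases xs) auto
  have "\<forall>i\<in>K. \<exists>k\<le>length xs - 1. xs ! k = i"
    using xs(1,3) by (metis Suc_pred' in_set_conv_nth length_greater_0_conv less_Suc_eq_le)
  then obtain p where p: "\<And>i. i \<in> K ==> p i \<le> length xs - 1 \<and> xs ! p i = i" by metis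
  show ?thesis
  proof (intro exI[of _ p] exI[of _ "length xs - 1"] exI[of _ "\<lambda>i. xs ! i"] conjI ballI allI impI)
    show "p i \<le> length xs - 1" "xs ! p i = i" if "i \<in> K" for i using p[OF that] by auto
    show "xs ! i \<in> K" if "i \<le> length xs - 1" for i
      using that xs by (metis Suc_pred' length_greater_0_conv less_Suc_eq_le nth_mem)
    show "xs ! i \<le> xs ! j \<longleftrightarrow> i \<le> j" if "i \<le> length xs - 1" "j \<le> length xs - 1" for i j
      using less[of i j] less[of j i] that by (metis less_le_not_le linorder_cases order_refl)
  qed
qed

lemma sum_component_measurable:
  "S \<subseteq> K ==> (\<lambda>v. \<Sum>l\<in>S. v l) \<in> borel_measurable (Pi\<^sub>M K (\<lambda>_. borel :: real measure))"
  by (rule borel_measurable_sum[where f="\<lambda>l v. v l"]) auto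

abbreviation path_space :: "(real => real) measure" where
  "path_space \<equiv> Pi\<^sub>M {0..} (\<lambda>_. borel)"

definition shifted_path :: "(real => 'a => real) => real => 'a => (real => real)" where
  "shifted_path X s w = (\<lambda>u\<in>{0..}. X (s + u) w - X s w)"

locale levy = prob_space M for M :: "'a measure" +
  fixes X :: "real => 'a => real"
  assumes levy: "levy_process M X"
begin

abbreviation expected :: "('a \<Rightarrow> ennreal) \<Rightarrow> ennreal" (binder "\<E> " 10) where
  "expected \<equiv> integral\<^sup>N M"

abbreviation LM :: "(real \<times> 'a) measure" where
  "LM \<equiv> lborel \<Otimes>\<^sub>M M"

definition path_law :: "(real => real) measure" where
  "path_law = distr M path_space (shifted_path X 0)"

abbreviation path_integral :: "((real => real) => ennreal) => ennreal" (binder "\<P> " 10) where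
  "path_integral \<equiv> integral\<^sup>N path_law"

lemma X_measurable [measurable]: "0 \<le> t ==> X t \<in> borel_measurable M"
  using levy by (auto simp: levy_process_def)

lemma cadlag_X: "w \<in> space M ==> cadlag (\<lambda>t. X t w)"
  using levy by (auto simp: levy_process_def)

lemma X0_AE: "AE w in M. X 0 w = 0"
  using levy by (auto simp: levy_process_def)

lemma shifted_path_measurable [measurable]:
  "0 \<le> s ==> shifted_path X s \<in> measurable M path_space"
  unfolding shifted_path_def by (intro measurable_restrict) auto

lemma space_filt [simp]: "space (filt M X t) = space M"
  unfolding filt_def by (intro space_measure_of) (auto dest: sets.sets_into_space)

lemma sets_filt:
  "sets (filt M X t) = sigma_sets (space M)
     ({X s -` B \<inter> space M | s B. s \<in> {0..t} \<and> B \<in> sets borel} \<union> null_sets M)"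
  unfolding filt_def by (intro sets_measure_of) (auto dest: sets.sets_into_space)

lemma filt_subset: "sets (filt M X t) \<subseteq> sets M"
  unfolding sets_filt by (intro sets.sigma_sets_subset) (auto intro: measurable_sets)

lemma filt_mono: assumes "s \<le> t" shows "sets (filt M X s) \<subseteq> sets (filt M X t)"
proof -
  have "{0..s} \<subseteq> {0..t}" using assms by auto
  then show ?thesis unfolding sets_filt by (intro sigma_sets_mono' Un_mono order_refl) blast
qed

lemma measurable_filt: "f \<in> measurable (filt M X t) N ==> f \<in> measurable M N"
  using filt_subset[of t] by (auto simp: measurable_def)

lemma measurable_filt_mono:
  "s \<le> t ==> f \<in> measurable (filt M X s) N ==> f \<in> measurable (filt M X t) N"
  using filt_mono[of s t] by (auto simp: measurable_def)

lemma X_filt: "0 \<le> s ==> s \<le> t ==> X s \<in> borel_measurable (filt M X t)"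
  by (intro measurableI) (auto simp: sets_filt intro!: sigma_sets.Basic)

text \<open>On a grid containing \<open>s\<close>, values up to \<open>s\<close> are partial sums
  over the positions up to \<open>k\<close>, and increments after \<open>s\<close> are sums over
  later positions; disjoint blocks of an independent family are independent.\<close>

lemma increments_indep_past:
  assumes I: "finite I" "I \<subseteq> {0..s}" and J: "finite J" "J \<subseteq> {0..}" and s: "0 \<le> s"
  shows "indep_var (Pi\<^sub>M I (\<lambda>_. borel)) (\<lambda>w. \<lambda>i\<in>I. X i w)
           (Pi\<^sub>M J (\<lambda>_. borel)) (\<lambda>w. \<lambda>j\<in>J. X (s + j) w - X s w)"
proof -
  define K where "K = insert s (I \<union> (+) s ` J)"
  have "finite K" "K \<noteq> {}" using I J by (auto simp: K_def)
  obtain p m and t :: "nat => real" where p: "\<And>i. i \<in> K ==> p i \<le> m \<and> t (p i) = i" and tK: "\<And>i. i \<le> m ==> t i \<in> K"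
    and t: "\<And>i j. i \<le> m ==> j \<le> m ==> t i \<le> t j \<longleftrightarrow> i \<le> j" 
    using finite_grid[OF \<open>finite K\<close> \<open>K \<noteq> {}\<close>] by metis
  have K0: "0 \<le> x" if "x \<in> K" for x using that I J s by (auto simp: K_def)
  define inc where "inc = (\<lambda>k w. if k = 0 then X (t 0) w else X (t k) w - X (t (k - 1)) w)"
  have ind: "indep_vars (\<lambda>_. borel) inc {..m}"
    using levy K0[OF tK[of 0]] t unfolding inc_def levy_process_def independent_increments_def by auto
  have sum1: "(\<Sum>l\<le>q. inc l w) = X (t q) w" for q w
    by (induction q) (auto simp: inc_def)
  have sum2: "(\<Sum>l\<in>{Suc k..q}. inc l w) = X (t q) w - X (t k) w" if "k \<le> q" for q k w
  proof -
    have "(\<Sum>l\<le>q. inc l w) = (\<Sum>l\<le>k. inc l w) + (\<Sum>l\<in>{Suc k..q}. inc l w)"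
      using that by (subst sum.union_disjoint[symmetric]) (auto intro!: sum.cong)
    then show ?thesis by (simp add: sum1)
  qed
  define k where "k = p s"
  have k: "k \<le> m" "t k = s" using p[of s] by (auto simp: k_def K_def)
  have ii: "indep_var (Pi\<^sub>M {..k} (\<lambda>_. borel)) (\<lambda>w. restrict (\<lambda>i. inc i w) {..k})
      (Pi\<^sub>M {Suc k..m} (\<lambda>_. borel)) (\<lambda>w. restrict (\<lambda>i. inc i w) {Suc k..m})"
    by (rule indep_var_restrict[OF ind]) (use k in auto)
  have pI: "p i \<le> k" if "i \<in> I" for i
  proof -
    have "t (p i) \<le> t k" using p[of i] that I k by (auto simp: K_def)
    then show ?thesis using t[of "p i" k] p[of i] that k by (auto simp: K_def)
  qed
  have pJ: "k \<le> p (s + j)" "p (s + j) \<le> m" "t (p (s + j)) = s + j" if "j \<in> J" for j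
  proof -
    have *: "s + j \<in> K" using that by (auto simp: K_def)
    have "t k \<le> t (p (s + j))" using p[OF *] that J k by auto
    then show "k \<le> p (s + j)" using t[of k "p (s + j)"] p[OF *] k by auto
    show "p (s + j) \<le> m" "t (p (s + j)) = s + j" using p[OF *] by auto
  qed
  have "indep_var (Pi\<^sub>M I (\<lambda>_. borel)) ((\<lambda>v. \<lambda>i\<in>I. \<Sum>l\<le>p i. v l) \<circ> (\<lambda>w. restrict (\<lambda>i. inc i w) {..k}))
      (Pi\<^sub>M J (\<lambda>_. borel)) ((\<lambda>v. \<lambda>j\<in>J. \<Sum>l\<in>{Suc k..p (s + j)}. v l) \<circ> (\<lambda>w. restrict (\<lambda>i. inc i w) {Suc k..m}))"
  proof (rule indep_var_compose[OF ii])
    show "(\<lambda>v. \<lambda>i\<in>I. \<Sum>l\<le>p i. v l) \<in> measurable (Pi\<^sub>M {..k} (\<lambda>_. borel :: real measure)) (Pi\<^sub>M I (\<lambda>_. borel))"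
      using pI by (intro measurable_restrict sum_component_measurable) auto
    show "(\<lambda>v. \<lambda>j\<in>J. \<Sum>l\<in>{Suc k..p (s + j)}. v l) \<in> measurable (Pi\<^sub>M {Suc k..m} (\<lambda>_. borel :: real measure)) (Pi\<^sub>M J (\<lambda>_. borel))"
      using pJ by (intro measurable_restrict sum_component_measurable) auto
  qed
  moreover have "((\<lambda>v. \<lambda>i\<in>I. \<Sum>l\<le>p i. v l) \<circ> (\<lambda>w. restrict (\<lambda>i. inc i w) {..k})) = (\<lambda>w. \<lambda>i\<in>I. X i w)"
  proof (intro ext)
    fix w i
    show "((\<lambda>v. \<lambda>i\<in>I. \<Sum>l\<le>p i. v l) \<circ> (\<lambda>w. restrict (\<lambda>i. inc i w) {..k})) w i = (\<lambda>i\<in>I. X i w) i"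
    proof (cases "i \<in> I")
      case True
      have "(\<Sum>l\<le>p i. restrict (\<lambda>i. inc i w) {..k} l) = (\<Sum>l\<le>p i. inc l w)"
        using pI[OF True] by (intro sum.cong) auto
      then show ?thesis using True p[of i] by (simp add: sum1 K_def)
    qed auto
  qed
  moreover have "((\<lambda>v. \<lambda>j\<in>J. \<Sum>l\<in>{Suc k..p (s + j)}. v l) \<circ> (\<lambda>w. restrict (\<lambda>i. inc i w) {Suc k..m})) =
      (\<lambda>w. \<lambda>j\<in>J. X (s + j) w - X s w)"
  proof (intro ext)
    fix w j
    show "((\<lambda>v. \<lambda>j\<in>J. \<Sum>l\<in>{Suc k..p (s + j)}. v l) \<circ> (\<lambda>w. restrict (\<lambda>i. inc i w) {Suc k..m})) w j =
      (\<lambda>j\<in>J. X (s + j) w - X s w) j"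
    proof (cases "j \<in> J")
      case True
      have "(\<Sum>l\<in>{Suc k..p (s + j)}. restrict (\<lambda>i. inc i w) {Suc k..m} l) = (\<Sum>l\<in>{Suc k..p (s + j)}. inc l w)"
        using pJ[OF True] by (intro sum.cong) auto
      then show ?thesis using True pJ[OF True] by (simp add: sum2 k)
    qed auto
  qed
  ultimately show ?thesis by simp
qed

lemma increments_distr:
  assumes t: "t 0 = 0" "\<And>k. k < m ==> t k \<le> t (Suc k)" and m: "0 < m" and s: "0 \<le> s"
  shows "indep_vars (\<lambda>_. borel) (\<lambda>k w. X (s + t k) w - X (s + t (k - 1)) w) {1..m}"
    "distr M (Pi\<^sub>M {1..m} (\<lambda>_. borel)) (\<lambda>w. \<lambda>k\<in>{1..m}. X (s + t k) w - X (s + t (k - 1)) w) =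
      Pi\<^sub>M {1..m} (\<lambda>k. distr M borel (\<lambda>w. X (t k - t (k - 1)) w - X 0 w))"
proof -
  have t0: "0 \<le> t k" if "k \<le> m" for k
    using that by (induction k) (use t in \<open>auto simp: Suc_le_eq intro: order_trans\<close>)
  let ?Y = "\<lambda>k w. X (s + t k) w - X (s + t (k - 1)) w"
  have "indep_vars (\<lambda>_. borel) (\<lambda>k w. if k = 0 then X (s + t 0) w else ?Y k w) {..m}"
    using levy t s unfolding levy_process_def independent_increments_def
    by (auto dest!: spec[of _ m] spec[of _ "\<lambda>k. s + t k"])
  then have "indep_vars (\<lambda>_. borel) (\<lambda>k w. if k = 0 then X (s + t 0) w else ?Y k w) {1..m}"
    by (rule indep_vars_subset) auto
  also have "?this \<longleftrightarrow> indep_vars (\<lambda>_. borel) ?Y {1..m}"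
    by (intro indep_vars_cong) auto
  finally show ind: "indep_vars (\<lambda>_. borel) ?Y {1..m}" .
  have d: "distr M borel (?Y k) = distr M borel (\<lambda>w. X (t k - t (k - 1)) w - X 0 w)" if k: "k \<in> {1..m}" for k
  proof -
    have "0 \<le> t k - t (k - 1)" using t(2)[of "k - 1"] k by auto
    moreover have "0 \<le> s + t (k - 1)" using t0[of "k - 1"] k s by auto
    ultimately have "distr M borel (\<lambda>w. X ((s + t (k - 1)) + (t k - t (k - 1))) w - X (s + t (k - 1)) w) =
       distr M borel (\<lambda>w. X (t k - t (k - 1)) w - X 0 w)"
      using levy unfolding levy_process_def stationary_increments_def by blast
    then show ?thesis by simp
  qed
  have "distr M (Pi\<^sub>M {1..m} (\<lambda>_. borel)) (\<lambda>w. \<lambda>k\<in>{1..m}. ?Y k w) = Pi\<^sub>M {1..m} (\<lambda>k. distr M borel (?Y k))"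
    using ind m t0 s by (subst (asm) indep_vars_iff_distr_eq_PiM') (auto simp: Suc_le_eq intro!: borel_measurable_diff X_measurable)
  also have "\<dots> = Pi\<^sub>M {1..m} (\<lambda>k. distr M borel (\<lambda>w. X (t k - t (k - 1)) w - X 0 w))"
    by (intro PiM_cong refl d)
  finally show "distr M (Pi\<^sub>M {1..m} (\<lambda>_. borel)) (\<lambda>w. \<lambda>k\<in>{1..m}. ?Y k w) = \<dots>" .
qed

text \<open>Both vectors are the same sums of consecutive increments, whose joint law is a product
  in which \<open>s\<close> does not occur.\<close>

lemma finite_increments_stationary:
  assumes J: "finite J" "J \<subseteq> {0..}" and s: "0 \<le> s"
  shows "distr M (Pi\<^sub>M J (\<lambda>_. borel)) (\<lambda>w. \<lambda>j\<in>J. X (s + j) w - X s w) =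
         distr M (Pi\<^sub>M J (\<lambda>_. borel)) (\<lambda>w. \<lambda>j\<in>J. X j w - X 0 w)"
proof -
  \<comment> \<open>The point 0 makes the grid start at 0, as \<open>increments_distr\<close> asks;
    the point 1 guarantees at least one increment, so that \<open>0 < m\<close>.\<close>
  define K where "K = insert 0 (insert 1 J)"
  have "finite K" "K \<noteq> {}" using J by (auto simp: K_def)
  obtain p m and t :: "nat => real" where p: "\<And>i. i \<in> K ==> p i \<le> m \<and> t (p i) = i" and tK: "\<And>i. i \<le> m ==> t i \<in> K"
    and t: "\<And>i j. i \<le> m ==> j \<le> m ==> t i \<le> t j \<longleftrightarrow> i \<le> j" 
    using finite_grid[OF \<open>finite K\<close> \<open>K \<noteq> {}\<close>] by metis
  have K0: "0 \<le> x" if "x \<in> K" for x using that J by (auto simp: K_def)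
  have t0: "t 0 = 0"
  proof (rule antisym)
    show "t 0 \<le> 0" using t[of 0 "p 0"] p[of 0] by (auto simp: K_def)
    show "0 \<le> t 0" using K0[OF tK[of 0]] by simp
  qed
  have m: "0 < m"
  proof (rule ccontr)
    assume "\<not> 0 < m"
    then have "p 0 = p 1" using p[of 0] p[of 1] by (auto simp: K_def)
    then show False using p[of 0] p[of 1] by (auto simp: K_def)
  qed
  have tS: "t k \<le> t (Suc k)" if "k < m" for k using t[of k "Suc k"] that by auto
  have pos: "0 \<le> t k" if "k \<le> m" for k using K0[OF tK[OF that]] .
  let ?V = "\<lambda>s w. \<lambda>k\<in>{1..m}. X (s + t k) w - X (s + t (k - 1)) w"
  let ?g = "\<lambda>v :: nat => real. \<lambda>j\<in>J. \<Sum>l\<in>{1..p j}. v l"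
  have g: "?g \<in> measurable (Pi\<^sub>M {1..m} (\<lambda>_. borel)) (Pi\<^sub>M J (\<lambda>_. borel))"
  proof (intro measurable_restrict sum_component_measurable)
    fix j assume "j \<in> J"
    then show "{1..p j} \<subseteq> {1..m}" using p[of j] by (simp add: K_def)
  qed
  have V: "?V s \<in> measurable M (Pi\<^sub>M {1..m} (\<lambda>_. borel))" if "0 \<le> s" for s
    using that pos by (intro measurable_restrict borel_measurable_diff X_measurable) auto
  have gV: "?g (?V s w) = (\<lambda>j\<in>J. X (s + j) w - X s w)" for s w
  proof (intro ext)
    fix j
    show "?g (?V s w) j = (\<lambda>j\<in>J. X (s + j) w - X s w) j"
    proof (cases "j \<in> J")
      case True
      have pj: "p j \<le> m" "t (p j) = j" using p[of j] True by (auto simp: K_def)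
      have "(\<Sum>l\<in>{1..q}. X (s + t l) w - X (s + t (l - 1)) w) = X (s + t q) w - X s w" for q
        by (induction q) (auto simp: t0)
      moreover have "(\<Sum>l\<in>{1..p j}. ?V s w l) = (\<Sum>l\<in>{1..p j}. X (s + t l) w - X (s + t (l - 1)) w)"
        using pj by (intro sum.cong) auto
      ultimately show ?thesis using True pj by simp
    qed auto
  qed
  have *: "distr M (Pi\<^sub>M J (\<lambda>_. borel)) (\<lambda>w. \<lambda>j\<in>J. X (s + j) w - X s w) =
      distr (Pi\<^sub>M {1..m} (\<lambda>k. distr M borel (\<lambda>w. X (t k - t (k - 1)) w - X 0 w))) (Pi\<^sub>M J (\<lambda>_. borel)) ?g"
    if s: "0 \<le> s" for s
  proof -
    have "distr M (Pi\<^sub>M J (\<lambda>_. borel)) (\<lambda>w. \<lambda>j\<in>J. X (s + j) w - X s w) =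
        distr (distr M (Pi\<^sub>M {1..m} (\<lambda>_. borel)) (?V s)) (Pi\<^sub>M J (\<lambda>_. borel)) ?g"
      by (subst distr_distr[OF g V[OF s]]) (simp only: comp_def gV)
    also have "distr M (Pi\<^sub>M {1..m} (\<lambda>_. borel)) (?V s) =
        Pi\<^sub>M {1..m} (\<lambda>k. distr M borel (\<lambda>w. X (t k - t (k - 1)) w - X 0 w))"
      by (rule increments_distr(2)) (use t0 tS m s in auto)
    finally show ?thesis .
  qed
  show ?thesis using *[OF s] *[of 0] by simp
qed

lemma shifted_path_law: assumes s: "0 \<le> s" shows "distr M path_space (shifted_path X s) = path_law"
proof (rule measure_eqI_PiM_infinite)
  fix A :: "real => real set" and J assume J: "finite J" "J \<subseteq> {0..}" and A: "\<And>i. i \<in> J ==> A i \<in> sets (borel :: real measure)"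
  let ?E = "prod_emb {0..} (\<lambda>_. borel) J (Pi\<^sub>E J A)"
  have E: "?E \<in> sets path_space" using J A by (intro sets_PiM_I) auto
  have *: "emeasure (distr M path_space (shifted_path X s)) ?E =
     emeasure (distr M (Pi\<^sub>M J (\<lambda>_. borel)) (\<lambda>w. \<lambda>j\<in>J. X (s + j) w - X s w)) (Pi\<^sub>E J A)" if s: "0 \<le> s" for s
  proof -
    have v: "(\<lambda>w. \<lambda>j\<in>J. X (s + j) w - X s w) \<in> measurable M (Pi\<^sub>M J (\<lambda>_. borel))"
      using J s by (intro measurable_restrict borel_measurable_diff X_measurable) auto
    have "shifted_path X s -` ?E \<inter> space M = (\<lambda>w. \<lambda>j\<in>J. X (s + j) w - X s w) -` (Pi\<^sub>E J A) \<inter> space M"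
      using J by (auto simp: shifted_path_def prod_emb_def PiE_iff extensional_def subset_eq split: if_splits)
    then show ?thesis
      using J A by (subst (1 2) emeasure_distr) (auto intro!: E v shifted_path_measurable s sets_PiM_I_finite)
  qed
  show "emeasure (distr M path_space (shifted_path X s)) ?E = emeasure path_law ?E"
    unfolding path_law_def *[OF s] *[OF order_refl] finite_increments_stationary[OF J s] by simp
qed (auto simp: path_law_def intro!: finite_measure_distr shifted_path_measurable s)

sublocale pl: prob_space path_law
  unfolding path_law_def by (intro prob_space_distr) auto

text \<open>Finite-dimensional events of the past and of the later increments form two
  intersection-stable systems, independent by \<open>increments_indep_past\<close>; independence
  passes to the generated \<sigma>-fields.\<close>

lemma markov_indep:
  assumes s: "0 \<le> s" and y: "y \<in> measurable (filt M X s) N" and AN: "E \<in> sets N" and BN: "F \<in> sets path_space"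
  shows "prob ((y -` E \<inter> space M) \<inter> (shifted_path X s -` F \<inter> space M)) =
    prob (y -` E \<inter> space M) * prob (shifted_path X s -` F \<inter> space M)"
proof -
  \<comment> \<open>Null sets belong to the generator because \<open>filt\<close> is augmented by
    them. They are independent of every event and keep the system stable under intersection.\<close>
  define A where "A = {{w\<in>space M. \<forall>i\<in>I. X i w \<in> B i} | I B. finite I \<and> I \<subseteq> {0..s} \<and> (\<forall>i. B i \<in> sets (borel :: real measure))} \<union> null_sets M"
  define C where "C = {{w\<in>space M. \<forall>j\<in>J. X (s + j) w - X s w \<in> B j} | J B. finite J \<and> J \<subseteq> {0..} \<and> (\<forall>i. B i \<in> sets (borel :: real measure))}"
  have AM: "A \<subseteq> sets M"
    unfolding A_def by (auto intro!: sets.sets_Collect_finite_All measurable_sets_Collect[OF X_measurable])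
  have CM: "C \<subseteq> sets M"
    unfolding C_def using s by (auto intro!: sets.sets_Collect_finite_All measurable_sets_Collect[OF borel_measurable_diff[OF X_measurable X_measurable]])
  \<comment> \<open>Two such events are merged over the union of their index sets, with the
    condition \<open>UNIV\<close> where one of them imposes nothing.\<close>
  have stab: "\<exists>I B. {w\<in>space M. \<forall>i\<in>I1. Y i w \<in> B1 i} \<inter> {w\<in>space M. \<forall>i\<in>I2. Y i w \<in> B2 i} = {w\<in>space M. \<forall>i\<in>I. Y i w \<in> B i}
      \<and> finite I \<and> I \<subseteq> D \<and> (\<forall>i. B i \<in> sets (borel :: real measure))"
    if "finite I1" "finite I2" "I1 \<subseteq> D" "I2 \<subseteq> D" "\<And>i. B1 i \<in> sets borel" "\<And>i. B2 i \<in> sets borel"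
    for I1 I2 B1 B2 D and Y :: "real => 'a => real"
    using that by (intro exI[of _ "I1 \<union> I2"] exI[of _ "\<lambda>i. (if i \<in> I1 then B1 i else UNIV) \<inter> (if i \<in> I2 then B2 i else UNIV)"]) auto
  have iA: "Int_stable A"
  proof (rule Int_stableI)
    fix a b assume ab: "a \<in> A" "b \<in> A"
    show "a \<inter> b \<in> A"
    proof (cases "a \<in> null_sets M \<or> b \<in> null_sets M")
      case True
      then have "a \<inter> b \<in> null_sets M" using ab AM by (auto intro: null_set_Int1 null_set_Int2)
      then show ?thesis by (auto simp: A_def)
    next
      case False
      then obtain I1 B1 I2 B2 where *: "a = {w\<in>space M. \<forall>i\<in>I1. X i w \<in> B1 i}" "b = {w\<in>space M. \<forall>i\<in>I2. X i w \<in> B2 i}"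
          "finite I1" "finite I2" "I1 \<subseteq> {0..s}" "I2 \<subseteq> {0..s}" "\<And>i. B1 i \<in> sets borel" "\<And>i. B2 i \<in> sets borel"
        using ab unfolding A_def by auto
      obtain I B where e: "a \<inter> b = {w\<in>space M. \<forall>i\<in>I. X i w \<in> B i}" "finite I" "I \<subseteq> {0..s}" "\<And>i. B i \<in> sets borel"
        using stab[of I1 I2 "{0..s}" B1 B2 X, OF *(3-8)] unfolding *(1,2)[symmetric] by auto
      show ?thesis unfolding A_def
        by (intro UnI1 CollectI exI[of _ I] exI[of _ B] conjI allI e)
    qed
  qed
  have iC: "Int_stable C"
  proof (rule Int_stableI)
    fix a b assume "a \<in> C" "b \<in> C"
    then obtain I1 B1 I2 B2 where *: "a = {w\<in>space M. \<forall>j\<in>I1. X (s + j) w - X s w \<in> B1 j}" "b = {w\<in>space M. \<forall>j\<in>I2. X (s + j) w - X s w \<in> B2 j}"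
          "finite I1" "finite I2" "I1 \<subseteq> {0..}" "I2 \<subseteq> {0..}" "\<And>i. B1 i \<in> sets borel" "\<And>i. B2 i \<in> sets borel"
      unfolding C_def by auto
    obtain I B where e: "a \<inter> b = {w\<in>space M. \<forall>i\<in>I. X (s + i) w - X s w \<in> B i}" "finite I" "I \<subseteq> {0..}" "\<And>i. B i \<in> sets borel"
      using stab[of I1 I2 "{0..}" B1 B2 "\<lambda>j w. X (s + j) w - X s w", OF *(3-8)] unfolding *(1,2)[symmetric] by auto
    show "a \<inter> b \<in> C" unfolding C_def
      by (intro CollectI exI[of _ I] exI[of _ B] conjI allI e)
  qed
  have "indep_set A C"
  proof (rule indep_setI[OF AM CM])
    fix a b assume a: "a \<in> A" and b: "b \<in> C"
    show "prob (a \<inter> b) = prob a * prob b"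
    proof (cases "a \<in> null_sets M")
      case True
      moreover from this have "a \<inter> b \<in> null_sets M" using b CM by (auto intro: null_set_Int2)
      ultimately show ?thesis by (auto simp: null_sets_def measure_def)
    next
      case False
      then obtain I B where I: "a = {w\<in>space M. \<forall>i\<in>I. X i w \<in> B i}" "finite I" "I \<subseteq> {0..s}" "\<And>i. B i \<in> sets borel"
        using a unfolding A_def by auto
      obtain J D where J: "b = {w\<in>space M. \<forall>j\<in>J. X (s + j) w - X s w \<in> D j}" "finite J" "J \<subseteq> {0..}" "\<And>i. D i \<in> sets borel"
        using b unfolding C_def by auto
      have a': "a = (\<lambda>w. \<lambda>i\<in>I. X i w) -` (Pi\<^sub>E I B) \<inter> space M" by (auto simp: I(1) PiE_iff)
      have b': "b = (\<lambda>w. \<lambda>j\<in>J. X (s + j) w - X s w) -` (Pi\<^sub>E J D) \<inter> space M" by (auto simp: J(1) PiE_iff)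
      have "prob ((\<lambda>w. (\<lambda>i\<in>I. X i w, \<lambda>j\<in>J. X (s + j) w - X s w)) -` (Pi\<^sub>E I B \<times> Pi\<^sub>E J D) \<inter> space M) = prob a * prob b"
        unfolding a' b' using I J
        by (intro indep_varD[OF increments_indep_past[OF I(2,3) J(2,3) s]] sets_PiM_I_finite) auto
      also have "(\<lambda>w. (\<lambda>i\<in>I. X i w, \<lambda>j\<in>J. X (s + j) w - X s w)) -` (Pi\<^sub>E I B \<times> Pi\<^sub>E J D) \<inter> space M = a \<inter> b"
        unfolding a' b' by auto
      finally show ?thesis .
    qed
  qed
  then have ind: "indep_set (sigma_sets (space M) A) (sigma_sets (space M) C)"
    using iA iC by (rule indep_set_sigma_sets)
  have CP: "C \<subseteq> Pow (space M)" using CM sets.sets_into_space by blast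
  have 1: "sigma_sets (space M) {y -` D \<inter> space M | D. D \<in> sets N} \<subseteq> sigma_sets (space M) A"
  proof (rule sigma_sets_mono, safe)
    fix D assume "D \<in> sets N"
    then have "y -` D \<inter> space M \<in> sets (filt M X s)" using measurable_sets[OF y] by simp
    moreover have "sets (filt M X s) \<subseteq> sigma_sets (space M) A" unfolding sets_filt
    proof (rule sigma_sets_mono, safe)
      fix u :: real and B :: "real set" assume "u \<in> {0..s}" "B \<in> sets borel"
      then have "X u -` B \<inter> space M \<in> A" unfolding A_def
        by (intro UnI1 CollectI exI[of _ "{u}"] exI[of _ "\<lambda>_. B"]) auto
      then show "X u -` B \<inter> space M \<in> sigma_sets (space M) A" ..
    qed (auto simp: A_def intro!: sigma_sets.Basic)
    ultimately show "y -` D \<inter> space M \<in> sigma_sets (space M) A" by auto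
  qed
  have "shifted_path X s \<in> measurable (sigma (space M) C) path_space"
    unfolding shifted_path_def
  proof (intro measurable_restrict measurableI)
    fix u :: real and B :: "real set" assume u: "u \<in> {0..}" and B: "B \<in> sets borel"
    have "(\<lambda>w. X (s + u) w - X s w) -` B \<inter> space M \<in> C" unfolding C_def
      using u B by (intro CollectI exI[of _ "{u}"] exI[of _ "\<lambda>_. B"]) auto
    then show "(\<lambda>w. X (s + u) w - X s w) -` B \<inter> space (sigma (space M) C) \<in> sets (sigma (space M) C)"
      using CP by (simp add: space_measure_of sets_measure_of sigma_sets.Basic)
  qed auto
  then have 2: "sigma_sets (space M) {shifted_path X s -` D \<inter> space M | D. D \<in> sets path_space} \<subseteq> sigma_sets (space M) C"
    using CP by (intro sigma_sets_mono) (auto dest!: measurable_sets simp: space_measure_of sets_measure_of)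
  show ?thesis
    using 1 2 AN BN by (intro indep_setD[OF ind]) blast+
qed

text \<open>Independence makes the law of the pair a product measure, and Tonelli averages over the
  future for a frozen past. All information from the past enters through the single variable
  \<open>y\<close>.\<close>

lemma markov_nn_integral:
  assumes s: "0 \<le> s" and y: "y \<in> measurable (filt M X s) N"
    and \<Psi>[measurable]: "\<Psi> \<in> borel_measurable (N \<Otimes>\<^sub>M path_space)"
  shows "(\<E> w. \<Psi> (y w, shifted_path X s w)) = (\<E> w. (\<P> ww. \<Psi> (y w, ww)))"
proof -
  have [measurable]: "y \<in> measurable M N" using measurable_filt[OF y] .
  have sp: "sets path_law = sets path_space" by (simp add: path_law_def)
  have sh[measurable]: "shifted_path X s \<in> measurable M path_space" using s by simp
  interpret y: prob_space "distr M N y" by (intro prob_space_distr) simp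
  have e: "distr M N y \<Otimes>\<^sub>M path_law = distr M (N \<Otimes>\<^sub>M path_space) (\<lambda>w. (y w, shifted_path X s w))"
  proof (rule pair_measure_eqI, goal_cases)
    case (4 E F)
    then have E: "E \<in> sets N" and F: "F \<in> sets path_space" by (auto simp: sp)
    have "(\<lambda>w. (y w, shifted_path X s w)) -` (E \<times> F) \<inter> space M =
        (y -` E \<inter> space M) \<inter> (shifted_path X s -` F \<inter> space M)" by auto
    then show ?case
      using E F markov_indep[OF s y E F]
      by (simp add: shifted_path_law[OF s, symmetric] emeasure_distr emeasure_eq_measure ennreal_mult)
  qed (auto simp: sp cong: sets_pair_measure_cong intro: y.sigma_finite_measure_axioms pl.sigma_finite_measure_axioms)
  have m: "\<Psi> \<in> borel_measurable (distr M N y \<Otimes>\<^sub>M path_law)"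
    using \<Psi> by (simp cong: measurable_cong_sets add: sets_pair_measure_cong[OF _ sp])
  have "(\<E> w. \<Psi> (y w, shifted_path X s w)) = (\<integral>\<^sup>+z. \<Psi> z \<partial>(distr M N y \<Otimes>\<^sub>M path_law))"
    unfolding e using s by (subst nn_integral_distr) auto
  also have "\<dots> = (\<integral>\<^sup>+z. (\<P> ww. \<Psi> (z, ww)) \<partial>distr M N y)"
    by (rule pl.nn_integral_fst[OF m, symmetric])
  also have "\<dots> = (\<E> w. (\<P> ww. \<Psi> (y w, ww)))"
    using pl.borel_measurable_nn_integral_fst[of \<Psi> N] \<Psi>
    by (subst nn_integral_distr) (simp_all cong: measurable_cong_sets add: sets_pair_measure_cong[OF refl sp])
  finally show ?thesis .
qed

end

section \<open>Dyadic approximation from the right; test functions that determine a measure\<close>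

definition dyadic_above :: "nat => real => real" where
  "dyadic_above m t = (of_int \<lfloor>2 ^ m * t\<rfloor> + 1) / 2 ^ m"

text \<open>The approximation is strictly larger than \<open>t\<close> even when \<open>t\<close> is
  dyadic, so right limits can be taken along it without a special case.\<close>

lemma dyadic_above: "t < dyadic_above m t" "dyadic_above m t \<le> t + 1 / 2 ^ m"
proof -
  have "2 ^ m * t < of_int \<lfloor>2 ^ m * t\<rfloor> + 1" by linarith
  then show "t < dyadic_above m t" by (simp add: dyadic_above_def field_simps)
  have "of_int \<lfloor>2 ^ m * t\<rfloor> \<le> 2 ^ m * t" by linarith
  then show "dyadic_above m t \<le> t + 1 / 2 ^ m" by (simp add: dyadic_above_def field_simps)
qed

lemma dyadic_above_tendsto: "filterlim (\<lambda>m. dyadic_above m t) (at_right t) sequentially"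
  unfolding filterlim_at
proof
  have "(\<lambda>m. t + (1/2) ^ m) \<longlonglongrightarrow> t + 0"
    by (intro tendsto_intros LIMSEQ_realpow_zero) auto
  then have 1: "(\<lambda>m. t + 1 / 2 ^ m) \<longlonglongrightarrow> t" by (simp add: power_one_over)
  show "(\<lambda>m. dyadic_above m t) \<longlonglongrightarrow> t"
    by (rule tendsto_sandwich[OF _ _ tendsto_const 1]) (auto simp: dyadic_above less_imp_le)
  show "\<forall>\<^sub>F x in sequentially. dyadic_above x t \<in> {t<..} \<and> dyadic_above x t \<noteq> t"
    by (simp add: dyadic_above(1) less_imp_neq[OF dyadic_above(1), symmetric])
qed

lemma dyadic_above_measurable [measurable]: "dyadic_above m \<in> borel_measurable borel"
  unfolding dyadic_above_def by measurable

text \<open>At dyadic times above \<open>t\<close> only countably many random variables occur, which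
  gives joint measurability; right continuity passes to the limit. The truncation
  \<open>max 0\<close> avoids negative times, where nothing is known.\<close>

lemma right_continuous_joint_measurable:
  fixes Y :: "real => 'a => real"
  assumes Y: "\<And>t. 0 \<le> t ==> Y t \<in> borel_measurable N"
    and r: "\<And>w t. w \<in> space N ==> 0 \<le> t ==> ((\<lambda>u. Y u w) \<longlongrightarrow> Y t w) (at_right t)"
  shows "(\<lambda>(t, w). Y (max 0 t) w) \<in> borel_measurable (borel \<Otimes>\<^sub>M N)"
proof -
  have "(\<lambda>z. Y (max 0 (fst z)) (snd z)) \<in> borel_measurable (borel \<Otimes>\<^sub>M N)"
  proof (rule borel_measurable_LIMSEQ_real[where u="\<lambda>m z. Y (dyadic_above m (max 0 (fst z))) (snd z)"])
    fix z :: "real \<times> 'a" assume "z \<in> space (borel \<Otimes>\<^sub>M N)"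
    then have z: "snd z \<in> space N" by (auto simp: space_pair_measure)
    show "(\<lambda>m. Y (dyadic_above m (max 0 (fst z))) (snd z)) \<longlonglongrightarrow> Y (max 0 (fst z)) (snd z)"
      by (rule filterlim_compose[OF r[OF z] dyadic_above_tendsto]) simp
  next
    fix m
    have "(\<lambda>z. (\<lambda>k z. Y (max 0 ((of_int k + 1) / 2 ^ m)) (snd z)) \<lfloor>2 ^ m * max 0 (fst z :: real)\<rfloor> z)
        \<in> borel_measurable (borel \<Otimes>\<^sub>M N)"
    proof (rule measurable_compose_countable[where f="\<lambda>k (z :: real \<times> 'a). Y (max 0 ((of_int k + 1) / 2 ^ m)) (snd z)"])
      show "(\<lambda>z. Y (max 0 ((of_int i + 1) / 2 ^ m)) (snd z)) \<in> borel_measurable (borel \<Otimes>\<^sub>M N)" for i :: int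
        by (rule measurable_compose[OF measurable_snd Y]) simp
      show "(\<lambda>z. \<lfloor>2 ^ m * max 0 (fst z :: real)\<rfloor>) \<in> borel \<Otimes>\<^sub>M N \<rightarrow>\<^sub>M count_space UNIV"
        by measurable
    qed
    moreover have "max 0 (dyadic_above m (max 0 t)) = dyadic_above m (max 0 t)" for t
      using dyadic_above(1)[of "max 0 t" m] by linarith
    ultimately show "(\<lambda>z. Y (dyadic_above m (max 0 (fst z))) (snd z)) \<in> borel_measurable (borel \<Otimes>\<^sub>M N)"
      by (simp add: dyadic_above_def)
  qed
  then show ?thesis by (simp add: case_prod_beta')
qed

lemma cts_step_bounds: "a < b ==> 0 \<le> cts_step a b x \<and> cts_step a b x \<le> 1"
  by (auto simp: cts_step_def divide_le_eq)

text \<open>The functions \<open>cts_step a (a + 1 / Suc n)\<close> converge to the indicator of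
  \<open>{..a}\<close>, so continuous functions with values in [0, 1] determine the distribution
  function.\<close>

lemma finite_measure_eqI_continuous:
  fixes P Q :: "real measure"
  assumes P: "finite_measure P" "sets P = sets borel" and Q: "finite_measure Q" "sets Q = sets borel"
    and eq: "\<And>\<psi> :: real => real. continuous_on UNIV \<psi> ==> (\<And>x. 0 \<le> \<psi> x \<and> \<psi> x \<le> 1) ==>
      (\<integral>\<^sup>+x. ennreal (\<psi> x) \<partial>P) = (\<integral>\<^sup>+x. ennreal (\<psi> x) \<partial>Q)"
  shows "P = Q"
proof (rule cdf_unique')
  show "finite_borel_measure P" "finite_borel_measure Q"
    using P Q by (auto simp: finite_borel_measure_def finite_borel_measure_axioms_def)
  have "emeasure P {..a} = emeasure Q {..a}" for a
  proof -
    let ?f = "\<lambda>n. cts_step a (a + 1 / Suc n)"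
    have cont: "continuous_on UNIV (?f n)" for n
      by (intro uniformly_continuous_imp_continuous cts_step_uniformly_continuous) auto
    then have [measurable]: "?f n \<in> borel_measurable borel" for n by (rule borel_measurable_continuous_onI)
    have b: "0 \<le> ?f n x \<and> ?f n x \<le> 1" for n x by (rule cts_step_bounds) simp
    have lim: "(\<lambda>n. ennreal (?f n x)) \<longlonglongrightarrow> ind {..a} x" for x
    proof (cases "x \<le> a")
      case False
      then obtain N where N: "1 / Suc N < x - a" using nat_approx_posE[of "x - a"] by auto
      have "?f n x = 0" if "n \<ge> N" for n
      proof -
        have "1 / real (Suc n) \<le> 1 / Suc N" using that by (intro divide_left_mono) auto
        then show ?thesis using N False by (auto simp: cts_step_def)
      qed
      then have "\<forall>\<^sub>F n in sequentially. ennreal (?f n x) = ind {..a} x"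
        using False by (intro eventually_sequentiallyI[of N]) auto
      then show ?thesis by (rule tendsto_eventually)
    qed (auto simp: cts_step_def)
    have *: "(\<lambda>n. \<integral>\<^sup>+x. ennreal (?f n x) \<partial>R) \<longlonglongrightarrow> emeasure R {..a}"
      if R: "finite_measure R" "sets R = sets borel" for R
    proof -
      interpret finite_measure R by fact
      have [measurable_cong]: "sets R = sets borel" by fact
      have "(\<lambda>n. \<integral>\<^sup>+x. ennreal (?f n x) \<partial>R) \<longlonglongrightarrow> (\<integral>\<^sup>+x. ind {..a} x \<partial>R)"
      proof (rule nn_integral_dominated_convergence[where w="\<lambda>_. 1"])
        show "AE x in R. ennreal (?f j x) \<le> 1" for j using b by (auto simp: ennreal_le_1)
        show "(\<integral>\<^sup>+x. 1 \<partial>R) < \<infinity>" by (simp add: less_top[symmetric])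
        show "(\<lambda>x. ennreal (?f n x)) \<in> borel_measurable R" for n by measurable
      qed (use lim in auto)
      then show ?thesis using R by (simp add: sets_eq_imp_space_eq)
    qed
    show ?thesis
      using LIMSEQ_unique[OF *[OF P]] *[OF Q] eq[OF cont b] by simp
  qed
  then show "cdf P = cdf Q" by (auto simp: cdf_def measure_def fun_eq_iff)
qed

lemma prod_le_1_ennreal:
  fixes f :: "'b => ennreal"
  assumes "\<And>x. x \<in> A ==> f x \<le> 1" shows "prod f A \<le> 1"
  using assms
proof (induction A rule: infinite_finite_induct)
  case (insert x A)
  then show ?case using mult_mono[of "f x" 1 "prod f A" 1] by simp
qed auto

text \<open>In the strong Markov property limits are available for continuous test functions only.
  This passes from them to cylinder sets by replacing one factor at a time by an indicator.\<close>

lemma path_space_eqI_continuous: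
  assumes P: "finite_measure P" "sets P = sets path_space"
    and Q: "finite_measure Q" "sets Q = sets path_space"
    and eq: "\<And>J \<psi>. finite J ==> J \<subseteq> {0..} ==> (\<And>j. continuous_on UNIV (\<psi> j)) ==>
      (\<And>j x. 0 \<le> \<psi> j x \<and> \<psi> j x \<le> (1 :: real)) ==>
      (\<integral>\<^sup>+ww. (\<Prod>j\<in>J. ennreal (\<psi> j (ww j))) \<partial>P) = (\<integral>\<^sup>+ww. (\<Prod>j\<in>J. ennreal (\<psi> j (ww j))) \<partial>Q)"
  shows "P = Q"
proof (rule measure_eqI_PiM_infinite[OF P(2) Q(2)])
  interpret P: finite_measure P by fact
  interpret Q: finite_measure Q by fact
  fix A :: "real => real set" and J assume J: "finite J" "J \<subseteq> {0..}" and A: "\<And>i. i \<in> J ==> A i \<in> sets (borel :: real measure)"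
  have [measurable_cong]: "sets P = sets path_space" "sets Q = sets path_space" by fact+
  define c where "c = (\<lambda>\<phi> :: real => ennreal. \<exists>\<psi> :: real => real. continuous_on UNIV \<psi> \<and> (\<forall>x. 0 \<le> \<psi> x \<and> \<psi> x \<le> 1) \<and> \<phi> = (\<lambda>x. ennreal (\<psi> x)))"
  have main: "(\<integral>\<^sup>+ww. (\<Prod>j\<in>J. \<phi> j (ww j)) \<partial>P) = (\<integral>\<^sup>+ww. (\<Prod>j\<in>J. \<phi> j (ww j)) \<partial>Q)"
    if "finite K" "K \<subseteq> J" "\<And>j. j \<in> K ==> \<phi> j = ind (A j)" "\<And>j. j \<in> J - K ==> c (\<phi> j)"
    for K \<phi> using that
  proof (induction K arbitrary: \<phi> rule: finite_induct)
    case empty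
    then have "\<forall>j. \<exists>\<psi> :: real => real. j \<in> J \<longrightarrow> continuous_on UNIV \<psi> \<and> (\<forall>x. 0 \<le> \<psi> x \<and> \<psi> x \<le> 1) \<and> \<phi> j = (\<lambda>x. ennreal (\<psi> x))"
      unfolding c_def by blast
    then obtain \<psi> :: "real => real => real" where \<psi>: "\<And>j. j \<in> J ==> continuous_on UNIV (\<psi> j) \<and> (\<forall>x. 0 \<le> \<psi> j x \<and> \<psi> j x \<le> 1) \<and> \<phi> j = (\<lambda>x. ennreal (\<psi> j x))"
      by metis
    define \<psi>' where "\<psi>' = (\<lambda>j. if j \<in> J then \<psi> j else (\<lambda>_. 0))"
    have "(\<Prod>j\<in>J. \<phi> j (ww j)) = (\<Prod>j\<in>J. ennreal (\<psi>' j (ww j)))" for ww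
      using \<psi> by (intro prod.cong) (auto simp: \<psi>'_def)
    moreover have "\<And>j. continuous_on UNIV (\<psi>' j)" "\<And>j x. 0 \<le> \<psi>' j x \<and> \<psi>' j x \<le> 1"
      using \<psi> by (auto simp: \<psi>'_def)
    ultimately show ?case using eq[OF J, of \<psi>'] by simp
  next
    case (insert k K)
    have kJ: "k \<in> J" "0 \<le> k" using insert.prems J by auto
    have \<phi>m: "\<phi> j \<in> borel_measurable borel" if jJ: "j \<in> J" for j
    proof (cases "j \<in> insert k K")
      case True
      then show ?thesis using insert.prems A[OF jJ] by simp
    next
      case False
      then obtain \<psi> :: "real => real" where "continuous_on UNIV \<psi>" "\<phi> j = (\<lambda>x. ennreal (\<psi> x))"
        using insert.prems(3)[of j] jJ unfolding c_def by blast
      then show ?thesis by (auto intro!: measurable_compose[OF borel_measurable_continuous_onI measurable_ennreal])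
    qed
    let ?g = "\<lambda>ww. \<Prod>j\<in>J - {k}. \<phi> j (ww j)"
    have g[measurable]: "?g \<in> borel_measurable path_space"
      using J by (intro borel_measurable_prod_ennreal measurable_compose[OF _ \<phi>m]) auto
    have k[measurable]: "(\<lambda>ww. ww k) \<in> measurable path_space borel"
      using kJ by (intro measurable_component_singleton) auto
    have g1: "?g ww \<le> 1" for ww
    proof (intro prod_le_1_ennreal)
      fix j assume "j \<in> J - {k}"
      then show "\<phi> j (ww j) \<le> 1" using insert.prems(2)[of j] insert.prems(3)[of j]
        by (cases "j \<in> K") (auto simp: c_def ennreal_le_1 split: split_indicator)
    qed
    \<comment> \<open>With all factors but the \<open>k\<close>-th frozen into a density, coordinate
      \<open>k\<close> has a finite law on the line, to which the one-dimensional criterion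
      applies.\<close>
    define R where "R = (\<lambda>P. distr (density P ?g) borel (\<lambda>ww. ww k))"
    have R: "(\<integral>\<^sup>+x. f x \<partial>R S) = (\<integral>\<^sup>+ww. ?g ww * f (ww k) \<partial>S)"
      if [measurable]: "f \<in> borel_measurable borel" and [measurable_cong]: "sets S = sets path_space" for f S
      unfolding R_def by (subst nn_integral_distr) (auto simp: nn_integral_density)
    have fin: "finite_measure (R S)" if S: "finite_measure S" and sS[measurable_cong]: "sets S = sets path_space" for S
    proof (rule finite_measureI)
      interpret finite_measure S by fact
      have "emeasure (R S) (space (R S)) = (\<integral>\<^sup>+x. 1 \<partial>R S)" by simp
      also have "\<dots> = (\<integral>\<^sup>+ww. ?g ww \<partial>S)" by (subst R[OF _ sS]) auto
      also have "\<dots> \<le> (\<integral>\<^sup>+ww. 1 \<partial>S)" using g1 by (intro nn_integral_mono) auto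
      also have "\<dots> < \<infinity>" by (simp add: less_top[symmetric])
      finally show "emeasure (R S) (space (R S)) \<noteq> \<infinity>" by simp
    qed
    have split: "(\<Prod>j\<in>J. \<phi>' j (ww j)) = ?g ww * \<phi>' k (ww k)" if "\<And>j. j \<noteq> k ==> \<phi>' j = \<phi> j" for \<phi>' ww
    proof -
      have "(\<Prod>j\<in>J. \<phi>' j (ww j)) = \<phi>' k (ww k) * (\<Prod>j\<in>J - {k}. \<phi>' j (ww j))"
        using J kJ by (simp add: prod.remove)
      also have "(\<Prod>j\<in>J - {k}. \<phi>' j (ww j)) = ?g ww" using that by (intro prod.cong) auto
      finally show ?thesis by (simp add: mult.commute)
    qed
    have "R P = R Q"
    proof (rule finite_measure_eqI_continuous)
      fix \<psi> :: "real => real" assume \<psi>: "continuous_on UNIV \<psi>" "\<And>x. 0 \<le> \<psi> x \<and> \<psi> x \<le> 1"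
      have m[measurable]: "(\<lambda>x. ennreal (\<psi> x)) \<in> borel_measurable borel"
        by (rule measurable_compose[OF borel_measurable_continuous_onI[OF \<psi>(1)] measurable_ennreal])
      define \<phi>' where "\<phi>' = \<phi>(k := \<lambda>x. ennreal (\<psi> x))"
      have "(\<integral>\<^sup>+ww. (\<Prod>j\<in>J. \<phi>' j (ww j)) \<partial>P) = (\<integral>\<^sup>+ww. (\<Prod>j\<in>J. \<phi>' j (ww j)) \<partial>Q)"
      proof (rule insert.IH)
        show "\<phi>' j = ind (A j)" if "j \<in> K" for j
          using that insert.prems insert.hyps by (auto simp: \<phi>'_def)
        show "c (\<phi>' j)" if "j \<in> J - K" for j
          using that insert.prems \<psi> by (auto simp: \<phi>'_def c_def)
      qed (use insert.prems in auto)
      moreover have "(\<Prod>j\<in>J. \<phi>' j (ww j)) = ?g ww * ennreal (\<psi> (ww k))" for ww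
        by (subst split[of \<phi>']) (auto simp: \<phi>'_def)
      ultimately show "(\<integral>\<^sup>+x. ennreal (\<psi> x) \<partial>R P) = (\<integral>\<^sup>+x. ennreal (\<psi> x) \<partial>R Q)"
        by (simp add: R[OF m P(2)] R[OF m Q(2)])
      next
      show "finite_measure (R P)" "finite_measure (R Q)" using fin P Q by auto
      show "sets (R P) = sets borel" "sets (R Q) = sets borel" by (simp_all add: R_def)
    qed
    then have "(\<integral>\<^sup>+x. \<phi> k x \<partial>R P) = (\<integral>\<^sup>+x. \<phi> k x \<partial>R Q)" by simp
    then show ?case
      by (simp add: R[OF \<phi>m[OF kJ(1)] P(2)] R[OF \<phi>m[OF kJ(1)] Q(2)] split[of \<phi>])
  qed
  let ?E = "prod_emb {0..} (\<lambda>_. borel) J (Pi\<^sub>E J A)"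
  have E: "?E \<in> sets path_space" using J A by (intro sets_PiM_I) auto
  have ind: "ind ?E ww = (\<Prod>j\<in>J. ind (A j) (ww j) :: ennreal)" if "ww \<in> space path_space" for ww
  proof -
    have "ww \<in> ?E \<longleftrightarrow> (\<forall>j\<in>J. ww j \<in> A j)"
      using that J by (auto simp: prod_emb_def space_PiM PiE_iff)
    then show ?thesis using J by (auto simp: prod_zero_iff split: split_indicator)
  qed
  have "emeasure S ?E = (\<integral>\<^sup>+ww. (\<Prod>j\<in>J. ind (A j) (ww j)) \<partial>S)" if "sets S = sets path_space" for S
  proof -
    have "emeasure S ?E = (\<integral>\<^sup>+ww. ind ?E ww \<partial>S)" using E that by simp
    also have "\<dots> = (\<integral>\<^sup>+ww. (\<Prod>j\<in>J. ind (A j) (ww j)) \<partial>S)"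
      using ind sets_eq_imp_space_eq[OF that] by (intro nn_integral_cong) auto
    finally show ?thesis .
  qed
  then show "emeasure P ?E = emeasure Q ?E"
    using main[of J "\<lambda>j. ind (A j)"] P Q J by simp
qed (use P in auto)

lemma suminf_single: "(\<And>k. k \<noteq> k0 ==> f k = (0::ennreal)) ==> (\<Sum>k. f k) = f k0"
  by (subst suminf_finite[of "{k0}"]) auto

lemma shifted_path_apply: "0 \<le> u ==> shifted_path X s w u = X (s + u) w - X s w"
  by (simp add: shifted_path_def)

lemma measurable_random_time:
  assumes "\<And>w. 0 \<le> \<tau> w" "\<And>s. 0 \<le> s ==> {w\<in>space M. \<tau> w < ereal s} \<in> sets M"
  shows "\<tau> \<in> borel_measurable M"
  unfolding borel_measurable_ereal_iff_Iio
proof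
  fix a :: ereal
  have e: "\<tau> -` {..<a} \<inter> space M = {w\<in>space M. \<tau> w < a}" by auto
  show "\<tau> -` {..<a} \<inter> space M \<in> sets M"
  proof (cases a)
    case (real r)
    show ?thesis
    proof (cases "0 \<le> r")
      case True
      then show ?thesis using assms(2) real unfolding e by simp
    next
      case False
      then have "\<not> \<tau> w < ereal r" for w
        using assms(1)[of w] by (cases "\<tau> w") auto
      then show ?thesis using real unfolding e by simp
    qed
  next
    case PInf
    have "{w\<in>space M. \<tau> w < \<infinity>} = (\<Union>n::nat. {w\<in>space M. \<tau> w < ereal (real n)})"
    proof safe
      fix w assume "w \<in> space M" "\<tau> w < \<infinity>"
      then have "\<exists>n::nat. \<tau> w < ereal n"
        using less_PInf_Ex_of_nat[of "\<tau> w"] by auto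
      then show "w \<in> (\<Union>n::nat. {w\<in>space M. \<tau> w < ereal (real n)})" using \<open>w \<in> space M\<close> by auto
    qed (auto intro: less_le_trans)
    also have "\<dots> \<in> sets M" by (intro sets.countable_UN image_subsetI assms(2)) auto
    finally show ?thesis using PInf unfolding e by simp
  next
    case MInf
    then show ?thesis unfolding e by simp
  qed
qed

section \<open>Strong Markov property\<close>

context levy
begin

lemma X_joint_measurable: "(\<lambda>(t, w). X (max 0 t) w) \<in> borel_measurable (borel \<Otimes>\<^sub>M M)"
  by (rule right_continuous_joint_measurable) (auto intro: cadlag_right cadlag_X)

lemma X_random_measurable:
  assumes [measurable]: "f \<in> borel_measurable N" "g \<in> measurable N M"
    and "\<And>x. x \<in> space N ==> 0 \<le> f x"
  shows "(\<lambda>x. X (f x) (g x)) \<in> borel_measurable N"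
proof -
  have "(\<lambda>x. (\<lambda>(t, w). X (max 0 t) w) (f x, g x)) \<in> borel_measurable N"
    by (rule measurable_compose[OF _ X_joint_measurable]) simp
  also have "?this \<longleftrightarrow> ?thesis"
    using assms(3) by (intro measurable_cong) simp
  finally show ?thesis .
qed

lemma shifted_path_random_measurable:
  assumes "f \<in> borel_measurable M" "\<And>w. 0 \<le> f w"
  shows "(\<lambda>w. shifted_path X (f w) w) \<in> measurable M path_space"
  unfolding shifted_path_def using assms
  by (intro measurable_restrict borel_measurable_diff X_random_measurable) auto

text \<open>At the dyadic times above \<tau> the identity is a countable sum of Markov properties at
  fixed times. Both sides then converge, because \<open>X\<close> and \<open>L\<close> are right
  continuous and the test functions continuous. The stopping condition uses
  \<open>\<tau> w < s\<close>, the form that first passage above a level satisfies in a filtration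
  that need not be right continuous.\<close>

lemma strong_markov:
  fixes L :: "real => 'a => real" and \<tau> :: "'a => ereal" and h :: "real \<times> real => real"
  defines "t \<equiv> \<lambda>w. real_of_ereal (\<tau> w)"
  assumes \<tau>0: "\<And>w. 0 \<le> \<tau> w"
    and \<tau>: "\<And>s. 0 \<le> s ==> {w\<in>space M. \<tau> w < ereal s} \<in> sets (filt M X s)"
    and L: "\<And>t. 0 \<le> t ==> L t \<in> borel_measurable (filt M X t)"
    and Lc: "\<And>w t. w \<in> space M ==> 0 \<le> t ==> ((\<lambda>u. L u w) \<longlongrightarrow> L t w) (at_right t)"
    and h: "continuous_on UNIV h" "\<And>z. 0 \<le> h z \<and> h z \<le> 1"
    and \<Psi>: "\<Psi> \<in> borel_measurable path_space"
  shows "(\<E> w. ennreal (h (t w, L (t w) w)) * ind {w. \<tau> w < \<infinity>} w * \<Psi> (shifted_path X (t w) w)) =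
    (\<E> w. ennreal (h (t w, L (t w) w)) * ind {w. \<tau> w < \<infinity>} w) * (\<P> ww. \<Psi> ww)"
proof -
  have [measurable]: "\<tau> \<in> borel_measurable M"
    using \<tau> filt_subset by (intro measurable_random_time \<tau>0) auto
  have [measurable]: "h \<in> borel_measurable borel"
    using h(1) by (rule borel_measurable_continuous_onI)
  have hm: "(\<lambda>x. ennreal (h (f x, g x))) \<in> borel_measurable N"
    if "f \<in> borel_measurable N" "g \<in> borel_measurable N" for f g and N :: "'a measure"
  proof -
    have "(\<lambda>x. (f x, g x)) \<in> borel_measurable N" using that by (rule borel_measurable_Pair)
    then show ?thesis by measurable
  qed
  have t0: "0 \<le> t w" for w using \<tau>0[of w] by (auto simp: t_def real_of_ereal_pos)
  have tm[measurable]: "t \<in> borel_measurable M" unfolding t_def by measurable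
  have LM: "L s \<in> borel_measurable M" if "0 \<le> s" for s using measurable_filt[OF L[OF that]] .
  have Lr: "(\<lambda>w. L (f w) w) \<in> borel_measurable M"
    if [measurable]: "f \<in> borel_measurable M" and f: "\<And>w. 0 \<le> f w" for f
  proof -
    have "(\<lambda>w. (\<lambda>(t, w). L (max 0 t) w) (f w, w)) \<in> borel_measurable M"
      by (rule measurable_compose[OF _ right_continuous_joint_measurable[OF LM Lc]]) auto
    then show ?thesis using f by (simp add: max_absorb2)
  qed
  define D where "D = (\<lambda>m w. dyadic_above m (t w))"
  have Dm[measurable]: "D m \<in> borel_measurable M" for m unfolding D_def by measurable
  have D0: "0 \<le> D m w" for m w using t0[of w] dyadic_above(1)[of "t w" m] by (simp add: D_def)
  define A where "A = {w. \<tau> w < \<infinity>}"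
  have Am[measurable]: "A \<inter> space M \<in> sets M"
  proof -
    have "{w\<in>space M. \<tau> w < \<infinity>} \<in> sets M" by measurable
    then show ?thesis by (simp add: A_def Int_def conj_commute)
  qed
  have Ai[measurable]: "(\<lambda>w. ind A w :: ennreal) \<in> borel_measurable M"
    using Am by (simp add: borel_measurable_indicator_iff)
  define H where "H = (\<lambda>w. ennreal (h (t w, L (t w) w)) * ind A w)"
  define HD where "HD = (\<lambda>m w. ennreal (h (D m w, L (D m w) w)) * ind A w)"
  have Hm[measurable]: "H \<in> borel_measurable M"
    unfolding H_def by (intro borel_measurable_times_ennreal hm Lr t0) auto
  have HDm[measurable]: "HD m \<in> borel_measurable M" for m
    unfolding HD_def by (intro borel_measurable_times_ennreal hm Lr D0) auto
  have H1: "H w \<le> 1" "HD m w \<le> 1" for m w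
    using h(2) by (auto simp: H_def HD_def ennreal_le_1 split: split_indicator)
  have shD[measurable]: "(\<lambda>w. shifted_path X (D m w) w) \<in> measurable M path_space" for m
    by (intro shifted_path_random_measurable D0) auto
  have sht[measurable]: "(\<lambda>w. shifted_path X (t w) w) \<in> measurable M path_space"
    by (intro shifted_path_random_measurable t0) auto
  have spl: "sets path_law = sets path_space" by (simp add: path_law_def)
  have dyadic: "(\<E> w. HD m w * \<Psi> (shifted_path X (D m w) w)) = (\<E> w. HD m w) * (\<P> ww. \<Psi> ww)"
    if \<Psi>[measurable]: "\<Psi> \<in> borel_measurable path_space" for m and \<Psi> :: "(real => real) => ennreal"
  proof -
    define s where "s = (\<lambda>k::nat. (real k + 1) / 2 ^ m)"
    have s0: "0 \<le> s k" for k by (simp add: s_def)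
    \<comment> \<open>\<open>B k\<close> collects the paths with \<tau> in the dyadic interval from
      \<open>k / 2 ^ m\<close> to \<open>s k\<close>, the right end excluded; there
      \<open>D m\<close> equals \<open>s k\<close>, and the event is known at time
      \<open>s k\<close>.\<close>
    define B where "B = (\<lambda>k. {w\<in>space M. \<tau> w < ereal (s k)} - {w\<in>space M. \<tau> w < ereal (real k / 2 ^ m)})"
    have Bf: "B k \<in> sets (filt M X (s k))" for k
    proof -
      have "{w\<in>space M. \<tau> w < ereal (real k / 2 ^ m)} \<in> sets (filt M X (s k))"
        using \<tau>[of "real k / 2 ^ m"] filt_mono[of "real k / 2 ^ m" "s k"]
        by (auto simp: s_def divide_right_mono)
      then show ?thesis unfolding B_def by (rule sets.Diff[OF \<tau>[OF s0]])
    qed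
    define Y where "Y = (\<lambda>k w. ennreal (h (s k, L (s k) w)) * ind (B k) w)"
    have Yf: "Y k \<in> borel_measurable (filt M X (s k))" for k
      unfolding Y_def using Bf s0 L by (intro borel_measurable_times_ennreal hm borel_measurable_indicator) auto
    have YM[measurable]: "Y k \<in> borel_measurable M" for k by (rule measurable_filt[OF Yf])
    have BD: "D m w = s k \<and> w \<in> A" if "w \<in> B k" for w k
    proof -
      have *: "ereal (real k / 2 ^ m) \<le> \<tau> w" "\<tau> w < ereal (s k)" using that by (auto simp: B_def)
      then obtain r where r: "\<tau> w = ereal r" by (cases "\<tau> w") auto
      then have "\<lfloor>2 ^ m * t w\<rfloor> = int k" using * by (auto simp: t_def s_def field_simps floor_eq_iff)
      then show ?thesis using r by (auto simp: D_def dyadic_above_def s_def A_def)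
    qed
    have ex: "\<exists>k. w \<in> B k" if w: "w \<in> A" "w \<in> space M" for w
    proof -
      obtain r where r: "\<tau> w = ereal r" using w \<tau>0[of w] by (cases "\<tau> w") (auto simp: A_def)
      have r0: "0 \<le> r" using \<tau>0[of w] r by simp
      have "real (nat \<lfloor>2 ^ m * r\<rfloor>) = of_int \<lfloor>2 ^ m * r\<rfloor>" using r0 by simp
      then have "w \<in> B (nat \<lfloor>2 ^ m * r\<rfloor>)"
        using w r unfolding B_def s_def by (auto simp: field_simps not_less) linarith+
      then show ?thesis by blast
    qed
    have pw: "HD m w * \<Phi> (D m w) w = (\<Sum>k. Y k w * \<Phi> (s k) w)" if w: "w \<in> space M" for w and \<Phi> :: "real => 'a => ennreal"
    proof (cases "w \<in> A")
      case True
      then obtain k0 where k0: "w \<in> B k0" using ex w by blast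
      have "k = k0" if "w \<in> B k" for k
      proof -
        have "s k = s k0" using BD[OF that] BD[OF k0] by simp
        then show ?thesis by (simp add: s_def field_simps)
      qed
      then have "(\<Sum>k. Y k w * \<Phi> (s k) w) = Y k0 w * \<Phi> (s k0) w"
        by (intro suminf_single) (auto simp: Y_def split: split_indicator)
      then show ?thesis using BD[OF k0] k0 by (simp add: Y_def HD_def)
    next
      case False
      then have "Y k w = 0" for k using BD[of w k] by (auto simp: Y_def split: split_indicator)
      then show ?thesis using False by (simp add: HD_def)
    qed
    have shs[measurable]: "shifted_path X (s k) \<in> measurable M path_space" for k using s0 by simp
    have "(\<E> w. HD m w * \<Psi> (shifted_path X (D m w) w)) = (\<E> w. (\<Sum>k. Y k w * \<Psi> (shifted_path X (s k) w)))"
      by (intro nn_integral_cong pw)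
    also have "\<dots> = (\<Sum>k. \<integral>\<^sup>+w. Y k w * \<Psi> (shifted_path X (s k) w) \<partial>M)"
      by (intro nn_integral_suminf) measurable
    also have "\<dots> = (\<Sum>k. (\<E> w. Y k w) * (\<P> ww. \<Psi> ww))"
    proof (intro suminf_cong)
      fix k
      have [measurable_cong]: "sets path_law = sets path_space" by (rule spl)
      have "(\<E> w. Y k w * \<Psi> (shifted_path X (s k) w)) = (\<E> w. (\<P> ww. Y k w * \<Psi> ww))"
        using markov_nn_integral[OF s0 Yf, of "\<lambda>(z, ww). z * \<Psi> ww"] by simp
      also have "\<dots> = (\<E> w. Y k w * (\<P> ww. \<Psi> ww))"
        by (intro nn_integral_cong nn_integral_cmult) simp
      also have "\<dots> = (\<E> w. Y k w) * (\<P> ww. \<Psi> ww)"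
        by (intro nn_integral_multc) simp
      finally show "(\<E> w. Y k w * \<Psi> (shifted_path X (s k) w)) = \<dots>" .
    qed
    also have "\<dots> = (\<Sum>k. \<integral>\<^sup>+w. Y k w \<partial>M) * (\<P> ww. \<Psi> ww)"
      by (rule ennreal_suminf_multc)
    also have "(\<Sum>k. \<integral>\<^sup>+w. Y k w \<partial>M) = (\<E> w. (\<Sum>k. Y k w))"
      by (intro nn_integral_suminf[symmetric]) measurable
    also have "\<dots> = (\<E> w. HD m w)"
      using pw[of _ "\<lambda>_ _. 1"] by (intro nn_integral_cong) simp
    finally show ?thesis .
  qed
  have Dlim: "filterlim (\<lambda>m. D m w) (at_right (t w)) sequentially" for w
    unfolding D_def by (rule dyadic_above_tendsto)
  have HDlim: "(\<lambda>m. HD m w) \<longlonglongrightarrow> H w" if w: "w \<in> space M" for w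
  proof -
    have "(\<lambda>m. (D m w, L (D m w) w)) \<longlonglongrightarrow> (t w, L (t w) w)"
    proof (rule tendsto_Pair)
      show "(\<lambda>m. D m w) \<longlonglongrightarrow> t w" using Dlim[of w] by (simp add: filterlim_at)
      show "(\<lambda>m. L (D m w) w) \<longlonglongrightarrow> L (t w) w" by (rule filterlim_compose[OF Lc[OF w t0] Dlim])
    qed
    then have "(\<lambda>m. h (D m w, L (D m w) w)) \<longlonglongrightarrow> h (t w, L (t w) w)"
      by (rule continuous_on_tendsto_compose[OF h(1)]) auto
    then show ?thesis unfolding H_def HD_def
      by (cases "w \<in> A") (auto intro: tendsto_ennrealI)
  qed
  \<comment> \<open>Written as an equality of finite measures on path space, the claim may be tested
    on products of continuous functions, where dominated convergence applies.\<close>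
  have "distr (density M H) path_space (\<lambda>w. shifted_path X (t w) w) = density path_law (\<lambda>_. \<integral>\<^sup>+w. H w \<partial>M)"
    (is "?P = ?Q")
  proof (rule path_space_eqI_continuous)
    have Hfin: "(\<E> w. H w) \<le> 1"
      using nn_integral_mono[of M H "\<lambda>_. 1"] H1 emeasure_space_1 by simp
    then have Hfin': "(\<E> w. H w) < \<top>" by (rule le_less_trans) simp
    have "emeasure (density M H) (space (density M H)) = (\<E> w. H w)"
      by (auto simp: emeasure_density intro!: nn_integral_cong)
    then have "finite_measure (density M H)"
      using Hfin' by (intro finite_measureI) auto
    then interpret HM: finite_measure "density M H" .
    show "finite_measure ?P" by (intro HM.finite_measure_distr) simp
    show "finite_measure ?Q"
      using Hfin' pl.emeasure_space_1 by (intro finite_measureI) (auto simp: emeasure_density)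
    show "sets ?P = sets path_space" "sets ?Q = sets path_space" by (simp_all add: spl)
    fix J :: "real set" and \<psi> :: "real => real => real"
    assume J: "finite J" "J \<subseteq> {0..}" and \<psi>: "\<And>j. continuous_on UNIV (\<psi> j)" "\<And>j x. 0 \<le> \<psi> j x \<and> \<psi> j x \<le> 1"
    define \<Psi> where "\<Psi> = (\<lambda>ww::real => real. \<Prod>j\<in>J. ennreal (\<psi> j (ww j)))"
    have \<Psi>m[measurable]: "\<Psi> \<in> borel_measurable path_space"
      unfolding \<Psi>_def
    proof (rule borel_measurable_prod_ennreal)
      fix j assume "j \<in> J"
      then have [measurable]: "(\<lambda>ww. ww j) \<in> measurable path_space borel"
        using J by (intro measurable_component_singleton) auto
      have [measurable]: "\<psi> j \<in> borel_measurable borel"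
        using \<psi>(1) by (rule borel_measurable_continuous_onI)
      show "(\<lambda>ww. ennreal (\<psi> j (ww j))) \<in> borel_measurable path_space" by measurable
    qed
    have \<Psi>1: "\<Psi> ww \<le> 1" for ww
      unfolding \<Psi>_def using \<psi>(2) by (intro prod_le_1_ennreal) (auto simp: ennreal_le_1)
    have fac1: "HD m w * \<Psi> ww \<le> 1" for m w ww using mult_mono[OF H1(2) \<Psi>1] by fastforce
    have lim1: "(\<lambda>m. \<integral>\<^sup>+w. HD m w * \<Psi> (shifted_path X (D m w) w) \<partial>M) \<longlonglongrightarrow> (\<E> w. H w * \<Psi> (shifted_path X (t w) w))"
    proof (rule nn_integral_dominated_convergence[where w="\<lambda>_. 1"])
      show "AE w in M. (\<lambda>m. HD m w * \<Psi> (shifted_path X (D m w) w)) \<longlonglongrightarrow> H w * \<Psi> (shifted_path X (t w) w)"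
      proof (rule AE_I2)
        fix w assume w: "w \<in> space M"
        have "(\<lambda>m. \<Prod>j\<in>J. \<psi> j (shifted_path X (D m w) w j)) \<longlonglongrightarrow> (\<Prod>j\<in>J. \<psi> j (shifted_path X (t w) w j))"
        proof (rule tendsto_prod)
          fix j assume "j \<in> J"
          then have j: "0 \<le> j" using J by auto
          have X1: "(\<lambda>m. X (D m w) w) \<longlonglongrightarrow> X (t w) w"
            by (rule filterlim_compose[OF cadlag_right[OF cadlag_X[OF w] t0] Dlim])
          have "filterlim (\<lambda>m. D m w + j) (at_right (t w + j)) sequentially"
            using Dlim[of w] by (auto simp: filterlim_at intro: tendsto_add)
          then have X2: "(\<lambda>m. X (D m w + j) w) \<longlonglongrightarrow> X (t w + j) w"
            by (intro filterlim_compose[OF cadlag_right[OF cadlag_X[OF w]]]) (use t0[of w] j in auto)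
          have "(\<lambda>m. X (D m w + j) w - X (D m w) w) \<longlonglongrightarrow> X (t w + j) w - X (t w) w"
            by (intro tendsto_diff X1 X2)
          then have "(\<lambda>m. shifted_path X (D m w) w j) \<longlonglongrightarrow> shifted_path X (t w) w j"
            using j by (simp add: shifted_path_apply)
          then show "(\<lambda>m. \<psi> j (shifted_path X (D m w) w j)) \<longlonglongrightarrow> \<psi> j (shifted_path X (t w) w j)"
            by (rule continuous_on_tendsto_compose[OF \<psi>(1)]) auto
        qed
        then have "(\<lambda>m. \<Psi> (shifted_path X (D m w) w)) \<longlonglongrightarrow> \<Psi> (shifted_path X (t w) w)"
          unfolding \<Psi>_def using \<psi>(2) by (subst (1 2) prod_ennreal) (auto intro: tendsto_ennrealI)
        moreover have "H w \<noteq> \<top>" "\<Psi> (shifted_path X (t w) w) \<noteq> \<top>"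
          using H1(1)[of w] \<Psi>1[of "shifted_path X (t w) w"] by (auto simp: top_unique)
        ultimately show "(\<lambda>m. HD m w * \<Psi> (shifted_path X (D m w) w)) \<longlonglongrightarrow> H w * \<Psi> (shifted_path X (t w) w)"
          using HDlim[OF w] by (intro tendsto_mult_ennreal) auto
      qed
    qed (use fac1 emeasure_space_1 in auto)
    have lim2: "(\<lambda>m. \<integral>\<^sup>+w. HD m w \<partial>M) \<longlonglongrightarrow> (\<E> w. H w)"
      by (rule nn_integral_dominated_convergence[where w="\<lambda>_. 1"]) (use HDlim H1 emeasure_space_1 in auto)
    have \<Psi>P1: "(\<P> ww. \<Psi> ww) \<le> 1"
      using nn_integral_mono[of path_law \<Psi> "\<lambda>_. 1"] \<Psi>1 pl.emeasure_space_1 by simp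
    have lim3: "(\<lambda>m. (\<E> w. HD m w) * (\<P> ww. \<Psi> ww)) \<longlonglongrightarrow> (\<E> w. H w) * (\<P> ww. \<Psi> ww)"
      using Hfin' le_less_trans[OF \<Psi>P1, of \<top>] by (intro tendsto_mult_ennreal lim2 tendsto_const) auto
    have "(\<E> w. H w * \<Psi> (shifted_path X (t w) w)) = (\<E> w. H w) * (\<P> ww. \<Psi> ww)"
      using LIMSEQ_unique[OF lim1] lim3 dyadic[OF \<Psi>m] by simp
    moreover have "(\<integral>\<^sup>+ww. \<Psi> ww \<partial>?P) = (\<E> w. H w * \<Psi> (shifted_path X (t w) w))"
      by (subst nn_integral_distr) (auto simp: nn_integral_density)
    moreover have "(\<integral>\<^sup>+ww. \<Psi> ww \<partial>?Q) = (\<E> w. H w) * (\<P> ww. \<Psi> ww)"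
      using \<Psi>m by (subst nn_integral_density) (auto simp: nn_integral_cmult cong: measurable_cong_sets[OF spl refl])
    ultimately show "(\<integral>\<^sup>+ww. (\<Prod>j\<in>J. ennreal (\<psi> j (ww j))) \<partial>?P) = (\<integral>\<^sup>+ww. (\<Prod>j\<in>J. ennreal (\<psi> j (ww j))) \<partial>?Q)"
      unfolding \<Psi>_def by simp
  qed
  then have "(\<integral>\<^sup>+ww. \<Psi> ww \<partial>?P) = (\<integral>\<^sup>+ww. \<Psi> ww \<partial>?Q)" by simp
  moreover have "(\<integral>\<^sup>+ww. \<Psi> ww \<partial>?P) = (\<E> w. H w * \<Psi> (shifted_path X (t w) w))"
    using \<Psi> by (subst nn_integral_distr) (auto simp: nn_integral_density)
  moreover have "(\<integral>\<^sup>+ww. \<Psi> ww \<partial>?Q) = (\<E> w. H w) * (\<P> ww. \<Psi> ww)"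
    using \<Psi> by (subst nn_integral_density) (auto simp: nn_integral_cmult cong: measurable_cong_sets[OF spl refl])
  ultimately show ?thesis by (simp add: H_def A_def)
qed

end

section \<open>Running supremum and first passage times\<close>

definition increment :: "(real => 'a => real) => real => real => 'a => real" where
  "increment X s u w = X (s + u) w - X s w"

text \<open>Path space contains arbitrary functions. Countably many times keep the supremum
  measurable, and it may be infinite; on cadlag paths it is the running supremum
  (\<open>path_sup_eq\<close>).\<close>

definition path_sup :: "real => (real => real) => ereal" where
  "path_sup t ww = (SUP r\<in>insert t {r\<in>\<rat>. 0 \<le> r \<and> r < t}. ereal (ww r))"

definition path_passage :: "real => (real => real) => ereal" where
  "path_passage y ww = (INF t\<in>{t\<in>\<rat>. 0 \<le> t \<and> y < ww t}. ereal t)"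

lemma countable_rat_set: "countable {r::real. r \<in> \<rat> \<and> P r}"
  by (rule countable_subset[OF _ countable_rat]) auto

lemma path_sup_measurable [measurable]: "0 \<le> t ==> path_sup t \<in> borel_measurable path_space"
  unfolding path_sup_def using countable_rat_set[of "\<lambda>r. 0 \<le> r \<and> r < t"]
  by (intro borel_measurable_SUP measurable_compose[OF measurable_component_singleton borel_measurable_ereal])
    (auto intro: countable_insert)

lemma path_passage_less_iff: "path_passage y ww < z \<longleftrightarrow> (\<exists>t\<in>\<rat>. 0 \<le> t \<and> y < ww t \<and> ereal t < z)"
  by (auto simp: path_passage_def INF_less_iff)

lemma path_passage_nonneg [simp]: "0 \<le> path_passage y ww"
  unfolding path_passage_def by (intro INF_greatest) auto

lemma path_passage_measurable:
  "(\<lambda>(y, ww). path_passage y ww) \<in> borel_measurable (borel \<Otimes>\<^sub>M path_space)"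
proof (rule measurable_random_time)
  fix s :: real
  have "{z \<in> space (borel \<Otimes>\<^sub>M path_space). (case z of (y, ww) => path_passage y ww) < ereal s} =
    (\<Union>t\<in>{t\<in>\<rat>. 0 \<le> t \<and> t < s}. {z \<in> space (borel \<Otimes>\<^sub>M path_space). fst z < snd z t})"
    by (auto simp: path_passage_less_iff)
  also have "\<dots> \<in> sets (borel \<Otimes>\<^sub>M path_space)"
  proof (rule sets.countable_UN''[OF countable_rat_set])
    show "{z \<in> space (borel \<Otimes>\<^sub>M path_space). fst z < snd z t} \<in> sets (borel \<Otimes>\<^sub>M path_space)" if "t \<in> {t\<in>\<rat>. 0 \<le> t \<and> t < s}" for t
    proof -
      have [measurable]: "(\<lambda>ww. ww t) \<in> measurable path_space borel"
        using that by (intro measurable_component_singleton) auto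
      show ?thesis by measurable
    qed
  qed
  finally show "{z \<in> space (borel \<Otimes>\<^sub>M path_space). (case z of (y, ww) => path_passage y ww) < ereal s}
      \<in> sets (borel \<Otimes>\<^sub>M path_space)" .
qed auto

lemma path_sup_eq:
  assumes "cadlag (\<lambda>t. Y t w)" "0 \<le> t" "\<And>u. 0 \<le> u ==> ww u = Y u w"
  shows "path_sup t ww = ereal (running_sup Y t w)"
proof (rule antisym)
  show "path_sup t ww \<le> ereal (running_sup Y t w)"
    unfolding path_sup_def using running_sup_upper[of Y w, OF assms(1)] assms(2,3) by (intro SUP_least) auto
  show "ereal (running_sup Y t w) \<le> path_sup t ww"
  proof (rule ccontr)
    assume "\<not> ?thesis"
    then obtain y where y: "path_sup t ww < ereal y" "y < running_sup Y t w"
      using ereal_dense2[of "path_sup t ww" "ereal (running_sup Y t w)"] by (auto simp: not_le)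
    then have "y < (SUP s\<in>{0..t}. Y s w)" by (simp add: running_sup_def)
    then obtain s where s: "s \<in> insert t {r\<in>\<rat>. 0 \<le> r \<and> r < t}" "y < Y s w"
      using less_SUP_rat_iff[of Y w 0 t y] assms by auto
    then have "ereal (ww s) \<le> path_sup t ww" unfolding path_sup_def by (intro SUP_upper)
    then show False using s y assms(2) assms(3)[of s] by (auto dest: order.strict_trans1)
  qed
qed

lemma ereal_eqI_less:
  fixes a b :: ereal
  assumes "\<And>z. a < ereal z \<longleftrightarrow> b < ereal z" shows "a = b"
proof (rule ccontr)
  assume "a \<noteq> b"
  then consider "a < b" | "b < a" by fastforce
  then show False using ereal_dense2 assms by cases (metis less_asym)+
qed

lemma path_passage_eq:
  assumes "cadlag (\<lambda>t. Y t w)" "\<And>u. 0 \<le> u ==> ww u = Y u w"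
  shows "path_passage y ww = first_passage Y y w"
proof -
  have *: "path_passage y ww < ereal z \<longleftrightarrow> first_passage Y y w < ereal z" for z
    using first_passage_less_rat_iff[of Y w, OF assms(1), of y z] assms(2)
    by (auto simp: path_passage_less_iff)
  then show ?thesis by (rule ereal_eqI_less)
qed

lemma at_right_shift: "at_right (s + u) = filtermap ((+) s) (at_right (u::real))"
proof -
  have "at_right (s + u) = at_right (u - (- s))" by (simp add: ac_simps)
  also have "\<dots> = filtermap (\<lambda>x. x - (- s)) (at_right u)" by (rule filtermap_at_right_shift[symmetric])
  also have "(\<lambda>x. x - (- s)) = (+) s" by auto
  finally show ?thesis .
qed

lemma at_left_shift: "at_left (s + u) = filtermap ((+) s) (at_left (u::real))"
proof -
  have "at_left (s + u) = filtermap uminus (at_right (- s + - u))" by (simp add: at_left_minus[of "s + u"] add.commute)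
  also have "\<dots> = filtermap ((+) s) (filtermap uminus (at_right (- u)))"
    by (simp only: at_right_shift filtermap_filtermap) (simp add: algebra_simps)
  finally show ?thesis by (simp add: at_left_minus[of u])
qed

lemma left_lim_increment:
  assumes "cadlag (\<lambda>t. X t w)" "0 \<le> s" "0 < t"
  shows "left_lim (\<lambda>u. increment X s u w) t = left_lim (\<lambda>u. X u w) (s + t) - X s w"
proof (rule left_lim_unique)
  have "((\<lambda>u. X u w) \<longlongrightarrow> left_lim (\<lambda>u. X u w) (s + t)) (at_left (s + t))"
    using assms by (intro cadlag_left) auto
  then have "((\<lambda>u. X (s + u) w) \<longlongrightarrow> left_lim (\<lambda>u. X u w) (s + t)) (at_left t)"
    by (simp add: at_left_shift filterlim_filtermap)
  then show "((\<lambda>u. increment X s u w) \<longlongrightarrow> left_lim (\<lambda>u. X u w) (s + t) - X s w) (at_left t)"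
    unfolding increment_def by (intro tendsto_intros)
qed

lemma cadlag_increment:
  assumes "cadlag (\<lambda>t. X t w)" "0 \<le> s" shows "cadlag (\<lambda>u. increment X s u w)"
  unfolding cadlag_def
proof (intro conjI allI impI)
  fix t :: real assume t: "0 \<le> t"
  have "((\<lambda>u. X u w) \<longlongrightarrow> X (s + t) w) (at_right (s + t))"
    using assms t by (intro cadlag_right) auto
  then have "((\<lambda>u. X (s + u) w) \<longlongrightarrow> X (s + t) w) (at_right t)"
    by (simp add: at_right_shift filterlim_filtermap)
  then show "continuous (at_right t) (\<lambda>u. increment X s u w)"
    unfolding increment_def continuous_within by (intro tendsto_intros)
next
  fix t :: real assume t: "0 < t"
  have "((\<lambda>u. X u w) \<longlongrightarrow> left_lim (\<lambda>u. X u w) (s + t)) (at_left (s + t))"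
    using assms t by (intro cadlag_left) auto
  then have "((\<lambda>u. X (s + u) w) \<longlongrightarrow> left_lim (\<lambda>u. X u w) (s + t)) (at_left t)"
    by (simp add: at_left_shift filterlim_filtermap)
  then have "((\<lambda>u. increment X s u w) \<longlongrightarrow> left_lim (\<lambda>u. X u w) (s + t) - X s w) (at_left t)"
    unfolding increment_def by (intro tendsto_intros)
  then show "\<exists>l. ((\<lambda>u. increment X s u w) \<longlongrightarrow> l) (at_left t)" by blast
qed

lemma snp_increment: assumes "snp X w" "0 \<le> s" shows "snp (increment X s) w"
proof -
  interpret snp X w by fact
  show ?thesis
  proof
    show "cadlag (\<lambda>t. increment X s t w)" by (rule cadlag_increment[of X w, OF cad assms(2)])
    show "increment X s 0 w = 0" by (simp add: increment_def)
    show "increment X s t w \<le> left_lim (\<lambda>u. increment X s u w) t" if "0 < t" for t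
      using npj[of "s + t"] left_lim_increment[of X w, OF cad assms(2) that] assms(2) that
      by (simp add: increment_def)
  qed
qed

lemma SUP_increment:
  assumes "cadlag (\<lambda>t. X t w)" "0 \<le> s" "0 \<le> u"
  shows "(SUP v\<in>{s..s + u}. X v w) = X s w + running_sup (increment X s) u w"
proof (rule antisym)
  have "X (s + v) w \<le> X s w + running_sup (increment X s) u w" if "0 \<le> v" "v \<le> u" for v
    using running_sup_upper[of "increment X s" w v u, OF cadlag_increment[of X w, OF assms(1,2)]] that
    by (simp add: increment_def)
  from this[of "_ - s"] show "(SUP v\<in>{s..s + u}. X v w) \<le> X s w + running_sup (increment X s) u w"
    using assms by (intro cSUP_least) auto
  have "running_sup (increment X s) u w \<le> (SUP v\<in>{s..s + u}. X v w) - X s w"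
    unfolding running_sup_def increment_def
    using cadlag_bdd_above[OF assms(1,2), of "s + u"] assms(3)
    by (intro cSUP_least) (auto intro!: diff_right_mono cSUP_upper)
  then show "X s w + running_sup (increment X s) u w \<le> (SUP v\<in>{s..s + u}. X v w)" by simp
qed

text \<open>After a rational time \<open>r\<close> the supremum of the later path never rests at the
  old maximum: once that maximum is regained, it is exceeded immediately. With rational times this
  is one almost sure event (\<open>good_AE\<close>); \<open>exceed\<close> extends it to real times
  after \<open>r\<close>.\<close>

locale good_path = snp +
  assumes no_flat: "\<And>r u v. r \<in> \<rat> ==> u \<in> \<rat> ==> v \<in> \<rat> ==> 0 \<le> r ==> r \<le> u ==> u < v ==>
    \<not> ((SUP s\<in>{r..u}. X s w) = running_sup X r w \<and> (SUP s\<in>{r..v}. X s w) = running_sup X r w)"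

locale spec_neg = levy +
  fixes \<Phi> :: "real => real"
  assumes npj: "no_positive_jumps M X" and lap: "laplace_exponent M (first_passage X) \<Phi>"
begin

abbreviation \<tau> :: "real \<Rightarrow> 'a \<Rightarrow> real" where
  "\<tau> x w \<equiv> real_of_ereal (first_passage X x w)"

abbreviation hit :: "real \<Rightarrow> 'a \<Rightarrow> ennreal" where
  "hit x w \<equiv> ind {0..} x * ind {w. first_passage X x w < \<infinity>} w"

abbreviation passage_density :: "(real \<Rightarrow> real) measure \<Rightarrow> (real \<times> real) set \<Rightarrow> real \<Rightarrow> real \<Rightarrow> 'a \<Rightarrow> ennreal" where
  "passage_density n A t x w \<equiv> ennreal (\<Phi> 1) *
    (ind A (\<tau> x w, x) * ind {0<..t} (\<tau> x w) * lifetime_tail n (t - \<tau> x w) * hit x w)"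

lemma snp_AE: "AE w in M. snp X w"
  using X0_AE npj[unfolded no_positive_jumps_def]
  by (auto simp: snp_def cadlag_X elim!: AE_mp intro!: AE_I2)

lemma X_greater_filt: "0 \<le> s ==> s \<le> t ==> {w\<in>space M. y < X s w} \<in> sets (filt M X t)"
  using X_filt[of s t] by (auto simp: borel_measurable_iff_greater)

lemma running_sup_filt: assumes "0 \<le> t" shows "running_sup X t \<in> borel_measurable (filt M X t)"
  unfolding borel_measurable_iff_greater
proof
  fix y
  have "{w \<in> space (filt M X t). y < running_sup X t w} =
      {w \<in> space (filt M X t). y < X t w} \<union> (\<Union>s\<in>{s\<in>\<rat>. 0 \<le> s \<and> s < t}. {w \<in> space (filt M X t). y < X s w})"
    using less_SUP_rat_iff[of X _ 0 t y, OF cadlag_X] assms by (auto simp: running_sup_def)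
  also have "\<dots> \<in> sets (filt M X t)"
    using X_greater_filt[of _ t] assms by (intro sets.Un sets.countable_UN''[OF countable_rat_set]) auto
  finally show "{w \<in> space (filt M X t). y < running_sup X t w} \<in> sets (filt M X t)" .
qed

lemma running_sup_measurable [measurable]: "0 \<le> t ==> running_sup X t \<in> borel_measurable M"
  by (rule measurable_filt[OF running_sup_filt])

lemma running_sup_joint_measurable: "(\<lambda>(t, w). running_sup X (max 0 t) w) \<in> borel_measurable (borel \<Otimes>\<^sub>M M)"
  unfolding borel_measurable_iff_greater
proof
  fix y
  note [measurable] = X_joint_measurable
  have *: "y < running_sup X (max 0 t) w \<longleftrightarrow> y < X (max 0 t) w \<or> (\<exists>s\<in>\<rat>. 0 \<le> s \<and> s < max 0 t \<and> y < X s w)"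
    if "w \<in> space M" for t w
    using less_SUP_rat_iff[of X w 0 "max 0 t" y, OF cadlag_X[OF that]] unfolding running_sup_def by simp
  have "{z \<in> space (borel \<Otimes>\<^sub>M M). y < (case z of (t, w) => running_sup X (max 0 t) w)} =
      {z \<in> space (borel \<Otimes>\<^sub>M M). y < (case z of (t, w) => X (max 0 t) w)} \<union>
      (\<Union>s\<in>{s\<in>\<rat>. 0 \<le> s \<and> True}. {z \<in> space (borel \<Otimes>\<^sub>M M). s < max 0 (fst z) \<and> y < X s (snd z)})"
  proof -
    define m where "m = (\<lambda>t::real. max 0 t)"
    have mx: "\<And>t. max 0 t = m t" by (simp add: m_def)
    show ?thesis using *[unfolded mx] unfolding mx by (auto simp: space_pair_measure)
  qed
  also have "\<dots> \<in> sets (borel \<Otimes>\<^sub>M M)"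
  proof (intro sets.Un sets.countable_UN''[OF countable_rat_set])
    show "{z \<in> space (borel \<Otimes>\<^sub>M M). s < max 0 (fst z) \<and> y < X s (snd z)} \<in> sets (borel \<Otimes>\<^sub>M M)"
      if "s \<in> {s\<in>\<rat>. 0 \<le> s \<and> True}" for s
    proof -
      have [measurable]: "X s \<in> borel_measurable M" using that by auto
      show ?thesis by measurable
    qed
  qed measurable
  finally show "{z \<in> space (borel \<Otimes>\<^sub>M M). y < (case z of (t, w) => running_sup X (max 0 t) w)} \<in> sets (borel \<Otimes>\<^sub>M M)" .
qed

lemma first_passage_stopping:
  assumes "0 \<le> s" shows "{w\<in>space M. first_passage X x w < ereal s} \<in> sets (filt M X s)"
proof -
  have "{w\<in>space M. first_passage X x w < ereal s} = (\<Union>t\<in>{t\<in>\<rat>. 0 \<le> t \<and> t < s}. {w\<in>space (filt M X s). x < X t w})"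
    using first_passage_less_rat_iff[of X _ x s, OF cadlag_X] by auto
  also have "\<dots> \<in> sets (filt M X s)"
    using X_greater_filt[of _ s] by (intro sets.countable_UN''[OF countable_rat_set]) auto
  finally show ?thesis .
qed

lemma first_passage_joint_measurable:
  "(\<lambda>(x, w). first_passage X x w) \<in> borel_measurable (borel \<Otimes>\<^sub>M M)"
proof (rule measurable_random_time)
  fix s :: real
  have "{z \<in> space (borel \<Otimes>\<^sub>M M). (case z of (x, w) => first_passage X x w) < ereal s} =
    (\<Union>t\<in>{t\<in>\<rat>. 0 \<le> t \<and> t < s}. {z \<in> space (borel \<Otimes>\<^sub>M M). fst z < X t (snd z)})"
    using first_passage_less_rat_iff[of X _ _ s, OF cadlag_X] by (auto simp: space_pair_measure)
  also have "\<dots> \<in> sets (borel \<Otimes>\<^sub>M M)"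
  proof (rule sets.countable_UN''[OF countable_rat_set])
    show "{z \<in> space (borel \<Otimes>\<^sub>M M). fst z < X t (snd z)} \<in> sets (borel \<Otimes>\<^sub>M M)" if "t \<in> {t\<in>\<rat>. 0 \<le> t \<and> t < s}" for t
    proof -
      have [measurable]: "X t \<in> borel_measurable M" using that by auto
      show ?thesis by measurable
    qed
  qed
  finally show "{z \<in> space (borel \<Otimes>\<^sub>M M). (case z of (x, w) => first_passage X x w) < ereal s} \<in> sets (borel \<Otimes>\<^sub>M M)" .
qed auto

lemma first_passage_measurable [measurable]: "first_passage X x \<in> borel_measurable M"
proof -
  have "(\<lambda>w. (\<lambda>(x, w). first_passage X x w) (x, w)) \<in> borel_measurable M"
    by (rule measurable_compose[OF _ first_passage_joint_measurable]) simp
  then show ?thesis by simp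
qed

lemma exp_time_measurable [measurable]: "exp_time q \<in> borel_measurable borel"
  unfolding exp_time_def by measurable

lemma exp_time_bounds: "0 \<le> q ==> 0 \<le> u ==> 0 \<le> exp_time q u \<and> exp_time q u \<le> 1"
  by (auto simp: exp_time_def real_of_ereal_pos)

lemma exp_time_integrable: "0 \<le> q ==> integrable M (\<lambda>w. exp_time q (first_passage X x w))"
  by (rule integrable_const_bound[where B=1]) (auto simp: exp_time_bounds)

lemma laplace_T: "0 < q ==> 0 \<le> x ==> (\<integral>w. exp_time q (first_passage X x w) \<partial>M) = exp (- (x * \<Phi> q))"
  using lap by (auto simp: laplace_exponent_def)

lemma nn_laplace_T:
  "0 < q ==> 0 \<le> x ==> (\<E> w. ennreal (exp_time q (first_passage X x w))) = expm (x * \<Phi> q)"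
  by (subst nn_integral_eq_integral) (auto simp: exp_time_integrable exp_time_bounds laplace_T)

lemma T_pos: assumes "snp X w" "0 < x" shows "0 < first_passage X x w"
proof -
  interpret snp X w by fact
  have "first_passage X x w \<noteq> 0"
    using T_value(2)[of x 0] X0 assms(2) by (auto simp: zero_ereal_def)
  then show ?thesis using first_passage_nonneg[of X x w] by order
qed

text \<open>Otherwise the Laplace transform at level 1 forces passage at time 0, while a path
  started at 0 that creeps upwards needs positive time.\<close>

lemma \<Phi>_pos: assumes "0 < q" shows "0 < \<Phi> q"
proof (rule ccontr)
  assume n: "\<not> 0 < \<Phi> q"
  have "(\<integral>w. 1 - exp_time q (first_passage X 1 w) \<partial>M) \<le> 0"
    using laplace_T[OF assms, of 1] exp_time_integrable[of q 1] assms n prob_space by simp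
  moreover have "(\<integral>w. 1 - exp_time q (first_passage X 1 w) \<partial>M) \<ge> 0"
    using assms by (intro integral_nonneg_AE) (auto simp: exp_time_bounds)
  ultimately have "AE w in M. 1 - exp_time q (first_passage X 1 w) = 0"
    using assms exp_time_integrable[of q 1] by (subst integral_nonneg_eq_0_iff_AE[symmetric]) (auto simp: exp_time_bounds)
  with snp_AE have "AE w in M. False"
  proof eventually_elim
    case (elim w)
    then have "0 < first_passage X 1 w" by (intro T_pos) auto
    with elim(2) assms show False by (cases "first_passage X 1 w") (auto simp: exp_time_def split: if_splits)
  qed
  then show False by simp
qed

text \<open>Otherwise the two discounts agree almost surely, so level 1 is almost surely never
  passed, against a positive Laplace transform.\<close>

lemma \<Phi>_strict_mono: assumes "0 < q" "q < q'" shows "\<Phi> q < \<Phi> q'"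
proof (rule ccontr)
  assume n: "\<not> \<Phi> q < \<Phi> q'"
  let ?f = "\<lambda>w. exp_time q (first_passage X 1 w) - exp_time q' (first_passage X 1 w)"
  have le: "exp_time q' u \<le> exp_time q u" if "0 \<le> u" for u
    using that assms by (auto simp: exp_time_def real_of_ereal_pos intro!: mult_right_mono)
  have "(\<integral>w. ?f w \<partial>M) \<le> 0"
    using laplace_T[of q 1] laplace_T[of q' 1] exp_time_integrable[of q 1] exp_time_integrable[of q' 1] assms n by simp
  moreover have "(\<integral>w. ?f w \<partial>M) \<ge> 0"
    using assms le by (intro integral_nonneg_AE) auto
  ultimately have "AE w in M. ?f w = 0"
    using assms le exp_time_integrable[of q 1] exp_time_integrable[of q' 1]
    by (subst integral_nonneg_eq_0_iff_AE[symmetric]) auto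
  with snp_AE have "AE w in M. exp_time q (first_passage X 1 w) = 0"
  proof eventually_elim
    case (elim w)
    then have "0 < first_passage X 1 w" by (intro T_pos) auto
    with elim(2) assms show ?case by (cases "first_passage X 1 w") (auto simp: exp_time_def split: if_splits)
  qed
  then have "(\<integral>w. exp_time q (first_passage X 1 w) \<partial>M) = 0"
    by (subst integral_cong_AE[where g="\<lambda>_. 0"]) auto
  then show False using laplace_T[of q 1] assms by simp
qed

text \<open>For \<open>z > 0\<close> the passage time jumps at level \<open>z\<close> from below
  \<open>a\<close> to at least \<open>b\<close> on this event, so the discount drops by at least
  \<open>exp (- a) - exp (- b)\<close>. Its mean is continuous in the level, hence the mean drop
  between \<open>y < z\<close> and \<open>z\<close> tends to 0. For \<open>z = 0\<close> the Laplace
  transform at level 0 gives immediate passage.\<close>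

lemma no_flat_level:
  assumes ab: "0 \<le> a" "a < b"
  shows "AE w in M. \<not> (running_sup X a w = z \<and> running_sup X b w = z)"
proof -
  consider "z < 0" | "z = 0" | "0 < z" by linarith
  then show ?thesis
  proof cases
    case 1
    show ?thesis using snp_AE
    proof eventually_elim
      case (elim w)
      then interpret snp X w .
      show ?case using S_nonneg[of a] 1 ab by auto
    qed
  next
    case 2
    have "(\<integral>w. 1 - exp_time 1 (first_passage X 0 w) \<partial>M) = 0"
      using laplace_T[of 1 0] exp_time_integrable[of 1 0] prob_space by simp
    then have "AE w in M. 1 - exp_time 1 (first_passage X 0 w) = 0"
      using exp_time_integrable[of 1 0] by (subst integral_nonneg_eq_0_iff_AE[symmetric]) (auto simp: exp_time_bounds)
    with snp_AE show ?thesis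
    proof eventually_elim
      case (elim w)
      then interpret snp X w by simp
      have "first_passage X 0 w = 0"
        using elim(2) first_passage_nonneg[of X 0 w] by (cases "first_passage X 0 w") (auto simp: exp_time_def zero_ereal_def split: if_splits)
      then show ?case using T_less_iff[of 0 b] ab 2 by auto
    qed
  next
    case 3
    define E where "E = {w\<in>space M. running_sup X a w = z \<and> running_sup X b w = z}"
    have [measurable]: "running_sup X a \<in> borel_measurable M" "running_sup X b \<in> borel_measurable M" using ab by auto
    have E[measurable]: "E \<in> sets M" unfolding E_def using ab by measurable
    let ?d = "exp (- a) - exp (- b)"
    have d: "0 < ?d" using ab by simp
    have ineq: "?d * prob E \<le> exp (- (y * \<Phi> 1)) - exp (- (z * \<Phi> 1))" if y: "0 \<le> y" "y < z" for y
    proof -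
      have "(\<integral>w. ?d * ind E w \<partial>M) \<le> (\<integral>w. exp_time 1 (first_passage X y w) - exp_time 1 (first_passage X z w) \<partial>M)"
      proof (rule integral_mono_AE)
        show "AE w in M. ?d * ind E w \<le> exp_time 1 (first_passage X y w) - exp_time 1 (first_passage X z w)"
          using snp_AE
        proof eventually_elim
          case (elim w)
          then interpret snp X w .
          have le: "exp_time 1 v \<le> exp_time 1 u" if "0 \<le> u" "u \<le> v" for u v
            using that by (cases u; cases v) (auto simp: exp_time_def)
          show ?case
          proof (cases "w \<in> E")
            case True
            then have "first_passage X y w < ereal a" "ereal b \<le> first_passage X z w"
              using T_less_iff[of y a] T_ge_iff[of z b] y ab by (auto simp: E_def)
            then have "exp_time 1 (ereal a) \<le> exp_time 1 (first_passage X y w)" "exp_time 1 (first_passage X z w) \<le> exp_time 1 (ereal b)"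
              using ab by (auto intro!: le)
            then show ?thesis using True by (simp add: exp_time_def)
          next
            case False
            then show ?thesis using le[OF _ first_passage_mono[of y z X w]] y by simp
          qed
        qed
      qed (auto intro!: Bochner_Integration.integrable_diff exp_time_integrable integrable_real_mult_indicator simp: less_top[symmetric])
      then show ?thesis using laplace_T[of 1 y] laplace_T[of 1 z] y E exp_time_integrable[of 1] by simp
    qed
    have "((\<lambda>y. exp (- (y * \<Phi> 1)) - exp (- (z * \<Phi> 1))) \<longlongrightarrow> exp (- (z * \<Phi> 1)) - exp (- (z * \<Phi> 1))) (at_left z)"
      by (intro tendsto_intros)
    moreover have "\<forall>\<^sub>F y in at_left z. ?d * prob E \<le> exp (- (y * \<Phi> 1)) - exp (- (z * \<Phi> 1))"
      using eventually_at_left_real[OF 3] by eventually_elim (use ineq in auto)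
    ultimately have "?d * prob E \<le> exp (- (z * \<Phi> 1)) - exp (- (z * \<Phi> 1))"
      by (intro tendsto_lowerbound) auto
    then have "prob E = 0" using d measure_nonneg[of M E] by (simp add: mult_le_0_iff)
    then have "E \<in> null_sets M" by (auto simp: emeasure_eq_measure)
    then show ?thesis by (rule AE_I') (auto simp: E_def)
  qed
qed

lemma reflected_filt: "0 \<le> t ==> reflected X t \<in> borel_measurable (filt M X t)"
  unfolding reflected_def using running_sup_filt X_filt by (intro borel_measurable_diff) auto

text \<open>The level in question is \<open>reflected X r w\<close>, which belongs to the past at
  \<open>r\<close>; by the Markov property it is a constant for the later increments, and
  \<open>no_flat_level\<close> applies to each constant.\<close>

lemma no_flat_AE:
  assumes "0 \<le> r" "r \<le> u" "u < v"
  shows "AE w in M. \<not> ((SUP s\<in>{r..u}. X s w) = running_sup X r w \<and> (SUP s\<in>{r..v}. X s w) = running_sup X r w)"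
proof -
  let ?a = "u - r" and ?b = "v - r"
  define \<Psi> :: "real \<times> (real => real) => ennreal" where
    "\<Psi> = (\<lambda>(z, ww). if path_sup ?a ww = ereal z \<and> path_sup ?b ww = ereal z then 1 else 0)"
  have ab: "0 \<le> ?a" "0 \<le> ?b" "?a < ?b" using assms by auto
  note [measurable] = path_sup_measurable[OF ab(1)] path_sup_measurable[OF ab(2)]
  have \<Psi>m[measurable]: "\<Psi> \<in> borel_measurable (borel \<Otimes>\<^sub>M path_space)" unfolding \<Psi>_def by measurable
  have z: "(\<P> ww. \<Psi> (z, ww)) = 0" for z
  proof -
    have "(\<P> ww. \<Psi> (z, ww)) = (\<E> w. \<Psi> (z, shifted_path X 0 w))"
      unfolding path_law_def by (rule nn_integral_distr) auto
    also have "\<dots> = (\<E> w. 0)"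
    proof (rule nn_integral_cong_AE)
      show "AE w in M. \<Psi> (z, shifted_path X 0 w) = 0" using snp_AE no_flat_level[OF ab(1,3), of z]
      proof eventually_elim
        case (elim w)
        then interpret snp X w by simp
        have "path_sup t (shifted_path X 0 w) = ereal (running_sup X t w)" if "0 \<le> t" for t
          using that by (intro path_sup_eq[of X w, OF cad]) (auto simp: shifted_path_apply X0)
        then show ?case using elim(2) ab by (auto simp: \<Psi>_def)
      qed
    qed
    finally show ?thesis by simp
  qed
  have "(\<E> w. \<Psi> (reflected X r w, shifted_path X r w)) = 0"
    using markov_nn_integral[OF \<open>0 \<le> r\<close> reflected_filt[OF \<open>0 \<le> r\<close>] \<Psi>m] by (simp add: z)
  moreover have [measurable]: "reflected X r \<in> borel_measurable M" "shifted_path X r \<in> measurable M path_space"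
    using measurable_filt[OF reflected_filt[of r]] assms by auto
  ultimately have "AE w in M. \<Psi> (reflected X r w, shifted_path X r w) = 0"
    by (subst (asm) nn_integral_0_iff_AE) auto
  with AE_space show ?thesis
  proof eventually_elim
    case (elim w)
    have c: "cadlag (\<lambda>t. X t w)" using elim by (intro cadlag_X)
    have "path_sup t (shifted_path X r w) = ereal (running_sup (increment X r) t w)" if "0 \<le> t" for t
      using that \<open>0 \<le> r\<close> by (intro path_sup_eq cadlag_increment c) (auto simp: shifted_path_apply increment_def)
    moreover have "(SUP s\<in>{r..u}. X s w) = X r w + running_sup (increment X r) ?a w"
      "(SUP s\<in>{r..v}. X s w) = X r w + running_sup (increment X r) ?b w"
      using SUP_increment[of X w r ?a] SUP_increment[of X w r ?b] c assms by auto
    ultimately show ?case using elim(2) ab by (auto simp: \<Psi>_def reflected_def split: if_splits)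
  qed
qed

lemma good_AE: "AE w in M. good_path X w"
proof -
  have "AE w in M. \<forall>r\<in>\<rat>. \<forall>u\<in>\<rat>. \<forall>v\<in>\<rat>. 0 \<le> r \<longrightarrow> r \<le> u \<longrightarrow> u < v \<longrightarrow>
     \<not> ((SUP s\<in>{r..u}. X s w) = running_sup X r w \<and> (SUP s\<in>{r..v}. X s w) = running_sup X r w)"
    using no_flat_AE by (simp add: AE_ball_countable[OF countable_rat] AE_impI)
  with snp_AE show ?thesis
  proof eventually_elim
    case (elim w)
    then show ?case by (auto simp: good_path_def good_path_axioms_def)
  qed
qed

end

section \<open>Additive functionals carried by the supremum\<close>

lemma running_sup_split:
  assumes c: "cadlag (\<lambda>t. X t w)" and s: "0 \<le> s" "0 \<le> u"
  shows "running_sup X (s + u) w = max (running_sup X s w) (X s w + running_sup (increment X s) u w)"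
proof -
  have c': "cadlag (\<lambda>t. increment X s t w)" using cadlag_increment[of X w, OF c s(1)] .
  have *: "y < running_sup X (s + u) w \<longleftrightarrow> y < max (running_sup X s w) (X s w + running_sup (increment X s) u w)" for y
  proof -
    have "y < running_sup X (s + u) w \<longleftrightarrow> (\<exists>v. 0 \<le> v \<and> v \<le> s + u \<and> y < X v w)"
      using s by (intro less_running_sup_iff[of X w, OF c]) auto
    also have "\<dots> \<longleftrightarrow> (\<exists>v. 0 \<le> v \<and> v \<le> s \<and> y < X v w) \<or> (\<exists>v. 0 \<le> v \<and> v \<le> u \<and> y < X (s + v) w)"
    proof safe
      fix v assume v: "0 \<le> v" "v \<le> s + u" "y < X v w" "\<nexists>v. 0 \<le> v \<and> v \<le> u \<and> y < X (s + v) w"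
      show "\<exists>v\<ge>0. v \<le> s \<and> y < X v w"
      proof (cases "v \<le> s")
        case False
        then have "0 \<le> v - s \<and> v - s \<le> u \<and> y < X (s + (v - s)) w" using v by auto
        then show ?thesis using v(4) by blast
      qed (use v in auto)
    next
      fix v assume "0 \<le> v" "v \<le> s" "y < X v w"
      then show "\<exists>v\<ge>0. v \<le> s + u \<and> y < X v w" using s by (intro exI[of _ v]) auto
    next
      fix v assume "0 \<le> v" "v \<le> u" "y < X (s + v) w"
      then show "\<exists>v\<ge>0. v \<le> s + u \<and> y < X v w" using s by (intro exI[of _ "s + v"]) auto
    qed
    also have "(\<exists>v. 0 \<le> v \<and> v \<le> s \<and> y < X v w) \<longleftrightarrow> y < running_sup X s w"
      using less_running_sup_iff[of X w, OF c s(1)] by simp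
    also have "(\<exists>v. 0 \<le> v \<and> v \<le> u \<and> y < X (s + v) w) \<longleftrightarrow> y - X s w < running_sup (increment X s) u w"
      using less_running_sup_iff[of "increment X s" w u "y - X s w", OF c' s(2)] by (simp add: increment_def)
    finally show ?thesis by (auto simp: less_max_iff_disj)
  qed
  show ?thesis by (meson * linorder_neqE_linordered_idom order_less_irrefl)
qed

lemma (in snp) reflected_shift:
  assumes "0 \<le> s" "0 \<le> u" "running_sup X s w = X s w"
  shows "reflected X (s + u) w = reflected (increment X s) u w"
proof -
  interpret i: snp "increment X s" w by (rule snp_increment) (use assms in \<open>auto intro: snp_axioms\<close>)
  show ?thesis
    using running_sup_split[of X w, OF cad assms(1,2)] assms i.S_nonneg[OF assms(2)]
    by (simp add: reflected_def increment_def)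
qed

text \<open>The path sits exactly at \<open>x\<close> when it passes that level, so it passes
  \<open>x + y\<close> when the restarted path passes \<open>y\<close>.\<close>

lemma (in snp) first_passage_shift:
  assumes x: "0 \<le> x" "first_passage X x w = ereal t" and y: "0 \<le> y"
  shows "first_passage X (x + y) w = ereal t + first_passage (increment X t) y w"
proof (rule ereal_eqI_less)
  fix z
  note t = T_value[OF x]
  have "first_passage X (x + y) w < ereal z \<longleftrightarrow> (\<exists>s\<ge>0. x + y < X s w \<and> s < z)"
    by (simp add: first_passage_less_iff)
  also have "\<dots> \<longleftrightarrow> (\<exists>u\<ge>0. y < increment X t u w \<and> u < z - t)"
  proof safe
    fix s assume s: "0 \<le> s" "x + y < X s w" "s < z"
    have "t < s"
    proof (rule ccontr)
      assume "\<not> t < s"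
      then show False using X_le_S[of s t] s t y by auto
    qed
    then show "\<exists>u\<ge>0. y < increment X t u w \<and> u < z - t"
      using s t by (intro exI[of _ "s - t"]) (auto simp: increment_def)
  next
    fix u assume "0 \<le> u" "y < increment X t u w" "u < z - t"
    then show "\<exists>s\<ge>0. x + y < X s w \<and> s < z"
      using t by (intro exI[of _ "t + u"]) (auto simp: increment_def)
  qed
  also have "\<dots> \<longleftrightarrow> first_passage (increment X t) y w < ereal (z - t)"
    by (simp add: first_passage_less_iff)
  also have "\<dots> \<longleftrightarrow> ereal t + first_passage (increment X t) y w < ereal z"
    by (cases "first_passage (increment X t) y w") auto
  finally show "first_passage X (x + y) w < ereal z \<longleftrightarrow> ereal t + first_passage (increment X t) y w < ereal z" .
qed

text \<open>A level strictly between \<open>S s\<close> and \<open>S t\<close> would be crossed by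
  creeping at a time inside the interval, and such a time is a zero of the reflected
  process.\<close>

lemma (in snp) constant_off_zeros:
  assumes s: "0 \<le> s" "s \<le> t" and z: "zero_set X w \<inter> {s<..<t} = {}"
  shows "S s = S t"
proof (rule ccontr)
  assume "S s \<noteq> S t"
  then have "S s < S t" using S_mono[OF s] by simp
  then obtain y where y: "S s < y" "y < S t" using dense by blast
  then have y0: "0 \<le> y" using S_nonneg[OF s(1)] by simp
  have "T y < ereal t" using T_less_iff[OF y0, of t] y s by auto
  then obtain u where u: "T y = ereal u" "u < t" using first_passage_nonneg[of X y w] by (cases "T y") auto
  note v = T_value[OF y0 u(1)]
  have "s < u"
  proof (rule ccontr)
    assume "\<not> s < u"
    then have "S u \<le> S s" using v by (intro S_mono) auto
    then show False using v y by simp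
  qed
  then have "u \<in> zero_set X w \<inter> {s<..<t}" using v u by (auto simp: zero_set_def)
  then show False using z by simp
qed

section \<open>Zeros of the reflected process and flat stretches of the supremum\<close>

context good_path
begin

text \<open>If the supremum were still at \<open>S r\<close> at time \<open>v\<close>, two rational
  times between \<open>u\<close> and \<open>v\<close> would contradict
  \<open>no_flat\<close>.\<close>

lemma exceed:
  assumes r: "r \<in> \<rat>" "0 \<le> r" "r \<le> u" "u < v" and s: "S r \<le> (SUP s\<in>{r..u}. X s w)"
  shows "S r < S v"
proof (rule ccontr)
  assume n: "\<not> S r < S v"
  obtain u' where u': "u' \<in> \<rat>" "u < u'" "u' < v" using Rats_dense_in_real[OF r(4)] by auto
  obtain v' where v': "v' \<in> \<rat>" "u' < v'" "v' < v" using Rats_dense_in_real[OF u'(3)] by auto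
  have e: "(SUP s\<in>{r..ww}. X s w) = S r" if ww: "u \<le> ww" "ww \<le> v" for ww
  proof (rule antisym)
    have "(SUP s\<in>{r..ww}. X s w) \<le> S ww" unfolding running_sup_def
      using cadlag_bdd_above[OF cad, of 0 ww] r ww by (intro cSUP_subset_mono) auto
    also have "\<dots> \<le> S r" using S_mono[of ww v] n r ww by auto
    finally show "(SUP s\<in>{r..ww}. X s w) \<le> S r" .
    have "(SUP s\<in>{r..u}. X s w) \<le> (SUP s\<in>{r..ww}. X s w)"
      using cadlag_bdd_above[OF cad r(2), of ww] r ww by (intro cSUP_subset_mono) auto
    then show "S r \<le> (SUP s\<in>{r..ww}. X s w)" using s by simp
  qed
  show False using no_flat[OF r(1) u'(1) v'(1) r(2) _ v'(2)] e[of u'] e[of v'] u' v' r by auto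
qed

lemma zero_exceeds:
  assumes t: "0 \<le> t0" "t0 < t" "S t0 = S t" "t \<in> zero_set X w" and v: "t < v"
  shows "S t < S v"
proof -
  obtain r where r: "r \<in> \<rat>" "t0 < r" "r < t" using Rats_dense_in_real[OF t(2)] by auto
  have "S r = S t" using S_mono[of t0 r] S_mono[of r t] t r by auto
  moreover have "X t w \<le> (SUP s\<in>{r..t}. X s w)"
    using cadlag_bdd_above[OF cad, of r t] r t by (intro cSUP_upper) auto
  ultimately show ?thesis using exceed[of r t v] r t v by (auto simp: zero_set_def)
qed

lemma no_zeros_of_flat:
  assumes "0 \<le> s" "s \<le> t" "S s = S t" shows "zero_set X w \<inter> {s<..<t} = {}"
proof (rule ccontr)
  assume "\<not> ?thesis"
  then obtain u where u: "u \<in> zero_set X w" "s < u" "u < t" by auto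
  have "S s = S u" using S_mono[of s u] S_mono[of u t] assms u by auto
  then show False using zero_exceeds[of s u t] u assms by auto
qed

lemma S_pos: assumes "0 < v" shows "0 < S v"
  using exceed[of 0 0 v] assms X0 by simp

lemma T_0: "T 0 = 0"
proof (rule antisym)
  show "T 0 \<le> 0"
  proof (rule ccontr)
    assume "\<not> T 0 \<le> 0"
    then obtain e where e: "0 < ereal e" "ereal e < T 0" using ereal_dense2[of 0 "T 0"] by (auto simp: not_le)
    then have "T 0 < ereal e" using T_less_iff[of 0 e] S_pos[of e] by auto
    then show False using e by simp
  qed
qed simp

end

text \<open>\<open>l\<close> is one path of the functional. It grows only at zeros of the reflected
  process; flat stretches of the supremum contain none, so \<open>l\<close> is a function of the
  supremum (\<open>l_eq\<close>).\<close>

locale path_functional = good_path +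
  fixes l :: "real => real"
  assumes l_cont: "continuous_on {0..} l"
    and l_const: "\<And>s t. 0 \<le> s ==> s \<le> t ==> zero_set X w \<inter> {s<..<t} = {} ==> l s = l t"
begin

lemma l_eq: assumes "0 \<le> s" "0 \<le> t" "S s = S t" shows "l s = l t"
proof -
  have "l s = l t" if "0 \<le> s" "s \<le> t" "S s = S t" for s t
    using l_const[OF that(1,2)] no_zeros_of_flat[OF that] by simp
  from this[of s t] this[of t s] assms linear[of s t] show ?thesis by metis
qed

definition lv where "lv x = l (real_of_ereal (T x))"

text \<open>Passage times may jump in the level, so \<open>lv\<close> is not a composition of
  continuous maps. Instead, the preimage of a closed set is the image of a compact set of times
  under the continuous supremum.\<close>

lemma lv_continuous: assumes x: "0 \<le> x" "T x < \<infinity>" shows "continuous_on {0..x} lv"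
proof -
  obtain t where t: "T x = ereal t" using x first_passage_nonneg[of X x w] by (cases "T x") auto
  note tv = T_value[OF x(1) t]
  have Tf: "\<exists>s. T y = ereal s \<and> s \<in> {0..t} \<and> S s = y" if y: "y \<in> {0..x}" for y
  proof -
    have "T y \<le> ereal t" using first_passage_mono[of y x X w] t y by simp
    then obtain s where s: "T y = ereal s" using first_passage_nonneg[of X y w] by (cases "T y") auto
    then show ?thesis using T_value[OF _ s] \<open>T y \<le> ereal t\<close> y by auto
  qed
  have "closed (lv -` C \<inter> {0..x})" if C: "closed C" for C
  proof -
    have "lv -` C \<inter> {0..x} = (\<lambda>s. S s) ` (l -` C \<inter> {0..t})"
    proof (intro subset_antisym subsetI)
      fix y assume "y \<in> lv -` C \<inter> {0..x}"
      then have y: "lv y \<in> C" "y \<in> {0..x}" by auto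
      obtain s where "T y = ereal s" "s \<in> {0..t}" "S s = y" using Tf[OF y(2)] by auto
      then show "y \<in> (\<lambda>s. S s) ` (l -` C \<inter> {0..t})" using y by (auto simp: lv_def)
    next
      fix y assume "y \<in> (\<lambda>s. S s) ` (l -` C \<inter> {0..t})"
      then obtain s where s: "s \<in> {0..t}" "l s \<in> C" and yS: "y = S s" by auto
      have Sx: "S s \<in> {0..x}" using S_nonneg[of s] S_mono[of s t] tv s by auto
      obtain u where u: "T (S s) = ereal u" "u \<in> {0..t}" "S u = S s" using Tf[OF Sx] by auto
      have "l u = l s" using u s by (intro l_eq) auto
      then show "y \<in> lv -` C \<inter> {0..x}" using u s Sx yS by (simp add: lv_def)
    qed
    moreover have "compact (l -` C \<inter> {0..t})"
      using continuous_closed_preimage[OF continuous_on_subset[OF l_cont, of "{0..t}"] _ C]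
      by (auto simp: compact_eq_bounded_closed Int_commute intro: bounded_subset[OF bounded_closed_interval])
    moreover have "continuous_on (l -` C \<inter> {0..t}) (\<lambda>s. S s)"
      by (rule continuous_on_subset[OF S_continuous]) auto
    ultimately show ?thesis using compact_imp_closed compact_continuous_image by metis
  qed
  then show ?thesis by (subst continuous_on_closed_vimage) auto
qed

text \<open>Rational levels reach every level with finite passage time by continuity of
  \<open>lv\<close>. If \<open>S t\<close> is the final supremum its passage time is infinite; then
  \<open>l\<close> is found by left continuity at the first time when this supremum is
  reached.\<close>

lemma l_linear:
  assumes a: "\<And>q. q \<in> \<rat> ==> 0 \<le> q ==> T q < \<infinity> ==> lv q = a * q" and t: "0 \<le> t"
  shows "l t = a * S t"
proof -
  have lv: "lv y = a * y" if y: "0 \<le> y" "T y < \<infinity>" for y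
  proof -
    obtain x where x: "y < x" "T x < \<infinity>"
    proof -
      obtain n :: nat where "T y < ereal n" using y(2) less_PInf_Ex_of_nat by auto
      then have "y < S n" using T_less_iff[of y n] y by simp
      then obtain x where x: "y < x" "x < S n" using dense by blast
      then have "T x < ereal n" using T_less_iff[of x n] y by simp
      then have "T x < \<infinity>" by auto
      with x that show thesis by blast
    qed
    have Tle: "T q < \<infinity>" if "q \<le> x" for q
      using first_passage_mono[OF that, of X w] x(2) by order
    have cA: "continuous_on {0..x} lv" using x y by (intro lv_continuous) auto
    have "((\<lambda>z. lv z - a * z) \<longlongrightarrow> lv y - a * y) (at_right y)"
    proof -
      have "(lv \<longlongrightarrow> lv y) (at y within {0..x})" using cA x y by (auto simp: continuous_on_def)
      then have "(lv \<longlongrightarrow> lv y) (at y within {y..x})" by (rule tendsto_within_subset) (use y in auto)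
      then have "(lv \<longlongrightarrow> lv y) (at_right y)" using x by (simp add: at_within_Icc_at_right)
      then show ?thesis by (intro tendsto_intros)
    qed
    \<comment> \<open>A nonzero limit would keep the difference away from 0 on a right neighbourhood
      of \<open>y\<close>, which contains rational levels.\<close>
    moreover have "lv y - a * y = 0" if "\<forall>\<^sub>F z in at_right y. lv z - a * z \<noteq> 0"
    proof -
      have "\<forall>\<^sub>F z in at_right y. z < x" using x by (auto simp: eventually_at_right_field)
      with that have "\<forall>\<^sub>F z in at_right y. z < x \<and> lv z - a * z \<noteq> 0" by eventually_elim auto
      then obtain b where b: "b > y" "\<And>z. y < z ==> z < b ==> z < x \<and> lv z - a * z \<noteq> 0"
        by (auto simp: eventually_at_right_field)
      obtain q where "q \<in> \<rat>" "y < q" "q < b" using Rats_dense_in_real[OF b(1)] by auto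
      then show ?thesis using b(2)[of q] a[of q] Tle[of q] y by auto
    qed
    ultimately have "lv y - a * y = 0"
      using tendsto_imp_eventually_ne[of "\<lambda>z. lv z - a * z" "lv y - a * y" "at_right y" 0] by blast
    then show ?thesis by simp
  qed
  show ?thesis
  proof (cases "T (S t) < \<infinity>")
    case True
    then obtain u where u: "T (S t) = ereal u" using first_passage_nonneg[of X "S t" w] by (cases "T (S t)") auto
    have "l t = l u" using T_value[OF S_nonneg[OF t] u] t by (intro l_eq) auto
    then show ?thesis using lv[OF S_nonneg[OF t] True] u by (simp add: lv_def)
  next
    case False
    define Z where "Z = {s. 0 \<le> s \<and> S s = S t}"
    have "closed Z"
    proof -
      have "closed ({0..} \<inter> (\<lambda>s. S s) -` {S t})"
        by (intro continuous_closed_preimage S_continuous) auto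
      also have "{0..} \<inter> (\<lambda>s. S s) -` {S t} = Z" by (auto simp: Z_def)
      finally show ?thesis .
    qed
    moreover have "Z \<noteq> {}" "bdd_below Z" using t by (auto simp: Z_def intro: bdd_belowI[of _ 0])
    ultimately have iZ: "Inf Z \<in> Z" by (intro closed_contains_Inf)
    define t0 where "t0 = Inf Z"
    have t0: "0 \<le> t0" "S t0 = S t" using iZ by (auto simp: t0_def Z_def)
    have "S t \<noteq> 0" using False T_0 by auto
    then have "0 < t0" using t0 by (cases "t0 = 0") auto
    have less: "S s < S t" if "0 \<le> s" "s < t0" for s
    proof -
      have "s \<notin> Z" using that \<open>bdd_below Z\<close> cInf_lower[of s Z] by (auto simp: t0_def)
      then have "S s \<noteq> S t" using that by (auto simp: Z_def)
      then show ?thesis using S_mono[of s t0] t0 that by auto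
    qed
    have ls: "l s = a * S s" if s: "0 \<le> s" "s < t0" for s
    proof -
      have "T (S s) < ereal t" using T_less_iff[OF S_nonneg[OF s(1)] t] less[OF s] by simp
      then have fin: "T (S s) < \<infinity>" by auto
      then obtain u where u: "T (S s) = ereal u" using first_passage_nonneg[of X "S s" w] by (cases "T (S s)") auto
      have "l s = l u" using T_value[OF S_nonneg[OF s(1)] u] s by (intro l_eq) auto
      then show ?thesis using lv[OF S_nonneg[OF s(1)] fin] u by (simp add: lv_def)
    qed
    have lim: "((\<lambda>s. f s) \<longlongrightarrow> f t0) (at_left t0)" if "continuous_on {0..} f" for f :: "real => real"
    proof -
      have "(f \<longlongrightarrow> f t0) (at t0 within {0..})" using that t0 by (auto simp: continuous_on_def)
      then have "(f \<longlongrightarrow> f t0) (at t0 within {0..t0})" by (rule tendsto_within_subset) auto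
      then show ?thesis using \<open>0 < t0\<close> by (simp add: at_within_Icc_at_left)
    qed
    have "((\<lambda>s. a * S s) \<longlongrightarrow> a * S t0) (at_left t0)"
      by (intro tendsto_intros lim S_continuous)
    moreover have "((\<lambda>s. a * S s) \<longlongrightarrow> l t0) (at_left t0)"
    proof (rule Lim_transform_eventually[OF lim[OF l_cont]])
      show "\<forall>\<^sub>F s in at_left t0. l s = a * S s"
        using eventually_at_left_real[OF \<open>0 < t0\<close>] by eventually_elim (use ls in auto)
    qed
    ultimately have "l t0 = a * S t0" by (intro tendsto_unique[of "at_left t0"]) auto
    moreover have "l t = l t0" using t t0 by (intro l_eq) auto
    ultimately show ?thesis using t0 by simp
  qed
qed

end

text \<open>Monotonicity sandwiches \<open>b (n * x)\<close> between integer multiples of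
  \<open>b 1\<close>, so \<open>n\<close> times the error stays below \<open>b 1\<close> for every
  \<open>n\<close>.\<close>

lemma additive_nonneg_linear:
  fixes b :: "real => real"
  assumes add: "\<And>x y. 0 \<le> x ==> 0 \<le> y ==> b (x + y) = b x + b y" and nn: "\<And>x. 0 \<le> x ==> 0 \<le> b x"
    and x: "0 \<le> x"
  shows "b x = b 1 * x"
proof -
  have mono: "b x \<le> b y" if "0 \<le> x" "x \<le> y" for x y
    using add[of x "y - x"] nn[of "y - x"] that by simp
  have mult: "b (real n * y) = real n * b y" if "0 \<le> y" for n y
  proof (induction n)
    case 0
    then show ?case using add[of 0 0] by simp
  next
    case (Suc n)
    then show ?case using add[of "real n * y" y] that by (simp add: algebra_simps)
  qed
  have b1: "0 \<le> b 1" using nn by simp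
  have bound: "real n * \<bar>b x - b 1 * x\<bar> \<le> b 1" if n: "0 < n" for n :: nat
  proof -
    define k where "k = nat \<lfloor>real n * x\<rfloor>"
    have k: "real k \<le> real n * x" "real n * x \<le> real k + 1"
      using x by (auto simp: k_def)
    have "b (real k * 1) \<le> b (real n * x)" using k by (intro mono) auto
    then have 1: "real k * b 1 \<le> real n * b x" using mult[of 1 k] mult[of x n] x by simp
    have "b (real n * x) \<le> b (real (Suc k) * 1)" using k x by (intro mono) auto
    then have 2: "real n * b x \<le> (real k + 1) * b 1" using mult[of 1 "Suc k"] mult[of x n] x by (simp add: algebra_simps)
    have 3: "real k * b 1 \<le> real n * x * b 1" "real n * x * b 1 \<le> (real k + 1) * b 1"
      using k b1 by (auto intro: mult_right_mono)
    have "\<bar>real n * b x - real n * x * b 1\<bar> \<le> b 1"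
      using 1 2 3 by (auto simp: algebra_simps abs_le_iff)
    also have "real n * b x - real n * x * b 1 = real n * (b x - b 1 * x)" by (simp add: algebra_simps)
    also have "\<bar>\<dots>\<bar> = real n * \<bar>b x - b 1 * x\<bar>" by (simp add: abs_mult)
    finally show ?thesis .
  qed
  show ?thesis
  proof (rule ccontr)
    assume "b x \<noteq> b 1 * x"
    then have p: "0 < \<bar>b x - b 1 * x\<bar>" by simp
    obtain n :: nat where n: "b 1 / \<bar>b x - b 1 * x\<bar> < real n" using reals_Archimedean2 by blast
    then have "b 1 < real n * \<bar>b x - b 1 * x\<bar>" using p by (simp add: field_simps)
    moreover have "0 < n" using n b1 p by (cases n) (auto simp: field_simps)
    ultimately show False using bound[of n] by simp
  qed
qed

definition path_reflected :: "(real => real) => (real => real)" where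
  "path_reflected ww = (\<lambda>u\<in>{0..}. real_of_ereal (path_sup u ww) - ww u)"

lemma path_reflected_measurable [measurable]: "path_reflected \<in> measurable path_space path_space"
  unfolding path_reflected_def
proof (rule measurable_restrict)
  fix u :: real assume u: "u \<in> {0..}"
  have [measurable]: "(\<lambda>ww. ww u) \<in> measurable path_space borel" using u by (rule measurable_component_singleton)
  have [measurable]: "path_sup u \<in> borel_measurable path_space" using u by (intro path_sup_measurable) auto
  show "(\<lambda>ww. real_of_ereal (path_sup u ww) - ww u) \<in> borel_measurable path_space" by measurable
qed

text \<open>From a zero on, the reflected process depends on the increments of \<open>X\<close>
  alone. A functional of the reflected path thereby becomes one of \<open>shifted_path\<close>,
  which the strong Markov property can handle.\<close>

lemma (in snp) path_from_reflected:
  assumes s: "0 \<le> s" "running_sup X s w = X s w"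
  shows "path_from (reflected X) s w = path_reflected (shifted_path X s w)"
proof
  fix u
  show "path_from (reflected X) s w u = path_reflected (shifted_path X s w) u"
  proof (cases "0 \<le> u")
    case True
    have "path_sup u (shifted_path X s w) = ereal (running_sup (increment X s) u w)"
      using True s(1) by (intro path_sup_eq cadlag_increment[of X w, OF cad]) (auto simp: shifted_path_apply increment_def)
    then show ?thesis
      using True reflected_shift[OF s(1) True s(2)]
      by (simp add: path_from_def path_reflected_def shifted_path_apply reflected_def[of "increment X s"] increment_def)
  qed (simp add: path_from_def path_reflected_def)
qed

text \<open>What the local time and the time spent at the supremum have in common; the
  proportionality theorem is applied to both.\<close>

locale sup_functional = spec_neg +
  fixes L :: "real => 'a => real"
  assumes L_filt: "\<And>t. 0 \<le> t ==> L t \<in> borel_measurable (filt M X t)"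
    and L_cont: "\<And>w. w \<in> space M ==> continuous_on {0..} (\<lambda>t. L t w)"
    and L_mono: "\<And>w. w \<in> space M ==> mono_on {0..} (\<lambda>t. L t w)"
    and L_0: "AE w in M. L 0 w = 0"
    and L_add: "additive_functional M (reflected X) L"
    and L_const: "AE w in M. \<forall>s t. 0 \<le> s \<longrightarrow> s \<le> t \<longrightarrow> zero_set X w \<inter> {s<..<t} = {} \<longrightarrow> L s w = L t w"
begin

text \<open>The truncation acts on a null set only, since \<open>L\<close> increases from 0 almost
  surely; it gives \<open>A_nonneg\<close> on every path.\<close>

definition A :: "real => 'a => real" where
  "A x w = max 0 (L (\<tau> x w) w)"

definition I :: "real => 'a => real" where
  "I x w = ind {w. first_passage X x w < \<infinity>} w"

definition \<alpha> :: "real => real => real" where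
  "\<alpha> p x = (\<integral>w. exp (- (p * A x w)) * I x w \<partial>M)"

lemma L_right: "w \<in> space M ==> 0 \<le> t ==> ((\<lambda>u. L u w) \<longlongrightarrow> L t w) (at_right t)"
  using L_cont[of w] by (auto simp: continuous_on_def intro: tendsto_within_subset)

lemma L_M: "0 \<le> t ==> L t \<in> borel_measurable M"
  by (rule measurable_filt[OF L_filt])

lemma A_measurable [measurable]: "A x \<in> borel_measurable M"
proof -
  have "(\<lambda>w. (\<lambda>(t, w). L (max 0 t) w) (\<tau> x w, w)) \<in> borel_measurable M"
    by (rule measurable_compose[OF _ right_continuous_joint_measurable[OF L_M L_right]]) auto
  then have "(\<lambda>w. L (\<tau> x w) w) \<in> borel_measurable M"
    by (simp add: max_absorb2 real_of_ereal_pos)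
  then show ?thesis unfolding A_def[abs_def] by measurable
qed

lemma I_measurable [measurable]: "I x \<in> borel_measurable M"
proof -
  have "{w\<in>space M. first_passage X x w < \<infinity>} \<in> sets M" by measurable
  then show ?thesis unfolding I_def[abs_def]
    by (subst borel_measurable_indicator_iff) (simp add: Int_def conj_commute)
qed

lemma I_cases: "I x w = (if first_passage X x w < \<infinity> then 1 else 0)"
  by (simp add: I_def)

lemma A_nonneg: "0 \<le> A x w" by (simp add: A_def)

lemma pf_AE: "AE w in M. path_functional X w (\<lambda>t. L t w) \<and> L 0 w = 0 \<and> w \<in> space M"
  using good_AE L_0 L_const AE_space
  by eventually_elim (auto simp: path_functional_def path_functional_axioms_def L_cont)

lemma L_nonneg: "w \<in> space M ==> L 0 w = 0 ==> 0 \<le> t ==> 0 \<le> L t w"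
  using mono_onD[OF L_mono[of w], of 0 t] by auto

lemma A_eq: "w \<in> space M ==> L 0 w = 0 ==> A x w = L (\<tau> x w) w"
  by (simp add: A_def L_nonneg real_of_ereal_pos)

lemma I_mono: "x \<le> y ==> I y w \<le> I x w"
  using first_passage_mono[of x y X w] by (auto simp: I_cases)

lemma A_mono: assumes "w \<in> space M" "x \<le> y" "I y w = 1" shows "A x w \<le> A y w"
proof -
  have "first_passage X x w \<le> first_passage X y w" "first_passage X y w < \<infinity>"
    using first_passage_mono[of x y X w] assms by (auto simp: I_cases split: if_splits)
  then have "\<tau> x w \<le> \<tau> y w"
    by (intro real_of_ereal_positive_mono) auto
  then have "L (\<tau> x w) w \<le> L (\<tau> y w) w"
    using L_mono[OF assms(1)] by (auto simp: mono_on_def real_of_ereal_pos)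
  then show ?thesis by (simp add: A_def)
qed

text \<open>Strong Markov property at the passage time of \<open>x\<close>. The factor
  \<open>I (x + y + z)\<close> restricts to paths that go on to pass a further level, so that all
  increments over a grid can be weighted by the same event.\<close>

lemma regenerate_nn:
  assumes xyz: "0 \<le> x" "0 \<le> y" "0 \<le> z" and pr: "0 \<le> p" "0 \<le> \<mu>"
  shows "(\<E> w. ennreal (exp (- (p * A x w)) * exp (- (\<mu> * (A (x + y) w - A x w))) * I (x + y + z) w)) =
    (\<E> w. ennreal (exp (- (p * A x w)) * I x w)) *
    (\<E> w. ennreal (exp (- (\<mu> * A y w)) * I (y + z) w))"
proof -
  obtain \<Lambda> where \<Lambda>m: "\<And>t. 0 \<le> t ==> \<Lambda> t \<in> borel_measurable path_space"
    and \<Lambda>: "AE w in M. \<forall>t\<ge>0. L t w = \<Lambda> t (path_from (reflected X) 0 w) \<and>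
       (\<forall>s\<ge>0. L (s + t) w = L s w + \<Lambda> t (path_from (reflected X) s w))"
    using L_add unfolding additive_functional_def by blast
  \<comment> \<open>\<open>\<Lambda>\<close> is measurable in the path for each fixed time only, so
    the passage time is replaced by dyadic times above it; continuity of \<open>L\<close> removes
    the approximation.\<close>
  define D where "D = (\<lambda>m ww. dyadic_above m (real_of_ereal (path_passage y ww)))"
  define \<Psi> where "\<Psi> = (\<lambda>m ww. ennreal (exp (- (\<mu> * max 0 (\<Lambda> (D m ww) (path_reflected ww)))) *
     (if path_passage (y + z) ww < \<infinity> then 1 else 0)))"
  have pp[measurable]: "path_passage y \<in> borel_measurable path_space" for y
    using measurable_compose[OF _ path_passage_measurable, of "\<lambda>ww. (y, ww)"] by simp
  have D0: "0 < D m ww" for m ww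
    using dyadic_above(1)[of "real_of_ereal (path_passage y ww)" m]
    by (simp add: D_def) (meson le_less_trans path_passage_nonneg real_of_ereal_pos)
  have "(\<lambda>ww. \<Lambda> (D m ww) (path_reflected ww)) \<in> borel_measurable path_space" for m
  proof -
    have "(\<lambda>ww. (\<lambda>k ww. \<Lambda> (max 0 ((of_int k + 1) / 2 ^ m)) (path_reflected ww)) \<lfloor>2 ^ m * real_of_ereal (path_passage y ww)\<rfloor> ww)
      \<in> borel_measurable path_space"
    proof (rule measurable_compose_countable[where f="\<lambda>k ww. \<Lambda> (max 0 ((of_int k + 1) / 2 ^ m)) (path_reflected ww)"])
      show "(\<lambda>ww. \<Lambda> (max 0 ((of_int k + 1) / 2 ^ m)) (path_reflected ww)) \<in> borel_measurable path_space" for k :: int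
        by (rule measurable_compose[OF path_reflected_measurable \<Lambda>m]) simp
      show "(\<lambda>ww. \<lfloor>2 ^ m * real_of_ereal (path_passage y ww)\<rfloor>) \<in> path_space \<rightarrow>\<^sub>M count_space UNIV"
        by measurable
    qed
    moreover have "max 0 ((of_int \<lfloor>2 ^ m * real_of_ereal (path_passage y ww)\<rfloor> + 1) / 2 ^ m) = D m ww" for ww
      using D0[of m ww] by (simp add: D_def dyadic_above_def)
    ultimately show ?thesis by simp
  qed
  then have \<Psi>m[measurable]: "\<Psi> m \<in> borel_measurable path_space" for m
    unfolding \<Psi>_def by measurable
  have \<Psi>1: "\<Psi> m ww \<le> 1" for m ww
    using pr by (auto simp: \<Psi>_def ennreal_le_1)
  let ?t = "\<lambda>w. \<tau> x w"
  define h where "h = (\<lambda>z::real\<times>real. exp (- (p * max 0 (snd z))))"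
  have SM: "(\<E> w. ennreal (h (?t w, L (?t w) w)) * ind {w. first_passage X x w < \<infinity>} w * \<Psi> m (shifted_path X (?t w) w)) =
    (\<E> w. ennreal (h (?t w, L (?t w) w)) * ind {w. first_passage X x w < \<infinity>} w) * (\<P> ww. \<Psi> m ww)" for m
  proof (rule strong_markov)
    show "continuous_on UNIV h" unfolding h_def by (intro continuous_intros)
    show "0 \<le> h z \<and> h z \<le> 1" for z using pr by (simp add: h_def)
  qed (use L_filt L_right first_passage_stopping in auto)
  have hA: "ennreal (h (?t w, L (?t w) w)) * ind {w. first_passage X x w < \<infinity>} w = ennreal (exp (- (p * A x w)) * I x w)" for w
    by (simp add: h_def A_def I_cases)
  have shm[measurable]: "(\<lambda>w. shifted_path X (?t w) w) \<in> measurable M path_space"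
    by (intro shifted_path_random_measurable) (auto simp: real_of_ereal_pos)
  have SM': "(\<E> w. ennreal (exp (- (p * A x w)) * I x w) * \<Psi> m (shifted_path X (?t w) w)) =
     (\<E> w. ennreal (exp (- (p * A x w)) * I x w)) * (\<E> w. \<Psi> m (shifted_path X 0 w))" for m
  proof -
    have "(\<P> ww. \<Psi> m ww) = (\<E> w. \<Psi> m (shifted_path X 0 w))"
      unfolding path_law_def by (rule nn_integral_distr) auto
    then show ?thesis using SM[of m] unfolding hA by simp
  qed
  \<comment> \<open>The limit is used twice: with \<open>x' = x\<close> behind the strong Markov
    property, and with \<open>x' = 0\<close> for the unshifted path.\<close>
  have conv: "(\<lambda>m. \<Psi> m (shifted_path X t w)) \<longlonglongrightarrow> ennreal (exp (- (\<mu> * (A (x' + y) w - A x' w))) * I (x' + y + z) w)"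
    if x': "0 \<le> x'" "first_passage X x' w = ereal t"
      and w: "path_functional X w (\<lambda>t. L t w) \<and> L 0 w = 0 \<and> w \<in> space M"
      and \<Lambda>: "\<forall>t\<ge>0. L t w = \<Lambda> t (path_from (reflected X) 0 w) \<and>
       (\<forall>s\<ge>0. L (s + t) w = L s w + \<Lambda> t (path_from (reflected X) s w))" for x' t w
  proof -
    interpret path_functional X w "\<lambda>t. L t w" using w by simp
    note tv = T_value[OF x']
    have pass: "path_passage v (shifted_path X t w) = first_passage (increment X t) v w" for v
      using tv by (intro path_passage_eq cadlag_increment[of X w, OF cad]) (auto simp: shifted_path_apply increment_def)
    have shift: "first_passage X (x' + v) w = ereal t + first_passage (increment X t) v w" if "0 \<le> v" for v
      using first_passage_shift[OF x' that] .
    show ?thesis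
    proof (cases "first_passage X (x' + y + z) w < \<infinity>")
      case False
      then have "\<not> path_passage (y + z) (shifted_path X t w) < \<infinity>"
        using shift[of "y + z"] xyz by (simp add: pass add.assoc)
      then show ?thesis using False by (simp add: \<Psi>_def I_cases)
    next
      case True
      have fin: "path_passage (y + z) (shifted_path X t w) < \<infinity>"
        using shift[of "y + z"] xyz True by (auto simp: pass add.assoc)
      then have "first_passage (increment X t) y w < \<infinity>"
        using first_passage_mono[of y "y + z" "increment X t" w] xyz fin by (simp only: pass) (auto intro: le_less_trans)
      then obtain s where s: "first_passage (increment X t) y w = ereal s"
        using first_passage_nonneg[of "increment X t" y w] by (cases "first_passage (increment X t) y w") auto
      have s0: "0 \<le> s" using first_passage_nonneg[of "increment X t" y w] s by simp
      have ts: "first_passage X (x' + y) w = ereal (t + s)" using shift[of y] s xyz by simp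
      have D: "D m (shifted_path X t w) = dyadic_above m s" for m by (simp add: D_def pass s)
      have dpos: "0 \<le> dyadic_above m s" for m using dyadic_above(1)[of s m] s0 by simp
      have "\<Lambda> (dyadic_above m s) (path_reflected (shifted_path X t w)) = L (t + dyadic_above m s) w - L t w" for m
      proof -
        have "L (t + dyadic_above m s) w = L t w + \<Lambda> (dyadic_above m s) (path_from (reflected X) t w)"
          using \<Lambda> dpos[of m] tv(1) by blast
        moreover have "path_from (reflected X) t w = path_reflected (shifted_path X t w)"
          using tv by (intro path_from_reflected) auto
        ultimately show ?thesis by simp
      qed
      then have val: "\<Psi> m (shifted_path X t w) = expm (\<mu> * (L (t + dyadic_above m s) w - L t w))" for m
        using fin L_mono[of w] w dpos[of m] tv by (simp add: \<Psi>_def D mono_on_def max_absorb2)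
      have "filterlim (\<lambda>m. t + dyadic_above m s) (at_right (t + s)) sequentially"
        using dyadic_above_tendsto[of s] by (auto simp: filterlim_at intro: tendsto_add)
      then have "(\<lambda>m. L (t + dyadic_above m s) w) \<longlonglongrightarrow> L (t + s) w"
        by (rule filterlim_compose[OF L_right, rotated 2]) (use w tv s0 in auto)
      then have "(\<lambda>m. expm (\<mu> * (L (t + dyadic_above m s) w - L t w))) \<longlonglongrightarrow>
         expm (\<mu> * (L (t + s) w - L t w))"
        by (intro tendsto_ennrealI tendsto_intros)
      then show ?thesis unfolding val
        using True A_eq[of w x'] A_eq[of w "x' + y"] w x' ts by (simp add: I_cases)
    qed
  qed
  have lim1: "(\<lambda>m. \<integral>\<^sup>+w. ennreal (exp (- (p * A x w)) * I x w) * \<Psi> m (shifted_path X (?t w) w) \<partial>M) \<longlonglongrightarrow>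
    (\<E> w. ennreal (exp (- (p * A x w)) * exp (- (\<mu> * (A (x + y) w - A x w))) * I (x + y + z) w))"
  proof (rule nn_integral_dominated_convergence[where w="\<lambda>_. 1"])
    have "ennreal (exp (- (p * A x w)) * I x w) \<le> 1" for w
      using pr by (auto simp: I_cases ennreal_le_1 A_nonneg)
    from mult_mono[OF this \<Psi>1] show "AE w in M. ennreal (exp (- (p * A x w)) * I x w) * \<Psi> j (shifted_path X (?t w) w) \<le> 1" for j
      by (intro AE_I2) fastforce
    show "AE w in M. (\<lambda>m. ennreal (exp (- (p * A x w)) * I x w) * \<Psi> m (shifted_path X (?t w) w)) \<longlonglongrightarrow>
      ennreal (exp (- (p * A x w)) * exp (- (\<mu> * (A (x + y) w - A x w))) * I (x + y + z) w)"
      using pf_AE \<Lambda>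
    proof eventually_elim
      case (elim w)
      show ?case
      proof (cases "first_passage X x w < \<infinity>")
        case True
        then obtain t where t: "first_passage X x w = ereal t"
          using first_passage_nonneg[of X x w] by (cases "first_passage X x w") auto
        have "(\<lambda>m. ennreal (exp (- (p * A x w)) * I x w) * \<Psi> m (shifted_path X t w)) \<longlonglongrightarrow>
           ennreal (exp (- (p * A x w)) * I x w) * ennreal (exp (- (\<mu> * (A (x + y) w - A x w))) * I (x + y + z) w)"
          by (intro tendsto_mult_ennreal tendsto_const conv[OF xyz(1) t elim]) auto
        then show ?thesis using True t by (simp add: I_cases ennreal_mult[symmetric] mult.assoc)
      next
        case False
        moreover from this have "\<not> first_passage X (x + y + z) w < \<infinity>"
          using first_passage_mono[of x "x + y + z" X w] xyz by auto
        ultimately show ?thesis by (simp add: I_cases)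
      qed
    qed
  qed (use emeasure_space_1 in auto)
  have lim2: "(\<lambda>m. \<integral>\<^sup>+w. \<Psi> m (shifted_path X 0 w) \<partial>M) \<longlonglongrightarrow> (\<E> w. ennreal (exp (- (\<mu> * A y w)) * I (y + z) w))"
  proof (rule nn_integral_dominated_convergence[where w="\<lambda>_. 1"])
    show "AE w in M. (\<lambda>m. \<Psi> m (shifted_path X 0 w)) \<longlonglongrightarrow> ennreal (exp (- (\<mu> * A y w)) * I (y + z) w)"
      using pf_AE \<Lambda>
    proof eventually_elim
      case (elim w)
      interpret path_functional X w "\<lambda>t. L t w" using elim by simp
      have "A 0 w = 0" using A_eq[of w 0] T_0 elim(1) by simp
      then show ?case using conv[OF order_refl _ elim, of 0] T_0 by (simp add: zero_ereal_def)
    qed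
    show "AE w in M. \<Psi> j (shifted_path X 0 w) \<le> 1" for j using \<Psi>1 by auto
  qed (use emeasure_space_1 in auto)
  have fin: "(\<E> w. ennreal (exp (- (p * A x w)) * I x w)) < \<top>" "(\<E> w. ennreal (exp (- (\<mu> * A y w)) * I (y + z) w)) < \<top>"
  proof -
    have *: "(\<E> w. ennreal (exp (- (p * A x w)) * I x' w)) \<le> (\<E> w. 1)" if "0 \<le> p" for p x x'
      using that by (intro nn_integral_mono) (auto simp: I_cases ennreal_le_1 A_nonneg)
    show "(\<E> w. ennreal (exp (- (p * A x w)) * I x w)) < \<top>" "(\<E> w. ennreal (exp (- (\<mu> * A y w)) * I (y + z) w)) < \<top>"
      using le_less_trans[OF *[OF pr(1)], of \<top>] le_less_trans[OF *[OF pr(2)], of \<top>] emeasure_space_1 by auto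
  qed
  have "(\<lambda>m. (\<E> w. ennreal (exp (- (p * A x w)) * I x w)) * (\<E> w. \<Psi> m (shifted_path X 0 w))) \<longlonglongrightarrow>
     (\<E> w. ennreal (exp (- (p * A x w)) * I x w)) * (\<E> w. ennreal (exp (- (\<mu> * A y w)) * I (y + z) w))"
    using fin by (intro tendsto_mult_ennreal tendsto_const lim2) auto
  then show ?thesis using LIMSEQ_unique[OF lim1] unfolding SM' by simp
qed

end

section \<open>Vanishing quadratic variation of the normalised exponential\<close>

lemma sum_squares_le_max_variation:
  fixes z :: "nat => real"
  assumes "\<And>k. k < n ==> \<bar>z (Suc k) - z k\<bar> \<le> e" "(\<Sum>k<n. \<bar>z (Suc k) - z k\<bar>) \<le> V" "0 \<le> e"
  shows "(\<Sum>k<n. (z (Suc k) - z k)\<^sup>2) \<le> e * V"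
proof -
  have "(\<Sum>k<n. (z (Suc k) - z k)\<^sup>2) \<le> (\<Sum>k<n. e * \<bar>z (Suc k) - z k\<bar>)"
  proof (rule sum_mono)
    fix k assume "k \<in> {..<n}"
    then have "\<bar>z (Suc k) - z k\<bar> * \<bar>z (Suc k) - z k\<bar> \<le> e * \<bar>z (Suc k) - z k\<bar>"
      using assms(1)[of k] by (intro mult_right_mono) auto
    then show "(z (Suc k) - z k)\<^sup>2 \<le> e * \<bar>z (Suc k) - z k\<bar>" by (simp add: power2_eq_square)
  qed
  also have "\<dots> = e * (\<Sum>k<n. \<bar>z (Suc k) - z k\<bar>)" by (simp add: sum_distrib_left)
  also have "\<dots> \<le> e * V" using assms by (intro mult_left_mono) auto
  finally show ?thesis .
qed

context sup_functional
begin

lemma expA_bounds: "0 \<le> p ==> 0 \<le> exp (- (p * A x w)) * I y w \<and> exp (- (p * A x w)) * I y w \<le> 1"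
  by (auto simp: I_cases A_nonneg)

lemma expA_integrable: "0 \<le> p ==> integrable M (\<lambda>w. exp (- (p * A x w)) * I y w)"
  by (rule integrable_const_bound[where B=1]) (use expA_bounds in auto)

lemma regenerate:
  assumes xyz: "0 \<le> x" "0 \<le> y" "0 \<le> z" and pr: "0 \<le> p" "0 \<le> r"
  shows "integrable M (\<lambda>w. exp (- (p * A x w)) * exp (- (r * (A (x + y) w - A x w))) * I (x + y + z) w)"
    and "(\<integral>w. exp (- (p * A x w)) * exp (- (r * (A (x + y) w - A x w))) * I (x + y + z) w \<partial>M) =
    \<alpha> p x * \<alpha> r y * \<alpha> 0 z"
proof -
  have step: "integrable M (\<lambda>w. exp (- (p * A x w)) * exp (- (r * (A (x + y) w - A x w))) * I (x + y + z) w) \<and>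
    (\<integral>w. exp (- (p * A x w)) * exp (- (r * (A (x + y) w - A x w))) * I (x + y + z) w \<partial>M) =
    \<alpha> p x * (\<integral>w. exp (- (r * A y w)) * I (y + z) w \<partial>M)"
    if xyz: "0 \<le> x" "0 \<le> y" "0 \<le> z" and pr: "0 \<le> p" "0 \<le> r" for x y z p r
  proof -
    let ?f = "\<lambda>w. exp (- (p * A x w)) * exp (- (r * (A (x + y) w - A x w))) * I (x + y + z) w"
    have nn: "0 \<le> ?f w" for w by (auto simp: I_cases)
    have i: "integrable M ?f"
    proof (rule integrable_const_bound[where B=1])
      show "AE w in M. norm (?f w) \<le> 1"
      proof (rule AE_I2)
        fix w assume w: "w \<in> space M"
        show "norm (?f w) \<le> 1"
        proof (cases "I (x + y + z) w = 1")
          case True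
          then have "I (x + y) w = 1" using I_mono[of "x + y" "x + y + z" w] xyz by (auto simp: I_cases split: if_splits)
          then have "A x w \<le> A (x + y) w" using A_mono[OF w, of x "x + y"] xyz by simp
          then have "exp (- (p * A x w)) * exp (- (r * (A (x + y) w - A x w))) \<le> 1 * 1"
            using pr A_nonneg[of x w] by (intro mult_mono) auto
          then show ?thesis using True nn[of w] by simp
        next
          case False
          then have "I (x + y + z) w = 0" by (auto simp: I_cases split: if_splits)
          then show ?thesis by simp
        qed
      qed
    qed measurable
    have e: "(\<E> w. ennreal (exp (- (p * A x w)) * I y w)) = ennreal (\<integral>w. exp (- (p * A x w)) * I y w \<partial>M)"
      if "0 \<le> p" for p x y
      using that by (intro nn_integral_eq_integral expA_integrable) (auto simp: I_cases)
    have nn2: "0 \<le> (\<integral>w. exp (- (p * A x w)) * I y w \<partial>M)" for p x y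
      by (intro integral_nonneg_AE) (auto simp: I_cases)
    have "ennreal (\<integral>w. ?f w \<partial>M) = (\<E> w. ennreal (?f w))"
      using nn by (intro nn_integral_eq_integral[symmetric] i) auto
    also have "\<dots> = ennreal (\<alpha> p x * (\<integral>w. exp (- (r * A y w)) * I (y + z) w \<partial>M))"
      unfolding regenerate_nn[OF xyz pr] e[OF pr(1)] e[OF pr(2)] by (simp add: \<alpha>_def ennreal_mult nn2)
    finally have "(\<integral>w. ?f w \<partial>M) = \<alpha> p x * (\<integral>w. exp (- (r * A y w)) * I (y + z) w \<partial>M)"
      using nn nn2 by (subst (asm) ennreal_inj) (auto simp: \<alpha>_def intro!: integral_nonneg_AE mult_nonneg_nonneg)
    with i show ?thesis by simp
  qed
  have "(\<integral>w. exp (- (r * A y w)) * I (y + z) w \<partial>M) = \<alpha> r y * \<alpha> 0 z"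
    using step[of y 0 z r 0] assms by (simp add: \<alpha>_def)
  then show "integrable M (\<lambda>w. exp (- (p * A x w)) * exp (- (r * (A (x + y) w - A x w))) * I (x + y + z) w)"
    "(\<integral>w. exp (- (p * A x w)) * exp (- (r * (A (x + y) w - A x w))) * I (x + y + z) w \<partial>M) = \<alpha> p x * \<alpha> r y * \<alpha> 0 z"
    using step[OF assms] by simp_all
qed

lemma \<alpha>_0_0: "0 \<le> p ==> \<alpha> p 0 = 1"
proof -
  assume "0 \<le> p"
  have "\<alpha> p 0 = (\<integral>w. 1 \<partial>M)" unfolding \<alpha>_def
  proof (rule integral_cong_AE)
    show "AE w in M. exp (- (p * A 0 w)) * I 0 w = 1"
      using pf_AE
    proof eventually_elim
      case (elim w)
      then interpret path_functional X w "\<lambda>t. L t w" by simp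
      show ?case using elim T_0 by (simp add: I_cases A_eq)
    qed
  qed auto
  then show ?thesis using prob_space by simp
qed

lemma \<alpha>_regenerate: "0 \<le> y ==> 0 \<le> z ==> 0 \<le> r ==>
    (\<integral>w. exp (- (r * A y w)) * I (y + z) w \<partial>M) = \<alpha> r y * \<alpha> 0 z"
  using regenerate(2)[of y 0 z r 0] \<alpha>_0_0[of 0] by simp

lemma \<alpha>_mult: "0 \<le> x ==> 0 \<le> y ==> 0 \<le> p ==> \<alpha> p (x + y) = \<alpha> p x * \<alpha> p y"
proof -
  assume xy: "0 \<le> x" "0 \<le> y" "0 \<le> p"
  have "\<alpha> p (x + y) = (\<integral>w. exp (- (p * A x w)) * exp (- (p * (A (x + y) w - A x w))) * I (x + y + 0) w \<partial>M)"
    unfolding \<alpha>_def by (intro Bochner_Integration.integral_cong) (auto simp: exp_add[symmetric] algebra_simps)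
  then show ?thesis using regenerate(2)[of x y 0 p p] \<alpha>_0_0[of 0] xy by simp
qed

lemma \<alpha>_pos: assumes "0 \<le> x" "0 \<le> p" shows "0 < \<alpha> p x"
proof -
  have "0 \<le> \<alpha> p x" unfolding \<alpha>_def by (intro integral_nonneg_AE) (auto simp: I_cases)
  moreover have "\<alpha> p x \<noteq> 0"
  proof
    assume "\<alpha> p x = 0"
    then have "AE w in M. exp (- (p * A x w)) * I x w = 0"
      using expA_integrable[OF assms(2), of x x] expA_bounds[OF assms(2)]
      unfolding \<alpha>_def by (subst (asm) integral_nonneg_eq_0_iff_AE) auto
    then have "AE w in M. exp_time 1 (first_passage X x w) = 0"
      by eventually_elim (auto simp: I_cases exp_time_def split: if_splits)
    then have "(\<integral>w. exp_time 1 (first_passage X x w) \<partial>M) = 0"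
      by (subst integral_cong_AE[where g="\<lambda>_. 0"]) auto
    then show False using laplace_T[of 1 x] assms by simp
  qed
  ultimately show ?thesis by simp
qed

lemma \<alpha>_antimono: "0 \<le> x ==> \<alpha> 1 x \<le> \<alpha> 0 x"
  unfolding \<alpha>_def by (rule integral_mono[OF expA_integrable expA_integrable]) (auto simp: I_cases A_nonneg)

text \<open>\<open>\<alpha> 0 x\<close> is the probability of passing \<open>x\<close>, so this is
  the Laplace transform at 1 of \<open>A x\<close> conditionally on passage.\<close>

definition \<phi> :: "real => real" where "\<phi> x = \<alpha> 1 x / \<alpha> 0 x"

lemma \<phi>: "0 \<le> x ==> 0 < \<phi> x" "0 \<le> x ==> \<phi> x \<le> 1" "\<phi> 0 = 1"
  "0 \<le> x ==> 0 \<le> y ==> \<phi> (x + y) = \<phi> x * \<phi> y"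
  using \<alpha>_pos[of x 0] \<alpha>_pos[of x 1] \<alpha>_antimono[of x]
  by (auto simp: \<phi>_def \<alpha>_mult \<alpha>_0_0)

lemma \<phi>_power: "0 \<le> x ==> \<phi> (real k * x) = \<phi> x ^ k"
proof (induction k)
  case (Suc k)
  have "\<phi> (real (Suc k) * x) = \<phi> (x + real k * x)" by (simp add: algebra_simps)
  also have "\<dots> = \<phi> x * \<phi> (real k * x)" using Suc by (intro \<phi>) auto
  finally show ?case using Suc by simp
qed (simp add: \<phi>)

definition Z :: "real => 'a => real" where "Z y w = exp (- A y w) / \<phi> y"

lemma Z_measurable [measurable]: "Z y \<in> borel_measurable M"
  unfolding Z_def[abs_def] by measurable

text \<open>Martingale orthogonality: the mixed term equals twice the second moment at the left end,
  so the mean square of an increment is a difference of second moments. The factors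
  \<open>\<alpha> 0\<close> account for passing the common final level
  \<open>y + \<delta> + z\<close>.\<close>

lemma Z_increment:
  assumes "0 \<le> y" "0 \<le> \<delta>" "0 \<le> z"
  shows "integrable M (\<lambda>w. (Z (y + \<delta>) w - Z y w)\<^sup>2 * I (y + \<delta> + z) w)"
    "(\<integral>w. (Z (y + \<delta>) w - Z y w)\<^sup>2 * I (y + \<delta> + z) w \<partial>M) =
     \<alpha> 2 (y + \<delta>) * \<alpha> 0 z / (\<phi> (y + \<delta>))\<^sup>2 - \<alpha> 2 y * \<alpha> 0 (\<delta> + z) / (\<phi> y)\<^sup>2"
proof -
  let ?I = "I (y + \<delta> + z)"
  let ?a = "\<phi> y" and ?b = "\<phi> (y + \<delta>)"
  have e2: "exp (- (2 * a)) = (exp (- a))\<^sup>2" for a :: real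
    by (simp add: power2_eq_square exp_add[symmetric])
  have eq: "(Z (y + \<delta>) w - Z y w)\<^sup>2 * ?I w =
     exp (- (2 * A (y + \<delta>) w)) * ?I w / ?b\<^sup>2
     - 2 * (exp (- (2 * A y w)) * exp (- (1 * (A (y + \<delta>) w - A y w))) * ?I w) / (?a * ?b)
     + exp (- (2 * A y w)) * I (y + (\<delta> + z)) w / ?a\<^sup>2" for w
  proof -
    have "exp (- (2 * A y w)) * exp (- (1 * (A (y + \<delta>) w - A y w))) = exp (- A y w) * exp (- A (y + \<delta>) w)"
      by (simp add: exp_add[symmetric])
    then show ?thesis
      by (simp add: Z_def e2 power2_eq_square add.assoc algebra_simps add_divide_distrib diff_divide_distrib)
  qed
  have i: "integrable M (\<lambda>w. exp (- (2 * A (y + \<delta>) w)) * ?I w / ?b\<^sup>2)"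
     "integrable M (\<lambda>w. 2 * (exp (- (2 * A y w)) * exp (- (1 * (A (y + \<delta>) w - A y w))) * ?I w) / (?a * ?b))"
     "integrable M (\<lambda>w. exp (- (2 * A y w)) * I (y + (\<delta> + z)) w / ?a\<^sup>2)"
    using assms by (intro integrable_divide integrable_mult_right expA_integrable regenerate; simp)+
  show "integrable M (\<lambda>w. (Z (y + \<delta>) w - Z y w)\<^sup>2 * ?I w)"
    unfolding eq using i by (intro Bochner_Integration.integrable_add Bochner_Integration.integrable_diff)
  have "(\<integral>w. (Z (y + \<delta>) w - Z y w)\<^sup>2 * ?I w \<partial>M) =
     (\<integral>w. exp (- (2 * A (y + \<delta>) w)) * ?I w / ?b\<^sup>2 \<partial>M)
     - (\<integral>w. 2 * (exp (- (2 * A y w)) * exp (- (1 * (A (y + \<delta>) w - A y w))) * ?I w) / (?a * ?b) \<partial>M)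
     + (\<integral>w. exp (- (2 * A y w)) * I (y + (\<delta> + z)) w / ?a\<^sup>2 \<partial>M)"
  proof -
    have "(\<integral>w. f w - g w + h w \<partial>M) = (\<integral>w. f w \<partial>M) - (\<integral>w. g w \<partial>M) + (\<integral>w. h w \<partial>M)"
      if "integrable M f" "integrable M g" "integrable M h" for f g h :: "'a => real"
      using that by simp
    from this[OF i] show ?thesis unfolding eq .
  qed
  also have "(\<integral>w. exp (- (2 * A (y + \<delta>) w)) * ?I w / ?b\<^sup>2 \<partial>M) = \<alpha> 2 (y + \<delta>) * \<alpha> 0 z / ?b\<^sup>2"
    using \<alpha>_regenerate[of "y + \<delta>" z 2] assms by simp
  also have "(\<integral>w. exp (- (2 * A y w)) * I (y + (\<delta> + z)) w / ?a\<^sup>2 \<partial>M) = \<alpha> 2 y * \<alpha> 0 (\<delta> + z) / ?a\<^sup>2"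
    using \<alpha>_regenerate[of y "\<delta> + z" 2] assms by simp
  also have "(\<integral>w. 2 * (exp (- (2 * A y w)) * exp (- (1 * (A (y + \<delta>) w - A y w))) * ?I w) / (?a * ?b) \<partial>M) =
      2 * (\<alpha> 2 y * \<alpha> 1 \<delta> * \<alpha> 0 z) / (?a * ?b)"
    using regenerate(2)[of y \<delta> z 2 1] assms by simp
  \<comment> \<open>Multiplicativity gives \<open>\<phi> (y + \<delta>)\<close> as
    \<open>\<phi> y\<close> times \<open>\<alpha> 1 \<delta> / \<alpha> 0 \<delta>\<close>, so
    \<open>\<alpha> 1 \<delta>\<close> is exchanged for the passage probability
    \<open>\<alpha> 0 \<delta>\<close>.\<close>
  also have "2 * (\<alpha> 2 y * \<alpha> 1 \<delta> * \<alpha> 0 z) / (?a * ?b) = 2 * (\<alpha> 2 y * \<alpha> 0 (\<delta> + z) / ?a\<^sup>2)"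
  proof -
    have b: "?b = ?a * (\<alpha> 1 \<delta> / \<alpha> 0 \<delta>)" using \<phi>(4)[of y \<delta>] assms by (simp add: \<phi>_def)
    have "0 < \<alpha> 1 \<delta>" "0 < \<alpha> 0 \<delta>" "0 < ?a" using \<alpha>_pos assms \<phi> by auto
    then show ?thesis unfolding b using assms by (simp add: \<alpha>_mult power2_eq_square field_simps)
  qed
  finally show "(\<integral>w. (Z (y + \<delta>) w - Z y w)\<^sup>2 * ?I w \<partial>M) =
     \<alpha> 2 (y + \<delta>) * \<alpha> 0 z / ?b\<^sup>2 - \<alpha> 2 y * \<alpha> 0 (\<delta> + z) / ?a\<^sup>2" by simp
qed

text \<open>\<open>Z\<close> is the product of the decreasing \<open>u\<close> and the increasing
  \<open>v\<close>, hence its variation is at most \<open>2 / \<phi> x\<close>. A single increment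
  is bounded by the oscillation \<open>e\<close> of \<open>u\<close> plus the relative growth
  \<open>1 / \<phi> (x / n) - 1\<close> of \<open>v\<close>, scaled by \<open>1 / \<phi> x\<close>.
  The sum of squares is at most the product of the two bounds.\<close>

lemma Z_variation:
  assumes x: "0 < x" and n: "0 < n" and w: "w \<in> space M" "I x w = 1" and e: "0 \<le> e"
    and osc: "\<And>k. k < n ==> exp (- A (real k * (x / n)) w) - exp (- A (real (Suc k) * (x / n)) w) \<le> e"
  shows "(\<Sum>k<n. (Z (real (Suc k) * (x / n)) w - Z (real k * (x / n)) w)\<^sup>2) \<le>
    ((e + (1 / \<phi> (x / n) - 1)) / \<phi> x) * (2 / \<phi> x)"
proof -
  let ?d = "x / n"
  define u where "u = (\<lambda>k::nat. exp (- A (real k * ?d) w))"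
  define v where "v = (\<lambda>k::nat. 1 / \<phi> (real k * ?d))"
  let ?V = "1 / \<phi> x"
  have d: "0 \<le> ?d" "real n * ?d = x" using x n by auto
  have px: "0 < \<phi> x" "0 < \<phi> ?d" "\<phi> ?d \<le> 1" "\<phi> x \<le> 1" using \<phi> x d by auto
  have le_x: "real k * ?d \<le> x" if "k \<le> n" for k
    using that d mult_right_mono[of "real k" "real n" ?d] by simp
  have u_anti: "u (Suc k) \<le> u k" if "k < n" for k
  proof -
    have "I (real (Suc k) * ?d) w = 1"
      using I_mono[OF le_x[of "Suc k"], of w] w that by (auto simp: I_cases split: if_splits)
    moreover have "real k * ?d \<le> real (Suc k) * ?d" using d by (intro mult_right_mono) auto
    ultimately have "A (real k * ?d) w \<le> A (real (Suc k) * ?d) w" using A_mono[OF w(1)] by blast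
    then show ?thesis unfolding u_def by (subst exp_le_cancel_iff) (rule le_imp_neg_le)
  qed
  have u01: "0 \<le> u k" "u k \<le> 1" for k by (auto simp: u_def A_nonneg)
  have v_eq: "v (Suc k) = v k * (1 / \<phi> ?d)" for k
    unfolding v_def \<phi>_power[OF d(1)] by simp
  have v1: "1 \<le> v k" for k
    unfolding v_def \<phi>_power[OF d(1)] using px by (simp add: power_le_one)
  have v_mono: "v k \<le> v (Suc k)" for k
    unfolding v_eq using v1[of k] px by (simp add: field_simps)
  have vV: "v k \<le> ?V" if "k \<le> n" for k
  proof -
    have "\<phi> x = \<phi> ?d ^ n" using \<phi>_power[OF d(1), of n] d by simp
    also have "\<dots> \<le> \<phi> ?d ^ k" using px that by (intro power_decreasing) auto
    finally show ?thesis unfolding v_def \<phi>_power[OF d(1)] using px by (simp add: frac_le)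
  qed
  have uv: "Z (real k * ?d) w = u k * v k" for k by (simp add: Z_def u_def v_def)
  have diff: "\<bar>u (Suc k) * v (Suc k) - u k * v k\<bar> \<le> (u k - u (Suc k)) * ?V + (v (Suc k) - v k)" if k: "k < n" for k
  proof -
    have "u (Suc k) * v (Suc k) - u k * v k = u k * (v (Suc k) - v k) - (u k - u (Suc k)) * v (Suc k)"
      by (simp add: algebra_simps)
    moreover have "0 \<le> u k * (v (Suc k) - v k)"
      using u01[of k] v_mono[of k] by (intro mult_nonneg_nonneg) auto
    moreover have "u k * (v (Suc k) - v k) \<le> 1 * (v (Suc k) - v k)"
      using u01[of k] v_mono[of k] by (intro mult_right_mono) auto
    moreover have "0 \<le> (u k - u (Suc k)) * v (Suc k)"
      using u_anti[OF k] v1[of "Suc k"] by (intro mult_nonneg_nonneg) auto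
    moreover have "(u k - u (Suc k)) * v (Suc k) \<le> (u k - u (Suc k)) * ?V"
      using u_anti[OF k] vV[of "Suc k"] k by (intro mult_left_mono) auto
    moreover have "\<bar>p - q\<bar> \<le> Q + P" if "0 \<le> p" "p \<le> P" "0 \<le> q" "q \<le> Q" for p q P Q :: real
      using that by linarith
    ultimately show ?thesis by simp
  qed
  show ?thesis unfolding uv
  proof (rule sum_squares_le_max_variation[where z="\<lambda>k. u k * v k"])
    fix k assume k: "k < n"
    have "(u k - u (Suc k)) * ?V \<le> e * ?V" using osc[OF k] px by (intro mult_right_mono) (auto simp: u_def)
    moreover have "v (Suc k) - v k = v k * (1 / \<phi> ?d - 1)" by (simp add: v_eq algebra_simps)
    moreover have "v k * (1 / \<phi> ?d - 1) \<le> ?V * (1 / \<phi> ?d - 1)"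
      using vV[of k] k px by (intro mult_right_mono) auto
    ultimately show "\<bar>u (Suc k) * v (Suc k) - u k * v k\<bar> \<le> (e + (1 / \<phi> ?d - 1)) / \<phi> x"
      using diff[OF k] by (simp add: add_divide_distrib diff_divide_distrib)
  next
    have "(\<Sum>k<n. \<bar>u (Suc k) * v (Suc k) - u k * v k\<bar>) \<le> (\<Sum>k<n. (u k - u (Suc k)) * ?V + (v (Suc k) - v k))"
      by (intro sum_mono diff) auto
    also have "\<dots> = (u 0 - u n) * ?V + (v n - v 0)"
      by (simp only: sum.distrib sum_distrib_right[symmetric] sum_lessThan_telescope sum_lessThan_telescope')
    also have "\<dots> \<le> 1 * ?V + ?V"
      using u01[of 0] u01[of n] px vV[of n] v1[of 0] by (intro add_mono mult_right_mono) auto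
    finally show "(\<Sum>k<n. \<bar>u (Suc k) * v (Suc k) - u k * v k\<bar>) \<le> 2 / \<phi> x" by simp
  next
    show "0 \<le> (e + (1 / \<phi> ?d - 1)) / \<phi> x" using px e by auto
  qed
qed

lemma Z_variation_integral:
  assumes x: "0 < x" and n: "0 < n"
  shows "integrable M (\<lambda>w. (\<Sum>k<n. (Z (real (Suc k) * (x / n)) w - Z (real k * (x / n)) w)\<^sup>2) * I x w)"
    "(\<integral>w. (\<Sum>k<n. (Z (real (Suc k) * (x / n)) w - Z (real k * (x / n)) w)\<^sup>2) * I x w \<partial>M) =
      (\<integral>w. (Z x w - Z 0 w)\<^sup>2 * I x w \<partial>M)"
proof -
  let ?d = "x / n"
  \<comment> \<open>\<open>W y\<close> is the second moment of \<open>Z y\<close> on the event that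
    the fixed level \<open>x\<close> is passed; this makes the sum telescope.\<close>
  define W where "W = (\<lambda>y. \<alpha> 2 y * \<alpha> 0 (x - y) / (\<phi> y)\<^sup>2)"
  have step: "integrable M (\<lambda>w. (Z (real (Suc k) * ?d) w - Z (real k * ?d) w)\<^sup>2 * I x w) \<and>
     (\<integral>w. (Z (real (Suc k) * ?d) w - Z (real k * ?d) w)\<^sup>2 * I x w \<partial>M) = W (real (Suc k) * ?d) - W (real k * ?d)"
    if k: "k < n" for k
  proof -
    have 1: "real (Suc k) * ?d = real k * ?d + ?d" by (simp add: algebra_simps add_divide_distrib)
    have "real (Suc k) * ?d \<le> real n * ?d" using k x by (intro mult_right_mono) auto
    then have 2: "0 \<le> x - (real k * ?d + ?d)" using n 1 by simp
    have 3: "real k * ?d + ?d + (x - (real k * ?d + ?d)) = x" "?d + (x - (real k * ?d + ?d)) = x - real k * ?d" by auto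
    show ?thesis
      using Z_increment[of "real k * ?d" ?d "x - (real k * ?d + ?d)"] 2 x unfolding 1 3 W_def by auto
  qed
  show "integrable M (\<lambda>w. (\<Sum>k<n. (Z (real (Suc k) * ?d) w - Z (real k * ?d) w)\<^sup>2) * I x w)"
    unfolding sum_distrib_right using step by (intro Bochner_Integration.integrable_sum) auto
  have "(\<integral>w. (\<Sum>k<n. (Z (real (Suc k) * ?d) w - Z (real k * ?d) w)\<^sup>2) * I x w \<partial>M) =
     (\<Sum>k<n. \<integral>w. (Z (real (Suc k) * ?d) w - Z (real k * ?d) w)\<^sup>2 * I x w \<partial>M)"
    unfolding sum_distrib_right using step by (intro Bochner_Integration.integral_sum) auto
  also have "\<dots> = (\<Sum>k<n. W (real (Suc k) * ?d) - W (real k * ?d))"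
    using step by (intro sum.cong) auto
  also have "\<dots> = W (real n * ?d) - W (real 0 * ?d)" by (rule sum_lessThan_telescope)
  also have "\<dots> = (\<integral>w. (Z x w - Z 0 w)\<^sup>2 * I x w \<partial>M)"
    using Z_increment(2)[of 0 x 0] n x by (simp add: W_def)
  finally show "(\<integral>w. (\<Sum>k<n. (Z (real (Suc k) * ?d) w - Z (real k * ?d) w)\<^sup>2) * I x w \<partial>M) = \<dots>" .
qed

text \<open>The expected sum of squared increments is the same for all grids. Pathwise the sums tend
  to 0 by uniform continuity, under a constant bound, so this common expectation is 0.\<close>

lemma Z_constant: assumes x: "0 < x" shows "AE w in M. (Z x w - Z 0 w)\<^sup>2 * I x w = 0"
proof -
  define f where "f = (\<lambda>n w. (\<Sum>k<Suc n. (Z (real (Suc k) * (x / Suc n)) w - Z (real k * (x / Suc n)) w)\<^sup>2) * I x w)"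
  have fm[measurable]: "f n \<in> borel_measurable M" for n unfolding f_def by measurable
  have f0: "0 \<le> f n w" for n w unfolding f_def by (intro mult_nonneg_nonneg sum_nonneg) (auto simp: I_cases)
  define c where "c = (\<lambda>n. 1 / \<phi> (x / real (Suc n)) - 1)"
  have px: "0 < \<phi> x" "\<phi> x \<le> 1" using \<phi> x by auto
  have root: "\<phi> (x / real (Suc n)) = root (Suc n) (\<phi> x)" for n
    using \<phi>_power[of "x / real (Suc n)" "Suc n"] \<phi>(1)[of "x / real (Suc n)"] x
    by (subst real_root_pos_unique[of "Suc n" "\<phi> (x / real (Suc n))"]) auto
  \<comment> \<open>\<open>\<phi> (x / Suc n)\<close> is the root of order \<open>Suc n\<close> of
    \<open>\<phi> x\<close>, hence tends to 1.\<close>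
  have clim: "c \<longlonglongrightarrow> 0"
  proof -
    have "(\<lambda>n. root (Suc n) (\<phi> x)) \<longlonglongrightarrow> 1" by (rule LIMSEQ_Suc[OF LIMSEQ_root_const[OF px(1)]])
    then have "(\<lambda>n. 1 / root (Suc n) (\<phi> x) - 1) \<longlonglongrightarrow> 1 / 1 - 1" by (intro tendsto_intros) auto
    then show ?thesis unfolding c_def root by simp
  qed
  have bound: "f n w \<le> (e + c n) / \<phi> x * (2 / \<phi> x)"
    if "w \<in> space M" "0 \<le> e" "I x w = 1 ==> \<forall>k<Suc n. exp (- A (real k * (x / Suc n)) w) - exp (- A (real (Suc k) * (x / Suc n)) w) \<le> e" for w n e
  proof -
    have "0 < \<phi> (x / real (Suc n))" "\<phi> (x / real (Suc n)) \<le> 1" using \<phi> x by auto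
    then have c0: "0 \<le> c n" by (simp add: c_def)
    show ?thesis
    proof (cases "I x w = 1")
      case True
      then show ?thesis using Z_variation[OF x _ that(1) True that(2), of "Suc n"] that(3) by (simp add: f_def c_def)
    next
      case False
      then have "f n w = 0" by (auto simp: f_def I_cases split: if_splits)
      then show ?thesis using c0 that(2) px by simp
    qed
  qed
  have lim0: "(\<lambda>n. \<integral>w. f n w \<partial>M) \<longlonglongrightarrow> (\<integral>w. 0 \<partial>M)"
  proof (rule integral_dominated_convergence[where w="\<lambda>_. (1 / \<phi> x) / \<phi> x * (2 / \<phi> x)"])
    show "AE w in M. norm (f n w) \<le> (1 / \<phi> x) / \<phi> x * (2 / \<phi> x)" for n
    proof (rule AE_I2)
      fix w assume w: "w \<in> space M"
      have "f n w \<le> (1 + c n) / \<phi> x * (2 / \<phi> x)"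
      proof (rule bound[OF w], simp, intro allI impI)
        fix k
        have "exp (- A (real k * (x / Suc n)) w) \<le> 1" "0 \<le> exp (- A (real (Suc k) * (x / Suc n)) w)" by (auto simp: A_nonneg)
        then show "exp (- A (real k * (x / Suc n)) w) - exp (- A (real (Suc k) * (x / Suc n)) w) \<le> 1" by linarith
      qed
      also have "1 + c n \<le> 1 / \<phi> x"
      proof -
        have le: "x / Suc n \<le> x" using x by (simp add: field_simps)
        have "\<phi> x = \<phi> ((x - x / Suc n) + x / Suc n)" by simp
        also have "\<dots> = \<phi> (x / Suc n) * \<phi> (x - x / Suc n)"
          using \<phi>(4)[of "x - x / Suc n" "x / Suc n"] x le by (simp only: mult.commute) simp
        also have "\<dots> \<le> \<phi> (x / Suc n) * 1"
          using \<phi>(1)[of "x / Suc n"] \<phi>(2)[of "x - x / Suc n"] x le by (intro mult_left_mono) auto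
        finally show ?thesis using px by (simp add: c_def frac_le)
      qed
      finally show "norm (f n w) \<le> (1 / \<phi> x) / \<phi> x * (2 / \<phi> x)"
        using f0[of n w] px by (simp add: divide_right_mono mult_right_mono)
    qed
    show "AE w in M. (\<lambda>n. f n w) \<longlonglongrightarrow> 0" using pf_AE
    proof eventually_elim
      case (elim w)
      then interpret path_functional X w "\<lambda>t. L t w" by simp
      have w: "w \<in> space M" using elim by simp
      show ?case
      proof (cases "I x w = 1")
        case False
        then show ?thesis by (auto simp: f_def I_cases split: if_splits)
      next
        case True
        then have "T x < \<infinity>" by (auto simp: I_cases split: if_splits)
        then have "continuous_on {0..x} lv" using x by (intro lv_continuous) auto
        moreover have "lv y = A y w" for y using A_eq[of w y] elim by (simp add: lv_def)
        ultimately have "continuous_on {0..x} (\<lambda>y. A y w)" by simp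
        then have "continuous_on {0..x} (\<lambda>y. exp (- A y w))" by (intro continuous_intros)
        then have uc: "uniformly_continuous_on {0..x} (\<lambda>y. exp (- A y w))"
          by (intro compact_uniformly_continuous) auto
        show ?thesis
        proof (rule LIMSEQ_I)
          fix r :: real assume r: "0 < r"
          \<comment> \<open>Once \<open>c n < e\<close>, the bound is below
            \<open>4 * e / (\<phi> x * \<phi> x)\<close>, which this choice makes equal to
            \<open>r / 2\<close>.\<close>
          define e where "e = r * \<phi> x * \<phi> x / 8"
          have e: "0 < e" using r px by (simp add: e_def)
          obtain d where d: "d > 0" "\<And>y y'. y \<in> {0..x} ==> y' \<in> {0..x} ==> dist y' y < d ==> dist (exp (- A y' w)) (exp (- A y w)) < e"
            using uc e unfolding uniformly_continuous_on_def by metis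
          obtain N1 where N1: "x / d < real N1" using reals_Archimedean2 by blast
          obtain N2 where N2: "\<And>n. N2 \<le> n ==> \<bar>c n\<bar> < e" using LIMSEQ_D[OF clim e] by auto
          show "\<exists>no. \<forall>n\<ge>no. norm (f n w - 0) < r"
          proof (intro exI[of _ "max N1 N2"] allI impI)
            fix n assume n: "max N1 N2 \<le> n"
            have xd: "x / Suc n < d"
            proof -
              have "x / d < real (Suc n)" using N1 n by auto
              then show ?thesis using d(1) by (simp add: field_simps)
            qed
            have "f n w \<le> (e + c n) / \<phi> x * (2 / \<phi> x)"
            proof (rule bound[OF w less_imp_le[OF e]], intro allI impI)
              fix k assume k: "k < Suc n"
              have a: "real (Suc k) * (x / Suc n) = real k * (x / Suc n) + x / Suc n" by (simp add: algebra_simps add_divide_distrib)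
              have "real (Suc k) * (x / Suc n) \<le> real (Suc n) * (x / Suc n)" using k x by (intro mult_right_mono) auto
              then have b: "real (Suc k) * (x / Suc n) \<le> x" by simp
              have c: "0 \<le> real k * (x / Suc n)" "0 \<le> x / Suc n" using x by auto
              have "dist (real k * (x / Suc n)) (real (Suc k) * (x / Suc n)) < d"
                unfolding a dist_real_def using xd c(2) by simp
              then have "dist (exp (- A (real k * (x / Suc n)) w)) (exp (- A (real (Suc k) * (x / Suc n)) w)) < e"
                using a b c by (intro d(2)) auto
              then show "exp (- A (real k * (x / Suc n)) w) - exp (- A (real (Suc k) * (x / Suc n)) w) \<le> e"
                unfolding dist_real_def by linarith
            qed
            also have "\<dots> < (e + e) / \<phi> x * (2 / \<phi> x)"
              using N2[of n] n px by (intro mult_strict_right_mono divide_strict_right_mono) auto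
            also have "\<dots> = r / 2" using px by (simp add: e_def field_simps)
            finally show "norm (f n w - 0) < r" using f0[of n w] r by simp
          qed
        qed
      qed
    qed
  qed auto
  have "(\<integral>w. f n w \<partial>M) = (\<integral>w. (Z x w - Z 0 w)\<^sup>2 * I x w \<partial>M)" for n
    using Z_variation_integral(2)[OF x, of "Suc n"] by (simp add: f_def)
  then have "(\<integral>w. (Z x w - Z 0 w)\<^sup>2 * I x w \<partial>M) = 0"
    using lim0 by (simp add: LIMSEQ_const_iff)
  moreover have "integrable M (\<lambda>w. (Z x w - Z 0 w)\<^sup>2 * I x w)"
    using Z_increment(1)[of 0 x 0] x by simp
  ultimately show ?thesis
    by (subst (asm) integral_nonneg_eq_0_iff_AE) (auto simp: I_cases)
qed

text \<open>Constancy of \<open>Z\<close> says that \<open>exp (- A x)\<close> is the number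
  \<open>\<phi> x\<close> whenever \<open>x\<close> is passed. As \<phi> is multiplicative,
  \<open>- ln (\<phi> x)\<close> is additive and nonnegative, hence linear. Taken at all rational
  levels at once, this reaches all times through \<open>l_linear\<close>.\<close>

theorem local_time_proportional:
  obtains a where "0 \<le> a" "AE w in M. \<forall>t\<ge>0. L t w = a * running_sup X t w"
proof -
  define b where "b = (\<lambda>x. - ln (\<phi> x))"
  have b_nn: "0 \<le> b x" if "0 \<le> x" for x using \<phi>(1,2)[OF that] by (simp add: b_def)
  have "b x = b 1 * x" if "0 \<le> x" for x
  proof (rule additive_nonneg_linear[OF _ b_nn that])
    show "b (x + y) = b x + b y" if "0 \<le> x" "0 \<le> y" for x y
      using \<phi>(1)[OF that(1)] \<phi>(1)[OF that(2)] \<phi>(4)[OF that] by (simp add: b_def ln_mult)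
  qed
  then have lin: "b x = b 1 * x" if "0 \<le> x" for x using that by blast
  have AEx: "AE w in M. first_passage X x w < \<infinity> \<longrightarrow> A x w = b 1 * x" if x: "0 \<le> x" for x
  proof (cases "x = 0")
    case True
    show ?thesis using pf_AE
    proof eventually_elim
      case (elim w)
      then interpret path_functional X w "\<lambda>t. L t w" by simp
      show ?case using elim True by (simp add: A_eq T_0)
    qed
  next
    case False
    then have x: "0 < x" using x by simp
    show ?thesis using Z_constant[OF x] pf_AE
    proof eventually_elim
      case (elim w)
      then interpret path_functional X w "\<lambda>t. L t w" by simp
      have "A 0 w = 0" using elim(2) by (simp add: A_eq T_0)
      then have Z0: "Z 0 w = 1" by (simp add: Z_def \<phi>)
      show ?case
      proof
        assume "T x < \<infinity>"
        then have "Z x w = 1" using elim(1) Z0 by (simp add: I_cases)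
        then have "exp (- A x w) = \<phi> x" using \<phi>(1)[of x] x by (simp add: Z_def)
        then have "b x = A x w" unfolding b_def by (metis ln_exp minus_minus)
        then show "A x w = b 1 * x" using lin[of x] x by simp
      qed
    qed
  qed
  have "AE w in M. \<forall>q\<in>\<rat>. 0 \<le> q \<longrightarrow> first_passage X q w < \<infinity> \<longrightarrow> A q w = b 1 * q"
    using AEx by (simp add: AE_ball_countable[OF countable_rat] AE_impI)
  with pf_AE have "AE w in M. \<forall>t\<ge>0. L t w = b 1 * running_sup X t w"
  proof eventually_elim
    case (elim w)
    then interpret path_functional X w "\<lambda>t. L t w" by simp
    show ?case
    proof (intro allI impI l_linear)
      fix q assume "q \<in> \<rat>" "0 \<le> q" "T q < \<infinity>"
      then show "lv q = b 1 * q" using elim A_eq[of w q] by (simp add: lv_def)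
    qed
  qed
  then show thesis using that[of "b 1"] b_nn[of 1] by simp
qed

end

section \<open>Change of variables from time to level; the constant of the local time\<close>

lemma measure_eqI_Ioc:
  fixes \<mu> \<nu> :: "real measure"
  assumes s: "sets \<mu> = sets borel" "sets \<nu> = sets borel"
    and z: "emeasure \<mu> {..0} = 0" "emeasure \<nu> {..0} = 0"
    and e: "\<And>a b. 0 \<le> a ==> a \<le> b ==> emeasure \<mu> {a<..b} = emeasure \<nu> {a<..b}"
    and f: "\<And>b. 0 \<le> b ==> emeasure \<mu> {0<..b} < \<infinity>"
  shows "\<mu> = \<nu>"
proof -
  have m: "emeasure \<rho> {a<..b} = emeasure \<rho> {max 0 a<..max 0 b}"
    if \<rho>: "sets \<rho> = sets borel" "emeasure \<rho> {..0} = 0" for \<rho> :: "real measure" and a b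
  proof (rule emeasure_eq_AE)
    have "{..0} \<in> null_sets \<rho>" using \<rho> by (auto simp: null_sets_def)
    then have "AE x in \<rho>. x \<notin> {..0}" by (rule AE_not_in)
    then show "AE x in \<rho>. (x \<in> {a<..b}) = (x \<in> {max 0 a<..max 0 b})"
      by eventually_elim auto
  qed (use \<rho> in auto)
  have e': "emeasure \<mu> {a<..b} = emeasure \<nu> {a<..b}" for a b
  proof -
    have "emeasure \<mu> {max 0 a<..max 0 b} = emeasure \<nu> {max 0 a<..max 0 b}"
    proof (cases "max 0 a \<le> max 0 b")
      case True
      then show ?thesis by (intro e) auto
    next
      case False
      then have *: "{max 0 a<..max 0 b} = {}" by auto
      show ?thesis unfolding * by simp
    qed
    then show ?thesis using m[OF s(1) z(1)] m[OF s(2) z(2)] by simp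
  qed
  show ?thesis
  proof (rule measure_eqI_generator_eq[where \<Omega>=UNIV and E="range (\<lambda>(a, b). {a<..b::real})" and A="\<lambda>i::nat. {-real i<..real i}"])
    show "(\<Union>i::nat. {- real i<..real i}) = UNIV"
    proof safe
      fix x :: real
      obtain n :: nat where "\<bar>x\<bar> < real n" using reals_Archimedean2 by blast
      then show "x \<in> (\<Union>i::nat. {- real i<..real i})" by (auto intro!: exI[of _ n])
    qed auto
    show "emeasure \<mu> {- real i<..real i} \<noteq> \<infinity>" for i :: nat
      using f[of "real i"] m[OF s(1) z(1), of "- real i" "real i"] by auto
  qed (auto simp: s e' borel_sigma_sets_Ioc Int_stable_def)
qed

text \<open>A measure that grows like \<open>k * S\<close> is the image of \<open>k\<close> times
  Lebesgue measure on levels under the passage time. Levels whose passage falls in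
  \<open>{a<..b}\<close> lie between the open and the closed interval from \<open>S a\<close> to
  \<open>S b\<close>, so jumps of the passage time change nothing.\<close>

lemma (in good_path) path_change_of_variable:
  fixes \<mu> :: "real measure"
  assumes s[measurable_cong]: "sets \<mu> = sets borel" and z: "emeasure \<mu> {..0} = 0" and k: "0 \<le> k"
    and e: "\<And>a b. 0 \<le> a ==> a \<le> b ==> emeasure \<mu> {a<..b} = ennreal (k * (S b - S a))"
    and Tm[measurable]: "(\<lambda>x. T x) \<in> borel_measurable borel"
    and f[measurable]: "f \<in> borel_measurable borel"
  shows "(\<integral>\<^sup>+t. f t \<partial>\<mu>) =
    (\<L> x. ennreal k * (f (real_of_ereal (T x)) * ind {x. 0 \<le> x \<and> T x < \<infinity>} x))"
proof -
  define J where "J = {x. 0 \<le> x \<and> T x < \<infinity>}"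
  have J[measurable]: "J \<in> sets borel" unfolding J_def by measurable
  define \<nu> where "\<nu> = distr (density lborel (\<lambda>x. ennreal k * ind J x)) borel (\<lambda>x. real_of_ereal (T x))"
  have \<nu>: "emeasure \<nu> C = ennreal k * emeasure lborel {x\<in>J. real_of_ereal (T x) \<in> C}" if [measurable]: "C \<in> sets borel" for C
  proof -
    have [measurable]: "(\<lambda>x. real_of_ereal (T x)) -` C \<in> sets borel"
      using measurable_sets[of "\<lambda>x. real_of_ereal (T x)" borel borel C] by simp
    have "emeasure \<nu> C = (\<L> x. ennreal k * ind J x * ind ((\<lambda>x. real_of_ereal (T x)) -` C) x)"
      unfolding \<nu>_def by (subst emeasure_distr) (auto simp: emeasure_density)
    also have "\<dots> = (\<L> x. ennreal k * ind {x\<in>J. real_of_ereal (T x) \<in> C} x)"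
      by (intro nn_integral_cong) (auto split: split_indicator)
    also have "\<dots> = ennreal k * emeasure lborel {x\<in>J. real_of_ereal (T x) \<in> C}"
      by (subst nn_integral_cmult_indicator) auto
    finally show ?thesis .
  qed
  have Tr: "\<exists>t. T x = ereal t \<and> 0 \<le> t \<and> S t = x" if xJ: "x \<in> J" for x
  proof -
    obtain t where "T x = ereal t" using xJ first_passage_nonneg[of X x w] by (cases "T x") (auto simp: J_def)
    then show ?thesis using T_value[of x t] xJ by (auto simp: J_def)
  qed
  have "\<mu> = \<nu>"
  proof (rule measure_eqI_Ioc)
    show "sets \<mu> = sets borel" by (rule s)
    show "sets \<nu> = sets borel" by (simp add: \<nu>_def)
    show "emeasure \<mu> {..0} = 0" by (rule z)
    have "{x \<in> J. real_of_ereal (T x) \<in> {..0}} \<subseteq> {0}"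
    proof
      fix x assume x: "x \<in> {x \<in> J. real_of_ereal (T x) \<in> {..0}}"
      then obtain t where "T x = ereal t" "0 \<le> t" "S t = x" using Tr by auto
      then show "x \<in> {0}" using x by auto
    qed
    then have "emeasure lborel {x \<in> J. real_of_ereal (T x) \<in> {..0}} \<le> emeasure lborel {0::real}"
      by (intro emeasure_mono) auto
    then show "emeasure \<nu> {..0} = 0" by (simp add: \<nu>)
    show "emeasure \<mu> {0<..b} < \<infinity>" if "0 \<le> b" for b using e[of 0 b] that by simp
    fix a b :: real assume ab: "0 \<le> a" "a \<le> b"
    let ?C = "{x \<in> J. real_of_ereal (T x) \<in> {a<..b}}"
    have Sab: "0 \<le> S a" "S a \<le> S b" using S_nonneg S_mono ab by auto
    have sub1: "{S a<..<S b} \<subseteq> ?C"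
    proof
      fix x assume x: "x \<in> {S a<..<S b}"
      then have x0: "0 \<le> x" using Sab by simp
      have "T x < ereal b" using T_less_iff[OF x0, of b] x ab by simp
      then have xJ: "x \<in> J" using x0 by (auto simp: J_def)
      then obtain t where t: "T x = ereal t" "0 \<le> t" "S t = x" using Tr by auto
      have "a < t"
      proof (rule ccontr)
        assume "\<not> a < t"
        then show False using S_mono[of t a] t x by auto
      qed
      then show "x \<in> ?C" using xJ t \<open>T x < ereal b\<close> by auto
    qed
    have sub2: "?C \<subseteq> {S a..S b}"
    proof
      fix x assume x: "x \<in> ?C"
      then obtain t where t: "T x = ereal t" "0 \<le> t" "S t = x" using Tr by auto
      then show "x \<in> {S a..S b}" using S_mono[of a t] S_mono[of t b] x ab by auto
    qed
    have "emeasure lborel ?C = ennreal (S b - S a)"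
    proof (rule antisym)
      show "emeasure lborel ?C \<le> ennreal (S b - S a)"
        using emeasure_mono[OF sub2, of lborel] Sab by simp
      show "ennreal (S b - S a) \<le> emeasure lborel ?C"
        using emeasure_mono[OF sub1, of lborel] Sab by simp
    qed
    then show "emeasure \<mu> {a<..b} = emeasure \<nu> {a<..b}"
      using e[OF ab] k Sab by (simp add: \<nu> ennreal_mult)
  qed
  then have "(\<integral>\<^sup>+t. f t \<partial>\<mu>) = (\<L> x. ennreal k * ind J x * f (real_of_ereal (T x)))"
    unfolding \<nu>_def by (simp add: nn_integral_distr nn_integral_density)
  then show ?thesis by (simp add: J_def ac_simps)
qed

lemma stieltjes_properties:
  assumes c: "continuous_on {0..} (\<lambda>t. L t w)" and m: "mono_on {0..} (\<lambda>t. L t w)"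
  shows "sets (stieltjes L w) = sets borel"
    "\<And>a b. 0 \<le> a ==> a \<le> b ==> emeasure (stieltjes L w) {a<..b} = ennreal (L b w - L a w)"
    "emeasure (stieltjes L w) {..0} = 0"
proof -
  let ?F = "\<lambda>t. L (max 0 t) w"
  have mono: "?F x \<le> ?F y" if "x \<le> y" for x y using mono_onD[OF m, of "max 0 x" "max 0 y"] that by auto
  have "continuous_on UNIV ?F"
    by (rule continuous_on_compose2[OF c]) (auto intro!: continuous_intros)
  then have cont: "continuous (at_right a) ?F" for a
    by (auto simp: continuous_on_eq_continuous_at intro: continuous_at_imp_continuous_at_within)
  have Ioc: "emeasure (stieltjes L w) {a<..b} = ennreal (?F b - ?F a)" if "a \<le> b" for a b
    unfolding stieltjes_def by (rule emeasure_interval_measure_Ioc[OF that mono cont])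
  show s: "sets (stieltjes L w) = sets borel" by (simp add: stieltjes_def)
  show "emeasure (stieltjes L w) {a<..b} = ennreal (L b w - L a w)" if "0 \<le> a" "a \<le> b" for a b
    using Ioc[OF that(2)] that by (simp add: max_absorb2)
  have "emeasure (stieltjes L w) (\<Union>n::nat. {- real n<..0}) = 0"
    using Ioc[of "- real _" 0] by (intro emeasure_UN_eq_0) (auto simp: s)
  moreover have "(\<Union>n::nat. {- real n<..0}) = {..0}"
  proof safe
    fix x :: real assume "x \<le> 0"
    obtain n :: nat where "- x < real n" using reals_Archimedean2 by blast
    then show "x \<in> (\<Union>n::nat. {- real n<..0})" using \<open>x \<le> 0\<close> by (auto intro!: exI[of _ n])
  qed auto
  ultimately show "emeasure (stieltjes L w) {..0} = 0" by simp
qed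

text \<open>Outside its support the Stieltjes measure vanishes locally; Bolzano's principle makes
  \<open>L\<close> constant on compact parts of the gap, and continuity reaches the end
  points.\<close>

lemma constant_off_support:
  assumes c: "continuous_on {0..} (\<lambda>t. L t w)" and m: "mono_on {0..} (\<lambda>t. L t w)"
    and supp: "measure_support (stieltjes L w) \<subseteq> closure Z"
    and st: "0 \<le> s" "s \<le> t" "Z \<inter> {s<..<t} = {}"
  shows "L s w = L t w"
proof (cases "s = t")
  case False
  then have "s < t" using st by simp
  note sp = stieltjes_properties[of L w, OF c m]
  have cl: "closure Z \<inter> {s<..<t} = {}"
    using st(3) open_Int_closure_eq_empty[of "{s<..<t}" Z] by (simp add: Int_commute)
  have eq: "L a w = L b w" if ab: "s < a" "a \<le> b" "b < t" for a b
  proof -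
    define P where "P = (\<lambda>u v. a \<le> u \<and> u \<le> v \<and> v \<le> b \<longrightarrow> L u w = L v w)"
    have "P a b"
    proof (rule Bolzano[OF ab(2)])
      fix x assume x: "a \<le> x" "x \<le> b"
      then have "x \<notin> measure_support (stieltjes L w)" using cl ab supp by auto
      then obtain U where U: "open U" "x \<in> U" "emeasure (stieltjes L w) U = 0"
        by (auto simp: measure_support_def not_gr_zero)
      obtain d where d: "d > 0" "ball x d \<subseteq> U" using U open_contains_ball by blast
      show "\<exists>d>0. \<forall>u v. u \<le> x \<and> x \<le> v \<and> v - u < d \<longrightarrow> P u v"
      proof (intro exI[of _ d] conjI allI impI d(1))
        fix u v assume uv: "u \<le> x \<and> x \<le> v \<and> v - u < d"
        show "P u v" unfolding P_def
        proof
          assume auv: "a \<le> u \<and> u \<le> v \<and> v \<le> b"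
          have "{u<..v} \<subseteq> U" using uv d(2) by (auto simp: dist_real_def subset_eq)
          then have "emeasure (stieltjes L w) {u<..v} \<le> emeasure (stieltjes L w) U"
            using U(1) by (intro emeasure_mono) (auto simp: sp(1))
          then have "ennreal (L v w - L u w) = 0" using sp(2)[of u v] auv U(3) ab st by auto
          moreover have "L u w \<le> L v w" using mono_onD[OF m, of u v] auv ab st by auto
          ultimately show "L u w = L v w" by simp
        qed
      qed
    next
      fix u v ww assume h: "P u v" "P v ww" "u \<le> v" "v \<le> ww"
      show "P u ww" unfolding P_def
      proof
        assume "a \<le> u \<and> u \<le> ww \<and> ww \<le> b"
        then have "L u w = L v w" "L v w = L ww w" using h by (auto simp: P_def)
        then show "L u w = L ww w" by simp
      qed
    qed
    then show ?thesis using ab by (simp add: P_def)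
  qed
  define p where "p = (s + t) / 2"
  have p: "s < p" "p < t" using \<open>s < t\<close> by (auto simp: p_def)
  have lim: "((\<lambda>u. L u w) \<longlongrightarrow> L a w) (at a within {0..})" if "0 \<le> a" for a
    using c that by (auto simp: continuous_on_def)
  have "((\<lambda>u. L u w) \<longlongrightarrow> L s w) (at s within {s..p})"
    by (rule tendsto_within_subset[OF lim]) (use st in auto)
  then have "((\<lambda>u. L u w) \<longlongrightarrow> L s w) (at_right s)" using p by (simp add: at_within_Icc_at_right)
  moreover have "((\<lambda>u. L u w) \<longlongrightarrow> L p w) (at_right s)"
  proof (rule tendsto_eventually)
    show "\<forall>\<^sub>F u in at_right s. L u w = L p w"
      using eventually_at_right_real[OF p(1)] by eventually_elim (rule eq, use p in auto)
  qed
  ultimately have 1: "L s w = L p w" by (intro tendsto_unique[of "at_right s"]) auto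
  have "((\<lambda>u. L u w) \<longlongrightarrow> L t w) (at t within {p..t})"
    by (rule tendsto_within_subset[OF lim]) (use st p in auto)
  then have "((\<lambda>u. L u w) \<longlongrightarrow> L t w) (at_left t)" using p by (simp add: at_within_Icc_at_left)
  moreover have "((\<lambda>u. L u w) \<longlongrightarrow> L p w) (at_left t)"
  proof (rule tendsto_eventually)
    show "\<forall>\<^sub>F u in at_left t. L u w = L p w"
      using eventually_at_left_real[OF p(2)] by eventually_elim (rule eq[symmetric], use p in auto)
  qed
  ultimately have "L t w = L p w" by (intro tendsto_unique[of "at_left t"]) auto
  with 1 show ?thesis by simp
qed simp

lemma nn_integral_exp_half_line:
  assumes "0 < b" shows "(\<L> x. expm (x * b) * ind {0..} x) = ennreal (1 / b)"
proof -
  have "(\<L> x. expm (x * b) * ind {0..} x) = ennreal (0 - (- exp (- (0 * b)) / b))"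
  proof (rule nn_integral_FTC_atLeast)
    have "((\<lambda>x. exp (- (x * b))) \<longlongrightarrow> 0) at_top"
      using assms by real_asymp
    then show "((\<lambda>x. - exp (- (x * b)) / b) \<longlongrightarrow> 0) at_top"
      using tendsto_divide[OF tendsto_minus tendsto_const] assms by fastforce
    show "((\<lambda>x. - exp (- (x * b)) / b) has_real_derivative exp (- (x * b))) (at x)" if "0 \<le> x" for x
      using assms by (auto intro!: derivative_eq_intros)
  qed auto
  then show ?thesis by simp
qed

context spec_neg
begin

lemma first_passage_level_measurable: "w \<in> space M ==> (\<lambda>x. first_passage X x w) \<in> borel_measurable borel"
  using measurable_compose[OF measurable_Pair2' first_passage_joint_measurable, of w] by simp

lemma local_time_is_sup_functional: "sup_local_time M X L ==> sup_functional M X \<Phi> L"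
proof -
  assume L: "sup_local_time M X L"
  note L' = L[unfolded sup_local_time_def]
  show ?thesis
  proof (intro sup_functional.intro sup_functional_axioms.intro)
    show "spec_neg M X \<Phi>" by unfold_locales
    have "AE w in M. measure_support (stieltjes L w) = closure (zero_set X w)" using L' by simp
    with AE_space show "AE w in M. \<forall>s t. 0 \<le> s \<longrightarrow> s \<le> t \<longrightarrow> zero_set X w \<inter> {s<..<t} = {} \<longrightarrow> L s w = L t w"
    proof eventually_elim
      case (elim w)
      then show ?case using constant_off_support[of L w "zero_set X w"] L' by auto
    qed
  qed (use L' in auto)
qed

text \<open>The constant comes from the normalisation. With \<open>L\<close> equal to
  \<open>a\<close> times the supremum, the discounted total of the Stieltjes measure has mean
  \<open>a\<close> times the integral of \<open>exp (- (x * \<Phi> 1))\<close> over levels, that is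
  \<open>a / \<Phi> 1\<close>.\<close>

theorem local_time_eq:
  assumes L: "sup_local_time M X L"
  shows "AE w in M. \<forall>t\<ge>0. L t w = \<Phi> 1 * running_sup X t w"
proof -
  interpret sup_functional M X \<Phi> L by (rule local_time_is_sup_functional[OF L])
  obtain a where a: "0 \<le> a" "AE w in M. \<forall>t\<ge>0. L t w = a * running_sup X t w"
    by (rule local_time_proportional)
  have "1 = (\<E> w. (\<integral>\<^sup>+t\<in>{0..}. expm t \<partial>stieltjes L w))"
    using L by (simp add: sup_local_time_def)
  also have "\<dots> = (\<E> w. (\<L> x. ennreal a * (ennreal (exp_time 1 (first_passage X x w)) * ind {0..} x)))"
  proof (rule nn_integral_cong_AE)
    show "AE w in M. (\<integral>\<^sup>+t\<in>{0..}. expm t \<partial>stieltjes L w) =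
      (\<L> x. ennreal a * (ennreal (exp_time 1 (first_passage X x w)) * ind {0..} x))"
      using pf_AE a(2)
    proof eventually_elim
      case (elim w)
      interpret path_functional X w "\<lambda>t. L t w" using elim by simp
      have w: "w \<in> space M" using elim by simp
      note sp = stieltjes_properties[of L w, OF L_cont[OF w] L_mono[OF w]]
      have "(\<integral>\<^sup>+t. expm t * ind {0..} t \<partial>stieltjes L w) =
        (\<L> x. ennreal a * ((expm (real_of_ereal (T x)) * ind {0..} (real_of_ereal (T x))) * ind {x. 0 \<le> x \<and> T x < \<infinity>} x))"
        by (rule path_change_of_variable[OF sp(1,3) a(1)])
          (use elim(2) sp(2) first_passage_level_measurable[OF w] in \<open>auto simp: right_diff_distrib\<close>)
      also have "\<dots> = (\<L> x. ennreal a * (ennreal (exp_time 1 (first_passage X x w)) * ind {0..} x))"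
        by (intro nn_integral_cong) (auto simp: exp_time_def real_of_ereal_pos split: split_indicator)
      finally show ?case .
    qed
  qed
  also have "\<dots> = (\<L> x. (\<E> w. ennreal a * (ennreal (exp_time 1 (first_passage X x w)) * ind {0..} x)))"
  proof -
    interpret pair_sigma_finite lborel M by unfold_locales
    note [measurable] = first_passage_joint_measurable
    show ?thesis by (intro Fubini') measurable
  qed
  also have "\<dots> = (\<L> x. ennreal a * (expm (x * \<Phi> 1) * ind {0..} x))"
    by (intro nn_integral_cong) (auto simp: nn_integral_cmult nn_integral_multc nn_laplace_T split: split_indicator)
  also have "\<dots> = ennreal a * ennreal (1 / \<Phi> 1)"
    using nn_integral_exp_half_line[OF \<Phi>_pos[of 1]] by (subst nn_integral_cmult) auto
  finally have "ennreal (a / \<Phi> 1) = 1" using a(1) \<Phi>_pos[of 1] by (simp add: ennreal_mult[symmetric])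
  then have "a = \<Phi> 1" using \<Phi>_pos[of 1] a(1) by (simp add: field_simps)
  then show ?thesis using a by simp
qed

lemma ladder_time_eq:
  assumes L: "sup_local_time M X L"
  shows "AE w in M. \<forall>x\<ge>0. ladder_time L (\<Phi> 1 * x) w = first_passage X x w"
  using local_time_eq[OF L] AE_space
proof eventually_elim
  case (elim w)
  show ?case
  proof (intro allI impI ereal_eqI_less)
    fix x z :: real assume "0 \<le> x"
    have "ladder_time L (\<Phi> 1 * x) w < ereal z \<longleftrightarrow> (\<exists>s\<ge>0. \<Phi> 1 * x < L s w \<and> s < z)"
      unfolding ladder_time_def ereal_INF_less_iff by auto
    also have "\<dots> \<longleftrightarrow> (\<exists>s\<ge>0. x < running_sup X s w \<and> s < z)"
      using elim(1) \<Phi>_pos[of 1] by auto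
    also have "\<dots> \<longleftrightarrow> (\<exists>s\<ge>0. x < X s w \<and> s < z)"
      using less_running_sup_iff[of X w, OF cadlag_X[OF elim(2)]] by (meson le_less_trans order_refl)
    also have "\<dots> \<longleftrightarrow> first_passage X x w < ereal z" by (simp add: first_passage_less_iff)
    finally show "ladder_time L (\<Phi> 1 * x) w < ereal z \<longleftrightarrow> first_passage X x w < ereal z" .
  qed
qed

end

section \<open>Time spent at the supremum as an additive functional\<close>

lemma running_sup_right_continuous:
  assumes c: "cadlag (\<lambda>t. X t w)" and t: "0 \<le> t"
  shows "((\<lambda>u. running_sup X u w) \<longlongrightarrow> running_sup X t w) (at_right t)"
proof (rule order_tendstoI)
  have gt: "\<forall>\<^sub>F u in at_right t. t < u" by (simp add: eventually_at_right_less)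
  fix a assume a: "a < running_sup X t w"
  show "\<forall>\<^sub>F u in at_right t. a < running_sup X u w"
    using gt by eventually_elim (use running_sup_mono[of X w t, OF c t] a in \<open>auto intro: less_le_trans\<close>)
next
  fix a assume a: "running_sup X t w < a"
  obtain b where b: "running_sup X t w < b" "b < a" using dense a by blast
  have "X t w < b" using running_sup_upper[of X w t t, OF c t] b by simp
  then have "eventually (\<lambda>v. X v w < b) (at_right t)"
    using cadlag_right[OF c t] by (auto intro: order_tendstoD)
  then obtain e where e: "e > t" "\<And>v. t < v ==> v < e ==> X v w < b"
    by (auto simp: eventually_at_right_field)
  show "\<forall>\<^sub>F u in at_right t. running_sup X u w < a"
    using eventually_at_right_real[OF e(1)]
  proof eventually_elim
    case (elim v)
    have "running_sup X v w \<le> b" unfolding running_sup_def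
    proof (rule cSUP_least)
      fix u assume "u \<in> {0..v}"
      then show "X u w \<le> b"
        using e(2)[of u] running_sup_upper[of X w u t, OF c] b elim by (cases "u \<le> t") auto
    qed (use elim t in auto)
    then show ?case using b by simp
  qed
qed

lemma lborel_Icc_Ioc:
  fixes a b :: real and f :: "real => ennreal"
  shows "(\<L> u. ind {a..b} u * f u) = (\<L> u. ind {a<..b} u * f u)"
proof (rule nn_integral_cong_AE)
  show "AE u in lborel. ind {a..b} u * f u = ind {a<..b} u * f u"
    using AE_lborel_singleton[of a] by eventually_elim (auto split: split_indicator)
qed

context spec_neg
begin

lemma reflected_right: "w \<in> space M ==> 0 \<le> t ==> ((\<lambda>u. reflected X u w) \<longlongrightarrow> reflected X t w) (at_right t)"
  unfolding reflected_def
  by (intro tendsto_diff running_sup_right_continuous cadlag_right cadlag_X)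

lemma reflected_measurable [measurable]: "0 \<le> t ==> reflected X t \<in> borel_measurable M"
  by (rule measurable_filt[OF reflected_filt])

lemma reflected_joint_measurable: "(\<lambda>(s, w). reflected X (max 0 s) w) \<in> borel_measurable (borel \<Otimes>\<^sub>M M)"
  by (rule right_continuous_joint_measurable) (auto intro: reflected_right)

lemma reflected_time_measurable: "w \<in> space M ==> (\<lambda>s. reflected X (max 0 s) w) \<in> borel_measurable borel"
  using measurable_compose[OF measurable_Pair2' reflected_joint_measurable, of w] by simp

definition at_sup :: "'a => real => ennreal" where
  "at_sup w s = ind {0} (reflected X (max 0 s) w)"

lemma at_sup_measurable [measurable]: "w \<in> space M ==> at_sup w \<in> borel_measurable borel"
  unfolding at_sup_def[abs_def]
  by (rule measurable_compose[OF reflected_time_measurable borel_measurable_indicator]) auto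

definition occupation :: "real => 'a => real" where
  "occupation t w = enn2real (\<L> s. ind {0..t} s * at_sup w s)"

lemma at_sup_integral_le:
  "a \<le> b ==> (\<L> s. ind {a<..b} s * at_sup w s) \<le> ennreal (b - a)"
proof -
  assume "a \<le> b"
  have "(\<L> s. ind {a<..b} s * at_sup w s) \<le> (\<L> s. ind {a<..b} s)"
    by (intro nn_integral_mono) (auto simp: at_sup_def split: split_indicator)
  then show ?thesis using \<open>a \<le> b\<close> by simp
qed

lemma occupation_nn:
  "0 \<le> t ==> ennreal (occupation t w) = (\<L> s. ind {0<..t} s * at_sup w s)"
  using at_sup_integral_le[of 0 t w] unfolding occupation_def lborel_Icc_Ioc[of 0 t]
  by (intro ennreal_enn2real) (auto intro: le_less_trans)

lemma occupation_split:
  assumes "w \<in> space M" "0 \<le> s" "s \<le> t"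
  shows "ennreal (occupation t w) = ennreal (occupation s w) + (\<L> u. ind {s<..t} u * at_sup w u)"
proof -
  note [measurable] = at_sup_measurable[OF assms(1)]
  have "(\<L> u. ind {0<..t} u * at_sup w u) =
     (\<L> u. ind {0<..s} u * at_sup w u + ind {s<..t} u * at_sup w u)"
    using assms by (intro nn_integral_cong) (auto split: split_indicator)
  also have "\<dots> = (\<L> u. ind {0<..s} u * at_sup w u) + (\<L> u. ind {s<..t} u * at_sup w u)"
    by (intro nn_integral_add) auto
  finally show ?thesis using assms by (simp add: occupation_nn)
qed

lemma occupation_nonneg: "0 \<le> occupation t w" by (simp add: occupation_def)

lemma occupation_diff:
  assumes "w \<in> space M" "0 \<le> s" "s \<le> t"
  shows "occupation s w \<le> occupation t w" "occupation t w \<le> occupation s w + (t - s)"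
    "(\<L> u. ind {s<..t} u * at_sup w u) = ennreal (occupation t w - occupation s w)"
proof -
  let ?i = "\<integral>\<^sup>+u. ind {s<..t} u * at_sup w u \<partial>lborel"
  have le: "?i \<le> ennreal (t - s)" by (rule at_sup_integral_le[OF assms(3)])
  then have "?i < \<top>" by (rule le_less_trans) simp
  then obtain r where r: "0 \<le> r" "?i = ennreal r" by (cases ?i) auto
  have "r \<le> t - s" using le r assms by simp
  moreover have "occupation t w = occupation s w + r"
    using occupation_split[OF assms] r occupation_nonneg[of t w] occupation_nonneg[of s w]
    by (simp add: ennreal_plus[symmetric] del: ennreal_plus)
  ultimately show "occupation s w \<le> occupation t w" "occupation t w \<le> occupation s w + (t - s)"
    "?i = ennreal (occupation t w - occupation s w)" using r by auto
qed

lemma occupation_filt: assumes t: "0 \<le> t" shows "occupation t \<in> borel_measurable (filt M X t)"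
proof -
  \<comment> \<open>Tonelli needs joint measurability with respect to the past at \<open>t\<close>.
    Freezing the reflected process at \<open>t\<close> by \<open>min\<close> provides it and changes
    nothing on the range of integration.\<close>
  have "(\<lambda>(s, w). reflected X (min (max 0 s) t) w) \<in> borel_measurable (borel \<Otimes>\<^sub>M filt M X t)"
  proof (rule right_continuous_joint_measurable[where Y="\<lambda>s. reflected X (min s t)"])
    show "reflected X (min s t) \<in> borel_measurable (filt M X t)" if "0 \<le> s" for s
      using that t by (intro measurable_filt_mono[OF _ reflected_filt]) auto
    fix w s assume w: "w \<in> space (filt M X t)" and s: "(0::real) \<le> s"
    show "((\<lambda>u. reflected X (min u t) w) \<longlongrightarrow> reflected X (min s t) w) (at_right s)"
    proof (cases "s < t")
      case True
      have "\<forall>\<^sub>F u in at_right s. reflected X u w = reflected X (min u t) w"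
        using eventually_at_right_real[OF True] by eventually_elim auto
      then show ?thesis using True reflected_right[of w s] w s
        by (auto elim: Lim_transform_eventually)
    next
      case False
      have "\<forall>\<^sub>F u in at_right s. s < u" by (simp add: eventually_at_right_less)
      then have "\<forall>\<^sub>F u in at_right s. reflected X (min u t) w = reflected X (min s t) w"
        by eventually_elim (use False in auto)
      then show ?thesis by (rule tendsto_eventually)
    qed
  qed
  then have [measurable]: "(\<lambda>z. reflected X (min (max 0 (snd z)) t) (fst z)) \<in> borel_measurable (filt M X t \<Otimes>\<^sub>M lborel)"
    by (subst (asm) measurable_pair_swap_iff) (simp add: case_prod_beta' cong: measurable_cong_sets)
  have "(\<lambda>w. \<integral>\<^sup>+s. ind {0..t} s * ind {0} (reflected X (min (max 0 s) t) w) \<partial>lborel)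
      \<in> borel_measurable (filt M X t)"
    by (rule lborel.borel_measurable_nn_integral) (simp add: case_prod_beta')
  also have "(\<lambda>w. \<integral>\<^sup>+s. ind {0..t} s * ind {0} (reflected X (min (max 0 s) t) w) \<partial>lborel) =
     (\<lambda>w. \<integral>\<^sup>+s. ind {0..t} s * at_sup w s \<partial>lborel)"
    by (intro ext nn_integral_cong) (auto simp: at_sup_def min_absorb1 split: split_indicator)
  finally show ?thesis unfolding occupation_def[abs_def] by measurable
qed

lemma occupation_additive: "additive_functional M (reflected X) occupation"
  unfolding additive_functional_def
proof (intro exI conjI allI impI)
  \<comment> \<open>The functional must be measurable on arbitrary elements of the product space, so
    the test for a zero reads the path along dyadic times. On a right continuous reflected path the
    limes superior is the value at \<open>u\<close> itself.\<close>
  define zz where "zz = (\<lambda>(r :: real => real) u. if limsup (\<lambda>m. ereal \<bar>r (dyadic_above m (max 0 u))\<bar>) = 0 then 1 else 0 :: ennreal)"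
  let ?\<Lambda> = "\<lambda>t r. enn2real (\<L> u. ind {0..t} u * zz r u)"
  have m1: "(\<lambda>z. fst z (dyadic_above m (max 0 (snd z)))) \<in> borel_measurable (path_space \<Otimes>\<^sub>M lborel)" for m
  proof -
    have "(\<lambda>z. (\<lambda>k z. fst z (max 0 ((of_int k + 1) / 2 ^ m))) \<lfloor>2 ^ m * max 0 (snd z :: real)\<rfloor> z) \<in> borel_measurable (path_space \<Otimes>\<^sub>M lborel)"
    proof (rule measurable_compose_countable[where f="\<lambda>k (z :: (real => real) \<times> real). fst z (max 0 ((of_int k + 1) / 2 ^ m))"])
      show "(\<lambda>z. fst z (max 0 ((of_int k + 1) / 2 ^ m))) \<in> borel_measurable (path_space \<Otimes>\<^sub>M lborel)" for k :: int
        by (rule measurable_compose[OF measurable_fst measurable_component_singleton]) simp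
      show "(\<lambda>z. \<lfloor>2 ^ m * max 0 (snd z :: real)\<rfloor>) \<in> path_space \<Otimes>\<^sub>M lborel \<rightarrow>\<^sub>M count_space UNIV" by measurable
    qed
    moreover have "max 0 (dyadic_above m (max 0 u)) = dyadic_above m (max 0 u)" for u
      using dyadic_above(1)[of "max 0 u" m] by linarith
    ultimately show ?thesis by (simp add: dyadic_above_def)
  qed
  have m2[measurable]: "(\<lambda>z. zz (fst z) (snd z)) \<in> borel_measurable (path_space \<Otimes>\<^sub>M lborel)"
    unfolding zz_def using m1 by measurable
  show "?\<Lambda> t \<in> borel_measurable path_space" for t
  proof -
    have "(\<lambda>r. \<integral>\<^sup>+u. ind {0..t} u * zz r u \<partial>lborel) \<in> borel_measurable path_space"
      by (rule lborel.borel_measurable_nn_integral) (simp add: case_prod_beta')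
    then show ?thesis by measurable
  qed
  have zz: "zz (path_from (reflected X) s w) u = at_sup w (s + u)" if w: "w \<in> space M" and s: "0 \<le> s" and u: "0 \<le> u" for w s u
  proof -
    have d: "0 \<le> dyadic_above m u" for m using dyadic_above(1)[of u m] u by simp
    have "filterlim (\<lambda>m. s + dyadic_above m u) (at_right (s + u)) sequentially"
      using dyadic_above_tendsto[of u] by (auto simp: filterlim_at intro: tendsto_add)
    then have "(\<lambda>m. reflected X (s + dyadic_above m u) w) \<longlonglongrightarrow> reflected X (s + u) w"
      by (rule filterlim_compose[OF reflected_right[OF w], rotated]) (use s u in auto)
    then have "(\<lambda>m. ereal \<bar>reflected X (s + dyadic_above m u) w\<bar>) \<longlonglongrightarrow> ereal \<bar>reflected X (s + u) w\<bar>"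
      by (intro tendsto_intros)
    then have "limsup (\<lambda>m. ereal \<bar>reflected X (s + dyadic_above m u) w\<bar>) = ereal \<bar>reflected X (s + u) w\<bar>"
      by (intro lim_imp_Limsup) auto
    then show ?thesis using u s d by (simp add: zz_def path_from_def at_sup_def max_absorb2 zero_ereal_def split: split_indicator)
  qed
  show "AE w in M. \<forall>t\<ge>0. occupation t w = ?\<Lambda> t (path_from (reflected X) 0 w) \<and>
      (\<forall>s\<ge>0. occupation (s + t) w = occupation s w + ?\<Lambda> t (path_from (reflected X) s w))"
  proof (intro AE_I2 allI impI conjI)
    fix w t assume w: "w \<in> space M" and t: "(0::real) \<le> t"
    note [measurable] = at_sup_measurable[OF w]
    have \<Lambda>: "?\<Lambda> t (path_from (reflected X) s w) = occupation (s + t) w - occupation s w" if s: "0 \<le> s" for s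
    proof -
      have "(\<L> u. ind {0..t} u * zz (path_from (reflected X) s w) u) =
        (\<L> u. ind {0..t} u * at_sup w (s + u))"
        using zz[OF w s] by (intro nn_integral_cong) (auto split: split_indicator)
      also have "\<dots> = (\<L> u. ind {s..s + t} (s + 1 * u) * at_sup w (s + 1 * u))"
        by (intro nn_integral_cong) (auto split: split_indicator)
      also have "\<dots> = (\<L> u. ind {s..s + t} u * at_sup w u)"
        by (subst nn_integral_real_affine[of "\<lambda>u. ind {s..s + t} u * at_sup w u" 1 s]) auto
      also have "\<dots> = ennreal (occupation (s + t) w - occupation s w)"
        unfolding lborel_Icc_Ioc using s t by (intro occupation_diff w) auto
      finally show ?thesis using occupation_diff(1)[OF w s, of "s + t"] t by simp
    qed
    have "occupation 0 w = 0" using occupation_nn[of 0 w] occupation_nonneg[of 0 w] by simp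
    then show "occupation t w = ?\<Lambda> t (path_from (reflected X) 0 w)" using \<Lambda>[of 0] by simp
    show "occupation (s + t) w = occupation s w + ?\<Lambda> t (path_from (reflected X) s w)" if "0 \<le> s" for s
      using \<Lambda>[OF that] by simp
  qed
qed

lemma occupation_continuous: assumes w: "w \<in> space M" shows "continuous_on {0..} (\<lambda>t. occupation t w)"
proof (rule continuous_onI)
  fix t e :: real assume t: "t \<in> {0..}" and e: "0 < e"
  have "\<bar>occupation u w - occupation t w\<bar> \<le> \<bar>u - t\<bar>" if "u \<in> {0..}" for u
    using occupation_diff(1,2)[OF w, of u t] occupation_diff(1,2)[OF w, of t u] t that
    by (cases "u \<le> t") auto
  then show "\<exists>d>0. \<forall>u\<in>{0..}. dist u t < d \<longrightarrow> dist (occupation u w) (occupation t w) \<le> e"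
    using e by (intro exI[of _ e]) (force simp: dist_real_def intro: order_trans)
qed

lemma occupation_proportional:
  obtains a where "0 \<le> a" "AE w in M. \<forall>t\<ge>0. occupation t w = a * running_sup X t w"
proof -
  interpret sup_functional M X \<Phi> occupation
  proof
    show "continuous_on {0..} (\<lambda>t. occupation t w)" if "w \<in> space M" for w
      by (rule occupation_continuous[OF that])
    show "mono_on {0..} (\<lambda>t. occupation t w)" if "w \<in> space M" for w
      using occupation_diff(1)[OF that] by (auto simp: mono_on_def)
    show "AE w in M. occupation 0 w = 0"
      using occupation_nn[of 0] occupation_nonneg[of 0] by auto
    show "AE w in M. \<forall>s t. 0 \<le> s \<longrightarrow> s \<le> t \<longrightarrow> zero_set X w \<inter> {s<..<t} = {} \<longrightarrow> occupation s w = occupation t w"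
    proof (intro AE_I2 allI impI)
      fix w s t assume w: "w \<in> space M" and st: "(0::real) \<le> s" "s \<le> t" "zero_set X w \<inter> {s<..<t} = {}"
      have "(\<L> u. ind {s<..t} u * at_sup w u) = (\<integral>\<^sup>+u. 0 \<partial>(lborel :: real measure))"
      proof (rule nn_integral_cong_AE)
        show "AE u in lborel. ind {s<..t} u * at_sup w u = 0"
          using AE_lborel_singleton[of t]
        proof eventually_elim
          case (elim u)
          show ?case
          proof (cases "s < u \<and> u < t")
            case True
            then have "u \<notin> zero_set X w" using st by auto
            then show ?thesis using True st by (simp add: at_sup_def zero_set_def reflected_def max_absorb2)
          next
            case False
            then show ?thesis using elim by auto
          qed
        qed
      qed
      then have "ennreal (occupation t w - occupation s w) = 0"
        using occupation_diff(3)[OF w st(1,2)] by simp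
      then show "occupation s w = occupation t w" using occupation_diff(1)[OF w st(1,2)] by simp
    qed
  qed (auto intro: occupation_filt occupation_additive)
  show thesis using local_time_proportional that by blast
qed

end

section \<open>Kendall's identity\<close>

text \<open>The substitution \<open>y = exp (- s)\<close> moves both measures to the unit interval
  and turns Laplace transforms at integers into moments, which determine a measure there by
  Weierstrass approximation.\<close>

lemma finite_measure_eqI_laplace:
  fixes P Q :: "real measure"
  assumes P: "finite_measure P" "sets P = sets borel" "emeasure P {..<0} = 0"
    and Q: "finite_measure Q" "sets Q = sets borel" "emeasure Q {..<0} = 0"
    and eq: "\<And>k::nat. (\<integral>s. exp (- (real k * s)) \<partial>P) = (\<integral>s. exp (- (real k * s)) \<partial>Q)"
  shows "P = Q"
proof -
  let ?e = "\<lambda>s::real. exp (- s)"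
  have AE0: "AE s in R. 0 \<le> s" if "sets R = sets borel" "emeasure R {..<0} = 0" for R :: "real measure"
  proof -
    have "{..<0::real} \<in> null_sets R" using that by (auto simp: null_sets_def)
    then show ?thesis by (rule AE_I') auto
  qed
  have bint: "integrable R (\<lambda>s. g (?e s))"
    if R: "finite_measure R" "sets R = sets borel" "emeasure R {..<0} = 0" and g: "continuous_on UNIV g" for R and g :: "real => real"
  proof -
    interpret finite_measure R by fact
    have [measurable_cong]: "sets R = sets borel" by fact
    have [measurable]: "g \<in> borel_measurable borel" using g by (rule borel_measurable_continuous_onI)
    have "compact (g ` {0..1})" by (intro compact_continuous_image continuous_on_subset[OF g]) auto
    then obtain b where b: "\<And>x. x \<in> {0..1} ==> norm (g x) \<le> b"
      using compact_imp_bounded bounded_iff by (metis imageI)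
    show ?thesis
      by (rule integrable_const_bound[where B=b]) (use AE0[OF R(2,3)] b in \<open>auto elim!: AE_mp\<close>)
  qed
  have poly: "(\<integral>s. g (?e s) \<partial>P) = (\<integral>s. g (?e s) \<partial>Q)" if pg: "real_polynomial_function g" for g
  proof -
    obtain a n where g: "g = (\<lambda>x. \<Sum>i\<le>n. a i * x ^ i)"
      using pg by (auto simp: real_polynomial_function_iff_sum)
    have pw: "(?e s) ^ i = exp (- (real i * s))" for s i by (simp add: exp_of_nat_mult[symmetric])
    have *: "(\<integral>s. g (?e s) \<partial>R) = (\<Sum>i\<le>n. a i * (\<integral>s. exp (- (real i * s)) \<partial>R))"
      if R: "finite_measure R" "sets R = sets borel" "emeasure R {..<0} = 0" for R
    proof -
      have "integrable R (\<lambda>s. exp (- (real i * s)))" for i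
        using bint[OF R, of "\<lambda>x. x ^ i"] by (simp add: pw continuous_intros)
      then show ?thesis unfolding g pw by (subst Bochner_Integration.integral_sum) auto
    qed
    show ?thesis unfolding *[OF P] *[OF Q] eq ..
  qed
  have cont: "(\<integral>s. g (?e s) \<partial>P) = (\<integral>s. g (?e s) \<partial>Q)" if g: "continuous_on UNIV g" for g :: "real => real"
  proof -
    define m where "m = measure P (space P) + measure Q (space Q)"
    have m0: "0 \<le> m" by (simp add: m_def)
    have "\<bar>(\<integral>s. g (?e s) \<partial>P) - (\<integral>s. g (?e s) \<partial>Q)\<bar> \<le> e * m" if e: "0 < e" for e
    proof -
      obtain p where p: "real_polynomial_function p" "\<And>x. x \<in> {0..1} ==> \<bar>g x - p x\<bar> < e"
        using Stone_Weierstrass_real_polynomial_function[OF compact_Icc[of 0 1] continuous_on_subset[OF g] e] by (metis subset_UNIV)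
      have pc: "continuous_on UNIV p" using p(1) by (intro continuous_on_polymonial_function) (simp add: real_polynomial_function_eq)
      have *: "\<bar>(\<integral>s. g (?e s) \<partial>R) - (\<integral>s. p (?e s) \<partial>R)\<bar> \<le> e * measure R (space R)"
        if R: "finite_measure R" "sets R = sets borel" "emeasure R {..<0} = 0" for R
      proof -
        interpret finite_measure R by fact
        have i: "integrable R (\<lambda>s. g (?e s) - p (?e s))" using bint[OF R g] bint[OF R pc] by simp
        have "\<bar>\<integral>s. g (?e s) - p (?e s) \<partial>R\<bar> \<le> (\<integral>s. \<bar>g (?e s) - p (?e s)\<bar> \<partial>R)" by (rule integral_abs_bound)
        also have "\<dots> \<le> (\<integral>s. e \<partial>R)"
        proof (rule integral_mono_AE)
          show "AE s in R. \<bar>g (?e s) - p (?e s)\<bar> \<le> e"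
            using AE0[OF R(2,3)] by eventually_elim (use p(2) in \<open>auto intro: less_imp_le\<close>)
        qed (use i in auto)
        finally have "\<bar>\<integral>s. g (?e s) - p (?e s) \<partial>R\<bar> \<le> (\<integral>s. e \<partial>R)" .
        then show ?thesis using bint[OF R g] bint[OF R pc] by (simp add: mult.commute)
      qed
      have "\<bar>(\<integral>s. g (?e s) \<partial>P) - (\<integral>s. g (?e s) \<partial>Q)\<bar> \<le> e * measure P (space P) + e * measure Q (space Q)"
        using *[OF P] *[OF Q] poly[OF p(1)] by linarith
      then show ?thesis by (simp add: m_def algebra_simps)
    qed
    then have "\<bar>(\<integral>s. g (?e s) \<partial>P) - (\<integral>s. g (?e s) \<partial>Q)\<bar> \<le> 0 + e" if "0 < e" for e
    proof -
      have "\<bar>(\<integral>s. g (?e s) \<partial>P) - (\<integral>s. g (?e s) \<partial>Q)\<bar> \<le> e / (m + 1) * m"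
        using m0 that by (intro \<open>\<And>e. 0 < e ==> _\<close>) auto
      also have "\<dots> \<le> e" using m0 that by (simp add: field_simps)
      finally show ?thesis by simp
    qed
    from field_le_epsilon[OF this] show ?thesis by simp
  qed
  have "distr P borel ?e = distr Q borel ?e"
  proof (rule finite_measure_eqI_continuous)
    have [measurable_cong]: "sets P = sets borel" "sets Q = sets borel" by fact+
    show "finite_measure (distr P borel ?e)" "finite_measure (distr Q borel ?e)"
      using P Q by (auto intro!: finite_measure.finite_measure_distr)
    fix \<psi> :: "real => real" assume \<psi>: "continuous_on UNIV \<psi>" "\<And>x. 0 \<le> \<psi> x \<and> \<psi> x \<le> 1"
    have [measurable]: "\<psi> \<in> borel_measurable borel" using \<psi>(1) by (rule borel_measurable_continuous_onI)
    have *: "(\<integral>\<^sup>+x. ennreal (\<psi> x) \<partial>distr R borel ?e) = ennreal (\<integral>s. \<psi> (?e s) \<partial>R)"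
      if R: "finite_measure R" "sets R = sets borel" "emeasure R {..<0} = 0" for R
    proof -
      have [measurable_cong]: "sets R = sets borel" by fact
      have "(\<integral>\<^sup>+x. ennreal (\<psi> x) \<partial>distr R borel ?e) = (\<integral>\<^sup>+s. ennreal (\<psi> (?e s)) \<partial>R)"
        by (rule nn_integral_distr) auto
      also have "\<dots> = ennreal (\<integral>s. \<psi> (?e s) \<partial>R)"
        using \<psi> by (intro nn_integral_eq_integral bint R) auto
      finally show ?thesis .
    qed
    show "(\<integral>\<^sup>+x. ennreal (\<psi> x) \<partial>distr P borel ?e) = (\<integral>\<^sup>+x. ennreal (\<psi> x) \<partial>distr Q borel ?e)"
      unfolding *[OF P] *[OF Q] cont[OF \<psi>(1)] ..
  qed auto
  then have e: "distr (distr P borel ?e) borel (\<lambda>y. - ln y) = distr (distr Q borel ?e) borel (\<lambda>y. - ln y)" by simp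
  have *: "distr (distr R borel ?e) borel (\<lambda>y. - ln y) = R" if "sets R = sets borel" for R
  proof -
    have [measurable_cong]: "sets R = sets borel" by fact
    have "distr (distr R borel ?e) borel (\<lambda>y. - ln y) = distr R borel (\<lambda>s. s)"
      by (subst distr_distr) (auto simp: comp_def)
    also have "\<dots> = R" by (rule distr_id2) (simp add: that)
    finally show ?thesis .
  qed
  show ?thesis using e unfolding *[OF P(2)] *[OF Q(2)] .
qed

lemma (in snp) first_passage_restart:
  assumes "0 \<le> t" "S t \<le> x"
  shows "first_passage X x w = ereal t + first_passage (increment X t) (x - X t w) w"
proof (rule ereal_eqI_less)
  fix z
  have "first_passage X x w < ereal z \<longleftrightarrow> (\<exists>s\<ge>0. x < X s w \<and> s < z)"
    by (simp add: first_passage_less_iff)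
  also have "\<dots> \<longleftrightarrow> (\<exists>u\<ge>0. x - X t w < increment X t u w \<and> u < z - t)"
  proof safe
    fix s assume s: "0 \<le> s" "x < X s w" "s < z"
    have "t \<le> s" using X_le_S[of s t] s assms by (cases "t \<le> s") auto
    then show "\<exists>u\<ge>0. x - X t w < increment X t u w \<and> u < z - t"
      using s by (intro exI[of _ "s - t"]) (auto simp: increment_def)
  next
    fix u assume "0 \<le> u" "x - X t w < increment X t u w" "u < z - t"
    then show "\<exists>s\<ge>0. x < X s w \<and> s < z"
      using assms by (intro exI[of _ "t + u"]) (auto simp: increment_def)
  qed
  also have "\<dots> \<longleftrightarrow> first_passage (increment X t) (x - X t w) w < ereal (z - t)"
    by (simp add: first_passage_less_iff)
  also have "\<dots> \<longleftrightarrow> ereal t + first_passage (increment X t) (x - X t w) w < ereal z"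
    by (cases "first_passage (increment X t) (x - X t w) w") auto
  finally show "first_passage X x w < ereal z \<longleftrightarrow> ereal t + first_passage (increment X t) (x - X t w) w < ereal z" .
qed

lemma (in snp) path_passage_shifted:
  "0 \<le> t ==> path_passage v (shifted_path X t w) = first_passage (increment X t) v w"
  by (intro path_passage_eq cadlag_increment[of X w, OF cad]) (auto simp: shifted_path_apply increment_def)

lemma exp_time_add: "0 \<le> u ==> exp_time q (ereal t + u) = exp (- (q * t)) * exp_time q u"
  by (cases u) (auto simp: exp_time_def exp_add[symmetric] algebra_simps)

section \<open>Exponential moments and the resolvent on the positive half-line\<close>

context spec_neg
begin

lemma path_law_eq: "(\<Psi> :: _ => ennreal) \<in> borel_measurable path_space ==> (\<P> ww. \<Psi> ww) = (\<E> w. \<Psi> (shifted_path X 0 w))"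
  unfolding path_law_def by (rule nn_integral_distr) auto

lemma path_passage_measurable' [measurable]: "path_passage y \<in> borel_measurable path_space"
  using measurable_compose[OF _ path_passage_measurable, of "\<lambda>ww. (y, ww)"] by simp

lemma path_law_laplace:
  assumes "0 < q" "0 \<le> y"
  shows "(\<P> ww. ennreal (exp_time q (path_passage y ww))) = expm (y * \<Phi> q)"
proof -
  have "(\<P> ww. ennreal (exp_time q (path_passage y ww))) = (\<E> w. ennreal (exp_time q (path_passage y (shifted_path X 0 w))))"
    by (rule path_law_eq) measurable
  also have "\<dots> = (\<E> w. ennreal (exp_time q (first_passage X y w)))"
  proof (rule nn_integral_cong_AE)
    show "AE w in M. ennreal (exp_time q (path_passage y (shifted_path X 0 w))) = ennreal (exp_time q (first_passage X y w))"
      using snp_AE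
    proof eventually_elim
      case (elim w)
      then interpret snp X w .
      have "increment X 0 = (\<lambda>u w. X u w - X 0 w)" by (auto simp: increment_def fun_eq_iff)
      then have "first_passage (increment X 0) y w = first_passage X y w" by (simp add: first_passage_def X0)
      then show ?case by (simp add: path_passage_shifted)
    qed
  qed
  also have "\<dots> = expm (y * \<Phi> q)" by (rule nn_laplace_T[OF assms])
  finally show ?thesis .
qed

text \<open>Markov property at the fixed time \<open>t\<close>: a path that has not exceeded
  \<open>x\<close> by then starts afresh with the distance \<open>x - X t w\<close> left to climb,
  at the price of the discount \<open>exp (- (q * t))\<close>.\<close>

lemma laplace_split:
  assumes q: "0 < q" and t: "0 \<le> t" and x: "0 \<le> x"
  shows "expm (x * \<Phi> q) =
    (\<E> w. ennreal (exp_time q (first_passage X x w)) * ind {w. x < running_sup X t w} w) +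
    expm (q * t) * (\<E> w. expm ((x - X t w) * \<Phi> q) * ind {w. running_sup X t w \<le> x} w)"
proof -
  have [measurable]: "running_sup X t \<in> borel_measurable M" "X t \<in> borel_measurable M" using t by auto
  have i1[measurable]: "(\<lambda>w. ind {w. x < running_sup X t w} w :: ennreal) \<in> borel_measurable M"
    unfolding indicator_def by measurable
  have i2[measurable]: "(\<lambda>w. ind {w. running_sup X t w \<le> x} w :: ennreal) \<in> borel_measurable M"
    unfolding indicator_def by measurable
  have "expm (x * \<Phi> q) = (\<E> w. ennreal (exp_time q (first_passage X x w)))"
    using nn_laplace_T[OF q x] by simp
  also have "\<dots> = (\<E> w. ennreal (exp_time q (first_passage X x w)) * ind {w. x < running_sup X t w} w
      + ennreal (exp_time q (first_passage X x w)) * ind {w. running_sup X t w \<le> x} w)"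
    by (intro nn_integral_cong) (auto split: split_indicator)
  also have "\<dots> = (\<E> w. ennreal (exp_time q (first_passage X x w)) * ind {w. x < running_sup X t w} w) +
     (\<E> w. ennreal (exp_time q (first_passage X x w)) * ind {w. running_sup X t w \<le> x} w)"
    by (intro nn_integral_add) auto
  also have "(\<E> w. ennreal (exp_time q (first_passage X x w)) * ind {w. running_sup X t w \<le> x} w) =
     expm (q * t) * (\<E> w. expm ((x - X t w) * \<Phi> q) * ind {w. running_sup X t w \<le> x} w)"
  proof -
    define \<Psi> where "\<Psi> = (\<lambda>(z :: real \<times> real, ww). (if fst z \<le> x then ennreal (exp (- (q * t)) * exp_time q (path_passage (x - snd z) ww)) else 0))"
    have "(\<lambda>z. (\<lambda>(y, ww). path_passage y ww) (x - snd (fst z), snd z)) \<in> borel_measurable (borel2 \<Otimes>\<^sub>M path_space)"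
      by (rule measurable_compose[OF _ path_passage_measurable]) measurable
    then have pm[measurable]: "(\<lambda>z. path_passage (x - snd (fst z)) (snd z)) \<in> borel_measurable (borel2 \<Otimes>\<^sub>M path_space)"
      by simp
    have \<Psi>m: "\<Psi> \<in> borel_measurable (borel2 \<Otimes>\<^sub>M path_space)"
      unfolding \<Psi>_def case_prod_beta' by measurable
    have y: "(\<lambda>w. (running_sup X t w, X t w)) \<in> measurable (filt M X t) borel2"
      using running_sup_filt[OF t] X_filt[OF t order_refl] by (rule measurable_Pair)
    have "(\<E> w. ennreal (exp_time q (first_passage X x w)) * ind {w. running_sup X t w \<le> x} w) =
       (\<E> w. \<Psi> ((running_sup X t w, X t w), shifted_path X t w))"
    proof (rule nn_integral_cong_AE)
      show "AE w in M. ennreal (exp_time q (first_passage X x w)) * ind {w. running_sup X t w \<le> x} w =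
        \<Psi> ((running_sup X t w, X t w), shifted_path X t w)"
        using snp_AE
      proof eventually_elim
        case (elim w)
        then interpret snp X w .
        show ?case
          using first_passage_restart[OF t, of x] t by (auto simp: \<Psi>_def exp_time_add path_passage_shifted)
      qed
    qed
    also have "\<dots> = (\<E> w. (\<P> ww. \<Psi> ((running_sup X t w, X t w), ww)))"
      by (rule markov_nn_integral[OF t y \<Psi>m])
    also have "\<dots> = (\<E> w. expm (q * t) * (expm ((x - X t w) * \<Phi> q) * ind {w. running_sup X t w \<le> x} w))"
    proof (rule nn_integral_cong)
      fix w assume w: "w \<in> space M"
      have [measurable_cong]: "sets path_law = sets path_space" by (simp add: path_law_def)
      show "(\<P> ww. \<Psi> ((running_sup X t w, X t w), ww)) =
        expm (q * t) * (expm ((x - X t w) * \<Phi> q) * ind {w. running_sup X t w \<le> x} w)"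
      proof (cases "running_sup X t w \<le> x")
        case True
        then have "0 \<le> x - X t w" using running_sup_upper[of X w t t, OF cadlag_X[OF w] t] by simp
        then show ?thesis using True path_law_laplace[OF q, of "x - X t w"] q
          by (simp add: \<Psi>_def ennreal_mult exp_time_bounds nn_integral_cmult)
      qed (simp add: \<Psi>_def)
    qed
    also have "\<dots> = expm (q * t) * (\<E> w. expm ((x - X t w) * \<Phi> q) * ind {w. running_sup X t w \<le> x} w)"
      by (intro nn_integral_cmult) measurable
    finally show ?thesis .
  qed
  finally show ?thesis .
qed

text \<open>Multiply \<open>laplace_split\<close> by \<open>exp (x * \<Phi> q)\<close> and let
  \<open>x\<close> tend to infinity: paths below \<open>x\<close> exhaust the space, and the
  contribution of paths that exceed \<open>x\<close> before \<open>t\<close> vanishes.\<close>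

lemma exp_moment:
  assumes q: "0 < q" and t: "0 \<le> t"
  shows "(\<E> w. ennreal (exp (\<Phi> q * X t w))) = ennreal (exp (q * t))"
proof -
  have Xm[measurable]: "X t \<in> borel_measurable M" "running_sup X t \<in> borel_measurable M" using t by auto
  define F where "F = (\<lambda>x. \<integral>\<^sup>+w. ennreal (exp_time q (first_passage X x w)) * ind {w. x < running_sup X t w} w \<partial>M)"
  define G where "G = (\<lambda>x. \<integral>\<^sup>+w. ennreal (exp (\<Phi> q * X t w)) * ind {w. running_sup X t w \<le> x} w \<partial>M)"
  have i2[measurable]: "(\<lambda>w. ind {w. running_sup X t w \<le> x} w :: ennreal) \<in> borel_measurable M" for x
    unfolding indicator_def by measurable
  have eq: "1 = ennreal (exp (x * \<Phi> q)) * F x + expm (q * t) * G x" if x: "0 \<le> x" for x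
  proof -
    have "(\<E> w. expm ((x - X t w) * \<Phi> q) * ind {w. running_sup X t w \<le> x} w) =
       (\<E> w. expm (x * \<Phi> q) * (ennreal (exp (\<Phi> q * X t w)) * ind {w. running_sup X t w \<le> x} w))"
      by (intro nn_integral_cong) (auto simp: ennreal_mult[symmetric] exp_add[symmetric] algebra_simps split: split_indicator)
    also have "\<dots> = expm (x * \<Phi> q) * G x"
      unfolding G_def by (intro nn_integral_cmult) measurable
    finally have "ennreal (exp (x * \<Phi> q)) * expm (x * \<Phi> q) =
      ennreal (exp (x * \<Phi> q)) * (F x + expm (q * t) * (expm (x * \<Phi> q) * G x))"
      using laplace_split[OF q t x] by (simp add: F_def)
    also have "\<dots> = ennreal (exp (x * \<Phi> q)) * F x + (ennreal (exp (x * \<Phi> q)) * expm (x * \<Phi> q)) * (expm (q * t) * G x)"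
      by (simp add: distrib_left ac_simps)
    finally show ?thesis by (simp add: ennreal_mult[symmetric] exp_add[symmetric])
  qed
  have "(\<lambda>n. ennreal (exp (real n * \<Phi> q)) * F (real n)) \<longlonglongrightarrow> 0"
  proof (rule tendsto_sandwich[of "\<lambda>_. 0"])
    \<comment> \<open>Before time \<open>t\<close>, raising the rate from \<open>q\<close> to
      \<open>q + 1\<close> costs at most the factor \<open>exp t\<close>; the resulting decay
      \<open>exp (- (x * \<Phi> (q + 1)))\<close> beats \<open>exp (x * \<Phi> q)\<close> by strict
      monotonicity of \<Phi>.\<close>
    have le: "exp_time q u \<le> exp t * exp_time (q + 1) u" if "0 \<le> u" "u \<le> ereal t" for u
      using that by (cases u) (auto simp: exp_time_def exp_add[symmetric] algebra_simps)
    have "F x \<le> ennreal (exp t * exp (- (x * \<Phi> (q + 1))))" if x: "0 \<le> x" for x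
    proof -
      have "F x \<le> (\<E> w. ennreal (exp t) * ennreal (exp_time (q + 1) (first_passage X x w)))"
        unfolding F_def
      proof (rule nn_integral_mono_AE)
        show "AE w in M. ennreal (exp_time q (first_passage X x w)) * ind {w. x < running_sup X t w} w \<le>
          ennreal (exp t) * ennreal (exp_time (q + 1) (first_passage X x w))"
          using snp_AE
        proof eventually_elim
          case (elim w)
          then interpret snp X w .
          show ?case
          proof (cases "x < S t")
            case True
            then have "T x \<le> ereal t" using T_less_iff[OF x t] by simp
            then show ?thesis using le[of "T x"] q True by (simp add: ennreal_mult[symmetric] exp_time_bounds)
          qed simp
        qed
      qed
      also have "\<dots> = ennreal (exp t) * expm (x * \<Phi> (q + 1))"
        using nn_laplace_T[of "q + 1" x] q x by (subst nn_integral_cmult) auto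
      finally show ?thesis by (simp add: ennreal_mult)
    qed
    then have "ennreal (exp (real n * \<Phi> q)) * F (real n) \<le> ennreal (exp t * exp (- (real n * (\<Phi> (q + 1) - \<Phi> q))))" for n
    proof -
      have "ennreal (exp (real n * \<Phi> q)) * F (real n) \<le> ennreal (exp (real n * \<Phi> q)) * ennreal (exp t * exp (- (real n * \<Phi> (q + 1))))"
        using \<open>\<And>x. 0 \<le> x ==> F x \<le> _\<close>[of "real n"] by (intro mult_left_mono) auto
      also have "\<dots> = ennreal (exp t * exp (- (real n * (\<Phi> (q + 1) - \<Phi> q))))"
        by (simp add: ennreal_mult[symmetric] exp_add[symmetric] algebra_simps)
      finally show ?thesis .
    qed
    then show "\<forall>\<^sub>F n in sequentially. ennreal (exp (real n * \<Phi> q)) * F (real n) \<le> ennreal (exp t * exp (- (real n * (\<Phi> (q + 1) - \<Phi> q))))"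
      by simp
    have "0 < \<Phi> (q + 1) - \<Phi> q" using \<Phi>_strict_mono[OF q, of "q + 1"] by simp
    then have "(\<lambda>n. exp t * exp (- (real n * (\<Phi> (q + 1) - \<Phi> q)))) \<longlonglongrightarrow> 0" by real_asymp
    then show "(\<lambda>n. ennreal (exp t * exp (- (real n * (\<Phi> (q + 1) - \<Phi> q))))) \<longlonglongrightarrow> 0"
      using tendsto_ennrealI by fastforce
  qed auto
  moreover have "(\<lambda>n. G (real n)) \<longlonglongrightarrow> (\<E> w. ennreal (exp (\<Phi> q * X t w)))"
    unfolding G_def
  proof (rule nn_integral_LIMSEQ)
    show "incseq (\<lambda>n w. ennreal (exp (\<Phi> q * X t w)) * ind {w. running_sup X t w \<le> real n} w)"
      by (auto simp: incseq_def le_fun_def split: split_indicator)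
    show "(\<lambda>n. ennreal (exp (\<Phi> q * X t w)) * ind {w. running_sup X t w \<le> real n} w) \<longlonglongrightarrow> ennreal (exp (\<Phi> q * X t w))" for w
    proof -
      obtain N :: nat where N: "running_sup X t w \<le> real N" using real_arch_simple by blast
      have "\<forall>\<^sub>F n in sequentially. ennreal (exp (\<Phi> q * X t w)) * ind {w. running_sup X t w \<le> real n} w = ennreal (exp (\<Phi> q * X t w))"
        using eventually_ge_at_top[of N] by eventually_elim (use N in auto)
      then show ?thesis by (rule tendsto_eventually)
    qed
  qed auto
  ultimately have "(\<lambda>n. ennreal (exp (real n * \<Phi> q)) * F (real n) + expm (q * t) * G (real n)) \<longlonglongrightarrow>
     0 + expm (q * t) * (\<E> w. ennreal (exp (\<Phi> q * X t w)))"
    by (intro tendsto_add tendsto_mult_ennreal tendsto_const) auto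
  then have "1 = expm (q * t) * (\<E> w. ennreal (exp (\<Phi> q * X t w)))"
    using eq[of "real _"] by (simp add: LIMSEQ_const_iff)
  then have "ennreal (exp (q * t)) * 1 = (ennreal (exp (q * t)) * expm (q * t)) * (\<E> w. ennreal (exp (\<Phi> q * X t w)))"
    by (simp add: mult.assoc)
  then show ?thesis by (simp add: ennreal_mult[symmetric] exp_add[symmetric])
qed

lemma strong_markov_laplace:
  assumes q: "0 < q" and x: "0 \<le> x" and \<Psi>: "\<Psi> \<in> borel_measurable path_space"
  shows "(\<E> w. ennreal (exp_time q (first_passage X x w)) * \<Psi> (shifted_path X (\<tau> x w) w)) =
    expm (x * \<Phi> q) * (\<P> ww. \<Psi> ww)"
proof -
  let ?t = "\<lambda>w. \<tau> x w"
  define h where "h = (\<lambda>z::real\<times>real. exp (- (q * max 0 (fst z))))"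
  have SM: "(\<E> w. ennreal (h (?t w, (\<lambda>_ _. 0) (?t w) w)) * ind {w. first_passage X x w < \<infinity>} w * \<Psi> (shifted_path X (?t w) w)) =
    (\<E> w. ennreal (h (?t w, (\<lambda>_ _. 0) (?t w) w)) * ind {w. first_passage X x w < \<infinity>} w) * (\<P> ww. \<Psi> ww)"
  proof (rule strong_markov)
    show "continuous_on UNIV h" unfolding h_def by (intro continuous_intros)
    show "0 \<le> h z \<and> h z \<le> 1" for z using q by (simp add: h_def)
  qed (use first_passage_stopping \<Psi> in auto)
  have h: "ennreal (h (?t w, (\<lambda>_ _. 0) (?t w) w)) * ind {w. first_passage X x w < \<infinity>} w = ennreal (exp_time q (first_passage X x w))" for w
    by (simp add: h_def exp_time_def real_of_ereal_pos max_absorb2 split: split_indicator)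
  show ?thesis using SM unfolding h nn_laplace_T[OF q x] .
qed

lemma X_time_measurable: "w \<in> space M ==> (\<lambda>t. X (max 0 t) w) \<in> borel_measurable borel"
  using measurable_compose[OF measurable_Pair2' X_joint_measurable, of w] by simp

lemma X_pair_measurable [measurable]: "(\<lambda>z. X (max 0 (fst z)) (snd z)) \<in> borel_measurable LM"
  using X_joint_measurable by (simp add: case_prod_beta' cong: measurable_cong_sets)

lemma T_pair_measurable [measurable]: "(\<lambda>z. first_passage X (fst z) (snd z)) \<in> borel_measurable LM"
  using first_passage_joint_measurable by (simp add: case_prod_beta' cong: measurable_cong_sets)

definition resolvent_tail :: "real => real => ennreal" where
  "resolvent_tail q x = (\<L> t. (\<E> w. expm (q * t) * ind {0..} t * ind {x<..} (X (max 0 t) w)))"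

text \<open>The path can be above \<open>x\<close> only after passing \<open>x\<close>, and from
  then on it starts afresh from exactly \<open>x\<close>. Thus the tail has no memory and is
  exponential in the level.\<close>

lemma resolvent_tail_eq:
  assumes q: "0 < q" and x: "0 \<le> x"
  shows "resolvent_tail q x = expm (x * \<Phi> q) * resolvent_tail q 0"
proof -
  interpret pair_sigma_finite lborel M by unfold_locales
  let ?t = "\<lambda>w. \<tau> x w"
  define g where "g = (\<lambda>u. expm (q * u) * ind {0..} u)"
  have gm[measurable]: "g \<in> borel_measurable borel" unfolding g_def by measurable
  have t0: "0 \<le> ?t w" for w by (simp add: real_of_ereal_pos)
  have [measurable]: "(\<lambda>z. X (?t (snd z) + max 0 (fst z)) (snd z)) \<in> borel_measurable LM"
    by (rule X_random_measurable) (use t0 in auto)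
  have [measurable]: "(\<lambda>z. X (?t (snd z)) (snd z)) \<in> borel_measurable LM"
    by (rule X_random_measurable) (use t0 in auto)
  define k where "k = (\<lambda>u w. ennreal (exp_time q (first_passage X x w)) * (g u * ind {0<..} (X (?t w + max 0 u) w - X (?t w) w)))"
  have "resolvent_tail q x = (\<L> t. (\<E> w. g t * ind {x<..} (X (max 0 t) w)))"
    unfolding resolvent_tail_def g_def ..
  also have "\<dots> = (\<E> w. (\<L> t. g t * ind {x<..} (X (max 0 t) w)))"
    by (intro Fubini'[symmetric]) (simp add: case_prod_beta')
  also have "\<dots> = (\<E> w. (\<L> u. k u w))"
  proof (rule nn_integral_cong_AE)
    show "AE w in M. (\<L> t. g t * ind {x<..} (X (max 0 t) w)) = (\<L> u. k u w)"
      using snp_AE AE_space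
    proof eventually_elim
      case (elim w)
      interpret snp X w by fact
      have [measurable]: "(\<lambda>t. X (max 0 t) w) \<in> borel_measurable borel" by (rule X_time_measurable[OF elim(2)])
      show ?case
      proof (cases "T x")
        case (real t)
        note tv = T_value[OF x real]
        have "(\<L> t. g t * ind {x<..} (X (max 0 t) w)) =
          (\<L> u. g (t + 1 * u) * ind {x<..} (X (max 0 (t + 1 * u)) w))"
          by (subst nn_integral_real_affine[of "\<lambda>t. g t * ind {x<..} (X (max 0 t) w)" 1 t]) auto
        also have "\<dots> = (\<L> u. k u w)"
        proof (rule nn_integral_cong)
          fix u
          show "g (t + 1 * u) * ind {x<..} (X (max 0 (t + 1 * u)) w) = k u w"
          proof (cases "0 \<le> u")
            case True
            then have "g (t + u) = expm (q * t) * g u"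
              using tv by (simp add: g_def ennreal_mult[symmetric] exp_add[symmetric] algebra_simps)
            then show ?thesis using True tv real
              by (simp add: k_def exp_time_def max_absorb2 mult.assoc split: split_indicator)
          next
            case False
            then have "X (max 0 (t + u)) w \<le> x" using X_le_S[of "max 0 (t + u)" t] tv by auto
            then show ?thesis using False by (simp add: k_def g_def)
          qed
        qed
        finally show ?thesis .
      next
        case PInf
        have "X s w \<le> x" if "0 \<le> s" for s using before_first_passage[of s X x w] PInf that by simp
        then have "ind {x<..} (X (max 0 t) w) = (0 :: ennreal)" for t by (simp add: not_less)
        then show ?thesis using PInf by (simp add: k_def exp_time_def)
      next
        case MInf
        then show ?thesis using first_passage_nonneg[of X x w] by simp
      qed
    qed
  qed
  also have "\<dots> = (\<L> u. (\<E> w. k u w))"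
    unfolding k_def by (intro Fubini') (simp add: case_prod_beta')
  also have "\<dots> = (\<L> u. expm (x * \<Phi> q) * (\<E> w. g u * ind {0<..} (X (max 0 u) w)))"
  proof (rule nn_integral_cong)
    fix u
    show "(\<E> w. k u w) = expm (x * \<Phi> q) * (\<E> w. g u * ind {0<..} (X (max 0 u) w))"
    proof (cases "0 \<le> u")
      case True
      define \<Psi> where "\<Psi> = (\<lambda>ww :: real => real. g u * ind {0<..} (ww u))"
      have [measurable]: "(\<lambda>ww. ww u) \<in> measurable path_space borel" using True by (intro measurable_component_singleton) auto
      have \<Psi>m: "\<Psi> \<in> borel_measurable path_space" unfolding \<Psi>_def by measurable
      have "(\<E> w. k u w) = expm (x * \<Phi> q) * (\<P> ww. \<Psi> ww)"
        using strong_markov_laplace[OF q x \<Psi>m] True by (simp add: k_def \<Psi>_def shifted_path_apply max_absorb2)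
      also have "(\<P> ww. \<Psi> ww) = (\<E> w. \<Psi> (shifted_path X 0 w))" by (rule path_law_eq[OF \<Psi>m])
      also have "\<dots> = (\<E> w. g u * ind {0<..} (X (max 0 u) w))"
      proof (rule nn_integral_cong_AE)
        show "AE w in M. \<Psi> (shifted_path X 0 w) = g u * ind {0<..} (X (max 0 u) w)"
          using X0_AE by eventually_elim (use True in \<open>simp add: \<Psi>_def shifted_path_apply max_absorb2\<close>)
      qed
      finally show ?thesis .
    qed (simp add: k_def g_def)
  qed
  also have "\<dots> = expm (x * \<Phi> q) * (\<L> u. (\<E> w. g u * ind {0<..} (X (max 0 u) w)))"
    by (intro nn_integral_cmult borel_measurable_nn_integral) (simp add: case_prod_beta')
  also have "(\<L> u. (\<E> w. g u * ind {0<..} (X (max 0 u) w))) = resolvent_tail q 0"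
    unfolding resolvent_tail_def g_def ..
  finally show ?thesis .
qed

lemma exp_discount: "0 < q ==> (\<L> t. expm (q * t) * ind {0..} t) = ennreal (1 / q)"
  using nn_integral_exp_half_line[of q] by (simp add: mult.commute)

lemma resolvent_tail_finite: assumes "0 < q" shows "resolvent_tail q x \<le> ennreal (1 / q)"
proof -
  have "resolvent_tail q x \<le> (\<L> t. expm (q * t) * ind {0..} t)"
    unfolding resolvent_tail_def
  proof (rule nn_integral_mono)
    fix t
    have "(\<E> w. expm (q * t) * ind {0..} t * ind {x<..} (X (max 0 t) w))
      \<le> (\<E> w. expm (q * t) * ind {0..} t)"
      by (intro nn_integral_mono) (auto split: split_indicator)
    then show "(\<E> w. expm (q * t) * ind {0..} t * ind {x<..} (X (max 0 t) w))
      \<le> expm (q * t) * ind {0..} t" by (simp add: emeasure_space_1)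
  qed
  then show ?thesis using exp_discount[OF assms] by simp
qed

text \<open>The constant of the resolvent density. By \<open>C_bounds\<close> it plays the role of
  the left derivative of \<Phi> at \<open>q\<close>.\<close>

definition C :: "real => real" where "C q = enn2real (resolvent_tail q 0) * \<Phi> q"

lemma C_nonneg: "0 < q ==> 0 \<le> C q" using \<Phi>_pos[of q] by (simp add: C_def)

lemma resolvent_density:
  assumes q: "0 < q" and g[measurable]: "g \<in> borel_measurable borel"
  shows "(\<L> t. (\<E> w. expm (q * t) * ind {0..} t * (g (X (max 0 t) w) * ind {0<..} (X (max 0 t) w)))) =
    (\<L> x. ennreal (C q * exp (- (x * \<Phi> q))) * (g x * ind {0..} x))"
proof -
  define u0 where "u0 = enn2real (resolvent_tail q 0)"
  have u0: "resolvent_tail q 0 = ennreal u0" "0 \<le> u0"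
  proof -
    have "resolvent_tail q 0 < \<top>" by (rule le_less_trans[OF resolvent_tail_finite[OF q]]) simp
    then show "resolvent_tail q 0 = ennreal u0" "0 \<le> u0" by (auto simp: u0_def)
  qed
  define ww where "ww = (\<lambda>z. expm (q * fst z) * ind {0..} (fst z) * ind {0<..} (X (max 0 (fst z)) (snd z)))"
  have wm[measurable]: "ww \<in> borel_measurable LM" unfolding ww_def by measurable
  define \<mu> where "\<mu> = distr (density LM ww) borel (\<lambda>z. X (max 0 (fst z)) (snd z))"
  define \<nu> where "\<nu> = density lborel (\<lambda>x. ennreal (C q * exp (- (x * \<Phi> q))) * ind {0..} x)"
  have \<mu>: "(\<integral>\<^sup>+x. f x \<partial>\<mu>) = (\<L> t. (\<E> w. expm (q * t) * ind {0..} t * (f (X (max 0 t) w) * ind {0<..} (X (max 0 t) w))))"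
    if [measurable]: "f \<in> borel_measurable borel" for f
  proof -
    have "(\<integral>\<^sup>+x. f x \<partial>\<mu>) = (\<integral>\<^sup>+z. ww z * f (X (max 0 (fst z)) (snd z)) \<partial>LM)"
      unfolding \<mu>_def by (subst nn_integral_distr) (auto simp: nn_integral_density)
    also have "\<dots> = (\<L> t. (\<E> w. ww (t, w) * f (X (max 0 t) w)))"
      using nn_integral_fst[of "\<lambda>z. ww z * f (X (max 0 (fst z)) (snd z))" lborel] by simp
    also have "\<dots> = (\<L> t. (\<E> w. expm (q * t) * ind {0..} t * (f (X (max 0 t) w) * ind {0<..} (X (max 0 t) w))))"
      unfolding ww_def by (intro nn_integral_cong) (simp add: ac_simps)
    finally show ?thesis .
  qed
  have tail: "emeasure \<mu> {x<..} = ennreal (exp (- (x * \<Phi> q)) * u0)" if x: "0 \<le> x" for x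
  proof -
    have m: "(ind {x<..} :: real => ennreal) \<in> borel_measurable borel" by simp
    have "emeasure \<mu> {x<..} = (\<integral>\<^sup>+y. ind {x<..} y \<partial>\<mu>)" by (simp add: \<mu>_def)
    also have "\<dots> = resolvent_tail q x"
      unfolding \<mu>[OF m] resolvent_tail_def
      using x by (intro nn_integral_cong) (auto split: split_indicator)
    also have "\<dots> = ennreal (exp (- (x * \<Phi> q)) * u0)"
      using resolvent_tail_eq[OF q x] u0 by (simp add: ennreal_mult)
    finally show ?thesis .
  qed
  have "\<mu> = \<nu>"
  proof (rule measure_eqI_Ioc)
    show "sets \<mu> = sets borel" "sets \<nu> = sets borel" by (auto simp: \<mu>_def \<nu>_def)
    have m: "(ind {..0} :: real => ennreal) \<in> borel_measurable borel" by simp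
    have "emeasure \<mu> {..0} = (\<integral>\<^sup>+y. ind {..0} y \<partial>\<mu>)" by (simp add: \<mu>_def)
    also have "\<dots> = (\<integral>\<^sup>+t. (\<E> w. 0) \<partial>(lborel :: real measure))"
      unfolding \<mu>[OF m]
      by (intro nn_integral_cong) (auto split: split_indicator)
    finally show "emeasure \<mu> {..0} = 0" by simp
    have "emeasure \<nu> {..0} = (\<L> x. ennreal (C q * exp (- (x * \<Phi> q))) * ind {0..} x * ind {..0} x)"
      unfolding \<nu>_def by (subst emeasure_density) auto
    also have "\<dots> = (\<integral>\<^sup>+x. 0 \<partial>(lborel :: real measure))"
    proof (rule nn_integral_cong_AE)
      show "AE x in lborel. ennreal (C q * exp (- (x * \<Phi> q))) * ind {0..} x * ind {..0} x = 0"
        using AE_lborel_singleton[of 0] by eventually_elim (auto split: split_indicator)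
    qed
    finally show "emeasure \<nu> {..0} = 0" by simp
    have Ioc: "emeasure \<mu> {a<..b} = ennreal (exp (- (a * \<Phi> q)) * u0 - exp (- (b * \<Phi> q)) * u0)" if ab: "0 \<le> a" "a \<le> b" for a b
    proof -
      have "{a<..b} = {a<..} - {b<..}" by auto
      then have "emeasure \<mu> {a<..b} = emeasure \<mu> {a<..} - emeasure \<mu> {b<..}"
        using tail[of b] ab by (simp add: emeasure_Diff \<mu>_def)
      then show ?thesis using tail[of a] tail[of b] ab u0 by (simp add: ennreal_minus)
    qed
    show "emeasure \<mu> {0<..b} < \<infinity>" if "0 \<le> b" for b using Ioc[of 0 b] that by simp
    fix a b :: real assume ab: "0 \<le> a" "a \<le> b"
    have "emeasure \<nu> {a<..b} = (\<L> x. ennreal (C q * exp (- (x * \<Phi> q))) * ind {0..} x * ind {a<..b} x)"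
      unfolding \<nu>_def by (subst emeasure_density) auto
    also have "\<dots> = (\<L> x. ennreal (C q * exp (- (x * \<Phi> q))) * ind {a..b} x)"
    proof (rule nn_integral_cong_AE)
      show "AE x in lborel. ennreal (C q * exp (- (x * \<Phi> q))) * ind {0..} x * ind {a<..b} x =
        ennreal (C q * exp (- (x * \<Phi> q))) * ind {a..b} x"
        using AE_lborel_singleton[of a] by eventually_elim (use ab in \<open>auto split: split_indicator\<close>)
    qed
    also have "\<dots> = ennreal ((- u0 * exp (- (b * \<Phi> q))) - (- u0 * exp (- (a * \<Phi> q))))"
      using ab C_nonneg[OF q]
      by (intro nn_integral_FTC_Icc) (auto intro!: derivative_eq_intros simp: C_def u0_def)
    finally show "emeasure \<mu> {a<..b} = emeasure \<nu> {a<..b}" using Ioc[OF ab] by (simp add: ac_simps)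
  qed
  then have "(\<integral>\<^sup>+x. g x \<partial>\<mu>) = (\<integral>\<^sup>+x. g x \<partial>\<nu>)" by simp
  then show ?thesis unfolding \<mu>[OF g] \<nu>_def by (simp add: nn_integral_density ac_simps)
qed

text \<open>Discount \<open>exp (\<Phi> q' * X t)\<close> at rate \<open>q\<close>. The total is
  \<open>1 / (q - q')\<close> by \<open>exp_moment\<close>; positive values of \<open>X\<close>
  contribute \<open>C q / (\<Phi> q - \<Phi> q')\<close> by the resolvent density; the rest lies
  between 0 and \<open>1 / q\<close>, since the exponential is at most 1 there.\<close>

lemma C_bounds:
  assumes q: "0 < q'" "q' < q"
  shows "C q * (q - q') \<le> \<Phi> q - \<Phi> q'" "(\<Phi> q - \<Phi> q') * (1 - (q - q') / q) \<le> C q * (q - q')"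
proof -
  let ?e = "\<lambda>t. expm (q * t) * ind {0..} t"
  let ?X = "\<lambda>t w. X (max 0 t) w"
  define K where "K = (\<L> t. (\<E> w. ?e t * (ennreal (exp (\<Phi> q' * ?X t w)) * ind {..0} (?X t w))))"
  define \<Delta> where "\<Delta> = \<Phi> q - \<Phi> q'"
  have \<Delta>: "0 < \<Delta>" using \<Phi>_strict_mono[OF q] by (simp add: \<Delta>_def)
  have C0: "0 \<le> C q" using C_nonneg q by simp
  have Xm: "X (max 0 t) \<in> borel_measurable M" for t by simp
  have "(\<L> t. (\<E> w. ?e t * ennreal (exp (\<Phi> q' * ?X t w)))) = (\<L> t. expm ((q - q') * t) * ind {0..} t)"
  proof (rule nn_integral_cong)
    fix t
    show "(\<E> w. ?e t * ennreal (exp (\<Phi> q' * ?X t w))) = expm ((q - q') * t) * ind {0..} t"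
    proof (cases "0 \<le> t")
      case True
      have "(\<E> w. ?e t * ennreal (exp (\<Phi> q' * ?X t w))) = ?e t * (\<E> w. ennreal (exp (\<Phi> q' * ?X t w)))"
        using Xm[of t] by (intro nn_integral_cmult) measurable
      then show ?thesis using True exp_moment[OF q(1) True]
        by (simp add: max_absorb2 ennreal_mult[symmetric] exp_add[symmetric] algebra_simps)
    qed simp
  qed
  also have "\<dots> = ennreal (1 / (q - q'))" using exp_discount[of "q - q'"] q by simp
  finally have tot: "(\<L> t. (\<E> w. ?e t * ennreal (exp (\<Phi> q' * ?X t w)))) = ennreal (1 / (q - q'))" .
  have "(\<L> t. (\<E> w. ?e t * ennreal (exp (\<Phi> q' * ?X t w)))) =
     (\<L> t. (\<E> w. ?e t * (ennreal (exp (\<Phi> q' * ?X t w)) * ind {0<..} (?X t w))) +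
       (\<E> w. ?e t * (ennreal (exp (\<Phi> q' * ?X t w)) * ind {..0} (?X t w))))"
  proof (rule nn_integral_cong)
    fix t
    note [measurable] = Xm[of t]
    have "(\<E> w. ?e t * ennreal (exp (\<Phi> q' * ?X t w))) = (\<E> w. ?e t * (ennreal (exp (\<Phi> q' * ?X t w)) * ind {0<..} (?X t w))
       + ?e t * (ennreal (exp (\<Phi> q' * ?X t w)) * ind {..0} (?X t w)))"
      by (intro nn_integral_cong) (auto split: split_indicator)
    also have "\<dots> = (\<E> w. ?e t * (ennreal (exp (\<Phi> q' * ?X t w)) * ind {0<..} (?X t w))) +
       (\<E> w. ?e t * (ennreal (exp (\<Phi> q' * ?X t w)) * ind {..0} (?X t w)))"
      by (intro nn_integral_add) measurable
    finally show "(\<E> w. ?e t * ennreal (exp (\<Phi> q' * ?X t w))) = \<dots>" .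
  qed
  also have "\<dots> = (\<L> t. (\<E> w. ?e t * (ennreal (exp (\<Phi> q' * ?X t w)) * ind {0<..} (?X t w)))) + K"
    unfolding K_def by (intro nn_integral_add borel_measurable_nn_integral) (simp_all add: case_prod_beta')
  also have "(\<L> t. (\<E> w. ?e t * (ennreal (exp (\<Phi> q' * ?X t w)) * ind {0<..} (?X t w)))) =
     (\<L> x. ennreal (C q * exp (- (x * \<Phi> q))) * (ennreal (exp (\<Phi> q' * x)) * ind {0..} x))"
    using q by (intro resolvent_density) auto
  also have "\<dots> = (\<L> x. ennreal (C q) * (expm (x * \<Delta>) * ind {0..} x))"
    using C0 by (intro nn_integral_cong) (auto simp: \<Delta>_def ennreal_mult[symmetric] exp_add[symmetric] algebra_simps split: split_indicator)
  also have "\<dots> = ennreal (C q) * ennreal (1 / \<Delta>)"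
    using nn_integral_exp_half_line[OF \<Delta>] by (subst nn_integral_cmult) auto
  finally have eq: "ennreal (1 / (q - q')) = ennreal (C q / \<Delta>) + K"
    using tot C0 \<Delta> by (simp add: ennreal_mult[symmetric])
  have "K \<le> (\<L> t. (\<E> w. ?e t))"
    unfolding K_def
  proof (intro nn_integral_mono)
    fix t w
    have "ennreal (exp (\<Phi> q' * ?X t w)) * ind {..0} (?X t w) \<le> 1"
      using \<Phi>_pos[OF q(1)] by (auto simp: mult_le_0_iff ennreal_le_1 split: split_indicator)
    from mult_left_mono[OF this, of "?e t"]
    show "?e t * (ennreal (exp (\<Phi> q' * ?X t w)) * ind {..0} (?X t w)) \<le> ?e t" by simp
  qed
  also have "\<dots> = ennreal (1 / q)" using exp_discount[of q] q by (simp add: emeasure_space_1)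
  finally have K: "K \<le> ennreal (1 / q)" .
  then have "K < \<top>" by (rule le_less_trans) simp
  then obtain r where r: "K = ennreal r" "0 \<le> r" by (cases K) auto
  have rq: "r \<le> 1 / q" using K r q by simp
  have "1 / (q - q') = C q / \<Delta> + r"
    using eq r C0 \<Delta> q by (simp add: ennreal_plus[symmetric] del: ennreal_plus)
  then have e: "\<Delta> = C q * (q - q') + r * (\<Delta> * (q - q'))" using \<Delta> q by (simp add: field_simps)
  have "0 \<le> r * (\<Delta> * (q - q'))" using r \<Delta> q by (intro mult_nonneg_nonneg) auto
  then show "C q * (q - q') \<le> \<Phi> q - \<Phi> q'" using e unfolding \<Delta>_def[symmetric] by linarith
  have "r * (\<Delta> * (q - q')) \<le> (1 / q) * (\<Delta> * (q - q'))" using rq \<Delta> q by (intro mult_right_mono) auto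
  moreover have "\<Delta> * (1 - (q - q') / q) = \<Delta> - (1 / q) * (\<Delta> * (q - q'))" using q by (simp add: field_simps)
  ultimately show "(\<Phi> q - \<Phi> q') * (1 - (q - q') / q) \<le> C q * (q - q')"
    using e unfolding \<Delta>_def[symmetric] by linarith
qed

end

lemma mult_exp_le: assumes "0 < a" shows "t * exp (- (a * t)) \<le> 1 / (a::real)"
proof -
  have "a * t \<le> exp (a * t)" using exp_ge_add_one_self[of "a * t"] by linarith
  then have "a * t * exp (- (a * t)) \<le> exp (a * t) * exp (- (a * t))" by (intro mult_right_mono) auto
  also have "\<dots> = 1" by (simp add: exp_minus_inverse)
  finally show ?thesis using assms by (simp add: field_simps)
qed

section \<open>Discounted mean passage times and Kendall's identity\<close>

context spec_neg
begin

text \<open>This is the derivative in \<open>q\<close> of the Laplace transform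
  \<open>exp (- (x * \<Phi> q))\<close>, computed with difference quotients from the left;
  \<open>C_bounds\<close> identifies the limit of those of \<Phi>.\<close>

lemma T_mean:
  assumes q: "0 < q" and x: "0 \<le> x"
  shows "(\<E> w. ennreal (\<tau> x w * exp_time q (first_passage X x w))) =
    ennreal (x * C q * exp (- (x * \<Phi> q)))"
proof -
  let ?T = "first_passage X x"
  \<comment> \<open>Steps of at most \<open>q / 2\<close> keep \<open>q - h n\<close> away from 0,
    which yields the uniform bound \<open>2 / q\<close> for dominated convergence.\<close>
  define h where "h = (\<lambda>n::nat. q / (real n + 2))"
  have h: "0 < h n" "h n \<le> q / 2" for n using q by (auto simp: h_def field_simps)
  have hq: "h n < q" for n using h(2)[of n] q by linarith
  have hlim: "h \<longlonglongrightarrow> 0" unfolding h_def using q by real_asymp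
  define f where "f = (\<lambda>n w. (exp_time (q - h n) (?T w) - exp_time q (?T w)) / h n)"
  have pw: "(\<lambda>n. f n w) \<longlonglongrightarrow> real_of_ereal (?T w) * exp_time q (?T w)" for w
  proof (cases "?T w = \<infinity>")
    case False
    then obtain t where t: "?T w = ereal t" using first_passage_nonneg[of X x w] by (cases "?T w") auto
    have "((\<lambda>s. exp (- (s * t))) has_real_derivative (- t * exp (- (q * t)))) (at q)"
      by (auto intro!: derivative_eq_intros)
    then have "((\<lambda>d. (exp (- ((q + d) * t)) - exp (- (q * t))) / d) \<longlongrightarrow> - t * exp (- (q * t))) (at 0)"
      by (simp add: DERIV_def)
    moreover have "filterlim (\<lambda>n. - h n) (at 0) sequentially"
      using h(1) tendsto_minus[OF hlim] unfolding filterlim_at by (auto simp: less_imp_neq[symmetric])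
    ultimately have "(\<lambda>n. (exp (- ((q + - h n) * t)) - exp (- (q * t))) / (- h n)) \<longlonglongrightarrow> - t * exp (- (q * t))"
      by (rule filterlim_compose)
    from tendsto_minus[OF this] show ?thesis by (simp add: f_def t exp_time_def)
  qed (simp add: f_def exp_time_def)
  have bound: "\<bar>f n w\<bar> \<le> 2 / q" and f0: "0 \<le> f n w" for n w
  proof -
    have "0 \<le> f n w \<and> f n w \<le> 2 / q"
    proof (cases "?T w = \<infinity>")
      case False
      then obtain t where t: "?T w = ereal t" "0 \<le> t"
        using first_passage_nonneg[of X x w] by (cases "?T w") auto
      have e: "exp (- (q * t)) = exp (- ((q - h n) * t)) * exp (- (h n * t))" by (simp add: exp_add[symmetric] algebra_simps)
      have fe: "f n w = exp (- ((q - h n) * t)) * ((1 - exp (- (h n * t))) / h n)"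
        by (simp add: f_def t exp_time_def e algebra_simps diff_divide_distrib)
      have "0 \<le> (1 - exp (- (h n * t))) / h n" using h(1)[of n] t by simp
      then have "0 \<le> f n w" unfolding fe by (intro mult_nonneg_nonneg) auto
      moreover have "(1 - exp (- (h n * t))) / h n \<le> t"
        using exp_ge_add_one_self[of "- (h n * t)"] h(1)[of n] by (simp add: field_simps)
      then have "f n w \<le> exp (- ((q - h n) * t)) * t" unfolding fe by (intro mult_left_mono) auto
      moreover have "t * exp (- ((q - h n) * t)) \<le> 1 / (q - h n)" using hq[of n] by (intro mult_exp_le) auto
      moreover have "1 / (q - h n) \<le> 1 / (q / 2)" using h(2)[of n] q by (intro divide_left_mono) auto
      ultimately show ?thesis by (simp add: mult.commute)
    qed (use q in \<open>simp add: f_def exp_time_def\<close>)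
    then show "\<bar>f n w\<bar> \<le> 2 / q" "0 \<le> f n w" by auto
  qed
  have gm[measurable]: "(\<lambda>w. real_of_ereal (?T w) * exp_time q (?T w)) \<in> borel_measurable M" by measurable
  have fm[measurable]: "f n \<in> borel_measurable M" for n unfolding f_def by measurable
  have dc: "integrable M (\<lambda>w. real_of_ereal (?T w) * exp_time q (?T w))"
    "(\<lambda>n. \<integral>w. f n w \<partial>M) \<longlonglongrightarrow> (\<integral>w. real_of_ereal (?T w) * exp_time q (?T w) \<partial>M)"
    by (rule integrable_dominated_convergence[where w="\<lambda>_. 2 / q" and s=f]; use pw bound in auto)
      (rule integral_dominated_convergence[where w="\<lambda>_. 2 / q"]; use pw bound in auto)
  have If: "(\<integral>w. f n w \<partial>M) = (exp (- (x * \<Phi> (q - h n))) - exp (- (x * \<Phi> q))) / h n" for n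
    using laplace_T[of "q - h n" x] laplace_T[of q x] exp_time_integrable[of "q - h n" x] exp_time_integrable[of q x] hq[of n] q x
    by (simp add: f_def)
  define \<Delta> where "\<Delta> = (\<lambda>n. \<Phi> q - \<Phi> (q - h n))"
  have C\<Delta>: "C q * h n \<le> \<Delta> n" "\<Delta> n * (1 - h n / q) \<le> C q * h n" for n
    using C_bounds[of "q - h n" q] hq[of n] h(1)[of n] by (auto simp: \<Delta>_def)
  have r: "(\<lambda>n. \<Delta> n / h n) \<longlonglongrightarrow> C q"
  proof (rule tendsto_sandwich[of "\<lambda>_. C q" _ _ "\<lambda>n. C q / (1 - h n / q)"])
    show "\<forall>\<^sub>F n in sequentially. C q \<le> \<Delta> n / h n"
      using C\<Delta>(1) h(1) by (auto intro!: always_eventually simp: field_simps)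
    show "\<forall>\<^sub>F n in sequentially. \<Delta> n / h n \<le> C q / (1 - h n / q)"
    proof (intro always_eventually allI)
      fix n
      have "0 < 1 - h n / q" using hq[of n] q by (simp add: field_simps)
      then show "\<Delta> n / h n \<le> C q / (1 - h n / q)"
        using C\<Delta>(2)[of n] h(1)[of n] by (simp add: pos_le_divide_eq pos_divide_le_eq mult.commute)
    qed
    have "(\<lambda>n. C q / (1 - h n / q)) \<longlonglongrightarrow> C q / (1 - 0 / q)" using q by (intro tendsto_intros hlim) auto
    then show "(\<lambda>n. C q / (1 - h n / q)) \<longlonglongrightarrow> C q" by simp
  qed simp
  have \<Delta>0: "\<Delta> \<longlonglongrightarrow> 0"
  proof -
    have "(\<lambda>n. \<Delta> n / h n * h n) \<longlonglongrightarrow> C q * 0" by (intro tendsto_intros r hlim)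
    moreover have "\<Delta> n / h n * h n = \<Delta> n" for n using h(1)[of n] by simp
    ultimately show ?thesis by simp
  qed
  have "(\<lambda>n. (exp (x * \<Delta> n) - 1) / h n) \<longlonglongrightarrow> x * C q"
  proof (rule tendsto_sandwich[of "\<lambda>n. x * (\<Delta> n / h n)" _ _ "\<lambda>n. x * (\<Delta> n / h n) * exp (x * \<Delta> n)"])
    show "\<forall>\<^sub>F n in sequentially. x * (\<Delta> n / h n) \<le> (exp (x * \<Delta> n) - 1) / h n"
    proof (intro always_eventually allI)
      fix n
      have "x * \<Delta> n \<le> exp (x * \<Delta> n) - 1" using exp_ge_add_one_self[of "x * \<Delta> n"] by linarith
      then show "x * (\<Delta> n / h n) \<le> (exp (x * \<Delta> n) - 1) / h n"
        using divide_right_mono[of "x * \<Delta> n" "exp (x * \<Delta> n) - 1" "h n"] h(1)[of n] by simp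
    qed
    show "\<forall>\<^sub>F n in sequentially. (exp (x * \<Delta> n) - 1) / h n \<le> x * (\<Delta> n / h n) * exp (x * \<Delta> n)"
    proof (intro always_eventually allI)
      fix n
      have "(1 + - (x * \<Delta> n)) * exp (x * \<Delta> n) \<le> exp (- (x * \<Delta> n)) * exp (x * \<Delta> n)"
        using exp_ge_add_one_self[of "- (x * \<Delta> n)"] by (intro mult_right_mono) auto
      also have "\<dots> = 1" by (simp add: exp_add[symmetric])
      finally have "exp (x * \<Delta> n) - 1 \<le> x * \<Delta> n * exp (x * \<Delta> n)" by (simp add: algebra_simps)
      then show "(exp (x * \<Delta> n) - 1) / h n \<le> x * (\<Delta> n / h n) * exp (x * \<Delta> n)"
        using h(1)[of n] by (simp add: divide_right_mono)
    qed
    show "(\<lambda>n. x * (\<Delta> n / h n)) \<longlonglongrightarrow> x * C q" by (intro tendsto_intros r)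
    have "(\<lambda>n. x * (\<Delta> n / h n) * exp (x * \<Delta> n)) \<longlonglongrightarrow> x * C q * exp (x * 0)" by (intro tendsto_intros r \<Delta>0)
    then show "(\<lambda>n. x * (\<Delta> n / h n) * exp (x * \<Delta> n)) \<longlonglongrightarrow> x * C q" by simp
  qed
  then have "(\<lambda>n. exp (- (x * \<Phi> q)) * ((exp (x * \<Delta> n) - 1) / h n)) \<longlonglongrightarrow> exp (- (x * \<Phi> q)) * (x * C q)"
    by (intro tendsto_intros)
  moreover have "exp (- (x * \<Phi> q)) * ((exp (x * \<Delta> n) - 1) / h n) = (\<integral>w. f n w \<partial>M)" for n
    unfolding If by (simp add: \<Delta>_def right_diff_distrib exp_add[symmetric])
  ultimately have "(\<integral>w. real_of_ereal (?T w) * exp_time q (?T w) \<partial>M) = exp (- (x * \<Phi> q)) * (x * C q)"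
    using LIMSEQ_unique[OF dc(2)] by simp
  moreover have "(\<E> w. ennreal (real_of_ereal (?T w) * exp_time q (?T w))) =
    ennreal (\<integral>w. real_of_ereal (?T w) * exp_time q (?T w) \<partial>M)"
    using q by (intro nn_integral_eq_integral dc(1)) (auto simp: exp_time_bounds real_of_ereal_pos)
  ultimately show ?thesis by (simp add: ac_simps)
qed

text \<open>The weight time times \<open>exp (- time)\<close> cancels the factor
  \<open>1 / s\<close> of Kendall's identity and makes both measures finite. Their Laplace
  transforms at \<open>k\<close> agree: the resolvent density on one side and \<open>T_mean\<close>
  on the other both give the integral of \<open>x * C (k + 1) * exp (- (x * \<Phi> (k + 1)))\<close>
  over the nonnegative part of \<open>B\<close>.\<close>

lemma kendall_measure:
  fixes B :: "real set"
  assumes B[measurable]: "B \<in> sets borel"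
  defines "P \<equiv> distr (density LM (\<lambda>z. expm (fst z) * ind {0..} (fst z) *
      (ennreal (max 0 (X (max 0 (fst z)) (snd z))) * ind B (X (max 0 (fst z)) (snd z))))) borel fst"
    and "Q \<equiv> distr (density LM (\<lambda>z. ennreal (\<tau> (fst z) (snd z) * exp_time 1 (first_passage X (fst z) (snd z))) *
      (ind {0..} (fst z) * ind B (fst z)))) borel (\<lambda>z. \<tau> (fst z) (snd z))"
  shows "P = Q" "finite_measure P"
proof -
  let ?g = "\<lambda>x. ennreal (max 0 x) * ind B x"
  define N where "N = (\<lambda>q. \<integral>\<^sup>+x. ennreal (C q * exp (- (x * \<Phi> q))) * (?g x * ind {0..} x) \<partial>lborel)"
  have P: "(\<integral>\<^sup>+s. expm (real k * s) \<partial>P) = N (real k + 1)" for k :: nat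
  proof -
    have "(\<integral>\<^sup>+s. expm (real k * s) \<partial>P) =
      (\<integral>\<^sup>+z. expm (fst z) * ind {0..} (fst z) *
        (ennreal (max 0 (X (max 0 (fst z)) (snd z))) * ind B (X (max 0 (fst z)) (snd z))) * expm (real k * fst z) \<partial>LM)"
      unfolding P_def by (subst nn_integral_distr) (auto simp: nn_integral_density)
    also have "\<dots> = (\<L> t. (\<E> w. expm t * ind {0..} t * ?g (X (max 0 t) w) * expm (real k * t)))"
      using nn_integral_fst[of "\<lambda>z. expm (fst z) * ind {0..} (fst z) *
        (ennreal (max 0 (X (max 0 (fst z)) (snd z))) * ind B (X (max 0 (fst z)) (snd z))) * expm (real k * fst z)" lborel] by simp
    also have "\<dots> = (\<L> t. (\<E> w. expm ((real k + 1) * t) * ind {0..} t * (?g (X (max 0 t) w) * ind {0<..} (X (max 0 t) w))))"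
    proof (intro nn_integral_cong)
      fix t w
      have e: "expm t * expm (real k * t) = expm ((real k + 1) * t)"
        by (simp add: ennreal_mult[symmetric] exp_add[symmetric] algebra_simps)
      have g: "?g (X (max 0 t) w) * ind {0<..} (X (max 0 t) w) = ?g (X (max 0 t) w)"
        by (auto simp: max_def split: split_indicator)
      show "expm t * ind {0..} t * ?g (X (max 0 t) w) * expm (real k * t) =
        expm ((real k + 1) * t) * ind {0..} t * (?g (X (max 0 t) w) * ind {0<..} (X (max 0 t) w))"
        unfolding g e[symmetric] by (simp only: ac_simps)
    qed
    also have "\<dots> = N (real k + 1)" unfolding N_def by (rule resolvent_density) auto
    finally show ?thesis .
  qed
  have Q: "(\<integral>\<^sup>+s. expm (real k * s) \<partial>Q) = N (real k + 1)" for k :: nat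
  proof -
    have "(\<integral>\<^sup>+s. expm (real k * s) \<partial>Q) =
      (\<integral>\<^sup>+z. ennreal (\<tau> (fst z) (snd z) * exp_time 1 (first_passage X (fst z) (snd z))) *
        (ind {0..} (fst z) * ind B (fst z)) * expm (real k * \<tau> (fst z) (snd z)) \<partial>LM)"
      unfolding Q_def by (subst nn_integral_distr) (auto simp: nn_integral_density)
    also have "\<dots> = (\<L> x. (\<E> w. ennreal (\<tau> x w * exp_time 1 (first_passage X x w)) *
        (ind {0..} x * ind B x) * expm (real k * \<tau> x w)))"
      using nn_integral_fst[of "\<lambda>z. ennreal (\<tau> (fst z) (snd z) * exp_time 1 (first_passage X (fst z) (snd z))) *
        (ind {0..} (fst z) * ind B (fst z)) * expm (real k * \<tau> (fst z) (snd z))" lborel] by simp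
    also have "\<dots> = N (real k + 1)"
      unfolding N_def
    proof (rule nn_integral_cong)
      fix x
      have "(\<E> w. ennreal (\<tau> x w * exp_time 1 (first_passage X x w)) *
        (ind {0..} x * ind B x) * expm (real k * \<tau> x w)) =
        (\<E> w. (ind {0..} x * ind B x) * ennreal (\<tau> x w * exp_time (real k + 1) (first_passage X x w)))"
        by (intro nn_integral_cong) (auto simp: exp_time_def real_of_ereal_pos ennreal_mult[symmetric] exp_add[symmetric] algebra_simps split: split_indicator)
      also have "\<dots> = (ind {0..} x * ind B x) * (\<E> w. ennreal (\<tau> x w * exp_time (real k + 1) (first_passage X x w)))"
        by (intro nn_integral_cmult) measurable
      also have "\<dots> = ennreal (C (real k + 1) * exp (- (x * \<Phi> (real k + 1)))) * (?g x * ind {0..} x)"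
        using T_mean[of "real k + 1" x] C_nonneg[of "real k + 1"]
        by (auto simp: ennreal_mult[symmetric] max_def ac_simps split: split_indicator)
      finally show "(\<E> w. ennreal (\<tau> x w * exp_time 1 (first_passage X x w)) *
        (ind {0..} x * ind B x) * expm (real k * \<tau> x w)) =
        ennreal (C (real k + 1) * exp (- (x * \<Phi> (real k + 1)))) * (?g x * ind {0..} x)" .
    qed
    finally show ?thesis .
  qed
  have sP[measurable_cong]: "sets P = sets borel" and sQ[measurable_cong]: "sets Q = sets borel" by (simp_all add: P_def Q_def)
  have "N 1 \<le> (\<L> x. ennreal (C 1 * (2 / \<Phi> 1)) * (expm (x * (\<Phi> 1 / 2)) * ind {0..} x))"
    unfolding N_def
  proof (rule nn_integral_mono)
    fix x
    show "ennreal (C 1 * exp (- (x * \<Phi> 1))) * (?g x * ind {0..} x) \<le>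
      ennreal (C 1 * (2 / \<Phi> 1)) * (expm (x * (\<Phi> 1 / 2)) * ind {0..} x)"
    proof (cases "x \<in> B \<and> 0 \<le> x")
      case True
      \<comment> \<open>Half of the exponent absorbs the factor \<open>x\<close>, the other half
        keeps the integral finite.\<close>
      have "x * exp (- (\<Phi> 1 / 2 * x)) \<le> 1 / (\<Phi> 1 / 2)" using \<Phi>_pos[of 1] by (intro mult_exp_le) auto
      then have le: "C 1 * (x * exp (- (\<Phi> 1 / 2 * x))) * exp (- (x * (\<Phi> 1 / 2))) \<le> C 1 * (1 / (\<Phi> 1 / 2)) * exp (- (x * (\<Phi> 1 / 2)))"
        using C_nonneg[of 1] by (intro mult_right_mono mult_left_mono) auto
      have "- (\<Phi> 1 / 2 * x) + - (x * (\<Phi> 1 / 2)) = - (x * \<Phi> 1)" by (simp add: field_simps)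
      then have "exp (- (\<Phi> 1 / 2 * x)) * exp (- (x * (\<Phi> 1 / 2))) = exp (- (x * \<Phi> 1))" by (simp only: exp_add[symmetric])
      then have eq: "C 1 * exp (- (x * \<Phi> 1)) * x = C 1 * (x * exp (- (\<Phi> 1 / 2 * x))) * exp (- (x * (\<Phi> 1 / 2)))"
        by (simp only: ac_simps)
      have "C 1 * exp (- (x * \<Phi> 1)) * x \<le> C 1 * (2 / \<Phi> 1) * exp (- (x * (\<Phi> 1 / 2)))"
        unfolding eq using le by simp
      then show ?thesis using True C_nonneg[of 1] \<Phi>_pos[of 1] by (simp add: ennreal_mult[symmetric])
    qed (auto split: split_indicator)
  qed
  also have "\<dots> = ennreal (C 1 * (2 / \<Phi> 1)) * ennreal (1 / (\<Phi> 1 / 2))"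
    using nn_integral_exp_half_line[of "\<Phi> 1 / 2"] \<Phi>_pos[of 1] by (subst nn_integral_cmult) auto
  also have "\<dots> < \<top>" by (simp add: ennreal_mult_less_top)
  finally have N1: "N 1 < \<top>" .
  show fP: "finite_measure P"
  proof (rule finite_measureI)
    have "emeasure P (space P) = N 1" using P[of 0] by simp
    then show "emeasure P (space P) \<noteq> \<infinity>" using N1 by simp
  qed
  have fQ: "finite_measure Q"
  proof (rule finite_measureI)
    have "emeasure Q (space Q) = N 1" using Q[of 0] by simp
    then show "emeasure Q (space Q) \<noteq> \<infinity>" using N1 by simp
  qed
  show "P = Q"
  proof (rule finite_measure_eqI_laplace[OF fP sP _ fQ sQ])
    have "emeasure P {..<0} = (\<integral>\<^sup>+z. expm (fst z) * ind {0..} (fst z) *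
        (ennreal (max 0 (X (max 0 (fst z)) (snd z))) * ind B (X (max 0 (fst z)) (snd z))) * ind {..<0} (fst z) \<partial>LM)"
      unfolding P_def by (subst nn_integral_indicator[symmetric], simp, subst nn_integral_distr) (auto simp: nn_integral_density)
    also have "\<dots> = (\<integral>\<^sup>+z. 0 \<partial>((lborel :: real measure) \<Otimes>\<^sub>M M))" by (intro nn_integral_cong) (auto split: split_indicator)
    finally show "emeasure P {..<0} = 0" by simp
    have "emeasure Q {..<0} = (\<integral>\<^sup>+z. ennreal (\<tau> (fst z) (snd z) * exp_time 1 (first_passage X (fst z) (snd z))) *
        (ind {0..} (fst z) * ind B (fst z)) * ind {..<0} (\<tau> (fst z) (snd z)) \<partial>LM)"
      unfolding Q_def by (subst nn_integral_indicator[symmetric], simp, subst nn_integral_distr) (auto simp: nn_integral_density)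
    also have "\<dots> = (\<integral>\<^sup>+z. 0 \<partial>((lborel :: real measure) \<Otimes>\<^sub>M M))" by (intro nn_integral_cong) (auto simp: real_of_ereal_pos not_less split: split_indicator)
    finally show "emeasure Q {..<0} = 0" by simp
    fix k :: nat
    have "(\<integral>s. exp (- (real k * s)) \<partial>P) = enn2real (N (real k + 1))"
      by (subst integral_eq_nn_integral) (auto simp: P)
    also have "\<dots> = (\<integral>s. exp (- (real k * s)) \<partial>Q)"
      by (subst integral_eq_nn_integral) (auto simp: Q)
    finally show "(\<integral>s. exp (- (real k * s)) \<partial>P) = (\<integral>s. exp (- (real k * s)) \<partial>Q)" .
  qed
qed

end

lemma finite_measure_pair_eqI:
  fixes P Q :: "(real \<times> real) measure"
  assumes P: "finite_measure P" "sets P = sets borel2" and Q: "sets Q = sets borel2"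
    and e: "\<And>A B. A \<in> sets borel ==> B \<in> sets borel ==> emeasure P (A \<times> B) = emeasure Q (A \<times> B)"
  shows "P = Q"
proof (rule measure_eqI_generator_eq[where E="{a \<times> b | a b. a \<in> sets borel \<and> b \<in> sets borel}" and \<Omega>=UNIV and A="\<lambda>_. UNIV"])
  interpret finite_measure P by fact
  show "Int_stable {a \<times> b | a b. a \<in> sets (borel :: real measure) \<and> b \<in> sets (borel :: real measure)}"
    by (rule Int_stable_pair_measure_generator)
  show "sets P = sigma_sets UNIV {a \<times> b | a b. a \<in> sets borel \<and> b \<in> sets borel}"
    "sets Q = sigma_sets UNIV {a \<times> b | a b. a \<in> sets borel \<and> b \<in> sets borel}"
    unfolding P Q sets_pair_measure by auto
  have "(UNIV :: (real \<times> real) set) \<in> {a \<times> b | a b. a \<in> sets (borel :: real measure) \<and> b \<in> sets (borel :: real measure)}"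
    by (rule CollectI, rule exI[of _ UNIV], rule exI[of _ UNIV]) simp
  then show "range (\<lambda>_::nat. UNIV) \<subseteq> {a \<times> b | a b. a \<in> sets (borel :: real measure) \<and> b \<in> sets (borel :: real measure)}"
    by auto
  show "emeasure P UNIV \<noteq> \<infinity>" for i :: nat by simp
qed (use e in auto)

context spec_neg
begin

text \<open>The weights of \<open>kendall_measure\<close> are removed by testing with
  \<open>h\<close> times \<open>exp s / s\<close>; the division is legitimate because positive
  levels have positive passage times.\<close>

theorem kendall:
  fixes h :: "real \<times> real => ennreal"
  assumes h[measurable]: "h \<in> borel_measurable borel2"
  shows "(\<L> s. (\<E> w. ennreal (max 0 (X (max 0 s) w) / s) * h (s, X (max 0 s) w) * ind {0<..} s)) =
    (\<L> x. (\<E> w. h (\<tau> x w, x) * hit x w))"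
proof -
  let ?X = "\<lambda>z. X (max 0 (fst z)) (snd z)" and ?T = "\<lambda>z. first_passage X (fst z) (snd z)"
  define w1 where "w1 = (\<lambda>z. expm (fst z) * ind {0..} (fst z) * ennreal (max 0 (?X z)))"
  define w2 where "w2 = (\<lambda>z. ennreal (real_of_ereal (?T z) * exp_time 1 (?T z)) * ind {0..} (fst z))"
  have [measurable]: "w1 \<in> borel_measurable LM" "w2 \<in> borel_measurable LM"
    unfolding w1_def w2_def by measurable
  define J1 where "J1 = distr (density LM w1) borel2 (\<lambda>z. (fst z, ?X z))"
  define J2 where "J2 = distr (density LM w2) borel2 (\<lambda>z. (real_of_ereal (?T z), fst z))"
  have J1: "(\<integral>\<^sup>+y. f y \<partial>J1) = (\<L> t. (\<E> w. w1 (t, w) * f (t, X (max 0 t) w)))"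
    if [measurable]: "f \<in> borel_measurable borel2" for f
  proof -
    have "(\<integral>\<^sup>+y. f y \<partial>J1) = (\<integral>\<^sup>+z. w1 z * f (fst z, ?X z) \<partial>LM)"
      unfolding J1_def by (subst nn_integral_distr) (auto simp: nn_integral_density)
    then show ?thesis using nn_integral_fst[of "\<lambda>z. w1 z * f (fst z, ?X z)" lborel] by simp
  qed
  have J2: "(\<integral>\<^sup>+y. f y \<partial>J2) = (\<L> x. (\<E> w. w2 (x, w) * f (\<tau> x w, x)))"
    if [measurable]: "f \<in> borel_measurable borel2" for f
  proof -
    have "(\<integral>\<^sup>+y. f y \<partial>J2) = (\<integral>\<^sup>+z. w2 z * f (real_of_ereal (?T z), fst z) \<partial>LM)"
      unfolding J2_def by (subst nn_integral_distr) (auto simp: nn_integral_density)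
    then show ?thesis using nn_integral_fst[of "\<lambda>z. w2 z * f (real_of_ereal (?T z), fst z)" lborel] by simp
  qed
  have rect1: "emeasure J1 (A \<times> B) = emeasure (distr (density LM (\<lambda>z. expm (fst z) * ind {0..} (fst z) *
      (ennreal (max 0 (?X z)) * ind B (?X z)))) borel fst) A" if [measurable]: "A \<in> sets borel" "B \<in> sets borel" for A B
  proof -
    have "emeasure J1 (A \<times> B) = (\<integral>\<^sup>+z. w1 z * ind (A \<times> B) (fst z, ?X z) \<partial>LM)"
      unfolding J1_def by (subst nn_integral_indicator[symmetric], simp, subst nn_integral_distr) (auto simp: nn_integral_density)
    also have "\<dots> = (\<integral>\<^sup>+z. expm (fst z) * ind {0..} (fst z) *
      (ennreal (max 0 (?X z)) * ind B (?X z)) * ind A (fst z) \<partial>LM)"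
      by (intro nn_integral_cong) (auto simp: w1_def split: split_indicator)
    also have "\<dots> = emeasure (distr (density LM (\<lambda>z. expm (fst z) * ind {0..} (fst z) *
      (ennreal (max 0 (?X z)) * ind B (?X z)))) borel fst) A"
      by (subst nn_integral_indicator[symmetric], simp, subst nn_integral_distr) (auto simp: nn_integral_density)
    finally show ?thesis .
  qed
  have rect2: "emeasure J2 (A \<times> B) = emeasure (distr (density LM (\<lambda>z. ennreal (real_of_ereal (?T z) * exp_time 1 (?T z)) *
      (ind {0..} (fst z) * ind B (fst z)))) borel (\<lambda>z. real_of_ereal (?T z))) A" if [measurable]: "A \<in> sets borel" "B \<in> sets borel" for A B
  proof -
    have "emeasure J2 (A \<times> B) = (\<integral>\<^sup>+z. w2 z * ind (A \<times> B) (real_of_ereal (?T z), fst z) \<partial>LM)"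
      unfolding J2_def by (subst nn_integral_indicator[symmetric], simp, subst nn_integral_distr) (auto simp: nn_integral_density)
    also have "\<dots> = (\<integral>\<^sup>+z. ennreal (real_of_ereal (?T z) * exp_time 1 (?T z)) *
      (ind {0..} (fst z) * ind B (fst z)) * ind A (real_of_ereal (?T z)) \<partial>LM)"
      by (intro nn_integral_cong) (auto simp: w2_def split: split_indicator)
    also have "\<dots> = emeasure (distr (density LM (\<lambda>z. ennreal (real_of_ereal (?T z) * exp_time 1 (?T z)) *
      (ind {0..} (fst z) * ind B (fst z)))) borel (\<lambda>z. real_of_ereal (?T z))) A"
      by (subst nn_integral_indicator[symmetric], simp, subst nn_integral_distr) (auto simp: nn_integral_density)
    finally show ?thesis .
  qed
  have "J1 = J2"
  proof (rule finite_measure_pair_eqI)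
    show "sets J1 = sets borel2" "sets J2 = sets borel2" by (simp_all add: J1_def J2_def)
    show "emeasure J1 (A \<times> B) = emeasure J2 (A \<times> B)" if "A \<in> sets borel" "B \<in> sets borel" for A B
      using rect1[OF that] rect2[OF that] kendall_measure(1)[OF that(2)] by simp
    show "finite_measure J1"
    proof (rule finite_measureI)
      have borel_UNIV: "(UNIV :: real set) \<in> sets borel" by simp
      have sp: "space J1 = UNIV \<times> UNIV" by (simp add: J1_def space_pair_measure)
      have "emeasure J1 (space J1) < \<infinity>"
        unfolding sp rect1[of UNIV UNIV, OF borel_UNIV borel_UNIV]
        using finite_measure.emeasure_finite[OF kendall_measure(2)[of UNIV]] by (simp add: less_top)
      then show "emeasure J1 (space J1) \<noteq> \<infinity>" by simp
    qed
  qed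
  define f where "f = (\<lambda>y. h y * (ennreal (exp (fst y) / fst y) * ind {0<..} (fst y)))"
  have fm[measurable]: "f \<in> borel_measurable borel2" unfolding f_def by measurable
  have "(\<L> s. (\<E> w. ennreal (max 0 (X (max 0 s) w) / s) * h (s, X (max 0 s) w) * ind {0<..} s)) = (\<integral>\<^sup>+y. f y \<partial>J1)"
    unfolding J1[OF fm]
  proof (intro nn_integral_cong)
    fix s w
    show "ennreal (max 0 (X (max 0 s) w) / s) * h (s, X (max 0 s) w) * ind {0<..} s = w1 (s, w) * f (s, X (max 0 s) w)"
    proof (cases "0 < s")
      case True
      have gen: "expm s * ennreal m * ennreal (exp s / s) = ennreal (m / s)" if "0 \<le> m" for m
        using True that by (simp add: ennreal_mult[symmetric] exp_minus field_simps)
      have "w1 (s, w) * f (s, X (max 0 s) w) =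
          (expm s * ennreal (max 0 (X s w)) * ennreal (exp s / s)) * h (s, X s w)"
        using True by (simp add: w1_def f_def max_absorb2 ac_simps)
      also have "\<dots> = ennreal (max 0 (X s w) / s) * h (s, X s w)" by (subst gen) auto
      finally show ?thesis using True by (simp add: max_absorb2)
    qed (simp add: f_def)
  qed
  also have "(\<integral>\<^sup>+y. f y \<partial>J1) = (\<integral>\<^sup>+y. f y \<partial>J2)" by (simp add: \<open>J1 = J2\<close>)
  also have "\<dots> = (\<L> x. (\<E> w. h (\<tau> x w, x) * hit x w))"
    unfolding J2[OF fm]
  proof (rule nn_integral_cong_AE)
    show "AE x in lborel. (\<E> w. w2 (x, w) * f (\<tau> x w, x)) =
      (\<E> w. h (\<tau> x w, x) * hit x w)"
      using AE_lborel_singleton[of 0]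
    proof eventually_elim
      case (elim x)
      show ?case
      proof (rule nn_integral_cong_AE)
        show "AE w in M. w2 (x, w) * f (\<tau> x w, x) =
          h (\<tau> x w, x) * hit x w"
          using snp_AE
        proof eventually_elim
          case (elim w)
          show ?case
          proof (cases "0 < x \<and> first_passage X x w < \<infinity>")
            case True
            then obtain t where t: "first_passage X x w = ereal t" "0 < t"
              using T_pos[OF elim, of x] by (cases "first_passage X x w") auto
            have "ennreal (t * exp (- t)) * ennreal (exp t / t) = 1"
              using t by (simp add: ennreal_mult[symmetric] exp_minus field_simps)
            then show ?thesis using True t by (simp add: w2_def f_def exp_time_def) (metis mult.left_commute mult.right_neutral)
          next
            case False
            then show ?thesis using \<open>x \<noteq> 0\<close> by (auto simp: w2_def exp_time_def split: split_indicator)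
          qed
        qed
      qed
    qed
  qed
  finally show ?thesis .
qed

end

section \<open>The excursion straddling a fixed time\<close>

lemma mono_ennreal_measurable:
  fixes f :: "real => ennreal"
  assumes "mono f" shows "f \<in> borel_measurable borel"
proof (rule borel_measurableI_greater)
  fix y
  have "y < f a'" if "y < f a" "a \<le> a'" for a a' using monoD[OF assms that(2)] that(1) by (rule less_le_trans[rotated])
  then have "is_interval {a. y < f a}" unfolding is_interval_1 by blast
  then show "{x \<in> space borel. y < f x} \<in> sets borel"
    using real_interval_borel_measurable by simp
qed

lemma ereal_INF_greater:
  assumes "z < (INF t\<in>{t. P t}. ereal t)" "P t" shows "z < ereal t"
proof -
  have "(INF t\<in>{t. P t}. ereal t) \<le> ereal t" using assms(2) by (intro INF_lower) auto
  then show ?thesis using assms(1) by simp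
qed

lemma before_next_zero:
  assumes "s < u" "ereal u < next_zero X s w" shows "running_sup X u w \<noteq> X u w"
  using ereal_INF_greater[OF assms(2)[unfolded next_zero_def], of u] assms(1) by auto

lemma last_sup_time_le:
  assumes c: "cadlag (\<lambda>t. X t w)" and t: "0 \<le> t"
  shows "last_sup_time X t w \<in> {0..t}"
    "\<And>u. 0 \<le> u ==> u \<le> t ==> X u w = running_sup X t w \<or> 0 < u \<and> left_lim (\<lambda>u. X u w) u = running_sup X t w ==> u \<le> last_sup_time X t w"
proof -
  let ?G = "{s. 0 \<le> s \<and> s \<le> t \<and> (X s w = running_sup X t w \<or> 0 < s \<and> left_lim (\<lambda>u. X u w) s = running_sup X t w)}"
  obtain u where u: "0 \<le> u" "u \<le> t" "X u w = running_sup X t w \<or> 0 < u \<and> left_lim (\<lambda>u. X u w) u = running_sup X t w"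
    using cadlag_sup_attained[OF c order_refl t] unfolding running_sup_def by metis
  have b: "bdd_above ?G" by (auto intro: bdd_aboveI[of _ t])
  have up: "v \<le> last_sup_time X t w" if "v \<in> ?G" for v
    unfolding last_sup_time_def using that b by (rule cSup_upper)
  have "last_sup_time X t w \<le> t" unfolding last_sup_time_def using u by (intro cSup_least) auto
  then show "last_sup_time X t w \<in> {0..t}" using up[of u] u by auto
  show "u \<le> last_sup_time X t w" if "0 \<le> u" "u \<le> t" "X u w = running_sup X t w \<or> 0 < u \<and> left_lim (\<lambda>u. X u w) u = running_sup X t w" for u
    using that by (intro up) auto
qed

text \<open>Since every supremum is attained in the cadlag sense, no attainment on
  \<open>[r, t]\<close> means a strictly smaller supremum there; rational \<open>r\<close> makes the
  event measurable.\<close>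

lemma last_sup_time_less_iff:
  assumes c: "cadlag (\<lambda>t. X t w)" and s: "0 < s" "s \<le> t"
  shows "last_sup_time X t w < s \<longleftrightarrow> (\<exists>r\<in>\<rat>. 0 \<le> r \<and> r < s \<and> (SUP v\<in>{r..t}. X v w) < running_sup X t w)"
proof
  have t: "0 \<le> t" using s by simp
  note g = last_sup_time_le[of X w, OF c t]
  assume l: "last_sup_time X t w < s"
  obtain r where r: "r \<in> \<rat>" "last_sup_time X t w < r" "r < s" using Rats_dense_in_real[OF l] by auto
  have r0: "0 \<le> r" "r \<le> t" using r g(1) s by auto
  obtain u where u: "r \<le> u" "u \<le> t" "X u w = (SUP v\<in>{r..t}. X v w) \<or> r < u \<and> left_lim (\<lambda>u. X u w) u = (SUP v\<in>{r..t}. X v w)"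
    using cadlag_sup_attained[OF c r0] by metis
  have "(SUP v\<in>{r..t}. X v w) \<noteq> running_sup X t w"
  proof
    assume "(SUP v\<in>{r..t}. X v w) = running_sup X t w"
    then have "u \<le> last_sup_time X t w" using u r0 by (intro g(2)) auto
    then show False using u r by simp
  qed
  moreover have "(SUP v\<in>{r..t}. X v w) \<le> running_sup X t w"
    unfolding running_sup_def using cadlag_bdd_above[OF c, of 0 t] r0 by (intro cSUP_subset_mono) auto
  ultimately show "\<exists>r\<in>\<rat>. 0 \<le> r \<and> r < s \<and> (SUP v\<in>{r..t}. X v w) < running_sup X t w"
    using r r0 by (intro bexI[of _ r]) auto
next
  assume "\<exists>r\<in>\<rat>. 0 \<le> r \<and> r < s \<and> (SUP v\<in>{r..t}. X v w) < running_sup X t w"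
  then obtain r where r: "0 \<le> r" "r < s" "(SUP v\<in>{r..t}. X v w) < running_sup X t w" by auto
  have t: "0 \<le> t" using s by simp
  have up: "X v w \<le> (SUP v\<in>{r..t}. X v w)" if "r \<le> v" "v \<le> t" for v
    using cadlag_bdd_above[OF c r(1), of t] that by (intro cSUP_upper) auto
  have le: "u \<le> r" if u: "0 \<le> u" "u \<le> t" "X u w = running_sup X t w \<or> 0 < u \<and> left_lim (\<lambda>u. X u w) u = running_sup X t w" for u
  proof (rule ccontr)
    assume "\<not> u \<le> r"
    then have ru: "r < u" by simp
    have "left_lim (\<lambda>u. X u w) u \<le> (SUP v\<in>{r..t}. X v w)"
      by (rule cadlag_le_left_lim[OF c r(1) ru]) (use up u in auto)
    then show False using u r up[of u] ru by auto
  qed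
  obtain u where u: "0 \<le> u" "u \<le> t" "X u w = running_sup X t w \<or> 0 < u \<and> left_lim (\<lambda>u. X u w) u = running_sup X t w"
    using cadlag_sup_attained[OF c order_refl t] unfolding running_sup_def by metis
  have "last_sup_time X t w \<le> r" unfolding last_sup_time_def using u le by (intro cSup_least) auto
  then show "last_sup_time X t w < s" using r by simp
qed

context good_path
begin

text \<open>The left end \<open>s\<close> need not be a zero: otherwise zeros accumulate at it from
  the left and the supremum is attained as a left limit. A later attainment would, by
  \<open>exceed\<close>, push the supremum up inside the excursion, where it is constant.\<close>

lemma excursion_straddling:
  assumes t: "0 \<le> t" and s: "s \<in> left_endpoints X w" "s \<le> t" "ereal t < next_zero X s w"
  shows "0 < s" "S s = S t" "last_sup_time X t w = s" "s < t ==> reflected X t w \<noteq> 0"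
proof -
  obtain v where v: "t < v" "ereal v < next_zero X s w"
    using ereal_dense2[OF s(3)] by auto
  have nz: "u \<notin> zero_set X w" if "s < u" "u \<le> v" for u
  proof -
    have "ereal u < next_zero X s w" using v(2) that by (auto intro: le_less_trans[of "ereal u" "ereal v"])
    then show ?thesis using before_next_zero[of s u X w] that by (auto simp: zero_set_def)
  qed
  have sc: "s \<in> closure (zero_set X w)" using s(1) by (simp add: left_endpoints_def)
  have "closure (zero_set X w) \<subseteq> {0..}" by (rule closure_minimal) (auto simp: zero_set_def)
  then have s0: "0 \<le> s" using sc by auto
  have const: "S u = S s" if u: "s \<le> u" "u \<le> v" for u
  proof -
    have "S s = S v" using nz s v s0 by (intro constant_off_zeros) auto
    then show ?thesis using S_mono[of s u] S_mono[of u v] u s0 by auto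
  qed
  show spos: "0 < s"
  proof (rule ccontr)
    assume "\<not> 0 < s"
    then have "s = 0" using s0 by simp
    then show False using const[of v] v S_pos[of v] s by auto
  qed
  show Sst: "S s = S t" using const[of t] s v by simp
  show "reflected X t w \<noteq> 0" if "s < t" using nz[of t] that v t by (auto simp: zero_set_def reflected_def)
  have attained: "X s w = S s \<or> left_lim (\<lambda>u. X u w) s = S s"
  proof (cases "s \<in> zero_set X w")
    case False
    have "left_lim (\<lambda>u. X u w) s \<le> S s"
      by (rule cadlag_le_left_lim[OF cad order_refl spos]) (use X_le_S in auto)
    moreover have "\<not> left_lim (\<lambda>u. X u w) s < S s"
    proof
      assume "left_lim (\<lambda>u. X u w) s < S s"
      then obtain m where m: "left_lim (\<lambda>u. X u w) s < m" "m < S s" using dense by blast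
      have "\<forall>\<^sub>F u in at_left s. X u w < m" using cadlag_left[OF cad spos] m by (auto intro: order_tendstoD)
      then obtain a where a: "a < s" "\<And>u. a < u ==> u < s ==> X u w < m" by (auto simp: eventually_at_left_field)
      obtain b where b: "0 \<le> b" "b < s" "m < X b w" using less_S_rat_iff[OF spos, of m] m by auto
      define \<delta> where "\<delta> = min (min (s - a) (s - b)) (v - s)"
      have "\<delta> > 0" using a b v s by (auto simp: \<delta>_def)
      then obtain z where z: "z \<in> zero_set X w" "dist z s < \<delta>" using sc closure_approachable by blast
      have "z \<noteq> s" using z False by auto
      moreover have "\<not> s < z" using nz[of z] z by (auto simp: dist_real_def \<delta>_def)
      ultimately have zs: "z < s" by simp
      then have "X z w < m" "b \<le> z" using a(2)[of z] z by (auto simp: dist_real_def \<delta>_def)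
      moreover have "S z = X z w" using z by (simp add: zero_set_def)
      ultimately show False using X_le_S[of b z] b by simp
    qed
    ultimately show ?thesis by simp
  qed (simp add: zero_set_def)
  show "last_sup_time X t w = s" unfolding last_sup_time_def
  proof (rule cSup_eq_maximum)
    show "s \<in> {s. 0 \<le> s \<and> s \<le> t \<and> (X s w = S t \<or> 0 < s \<and> left_lim (\<lambda>u. X u w) s = S t)}"
      using attained spos s Sst by auto
    fix u assume u: "u \<in> {s. 0 \<le> s \<and> s \<le> t \<and> (X s w = S t \<or> 0 < s \<and> left_lim (\<lambda>u. X u w) s = S t)}"
    show "u \<le> s"
    proof (rule ccontr)
      assume "\<not> u \<le> s"
      then have su: "s < u" by simp
      have "X u w \<noteq> S t" using nz[of u] const[of u] su u v Sst by (auto simp: zero_set_def)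
      then have ll: "left_lim (\<lambda>u. X u w) u = S t" using u by auto
      \<comment> \<open>\<open>exceed\<close> starts from rational times; inside the excursion the
        past maximum at such a time is already \<open>S s\<close>.\<close>
      obtain r where r: "r \<in> \<rat>" "s < r" "r < u" using Rats_dense_in_real[OF su] by auto
      have "left_lim (\<lambda>u. X u w) u \<le> (SUP ww\<in>{r..u}. X ww w)"
        using r s0 cadlag_bdd_above[OF cad, of r u]
        by (intro cadlag_le_left_lim[OF cad _ r(3)] cSUP_upper) auto
      then have "S r < S v" using r s0 u v ll const[of r] Sst by (intro exceed[of r u v]) auto
      then show False using const[of r] const[of v] r u v s by auto
    qed
  qed
qed

lemma excursion_exists:
  assumes t: "0 \<le> t" and R: "reflected X t w \<noteq> 0"
  obtains s where "s \<in> left_endpoints X w" "s \<le> t" "ereal t < next_zero X s w"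
proof -
  define Zt where "Zt = zero_set X w \<inter> {0..t}"
  have Z0: "0 \<in> Zt" using t X0 by (auto simp: Zt_def zero_set_def)
  have b: "bdd_above Zt" by (auto simp: Zt_def intro: bdd_aboveI[of _ t])
  define s where "s = Sup Zt"
  have "s \<in> closure Zt" unfolding s_def using Z0 b by (intro closure_contains_Sup) auto
  then have sc: "s \<in> closure (zero_set X w)" using closure_mono[of Zt "zero_set X w"] by (auto simp: Zt_def)
  have st: "s \<le> t" unfolding s_def using Z0 by (intro cSup_least) (auto simp: Zt_def)
  have s0: "0 \<le> s" unfolding s_def using Z0 b by (intro cSup_upper) auto
  have "0 < reflected X t w" using R X_le_S[of t t] t by (auto simp: reflected_def)
  moreover have "((\<lambda>u. reflected X u w) \<longlongrightarrow> reflected X t w) (at_right t)"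
    unfolding reflected_def using t by (intro tendsto_diff running_sup_right_continuous cadlag_right cad)
  ultimately have "\<forall>\<^sub>F u in at_right t. 0 < reflected X u w" by (auto intro: order_tendstoD)
  then obtain e where e: "t < e" "\<And>u. t < u ==> u < e ==> 0 < reflected X u w" by (auto simp: eventually_at_right_field)
  have "ereal e \<le> next_zero X s w" unfolding next_zero_def
  proof (rule INF_greatest)
    fix u assume "u \<in> {u. s < u \<and> S u = X u w}"
    then have u: "s < u" "u \<in> zero_set X w" using s0 by (auto simp: zero_set_def)
    have "t < u"
    proof (rule ccontr)
      assume "\<not> t < u"
      then have "u \<in> Zt" using u s0 by (auto simp: Zt_def)
      then have "u \<le> s" unfolding s_def using b by (rule cSup_upper)
      then show False using u by simp
    qed
    then show "ereal e \<le> ereal u" using e(2)[of u] u by (cases "u < e") (auto simp: zero_set_def reflected_def)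
  qed
  then have "ereal t < next_zero X s w" using e(1) by (auto intro: less_le_trans[of _ "ereal e"])
  moreover from this have "ereal s < next_zero X s w" using st by (auto intro: le_less_trans[of _ "ereal t"])
  ultimately show thesis using that[of s] sc st by (auto simp: left_endpoints_def)
qed

lemma lifetime_excursion_at:
  assumes s: "s \<in> left_endpoints X w" and t: "s \<le> t"
  shows "ereal (t - s) < lifetime (excursion_at X s w) \<longleftrightarrow> ereal t < next_zero X s w"
proof -
  have ns: "ereal s < next_zero X s w" using s by (simp add: left_endpoints_def)
  have z: "excursion_at X s w u = 0 \<longleftrightarrow> next_zero X s w \<le> ereal (s + u)" if u: "0 < u" for u
  proof (cases "ereal (s + u) < next_zero X s w")
    case True
    then show ?thesis using before_next_zero[of s "s + u" X w] u by (auto simp: excursion_at_def reflected_def)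
  qed (use u in \<open>auto simp: excursion_at_def not_less\<close>)
  have "{u. 0 < u \<and> excursion_at X s w u = 0} = {u. 0 < u \<and> next_zero X s w \<le> ereal (s + u)}" using z by auto
  then have lt: "lifetime (excursion_at X s w) = (INF u\<in>{u. 0 < u \<and> next_zero X s w \<le> ereal (s + u)}. ereal u)"
    by (simp add: lifetime_def)
  show ?thesis
  proof
    assume "ereal (t - s) < lifetime (excursion_at X s w)"
    then have *: "ereal (t - s) < (INF u\<in>{u. 0 < u \<and> next_zero X s w \<le> ereal (s + u)}. ereal u)" unfolding lt .
    show "ereal t < next_zero X s w"
    proof (rule ccontr)
      assume n: "\<not> ereal t < next_zero X s w"
      then have "s < t" using ns by (auto simp: not_less dest: less_le_trans)
      then show False using ereal_INF_greater[OF *, of "t - s"] n by (auto simp: not_less)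
    qed
  next
    assume "ereal t < next_zero X s w"
    then obtain v where v: "t < v" "ereal v < next_zero X s w" using ereal_dense2[of "ereal t"] by auto
    have "ereal (v - s) \<le> lifetime (excursion_at X s w)" unfolding lt
    proof (rule INF_greatest)
      fix u assume "u \<in> {u. 0 < u \<and> next_zero X s w \<le> ereal (s + u)}"
      then have "ereal v < ereal (s + u)" using less_le_trans[OF v(2)] by blast
      then show "ereal (v - s) \<le> ereal u" by simp
    qed
    then show "ereal (t - s) < lifetime (excursion_at X s w)" using v by (auto intro: less_le_trans[of _ "ereal (v - s)"])
  qed
qed

end

lemma lifetime_gt_iff:
  assumes "\<epsilon> \<in> excursions" "0 < r" shows "ereal r < lifetime \<epsilon> \<longleftrightarrow> \<epsilon> r \<noteq> 0"
  using assms by (cases "ereal r < lifetime \<epsilon>") (auto simp: excursions_def not_less)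

text \<open>An excursion stays at 0 after its lifetime, so survival beyond \<open>r > 0\<close> is
  read off the single coordinate \<open>r\<close>.\<close>

lemma lifetime_measurable [measurable]: "lifetime \<in> borel_measurable excursion_space"
proof (rule borel_measurableI_greater)
  have sp: "space excursion_space = excursions"
    by (auto simp: excursion_space_def space_restrict_space space_PiM excursions_def extensional_def PiE_def)
  have comp: "(\<lambda>\<epsilon>. \<epsilon> r) \<in> borel_measurable excursion_space" if "0 \<le> r" for r :: real
    unfolding excursion_space_def using that by (intro measurable_restrict_space1 measurable_component_singleton) auto
  fix y :: ereal
  show "{\<epsilon> \<in> space excursion_space. y < lifetime \<epsilon>} \<in> sets excursion_space"
  proof (cases y)
    case (real r)
    show ?thesis
    proof (cases "0 < r")
      case True
      have "{\<epsilon> \<in> space excursion_space. y < lifetime \<epsilon>} = {\<epsilon> \<in> space excursion_space. \<epsilon> r \<noteq> 0}"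
        using lifetime_gt_iff[OF _ True] real by (auto simp: sp)
      also have "\<dots> \<in> sets excursion_space"
      proof -
        have [measurable]: "(\<lambda>\<epsilon>. \<epsilon> r) \<in> borel_measurable excursion_space" using comp[of r] True by simp
        show ?thesis by measurable
      qed
      finally show ?thesis .
    next
      case False
      have "{\<epsilon> \<in> space excursion_space. y < lifetime \<epsilon>} = space excursion_space"
        using False real by (auto simp: sp excursions_def intro: le_less_trans[of "ereal r" 0])
      then show ?thesis by simp
    qed
  next
    case MInf
    have "{\<epsilon> \<in> space excursion_space. y < lifetime \<epsilon>} = space excursion_space"
      unfolding MInf by (auto simp: sp excursions_def intro: less_trans[of "-\<infinity>" 0])
    then show ?thesis by simp
  qed simp
qed

text \<open>Only one excursion can straddle \<open>t\<close>, because its left end must be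
  \<open>last_sup_time X t w\<close>. Excluding \<open>t\<close> as a left end rules out an
  excursion that starts at \<open>t\<close> while the reflected process is 0 there.\<close>

lemma (in good_path) excursion_sum:
  fixes H :: "real => ennreal"
  assumes t: "0 \<le> t" "t \<notin> left_endpoints X w"
  shows "(\<integral>\<^sup>+s. H s * ind {0<..t} s * ind {\<epsilon>. ereal (t - s) < lifetime \<epsilon>} (excursion_at X s w) \<partial>count_space (left_endpoints X w)) =
    (if reflected X t w = 0 then 0 else H (last_sup_time X t w))" (is "?l = _")
proof (cases "reflected X t w = 0")
  case True
  have "\<not> ereal (t - s) < lifetime (excursion_at X s w)" if "s \<in> left_endpoints X w" "s \<le> t" for s
    using excursion_straddling(4)[OF t(1) that] lifetime_excursion_at[OF that] True t(2) that by (cases "s = t") auto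
  then have "?l = (\<integral>\<^sup>+s. 0 \<partial>count_space (left_endpoints X w))"
    by (intro nn_integral_cong) (auto simp: indicator_def)
  then show ?thesis using True by simp
next
  case False
  obtain s where s: "s \<in> left_endpoints X w" "s \<le> t" "ereal t < next_zero X s w"
    using excursion_exists[OF t(1) False] by blast
  note g = excursion_straddling[OF t(1) s]
  have un: "s' = s" if "s' \<in> left_endpoints X w" "s' \<le> t" "ereal (t - s') < lifetime (excursion_at X s' w)" for s'
    using excursion_straddling(3)[OF t(1) that(1,2)] that(3) lifetime_excursion_at[OF that(1,2)] g(3) by simp
  have lt: "ereal (t - s) < lifetime (excursion_at X s w)" using lifetime_excursion_at[OF s(1,2)] s(3) by simp
  have "?l = (\<integral>\<^sup>+s'. H s * ind {s} s' \<partial>count_space (left_endpoints X w))"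
  proof (intro nn_integral_cong)
    fix s' assume "s' \<in> space (count_space (left_endpoints X w))"
    then have s': "s' \<in> left_endpoints X w" by simp
    show "H s' * ind {0<..t} s' * ind {\<epsilon>. ereal (t - s') < lifetime \<epsilon>} (excursion_at X s' w) = H s * ind {s} s'"
    proof (cases "s' = s")
      case True
      then show ?thesis using g(1) s(2) lt by simp
    next
      case False
      then have "\<not> (s' \<le> t \<and> ereal (t - s') < lifetime (excursion_at X s' w))" using un[OF s'] by blast
      then show ?thesis using False by (auto simp: indicator_def)
    qed
  qed
  also have "\<dots> = H s * emeasure (count_space (left_endpoints X w)) {s}"
    using s by (intro nn_integral_cmult_indicator) auto
  also have "\<dots> = H s" using s by (subst emeasure_count_space_finite) auto
  finally show ?thesis using False g(3) by simp
qed

section \<open>Measurability, predictability and behaviour at a fixed time\<close>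

context spec_neg
begin

lemma SUP_measurable:
  assumes r: "0 \<le> r" "r \<le> t" shows "(\<lambda>w. SUP s\<in>{r..t}. X s w) \<in> borel_measurable M"
proof (rule borel_measurableI_greater)
  fix y
  have "{w \<in> space M. y < (SUP s\<in>{r..t}. X s w)} =
      {w \<in> space M. y < X t w} \<union> (\<Union>s\<in>{s. s \<in> \<rat> \<and> r \<le> s \<and> s < t}. {w \<in> space M. y < X s w})"
    using less_SUP_rat_iff[of X _ r t y, OF cadlag_X r] by auto
  also have "\<dots> \<in> sets M"
  proof (intro sets.Un sets.countable_UN''[OF countable_rat_set])
    show "{w \<in> space M. y < X t w} \<in> sets M"
      using X_measurable[of t] r by (intro borel_measurable_less) auto
    show "{w \<in> space M. y < X s w} \<in> sets M" if "s \<in> {s. s \<in> \<rat> \<and> r \<le> s \<and> s < t}" for s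
      using X_measurable[of s] r that by (intro borel_measurable_less) auto
  qed
  finally show "{w \<in> space M. y < (SUP s\<in>{r..t}. X s w)} \<in> sets M" .
qed

lemma last_sup_time_measurable [measurable]:
  assumes t: "0 \<le> t" shows "last_sup_time X t \<in> borel_measurable M"
proof (rule borel_measurableI_less)
  fix y
  have g: "last_sup_time X t w \<in> {0..t}" if "w \<in> space M" for w
    by (rule last_sup_time_le(1)[of X w, OF cadlag_X[OF that] t])
  consider "y \<le> 0" | "0 < y" "y \<le> t" | "t < y" by linarith
  then show "{w \<in> space M. last_sup_time X t w < y} \<in> sets M"
  proof cases
    case 1
    then have "{w \<in> space M. last_sup_time X t w < y} = {}" using g by force
    then show ?thesis by (simp only: sets.empty_sets)
  next
    case 2
    have "{w \<in> space M. last_sup_time X t w < y} =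
       (\<Union>r\<in>{r. r \<in> \<rat> \<and> 0 \<le> r \<and> r < y}. {w \<in> space M. (SUP v\<in>{r..t}. X v w) < running_sup X t w})"
      using last_sup_time_less_iff[of X _ y t, OF cadlag_X 2] by auto
    also have "\<dots> \<in> sets M"
    proof (intro sets.countable_UN''[OF countable_rat_set])
      show "{w \<in> space M. (SUP v\<in>{r..t}. X v w) < running_sup X t w} \<in> sets M" if "r \<in> {r. r \<in> \<rat> \<and> 0 \<le> r \<and> r < y}" for r
        using SUP_measurable[of r t] running_sup_measurable[OF t] that 2 by (intro borel_measurable_less) auto
    qed
    finally show ?thesis .
  next
    case 3
    then have "{w \<in> space M. last_sup_time X t w < y} = space M" using g by force
    then show ?thesis by (simp only: sets.top)
  qed
qed

lemma space_predictable: "space (predictable M X) = {0..} \<times> space M"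
  by (simp add: predictable_def space_measure_of_conv)

lemma predictable_rectangle:
  assumes s: "0 \<le> s" and A: "A \<in> sets (filt M X s)"
  shows "{s<..} \<times> A \<in> sets (predictable M X)"
proof -
  have sub: "A \<subseteq> space M" if "A \<in> sets (filt M X s)" for A s using sets.sets_into_space[OF that] by simp
  let ?G = "{{0} \<times> A | A. A \<in> sets (filt M X 0)} \<union> {{s<..t} \<times> A | s t A. 0 \<le> s \<and> s < t \<and> A \<in> sets (filt M X s)}"
  have G: "?G \<subseteq> Pow ({0..} \<times> space M)"
  proof
    fix Q assume "Q \<in> ?G"
    then consider A where "Q = {0} \<times> A" "A \<in> sets (filt M X 0)"
      | u v A where "Q = {u<..v} \<times> A" "0 \<le> u" "A \<in> sets (filt M X u)" by blast
    then show "Q \<in> Pow ({0..} \<times> space M)"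
    proof cases
      case 1
      then show ?thesis using sub[of A 0] by auto
    next
      case 2
      then show ?thesis using sub[of A u] by auto
    qed
  qed
  have "{s<..s + (real k + 1)} \<times> A \<in> sets (predictable M X)" for k :: nat
  proof -
    have "{s<..s + (real k + 1)} \<times> A \<in> ?G"
      by (intro UnI2 CollectI exI[of _ s] exI[of _ "s + (real k + 1)"] exI[of _ A] conjI refl s A) linarith
    then show ?thesis unfolding predictable_def sets_measure_of[OF G] by (rule sigma_sets.Basic)
  qed
  then have "(\<Union>k::nat. {s<..s + (real k + 1)} \<times> A) \<in> sets (predictable M X)" by auto
  moreover have "\<exists>k::nat. u \<le> s + (real k + 1)" for u
  proof -
    obtain k :: nat where "u - s \<le> real k" using real_arch_simple by blast
    then show ?thesis by (intro exI[of _ k]) linarith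
  qed
  then have "(\<Union>k::nat. {s<..s + (real k + 1)} \<times> A) = {s<..} \<times> A" by force
  ultimately show ?thesis by simp
qed

lemma fst_predictable [measurable]: "fst \<in> borel_measurable (predictable M X)"
proof (rule borel_measurableI_greater)
  fix y :: real
  show "{z \<in> space (predictable M X). y < fst z} \<in> sets (predictable M X)"
  proof (cases "0 \<le> y")
    case True
    then have "{z \<in> space (predictable M X). y < fst z} = {y<..} \<times> space M" by (auto simp: space_predictable)
    then show ?thesis using predictable_rectangle[OF True, of "space M"] sets.top[of "filt M X y"] by simp
  next
    case False
    then have "{z \<in> space (predictable M X). y < fst z} = space (predictable M X)" by (auto simp: space_predictable)
    then show ?thesis by simp
  qed
qed

text \<open>A predictable integrand may use only times strictly before \<open>s\<close>; without
  positive jumps these already determine the supremum at \<open>s\<close>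
  (\<open>pre_sup_eq\<close>).\<close>

definition pre_sup :: "real \<times> 'a => ereal" where
  "pre_sup z = (SUP u\<in>{u. u \<in> \<rat> \<and> 0 \<le> u \<and> u < fst z}. ereal (X u (snd z)))"

lemma pre_sup_predictable [measurable]: "pre_sup \<in> borel_measurable (predictable M X)"
proof (rule borel_measurableI_greater)
  fix y :: ereal
  have "{z \<in> space (predictable M X). y < pre_sup z} =
      (\<Union>u\<in>{u. u \<in> \<rat> \<and> 0 \<le> u}. {u<..} \<times> {w \<in> space M. y < ereal (X u w)})"
    by (auto simp: space_predictable pre_sup_def less_SUP_iff)
  also have "\<dots> \<in> sets (predictable M X)"
  proof (intro sets.countable_UN''[OF countable_rat_set] predictable_rectangle)
    fix u :: real assume u: "u \<in> {u. u \<in> \<rat> \<and> 0 \<le> u}"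
    then show "0 \<le> u" by simp
    have "{w \<in> space (filt M X u). y < ereal (X u w)} \<in> sets (filt M X u)"
      using X_filt[of u u] u by (intro borel_measurable_less borel_measurable_const borel_measurable_ereal) auto
    then show "{w \<in> space M. y < ereal (X u w)} \<in> sets (filt M X u)" by simp
  qed
  finally show "{z \<in> space (predictable M X). y < pre_sup z} \<in> sets (predictable M X)" .
qed

lemma pre_sup_eq:
  assumes "snp X w" "0 < s" shows "pre_sup (s, w) = ereal (running_sup X s w)"
proof -
  interpret snp X w by fact
  show ?thesis
  proof (rule antisym)
    show "pre_sup (s, w) \<le> ereal (S s)" unfolding pre_sup_def using X_le_S by (intro SUP_least) auto
    show "ereal (S s) \<le> pre_sup (s, w)" unfolding pre_sup_def le_SUP_iff
    proof (intro allI impI)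
      fix y assume y: "y < ereal (S s)"
      obtain z where z: "y < ereal z" "z < S s" using ereal_dense2[OF y] by auto
      obtain u where "u \<in> \<rat>" "0 \<le> u" "u < s" "z < X u w" using less_S_rat_iff[OF assms(2), of z] z by auto
      then show "\<exists>i\<in>{u. u \<in> \<rat> \<and> 0 \<le> u \<and> u < fst (s, w)}. y < ereal (X i (snd (s, w)))"
        using z by (intro bexI[of _ u]) (auto intro: less_trans[of y "ereal z"])
    qed
  qed
qed

text \<open>The jump at \<open>t\<close> is the limit of increments over \<open>[t - h, t]\<close>.
  By stationarity these have the law of increments over \<open>[0, h]\<close>, which vanish in the
  limit by right continuity at 0.\<close>

lemma left_cont_AE:
  assumes t: "0 < t" shows "AE w in M. left_lim (\<lambda>s. X s w) t = X t w"
proof -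
  define h where "h k = t / (real k + 2)" for k :: nat
  have h: "0 < h k" "h k < t" for k using t by (auto simp: h_def field_simps intro: add_pos_nonneg)
  have h0: "h \<longlonglongrightarrow> 0" unfolding h_def by real_asymp
  define D where "D w = X t w - left_lim (\<lambda>s. X s w) t" for w
  have lim: "(\<lambda>k. X t w - X (t - h k) w) \<longlonglongrightarrow> D w" if "w \<in> space M" for w
  proof -
    have "filterlim (\<lambda>k. t - h k) (at_left t) sequentially" unfolding filterlim_at
      using h less_imp_neq[OF h(1)] tendsto_diff[OF tendsto_const h0, of t] by (auto intro: always_eventually)
    then show ?thesis unfolding D_def
      by (intro tendsto_diff tendsto_const filterlim_compose[OF cadlag_left[OF cadlag_X[OF that] t]])
  qed
  have lim0: "(\<lambda>k. X (h k) w - X 0 w) \<longlonglongrightarrow> 0" if "w \<in> space M" for w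
  proof -
    have "filterlim h (at_right 0) sequentially" unfolding filterlim_at using h less_imp_neq[OF h(1)] h0 by (auto intro: always_eventually)
    then have "(\<lambda>k. X (h k) w) \<longlonglongrightarrow> X 0 w"
      by (rule filterlim_compose[OF cadlag_right[OF cadlag_X[OF that], of 0, simplified]])
    from tendsto_diff[OF this tendsto_const, of "X 0 w"] show ?thesis by simp
  qed
  have m [measurable]: "X (h k) \<in> borel_measurable M" "X (t - h k) \<in> borel_measurable M" "X t \<in> borel_measurable M" "X 0 \<in> borel_measurable M" for k
    using h[of k] t by (auto intro!: X_measurable)
  have Dm [measurable]: "D \<in> borel_measurable M" by (rule borel_measurable_LIMSEQ_real[OF lim]) auto
  let ?f = "\<lambda>x::real. min 1 \<bar>x\<bar>"
  have "(\<lambda>k. \<integral>w. ?f (X t w - X (t - h k) w) \<partial>M) \<longlonglongrightarrow> (\<integral>w. ?f (D w) \<partial>M)"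
    by (rule integral_dominated_convergence[where w="\<lambda>_. 1"])
       (auto intro!: tendsto_min tendsto_const tendsto_rabs lim AE_I2)
  moreover have "(\<lambda>k. \<integral>w. ?f (X (h k) w - X 0 w) \<partial>M) \<longlonglongrightarrow> (\<integral>w. ?f 0 \<partial>M)"
  proof (rule integral_dominated_convergence[where w="\<lambda>_. 1"])
    show "AE w in M. (\<lambda>k. ?f (X (h k) w - X 0 w)) \<longlonglongrightarrow> ?f 0"
      by (intro AE_I2 tendsto_min tendsto_const tendsto_rabs lim0)
  qed auto
  moreover have "(\<integral>w. ?f (X t w - X (t - h k) w) \<partial>M) = (\<integral>w. ?f (X (h k) w - X 0 w) \<partial>M)" for k
  proof -
    have "0 \<le> t - h k" "0 \<le> h k" using h[of k] by auto
    then have "distr M borel (\<lambda>w. X ((t - h k) + h k) w - X (t - h k) w) = distr M borel (\<lambda>w. X (h k) w - X 0 w)"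
      using levy unfolding levy_process_def stationary_increments_def by blast
    then have e: "distr M borel (\<lambda>w. X t w - X (t - h k) w) = distr M borel (\<lambda>w. X (h k) w - X 0 w)" by simp
    have "(\<integral>w. ?f (X t w - X (t - h k) w) \<partial>M) = (\<integral>x. ?f x \<partial>distr M borel (\<lambda>w. X t w - X (t - h k) w))"
      by (subst integral_distr) auto
    also have "\<dots> = (\<integral>w. ?f (X (h k) w - X 0 w) \<partial>M)" unfolding e by (subst integral_distr) auto
    finally show ?thesis .
  qed
  ultimately have "(\<integral>w. ?f (D w) \<partial>M) = 0" using LIMSEQ_unique by fastforce
  moreover have "integrable M (\<lambda>w. ?f (D w))" by (rule integrable_const_bound[where B=1]) auto
  ultimately have "AE w in M. ?f (D w) = 0" by (subst (asm) integral_nonneg_eq_0_iff_AE) auto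
  then show ?thesis by eventually_elim (auto simp: D_def min_def split: if_splits)
qed

text \<open>If \<open>X\<close> is at its supremum at \<open>t\<close>, the no-flat property with
  \<open>r = u = t\<close> forbids an excursion to start there. If not, the absence of a jump at
  \<open>t\<close> keeps the reflected process positive just before \<open>t\<close>, so zeros
  cannot accumulate from the left.\<close>

lemma not_left_endpoint_AE:
  assumes t: "0 < t" shows "AE w in M. t \<notin> left_endpoints X w"
proof -
  have "AE w in M. \<forall>k::nat. \<not> ((SUP s\<in>{t..t}. X s w) = running_sup X t w \<and> (SUP s\<in>{t..t + 1 / real (Suc k)}. X s w) = running_sup X t w)"
    unfolding AE_all_countable using t by (intro allI no_flat_AE) auto
  then show ?thesis using left_cont_AE[OF t] good_AE
  proof eventually_elim
    case (elim w)
    interpret good_path X w by fact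
    show ?case
    proof
      assume l: "t \<in> left_endpoints X w"
      then have tc: "t \<in> closure (zero_set X w)" and tn: "ereal t < next_zero X t w" by (auto simp: left_endpoints_def)
      obtain ww where ww: "t < ww" "ereal ww < next_zero X t w" using ereal_dense2[OF tn] by auto
      have nz: "u \<notin> zero_set X w" if "t < u" "u \<le> ww" for u
      proof -
        have "ereal u < next_zero X t w" using ww(2) that by (auto intro: le_less_trans[of "ereal u" "ereal ww"])
        then show ?thesis using before_next_zero[of t u X w] that by (auto simp: zero_set_def)
      qed
      show False
      proof (cases "X t w = S t")
        case True
        obtain k where k: "1 / real (Suc k) < ww - t" using ww nat_approx_posE[of "ww - t"] by (auto simp: inverse_eq_divide)
        let ?v = "t + 1 / real (Suc k)"
        have "S t = S ?v" using nz k t by (intro constant_off_zeros) auto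
        moreover have "(SUP s\<in>{t..?v}. X s w) \<le> S ?v" using t X_le_S[of _ ?v] by (intro cSUP_least) auto
        moreover have "X t w \<le> (SUP s\<in>{t..?v}. X s w)" using t cadlag_bdd_above[OF cad, of t ?v] by (intro cSUP_upper) auto
        ultimately show False using elim(1)[rule_format, of k] True by auto
      next
        case False
        have "X t w \<le> S t" using X_le_S[of t t] t by simp
        then obtain m where m: "X t w < m" "m < S t" using False dense[of "X t w" "S t"] by auto
        have "\<forall>\<^sub>F u in at_left t. X u w < m" using cadlag_left[OF cad t] elim(2) m by (auto intro: order_tendstoD)
        then obtain a where a: "a < t" "\<And>u. a < u ==> u < t ==> X u w < m" by (auto simp: eventually_at_left_field)
        obtain b where b: "0 \<le> b" "b < t" "m < X b w" using less_S_rat_iff[OF t, of m] m by auto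
        define \<delta> where "\<delta> = min (min (t - a) (t - b)) (ww - t)"
        have "\<delta> > 0" using a b ww by (auto simp: \<delta>_def)
        then obtain z where z: "z \<in> zero_set X w" "dist z t < \<delta>" using tc closure_approachable by blast
        have "z \<noteq> t" using z False by (auto simp: zero_set_def)
        moreover have "\<not> t < z" using nz[of z] z by (auto simp: dist_real_def \<delta>_def)
        ultimately have zs: "z < t" by simp
        then have "X z w < m" "b \<le> z" using a(2)[of z] z by (auto simp: dist_real_def \<delta>_def)
        moreover have "S z = X z w" using z by (simp add: zero_set_def)
        ultimately show False using X_le_S[of b z] b by simp
      qed
    qed
  qed
qed

end

lemma lifetime_tail_measurable:
  assumes n[measurable_cong]: "sets n = sets excursion_space"
  shows "lifetime_tail n \<in> borel_measurable borel"
proof -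
  have "(\<lambda>r. lifetime_tail n (- r)) \<in> borel_measurable borel"
    unfolding lifetime_tail_def by (intro mono_ennreal_measurable monoI emeasure_mono) (auto intro: le_less_trans[rotated])
  from measurable_compose[OF borel_measurable_uminus[OF measurable_ident] this] show ?thesis by simp
qed

section \<open>Compensation formula at a fixed time\<close>

context spec_neg
begin

lemma at_sup_last_time:
  assumes "w \<in> space M" "0 \<le> t" "reflected X t w = 0"
  shows "last_sup_time X t w = t" "running_sup X t w = X t w"
proof -
  show e: "running_sup X t w = X t w" using assms by (simp add: reflected_def)
  note g = last_sup_time_le[of X w, OF cadlag_X[OF assms(1)] assms(2)]
  show "last_sup_time X t w = t" using g(1) g(2)[of t] e assms(2) by auto
qed

text \<open>By \<open>local_time_eq\<close> the Stieltjes measure grows like \<open>\<Phi> 1\<close>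
  times the supremum, and at the passage time of \<open>x\<close> the supremum equals
  \<open>x\<close>.\<close>

lemma compensation_path:
  assumes L: "sup_local_time M X L" and n[measurable_cong]: "sets n = sets excursion_space"
    and A[measurable]: "A \<in> sets borel2" and t: "0 < t"
  shows "AE w in M. (\<integral>\<^sup>+s\<in>{0..}. ind A (s, real_of_ereal (pre_sup (s, w))) * ind {0<..t} s * lifetime_tail n (t - s) \<partial>stieltjes L w) =
    (\<L> x. ennreal (\<Phi> 1) * (ind A (\<tau> x w, x) * ind {0<..t} (\<tau> x w) *
        lifetime_tail n (t - \<tau> x w) * ind {x. 0 \<le> x \<and> first_passage X x w < \<infinity>} x))"
  using good_AE local_time_eq[OF L] AE_space
proof eventually_elim
  case (elim w)
  interpret good_path X w by fact
  have c: "continuous_on {0..} (\<lambda>t. L t w)" and m: "mono_on {0..} (\<lambda>t. L t w)"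
    using L elim(3) by (auto simp: sup_local_time_def)
  note st = stieltjes_properties[of L w, OF c m]
  have [measurable_cong]: "sets (stieltjes L w) = sets borel" by (rule st(1))
  have [measurable]: "(\<lambda>s. S (max 0 s)) \<in> borel_measurable borel"
    using measurable_compose[OF measurable_Pair[OF measurable_ident measurable_const[OF elim(3)]] running_sup_joint_measurable] by simp
  note [measurable] = lifetime_tail_measurable[OF n]
  let ?f = "\<lambda>s. ind A (s, S (max 0 s)) * ind {0<..t} s * lifetime_tail n (t - s)"
  have "(\<integral>\<^sup>+s\<in>{0..}. ind A (s, real_of_ereal (pre_sup (s, w))) * ind {0<..t} s * lifetime_tail n (t - s) \<partial>stieltjes L w) =
      (\<integral>\<^sup>+s. ?f s \<partial>stieltjes L w)"
    using pre_sup_eq[OF snp_axioms] by (intro nn_integral_cong) (auto simp: indicator_def)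
  also have "\<dots> = (\<L> x. ennreal (\<Phi> 1) * (?f (real_of_ereal (T x)) * ind {x. 0 \<le> x \<and> T x < \<infinity>} x))"
  proof (rule path_change_of_variable[OF st(1) st(3)])
    show "0 \<le> \<Phi> 1" using \<Phi>_pos[of 1] by simp
    show "emeasure (stieltjes L w) {a<..b} = ennreal (\<Phi> 1 * (S b - S a))" if "0 \<le> a" "a \<le> b" for a b
      using st(2)[OF that] elim(2) that by (simp add: right_diff_distrib)
    show "(\<lambda>x. T x) \<in> borel_measurable borel" by (rule first_passage_level_measurable[OF elim(3)])
    show "?f \<in> borel_measurable borel" by measurable
  qed
  also have "\<dots> = (\<L> x. ennreal (\<Phi> 1) * (ind A (real_of_ereal (T x), x) * ind {0<..t} (real_of_ereal (T x)) *
        lifetime_tail n (t - real_of_ereal (T x)) * ind {x. 0 \<le> x \<and> T x < \<infinity>} x))"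
  proof (intro nn_integral_cong)
    fix x
    show "ennreal (\<Phi> 1) * (?f (real_of_ereal (T x)) * ind {x. 0 \<le> x \<and> T x < \<infinity>} x) =
      ennreal (\<Phi> 1) * (ind A (real_of_ereal (T x), x) * ind {0<..t} (real_of_ereal (T x)) *
        lifetime_tail n (t - real_of_ereal (T x)) * ind {x. 0 \<le> x \<and> T x < \<infinity>} x)"
    proof (cases "0 \<le> x \<and> T x < \<infinity>")
      case True
      then obtain r where r: "T x = ereal r" using first_passage_nonneg[of X x w] by (cases "T x") auto
      then have "S (max 0 r) = x" using T_value[of x r] True by (simp add: max_absorb2)
      then show ?thesis using r by simp
    qed simp
  qed
  finally show ?case .
qed

text \<open>\<open>F\<close> charges only the excursion straddling \<open>t\<close>, during which
  the supremum keeps the value it had at the start, so \<open>pre_sup\<close> supplies the level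
  predictably. Paths at their supremum at \<open>t\<close> have no such excursion and form the
  second term.\<close>

theorem compensation:
  assumes L: "sup_local_time M X L" and n: "excursion_measure M X L n"
    and A[measurable]: "A \<in> sets borel2" and t: "0 < t"
  shows "emeasure (sup_law M X t) A =
    (\<L> x. (\<E> w. passage_density n A t x w)) +
    (\<E> w. ind A (t, X t w) * ind {0} (reflected X t w))" (is "_ = ?I + ?J")
proof -
  have ns[measurable_cong]: "sets n = sets excursion_space" using n by (simp add: excursion_measure_def)
  note [measurable] = lifetime_tail_measurable[OF ns]
  have t0: "0 \<le> t" using t by simp
  note [measurable] = last_sup_time_measurable[OF t0] running_sup_measurable[OF t0] reflected_measurable[OF t0] X_measurable[OF t0]
  define F :: "(real \<times> 'a) \<times> (real => real) => ennreal" where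
    "F = (\<lambda>z. ind A (fst (fst z), real_of_ereal (pre_sup (fst z))) * ind {0<..t} (fst (fst z)) *
      ind {\<epsilon>. ereal (t - fst (fst z)) < lifetime \<epsilon>} (snd z))"
  have Fm: "F \<in> borel_measurable (predictable M X \<Otimes>\<^sub>M excursion_space)"
  proof -
    have "(\<lambda>z. ind A (fst (fst z), real_of_ereal (pre_sup (fst z))) * ind {0<..t} (fst (fst z)) *
      ind {z. ereal (t - fst (fst z)) < lifetime (snd z)} z :: ennreal) \<in> borel_measurable (predictable M X \<Otimes>\<^sub>M excursion_space)"
      by measurable
    then show ?thesis by (simp add: F_def indicator_def)
  qed
  have AE1: "AE w in M. (\<integral>\<^sup>+s. F ((s, w), excursion_at X s w) \<partial>count_space (left_endpoints X w)) =
      ind A (last_sup_time X t w, running_sup X t w) * ind (- {0}) (reflected X t w)"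
    using good_AE not_left_endpoint_AE[OF t] AE_space
  proof eventually_elim
    case (elim w)
    interpret good_path X w by fact
    define H :: "real => ennreal" where "H s = ind A (s, S t)" for s
    have "(\<integral>\<^sup>+s. F ((s, w), excursion_at X s w) \<partial>count_space (left_endpoints X w)) =
      (\<integral>\<^sup>+s. H s * ind {0<..t} s * ind {\<epsilon>. ereal (t - s) < lifetime \<epsilon>} (excursion_at X s w) \<partial>count_space (left_endpoints X w))"
    proof (intro nn_integral_cong)
      fix s assume "s \<in> space (count_space (left_endpoints X w))"
      then have s: "s \<in> left_endpoints X w" by simp
      show "F ((s, w), excursion_at X s w) = H s * ind {0<..t} s * ind {\<epsilon>. ereal (t - s) < lifetime \<epsilon>} (excursion_at X s w)"
      proof (cases "0 < s \<and> s \<le> t \<and> ereal (t - s) < lifetime (excursion_at X s w)")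
        case True
        then have "S s = S t" using excursion_straddling(2)[OF t0 s] lifetime_excursion_at[OF s, of t] by simp
        then show ?thesis using pre_sup_eq[OF snp_axioms, of s] True by (simp add: F_def H_def)
      next
        case False
        then show ?thesis by (auto simp: F_def indicator_def)
      qed
    qed
    also have "\<dots> = (if reflected X t w = 0 then 0 else H (last_sup_time X t w))"
      by (rule excursion_sum[OF t0 elim(2)])
    finally show ?case by (simp add: H_def)
  qed
  have "emeasure (sup_law M X t) A = (\<E> w. ind A (last_sup_time X t w, running_sup X t w))"
    unfolding sup_law_def by (subst nn_integral_indicator[symmetric], simp, subst nn_integral_distr) auto
  also have "\<dots> = (\<E> w. ind A (last_sup_time X t w, running_sup X t w) * ind (- {0}) (reflected X t w) +
      ind A (t, X t w) * ind {0} (reflected X t w))"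
    using at_sup_last_time[OF _ t0] by (intro nn_integral_cong) (auto simp: indicator_def)
  also have "\<dots> = (\<E> w. ind A (last_sup_time X t w, running_sup X t w) * ind (- {0}) (reflected X t w)) + ?J"
    by (rule nn_integral_add) measurable
  also have "(\<E> w. ind A (last_sup_time X t w, running_sup X t w) * ind (- {0}) (reflected X t w)) =
      (\<E> w. (\<integral>\<^sup>+s. F ((s, w), excursion_at X s w) \<partial>count_space (left_endpoints X w)))"
    using AE1 by (intro nn_integral_cong_AE) auto
  also have "\<dots> = (\<E> w. (\<integral>\<^sup>+s\<in>{0..}. (\<integral>\<^sup>+\<epsilon>. F ((s, w), \<epsilon>) \<partial>n) \<partial>stieltjes L w))"
    using n Fm unfolding excursion_measure_def by blast
  also have "\<dots> = (\<E> w. (\<integral>\<^sup>+s\<in>{0..}. ind A (s, real_of_ereal (pre_sup (s, w))) * ind {0<..t} s * lifetime_tail n (t - s) \<partial>stieltjes L w))"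
  proof (intro nn_integral_cong arg_cong2[where f="(*)"] refl)
    fix w s
    have "{\<epsilon> \<in> space n. ereal (t - s) < lifetime \<epsilon>} \<in> sets n" by measurable
    moreover have "(\<integral>\<^sup>+\<epsilon>. F ((s, w), \<epsilon>) \<partial>n) = (\<integral>\<^sup>+\<epsilon>. (ind A (s, real_of_ereal (pre_sup (s, w))) * ind {0<..t} s) *
        ind {\<epsilon> \<in> space n. ereal (t - s) < lifetime \<epsilon>} \<epsilon> \<partial>n)"
      by (intro nn_integral_cong) (auto simp: F_def indicator_def)
    ultimately show "(\<integral>\<^sup>+\<epsilon>. F ((s, w), \<epsilon>) \<partial>n) = ind A (s, real_of_ereal (pre_sup (s, w))) * ind {0<..t} s * lifetime_tail n (t - s)"
      by (simp add: nn_integral_cmult_indicator lifetime_tail_def)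
  qed
  also have "\<dots> = (\<E> w. (\<L> x. ennreal (\<Phi> 1) * (ind A (\<tau> x w, x) * ind {0<..t} (\<tau> x w) *
        lifetime_tail n (t - \<tau> x w) * ind {x. 0 \<le> x \<and> first_passage X x w < \<infinity>} x)))"
    by (rule nn_integral_cong_AE[OF compensation_path[OF L ns A t]])
  also have "\<dots> = (\<E> w. (\<L> x. passage_density n A t x w))"
    by (intro nn_integral_cong) (auto simp: indicator_def)
  also have "\<dots> = ?I"
  proof -
    interpret pair_sigma_finite lborel M by unfold_locales
    let ?g = "\<lambda>z. ennreal (\<Phi> 1) * (ind A (\<tau> (fst z) (snd z), fst z) * ind {0<..t} (\<tau> (fst z) (snd z)) *
        lifetime_tail n (t - \<tau> (fst z) (snd z)) * (ind {0..} (fst z) * ind {z. first_passage X (fst z) (snd z) < \<infinity>} z))"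
    have gm: "?g \<in> borel_measurable LM" by measurable
    have "(\<E> w. (\<L> x. ?g (x, w))) = (\<L> x. (\<E> w. ?g (x, w)))"
      by (rule Fubini[OF gm])
    then show ?thesis by (simp add: indicator_def)
  qed
  finally show ?thesis .
qed

end

section \<open>Time spent at the supremum\<close>

lemma dyadic_grid_le:
  fixes f :: "real => real"
  assumes t: "0 < t" and r: "\<And>u. 0 \<le> u ==> u < t ==> (f \<longlongrightarrow> f u) (at_right u)"
    and g: "\<And>m k. k \<le> (2::nat) ^ m ==> f (t * real k / 2 ^ m) \<le> y" and u: "0 \<le> u" "u \<le> t"
  shows "f u \<le> y"
proof (cases "u = t")
  case True
  then show ?thesis using g[of 1 0] by simp
next
  case False
  define v where "v = u / t"
  have v: "0 \<le> v" "v < 1" "u = t * v" using u t False by (auto simp: v_def)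
  have "filterlim (\<lambda>m. t * dyadic_above m v) (at_right u) sequentially"
    unfolding filterlim_at v(3)
  proof
    show "(\<lambda>m. t * dyadic_above m v) \<longlonglongrightarrow> t * v"
      using dyadic_above_tendsto[of v] by (intro tendsto_mult tendsto_const) (auto simp: filterlim_at)
    show "\<forall>\<^sub>F m in sequentially. t * dyadic_above m v \<in> {t * v<..} \<and> t * dyadic_above m v \<noteq> t * v"
    proof (intro always_eventually allI)
      fix m
      have lt: "t * v < t * dyadic_above m v" using t dyadic_above(1)[of v m] by (rule mult_strict_left_mono[rotated])
      show "t * dyadic_above m v \<in> {t * v<..} \<and> t * dyadic_above m v \<noteq> t * v"
        using lt less_imp_neq[OF lt, symmetric] unfolding greaterThan_iff by (rule conjI)
    qed
  qed
  then have lim: "(\<lambda>m. f (t * dyadic_above m v)) \<longlonglongrightarrow> f u"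
    by (rule filterlim_compose[rotated]) (use r[of u] u False in simp)
  have "f (t * dyadic_above m v) \<le> y" for m
  proof -
    have "2 ^ m * v < 2 ^ m * 1" using v by (intro mult_strict_left_mono) auto
    then have "\<lfloor>2 ^ m * v\<rfloor> < 2 ^ m" by (simp add: floor_less_iff)
    moreover have "0 \<le> \<lfloor>2 ^ m * v\<rfloor>" using v by simp
    ultimately have k: "nat (\<lfloor>2 ^ m * v\<rfloor> + 1) \<le> 2 ^ m" "real (nat (\<lfloor>2 ^ m * v\<rfloor> + 1)) = of_int \<lfloor>2 ^ m * v\<rfloor> + 1"
      by (auto simp: nat_le_iff)
    show ?thesis using g[OF k(1)] k(2) by (simp add: dyadic_above_def)
  qed
  then show ?thesis by (intro LIMSEQ_le_const2[OF lim]) auto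
qed

lemma telescope_from_1:
  fixes f :: "nat => real"
  shows "(\<Sum>j\<in>{1..k}. f j - f (j - 1)) = f k - f 0"
  by (induction k) auto

lemma telescope_tail:
  fixes f :: "nat => real"
  assumes "k \<le> N" shows "(\<Sum>j\<in>{k<..N}. f j - f (j - 1)) = f N - f k"
  using assms
proof (induction N)
  case (Suc N)
  show ?case
  proof (cases "k = Suc N")
    case False
    then have "{k<..Suc N} = insert (Suc N) {k<..N}" using Suc.prems by auto
    then show ?thesis using Suc False by simp
  qed simp
qed simp

section \<open>Time reversal and the occupation identity\<close>

context spec_neg
begin

text \<open>The increments over a regular grid are exchangeable; reversing their order turns
  \<open>X\<close> staying below its final value into \<open>X\<close> staying above its initial value.\<close>

lemma grid_reversal:
  fixes N :: nat
  assumes t: "0 < t" and N: "0 < N" and B[measurable]: "B \<in> sets borel"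
  shows "emeasure M {w\<in>space M. X t w \<in> B \<and> (\<forall>k\<le>N. X (t * real k / real N) w \<le> X t w)} =
    emeasure M {w\<in>space M. X t w \<in> B \<and> (\<forall>k\<le>N. 0 \<le> X (t * real k / real N) w)}"
proof -
  define g where "g k = t * real k / real N" for k
  have g0: "g 0 = 0" "g N = t" using N by (auto simp: g_def)
  have gn: "0 \<le> g k" for k using t N by (simp add: g_def)
  have gm: "g k \<le> g (Suc k)" for k using t N by (simp add: g_def divide_right_mono)
  define K where "K = {1..N}"
  define Y where "Y w = (\<lambda>k\<in>K. X (0 + g k) w - X (0 + g (k - 1)) w)" for w
  define \<mu> where "\<mu> = distr M borel (\<lambda>w. X (g 1) w - X 0 w)"
  define P where "P = Pi\<^sub>M K (\<lambda>_. \<mu>)"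
  have gX[measurable]: "X (g k) \<in> borel_measurable M" for k using gn by (rule X_measurable)
  have X0m[measurable]: "X 0 \<in> borel_measurable M" by (rule X_measurable) simp
  have Xtm[measurable]: "X t \<in> borel_measurable M" using t by (intro X_measurable) simp
  have Ym[measurable]: "Y \<in> measurable M (Pi\<^sub>M K (\<lambda>_. borel))" unfolding Y_def by (rule measurable_restrict) simp
  have "distr M (Pi\<^sub>M K (\<lambda>_. borel)) Y = Pi\<^sub>M K (\<lambda>k. distr M borel (\<lambda>w. X (g k - g (k - 1)) w - X 0 w))"
    unfolding Y_def K_def by (rule increments_distr(2)) (use g0 gm N in auto)
  also have "\<dots> = P" unfolding P_def
  proof (rule PiM_cong)
    fix k assume "k \<in> K"
    then obtain j where "k = Suc j" by (cases k) (auto simp: K_def)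
    then have "g k - g (k - 1) = g 1" using N by (simp add: g_def field_simps)
    then show "distr M borel (\<lambda>w. X (g k - g (k - 1)) w - X 0 w) = \<mu>" by (simp add: \<mu>_def)
  qed simp
  finally have law: "distr M (Pi\<^sub>M K (\<lambda>_. borel)) Y = P" .
  have \<mu>s: "sets \<mu> = sets borel" "prob_space \<mu>" unfolding \<mu>_def by (auto intro: prob_space_distr)
  have Ps: "sets P = sets (Pi\<^sub>M K (\<lambda>_. borel))" unfolding P_def by (rule sets_PiM_cong) (use \<mu>s in auto)
  \<comment> \<open>Positions run from 1 to \<open>N\<close>, hence the reflection at
    \<open>N + 1\<close>: sums over the last \<open>N - k\<close> positions become sums over the
    first \<open>N - k\<close>.\<close>
  define rv :: "(nat => real) => nat => real" where "rv v = (\<lambda>k\<in>K. v (N + 1 - k))" for v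
  have rvm: "rv \<in> measurable P P" unfolding rv_def P_def
    by (rule measurable_restrict, rule measurable_component_singleton) (auto simp: K_def)
  have rev: "distr P P rv = P"
    unfolding P_def rv_def by (rule distr_PiM_reindex) (use \<mu>s in \<open>auto simp: K_def inj_on_def\<close>)
  define E1 where "E1 = {v \<in> space P. (\<Sum>l\<in>K. v l) \<in> B \<and> (\<forall>k\<in>{..N}. 0 \<le> (\<Sum>l\<in>{k<..N}. v l))}"
  define E2 where "E2 = {v \<in> space P. (\<Sum>l\<in>K. v l) \<in> B \<and> (\<forall>k\<in>{..N}. 0 \<le> (\<Sum>l\<in>{1..k}. v l))}"
  have sm[measurable]: "(\<lambda>v. \<Sum>l\<in>S. v l) \<in> borel_measurable P" if "S \<subseteq> K" for S
    using sum_component_measurable[OF that] by (simp add: measurable_cong_sets[OF Ps refl])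
  have sm1: "(\<lambda>v. \<Sum>l\<in>{k<..N}. v l) \<in> borel_measurable P" "(\<lambda>v. \<Sum>l\<in>{1..k}. v l) \<in> borel_measurable P" if "k \<in> {..N}" for k
    using that by (intro sm; auto simp: K_def)+
  have smK[measurable]: "(\<lambda>v. \<Sum>l\<in>K. v l) \<in> borel_measurable P" by (rule sm) simp
  have E1m: "E1 \<in> sets P" unfolding E1_def
    by (intro sets.sets_Collect_conj sets.sets_Collect_finite_All' pred_sets2[OF B] borel_measurable_le borel_measurable_const sm1 smK predE) (auto intro!: pred_sets2[OF B] smK simp: pred_def)
  have E2m: "E2 \<in> sets P" unfolding E2_def
    by (intro sets.sets_Collect_conj sets.sets_Collect_finite_All' pred_sets2[OF B] borel_measurable_le borel_measurable_const sm1 smK predE) (auto intro!: pred_sets2[OF B] smK simp: pred_def)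
  have flip: "rv v \<in> E1 \<longleftrightarrow> v \<in> E2" if v: "v \<in> space P" for v
  proof -
    have s: "(\<Sum>l\<in>{k<..N}. rv v l) = (\<Sum>l\<in>{1..N - k}. v l)" if "k \<le> N" for k
      by (rule sum.reindex_bij_witness[of _ "\<lambda>l. N + 1 - l" "\<lambda>l. N + 1 - l"]) (auto simp: rv_def K_def)
    have "K = {0<..N}" by (auto simp: K_def)
    then have sK: "(\<Sum>l\<in>K. rv v l) = (\<Sum>l\<in>K. v l)" using s[of 0] by (simp add: K_def)
    have "(\<forall>k\<in>{..N}. 0 \<le> (\<Sum>l\<in>{k<..N}. rv v l)) \<longleftrightarrow> (\<forall>k\<in>{..N}. 0 \<le> (\<Sum>l\<in>{1..N - k}. v l))" using s by auto
    also have "\<dots> \<longleftrightarrow> (\<forall>k\<in>{..N}. 0 \<le> (\<Sum>l\<in>{1..k}. v l))"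
    proof
      assume a: "\<forall>k\<in>{..N}. 0 \<le> (\<Sum>l\<in>{1..N - k}. v l)"
      show "\<forall>k\<in>{..N}. 0 \<le> (\<Sum>l\<in>{1..k}. v l)"
      proof
        fix k assume "k \<in> {..N}"
        then show "0 \<le> (\<Sum>l\<in>{1..k}. v l)" using a[rule_format, of "N - k"] by simp
      qed
    qed auto
    finally show ?thesis using v measurable_space[OF rvm v] sK by (simp add: E1_def E2_def)
  qed
  have YP: "Y w \<in> space P" if "w \<in> space M" for w
    using measurable_space[OF Ym that] sets_eq_imp_space_eq[OF Ps] by simp
  have YE: "emeasure M (Y -` E \<inter> space M) = emeasure P E" if "E \<in> sets P" for E
    using that by (subst law[symmetric], subst emeasure_distr) (auto simp: Ps)
  have "emeasure M {w\<in>space M. X t w \<in> B \<and> (\<forall>k\<le>N. X (g k) w \<le> X t w)} = emeasure M (Y -` E1 \<inter> space M)"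
  proof (rule emeasure_eq_AE)
    show "AE w in M. w \<in> {w\<in>space M. X t w \<in> B \<and> (\<forall>k\<le>N. X (g k) w \<le> X t w)} \<longleftrightarrow> w \<in> Y -` E1 \<inter> space M"
      using X0_AE AE_space
    proof eventually_elim
      case (elim w)
      have "(\<Sum>l\<in>{k<..N}. Y w l) = X t w - X (g k) w" if "k \<le> N" for k
      proof -
        have "(\<Sum>l\<in>{k<..N}. Y w l) = (\<Sum>l\<in>{k<..N}. X (g l) w - X (g (l - 1)) w)"
          by (rule sum.cong) (auto simp: Y_def K_def)
        then show ?thesis using telescope_tail[OF that, of "\<lambda>k. X (g k) w"] g0 by simp
      qed
      moreover have "(\<Sum>l\<in>K. Y w l) = X t w"
      proof -
        have "(\<Sum>l\<in>K. Y w l) = (\<Sum>l\<in>{1..N}. X (g l) w - X (g (l - 1)) w)"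
          by (rule sum.cong) (auto simp: Y_def K_def)
        then show ?thesis using telescope_from_1[of "\<lambda>k. X (g k) w" N] g0 elim(1) by simp
      qed
      ultimately show ?case using elim(2) YP[OF elim(2)] by (auto simp: E1_def)
    qed
    show "{w\<in>space M. X t w \<in> B \<and> (\<forall>k\<le>N. X (g k) w \<le> X t w)} \<in> sets M" by measurable
    show "Y -` E1 \<inter> space M \<in> sets M" using E1m Ps by (intro measurable_sets[OF Ym]) simp
  qed
  also have "\<dots> = emeasure P E1" by (rule YE[OF E1m])
  also have "\<dots> = emeasure P (rv -` E1 \<inter> space P)" by (subst rev[symmetric], rule emeasure_distr[OF rvm E1m])
  also have "rv -` E1 \<inter> space P = E2" using flip by (auto simp: E2_def)
  also have "emeasure P E2 = emeasure M (Y -` E2 \<inter> space M)" by (rule YE[OF E2m, symmetric])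
  also have "\<dots> = emeasure M {w\<in>space M. X t w \<in> B \<and> (\<forall>k\<le>N. 0 \<le> X (g k) w)}"
  proof (rule emeasure_eq_AE)
    show "AE w in M. w \<in> Y -` E2 \<inter> space M \<longleftrightarrow> w \<in> {w\<in>space M. X t w \<in> B \<and> (\<forall>k\<le>N. 0 \<le> X (g k) w)}"
      using X0_AE AE_space
    proof eventually_elim
      case (elim w)
      have s: "(\<Sum>l\<in>{1..k}. Y w l) = X (g k) w" if "k \<le> N" for k
      proof -
        have "(\<Sum>l\<in>{1..k}. Y w l) = (\<Sum>l\<in>{1..k}. X (g l) w - X (g (l - 1)) w)"
          by (rule sum.cong) (use that in \<open>auto simp: Y_def K_def\<close>)
        then show ?thesis using telescope_from_1[of "\<lambda>k. X (g k) w" k] g0 elim(1) by simp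
      qed
      then have "(\<Sum>l\<in>K. Y w l) = X t w" using g0 by (simp add: K_def)
      then show ?case using s elim(2) YP[OF elim(2)] by (auto simp: E2_def)
    qed
    show "{w\<in>space M. X t w \<in> B \<and> (\<forall>k\<le>N. 0 \<le> X (g k) w)} \<in> sets M" by measurable
    show "Y -` E2 \<inter> space M \<in> sets M" using E2m Ps by (intro measurable_sets[OF Ym]) simp
  qed
  finally show ?thesis unfolding g_def .
qed

text \<open>In contrast to the event of being at the supremum at \<open>t\<close>, this event
  decreases as \<open>t\<close> grows; its regularity in \<open>t\<close> is exploited in
  \<open>d_term_exp\<close>.\<close>

definition stays_nonneg :: "real => 'a set" where
  "stays_nonneg t = {w\<in>space M. \<forall>u\<in>{0..t}. 0 \<le> X u w}"

lemma reflected_zero_iff: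
  assumes "w \<in> space M" "0 \<le> t"
  shows "reflected X t w = 0 \<longleftrightarrow> (\<forall>u\<in>{0..t}. X u w \<le> X t w)"
proof -
  have le: "X u w \<le> running_sup X t w" if "u \<in> {0..t}" for u
    unfolding running_sup_def using cadlag_bdd_above[OF cadlag_X[OF assms(1)], of 0 t] that
    by (intro cSUP_upper) auto
  have "running_sup X t w \<le> X t w" if "\<forall>u\<in>{0..t}. X u w \<le> X t w"
    unfolding running_sup_def using that assms by (intro cSUP_least) auto
  then show ?thesis using le le[of t] assms by (force simp: reflected_def)
qed

lemma nested_grid_le:
  assumes le: "\<forall>k\<le>(2::nat) ^ Suc m. P (t * real k / 2 ^ Suc m)" and k: "k \<le> 2 ^ m"
  shows "P (t * real k / 2 ^ m)"
  using le[rule_format, of "2 * k"] k by simp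

text \<open>Grids with \<open>2 ^ m\<close> steps are nested, so the grid events decrease with
  \<open>m\<close>; by right continuity their intersections are the events on all of
  \<open>[0, t]\<close>, and the equal probabilities pass to the limit.\<close>

lemma time_reversal:
  assumes t: "0 < t" and B[measurable]: "B \<in> sets borel"
  shows "emeasure M {w\<in>space M. X t w \<in> B \<and> reflected X t w = 0} = emeasure M ({w\<in>space M. X t w \<in> B} \<inter> stays_nonneg t)"
    "stays_nonneg t \<in> sets M"
proof -
  have gX[measurable]: "X (t * real k / 2 ^ m) \<in> borel_measurable M" for k m using t by (intro X_measurable) simp
  have Xtm[measurable]: "X t \<in> borel_measurable M" using t by (intro X_measurable) simp
  define U where "U m = {w\<in>space M. X t w \<in> B \<and> (\<forall>k\<le>(2::nat) ^ m. X (t * real k / 2 ^ m) w \<le> X t w)}" for m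
  define V where "V B m = {w\<in>space M. X t w \<in> B \<and> (\<forall>k\<le>(2::nat) ^ m. 0 \<le> X (t * real k / 2 ^ m) w)}" for B m
  have Um: "U m \<in> sets M" for m unfolding U_def by measurable
  have Vm: "V B m \<in> sets M" if [measurable]: "B \<in> sets borel" for B m unfolding V_def by measurable
  have Ud: "decseq U"
  proof (intro decseq_SucI subsetI)
    fix m w assume "w \<in> U (Suc m)"
    then show "w \<in> U m" using nested_grid_le[of m "\<lambda>s. X s w \<le> X t w" t] by (simp add: U_def del: power_Suc)
  qed
  have Vd: "decseq (V B)"
  proof (intro decseq_SucI subsetI)
    fix m w assume "w \<in> V B (Suc m)"
    then show "w \<in> V B m" using nested_grid_le[of m "\<lambda>s. 0 \<le> X s w" t] by (simp add: V_def del: power_Suc)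
  qed
  have UV: "emeasure M (U m) = emeasure M (V B m)" for m
    using grid_reversal[OF t _ B, of "2 ^ m"] by (simp add: U_def V_def)
  have grid: "0 \<le> t * real k / 2 ^ m \<and> t * real k / 2 ^ m \<le> t" if "k \<le> (2::nat) ^ m" for k m
  proof -
    have "real k \<le> 2 ^ m" using that by (metis of_nat_le_iff of_nat_numeral of_nat_power)
    then show ?thesis using t by (auto simp: divide_le_eq)
  qed
  have Ui: "(\<Inter>m. U m) = {w\<in>space M. X t w \<in> B \<and> reflected X t w = 0}"
  proof (intro set_eqI iffI)
    fix w assume a: "w \<in> (\<Inter>m. U m)"
    then have w: "w \<in> space M" "X t w \<in> B" by (auto simp: U_def)
    have "X u w \<le> X t w" if "u \<in> {0..t}" for u
      by (rule dyadic_grid_le[OF t cadlag_right[OF cadlag_X[OF w(1)]]]) (use a that in \<open>auto simp: U_def\<close>)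
    then show "w \<in> {w\<in>space M. X t w \<in> B \<and> reflected X t w = 0}" using reflected_zero_iff[OF w(1)] w t by simp
  next
    fix w assume "w \<in> {w\<in>space M. X t w \<in> B \<and> reflected X t w = 0}"
    then show "w \<in> (\<Inter>m. U m)" using reflected_zero_iff[of w t] t grid by (auto simp: U_def)
  qed
  have Vi: "(\<Inter>m. V B m) = {w\<in>space M. X t w \<in> B} \<inter> stays_nonneg t" for B
  proof (intro set_eqI iffI)
    fix w assume a: "w \<in> (\<Inter>m. V B m)"
    then have w: "w \<in> space M" "X t w \<in> B" by (auto simp: V_def)
    have "- X u w \<le> 0" if "u \<in> {0..t}" for u
      by (rule dyadic_grid_le[OF t tendsto_minus[OF cadlag_right[OF cadlag_X[OF w(1)]]]]) (use a that in \<open>auto simp: V_def\<close>)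
    then show "w \<in> {w\<in>space M. X t w \<in> B} \<inter> stays_nonneg t" using w by (auto simp: stays_nonneg_def)
  next
    fix w assume "w \<in> {w\<in>space M. X t w \<in> B} \<inter> stays_nonneg t"
    then show "w \<in> (\<Inter>m. V B m)" using grid by (auto simp: V_def stays_nonneg_def)
  qed
  have "(\<lambda>m. emeasure M (U m)) \<longlonglongrightarrow> emeasure M (\<Inter>m. U m)"
    using Um Ud by (intro Lim_emeasure_decseq) auto
  moreover have "(\<lambda>m. emeasure M (V B m)) \<longlonglongrightarrow> emeasure M (\<Inter>m. V B m)"
    using Vm[OF B] Vd by (intro Lim_emeasure_decseq) auto
  ultimately show "emeasure M {w\<in>space M. X t w \<in> B \<and> reflected X t w = 0} = emeasure M ({w\<in>space M. X t w \<in> B} \<inter> stays_nonneg t)"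
    unfolding UV Ui Vi by (rule LIMSEQ_unique)
  have "stays_nonneg t = (\<Inter>m. V UNIV m)" unfolding Vi by (auto simp: stays_nonneg_def)
  also have "\<dots> \<in> sets M" using Vm[of UNIV] by (intro sets.countable_INT) auto
  finally show "stays_nonneg t \<in> sets M" .
qed

lemma time_reversal_nn:
  fixes \<phi> :: "real => ennreal"
  assumes t: "0 < t" and [measurable]: "\<phi> \<in> borel_measurable borel"
  shows "(\<E> w. \<phi> (X t w) * ind {0} (reflected X t w)) = (\<E> w. \<phi> (X t w) * ind (stays_nonneg t) w)"
proof -
  note [measurable] = time_reversal(2)[OF t] X_measurable[OF less_imp_le[OF t]] reflected_measurable[OF less_imp_le[OF t]]
  let ?P = "distr (density M (\<lambda>w. ind {0} (reflected X t w))) borel (X t)"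
  let ?Q = "distr (density M (ind (stays_nonneg t))) borel (X t)"
  have "?P = ?Q"
  proof (rule measure_eqI)
    fix B assume "B \<in> sets ?P"
    then have [measurable]: "B \<in> sets borel" by simp
    have "emeasure ?P B = (\<E> w. ind {0} (reflected X t w) * ind (X t -` B \<inter> space M) w)"
      by (simp add: emeasure_distr emeasure_density)
    also have "\<dots> = (\<E> w. ind {w\<in>space M. X t w \<in> B \<and> reflected X t w = 0} w)"
      by (intro nn_integral_cong) (auto simp: indicator_def)
    also have "\<dots> = (\<E> w. ind ({w\<in>space M. X t w \<in> B} \<inter> stays_nonneg t) w)"
      using time_reversal(1)[OF t, of B] by (subst (1 2) nn_integral_indicator) auto
    also have "\<dots> = (\<E> w. ind (stays_nonneg t) w * ind (X t -` B \<inter> space M) w)"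
      by (intro nn_integral_cong) (auto simp: indicator_def)
    also have "\<dots> = emeasure ?Q B"
      by (simp add: emeasure_distr emeasure_density)
    finally show "emeasure ?P B = emeasure ?Q B" .
  qed simp
  then have "(\<integral>\<^sup>+x. \<phi> x \<partial>?P) = (\<integral>\<^sup>+x. \<phi> x \<partial>?Q)" by simp
  then show ?thesis by (subst (asm) (1 2) nn_integral_distr) (auto simp: nn_integral_density mult.commute)
qed

text \<open>Path by path, Lebesgue measure on the times at the supremum grows like \<open>a\<close>
  times the supremum, and at the passage time of \<open>x\<close> the process is at
  \<open>x\<close>. The change of variables is carried out between two uses of Tonelli.\<close>

theorem occupation_identity:
  fixes h :: "real \<times> real => ennreal"
  assumes a: "0 \<le> a" "AE w in M. \<forall>t\<ge>0. occupation t w = a * running_sup X t w"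
    and h[measurable]: "h \<in> borel_measurable borel2"
  shows "(\<L> t. (\<E> w. h (t, X (max 0 t) w) * ind {0} (reflected X (max 0 t) w) * ind {0<..} t)) =
    (\<L> x. (\<E> w. ennreal a * (h (\<tau> x w, x) * hit x w)))"
proof -
  interpret pair_sigma_finite lborel M by unfold_locales
  have rm[measurable]: "(\<lambda>z. reflected X (max 0 (fst z)) (snd z)) \<in> borel_measurable LM"
    using reflected_joint_measurable by (simp add: case_prod_beta')
  let ?f = "\<lambda>z. h (fst z, X (max 0 (fst z)) (snd z)) * ind {0} (reflected X (max 0 (fst z)) (snd z)) * ind {0<..} (fst z)"
  let ?g = "\<lambda>z. ennreal a * (h (\<tau> (fst z) (snd z), fst z) * (ind {0..} (fst z) * ind {z. first_passage X (fst z) (snd z) < \<infinity>} z))"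
  have fm: "?f \<in> borel_measurable LM" by measurable
  have gm: "?g \<in> borel_measurable LM" by measurable
  have "(\<L> t. (\<E> w. ?f (t, w))) = (\<E> w. (\<L> t. ?f (t, w)))"
    by (rule Fubini[OF fm, symmetric])
  also have "\<dots> = (\<E> w. (\<L> x. ?g (x, w)))"
  proof (rule nn_integral_cong_AE)
    show "AE w in M. (\<L> t. ?f (t, w)) = (\<L> x. ?g (x, w))"
      using good_AE a(2) AE_space
    proof eventually_elim
      case (elim w)
      interpret good_path X w by fact
      note [measurable] = at_sup_measurable[OF elim(3)] reflected_time_measurable[OF elim(3)] X_time_measurable[OF elim(3)]
      define \<mu> where "\<mu> = density lborel (\<lambda>s. ind {0<..} s * at_sup w s)"
      have [measurable_cong]: "sets \<mu> = sets borel" by (simp add: \<mu>_def)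
      have em: "emeasure \<mu> A = (\<L> s. ind {0<..} s * at_sup w s * ind A s)" if "A \<in> sets borel" for A
        unfolding \<mu>_def using that by (subst emeasure_density) auto
      have z: "emeasure \<mu> {..0} = 0"
      proof -
        have "emeasure \<mu> {..0} = (\<integral>\<^sup>+s. 0 \<partial>(lborel :: real measure))" unfolding em[of "{..0}", simplified]
          by (intro nn_integral_cong) (auto simp: indicator_def)
        then show ?thesis by simp
      qed
      have Ioc: "emeasure \<mu> {u<..v} = ennreal (a * (S v - S u))" if "0 \<le> u" "u \<le> v" for u v
      proof -
        have "emeasure \<mu> {u<..v} = (\<L> s. ind {u<..v} s * at_sup w s)" unfolding em[of "{u<..v}", simplified]
          using that by (intro nn_integral_cong) (auto simp: indicator_def)
        also have "\<dots> = ennreal (occupation v w - occupation u w)" by (rule occupation_diff(3)[OF elim(3) that])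
        also have "occupation v w - occupation u w = a * (S v - S u)" using elim(2) that by (simp add: right_diff_distrib)
        finally show ?thesis .
      qed
      have "(\<L> t. ?f (t, w)) = (\<integral>\<^sup>+t. h (t, X (max 0 t) w) \<partial>\<mu>)"
        unfolding \<mu>_def by (subst nn_integral_density) (auto simp: at_sup_def mult_ac intro!: nn_integral_cong)
      also have "\<dots> = (\<L> x. ennreal a * (h (real_of_ereal (T x), X (max 0 (real_of_ereal (T x))) w) * ind {x. 0 \<le> x \<and> T x < \<infinity>} x))"
        by (rule path_change_of_variable[OF _ z a(1) Ioc first_passage_level_measurable[OF elim(3)]]) (auto simp: \<mu>_def)
      also have "\<dots> = (\<L> x. ?g (x, w))"
      proof (intro nn_integral_cong)
        fix x
        show "ennreal a * (h (real_of_ereal (T x), X (max 0 (real_of_ereal (T x))) w) * ind {x. 0 \<le> x \<and> T x < \<infinity>} x) = ?g (x, w)"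
        proof (cases "0 \<le> x \<and> T x < \<infinity>")
          case True
          then obtain r where r: "T x = ereal r" using first_passage_nonneg[of X x w] by (cases "T x") auto
          then have "X (max 0 r) w = x" using T_value[of x r] True by (simp add: max_absorb2)
          then show ?thesis using r True by simp
        qed (auto simp: indicator_def)
      qed
      finally show ?case .
    qed
  qed
  also have "\<dots> = (\<L> x. (\<E> w. ?g (x, w)))" by (rule Fubini[OF gm])
  finally show ?thesis by (simp add: indicator_def)
qed

end

lemma AE_lborel_interval:
  assumes "AE x in lborel. P x" "a < (b::real)" obtains x where "a < x" "x < b" "P x"
proof -
  have "\<not> (\<forall>x\<in>{a<..<b}. \<not> P x)"
  proof
    assume n: "\<forall>x\<in>{a<..<b}. \<not> P x"
    obtain N where N: "{x \<in> space lborel. \<not> P x} \<subseteq> N" "emeasure lborel N = 0" "N \<in> sets lborel"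
      using AE_E[OF assms(1)] by blast
    have "{a<..<b} \<subseteq> N" using n N(1) by auto
    then have "emeasure lborel {a<..<b} \<le> 0" using emeasure_mono[OF _ N(3)] N(2) by metis
    then show False using assms(2) by simp
  qed
  then show thesis using that by auto
qed

text \<open>After division by \<open>q\<close> the killing rate disappears in the limit, and so does
  the jump part: \<open>(1 - exp (- (q * y))) / q\<close> tends to 0 and is dominated by
  \<open>min 1 y\<close> for \<open>q\<close> at least 1.\<close>

lemma subordinator_exponent_limit:
  fixes \<pi> :: "real measure" and k d :: real
  assumes \<pi>[measurable_cong]: "sets \<pi> = sets borel" and z: "emeasure \<pi> {..0} = 0"
    and f: "(\<integral>\<^sup>+y. ennreal (min 1 y) \<partial>\<pi>) < \<infinity>"
  shows "(\<lambda>m. (k + d * real (Suc m) + (\<integral>y. (1 - exp (- (real (Suc m) * y))) \<partial>\<pi>)) / real (Suc m)) \<longlonglongrightarrow> d"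
proof -
  have pos: "AE y in \<pi>. 0 < y"
    by (rule AE_I[of _ _ "{..0}"]) (use z \<pi> in auto)
  have ww: "integrable \<pi> (\<lambda>y. min 1 y :: real)"
  proof (rule integrableI_bounded)
    have "(\<integral>\<^sup>+y. ennreal (norm (min 1 y :: real)) \<partial>\<pi>) = (\<integral>\<^sup>+y. ennreal (min 1 y) \<partial>\<pi>)"
      by (rule nn_integral_cong_AE) (use pos in eventually_elim, simp)
    then show "(\<integral>\<^sup>+y. ennreal (norm (min 1 y :: real)) \<partial>\<pi>) < \<infinity>" using f by simp
  qed measurable
  have "(\<lambda>m. \<integral>y. (1 - exp (- (real (Suc m) * y))) / real (Suc m) \<partial>\<pi>) \<longlonglongrightarrow> (\<integral>y. 0 \<partial>\<pi>)"
  proof (rule integral_dominated_convergence[OF _ _ ww])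
    show "AE y in \<pi>. (\<lambda>m. (1 - exp (- (real (Suc m) * y))) / real (Suc m)) \<longlonglongrightarrow> 0"
      using pos
    proof eventually_elim
      case (elim y)
      then show ?case by real_asymp
    qed
    show "AE y in \<pi>. norm ((1 - exp (- (real (Suc m) * y))) / real (Suc m)) \<le> min 1 y" for m
      using pos
    proof eventually_elim
      case (elim y)
      have "0 \<le> 1 - exp (- (real (Suc m) * y))" using elim by simp
      moreover have "1 - exp (- (real (Suc m) * y)) \<le> y * real (Suc m)"
        using exp_ge_add_one_self[of "- (real (Suc m) * y)"] by (simp add: mult.commute)
      moreover have "1 - exp (- (real (Suc m) * y)) \<le> 1 * real (Suc m)"
        by (rule order_trans[of _ 1]) auto
      ultimately show ?case by (simp add: pos_divide_le_eq del: of_nat_Suc)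
    qed
  qed measurable
  then have "(\<lambda>m. (\<integral>y. (1 - exp (- (real (Suc m) * y))) \<partial>\<pi>) / real (Suc m)) \<longlonglongrightarrow> 0" by simp
  moreover have "(\<lambda>m. k / real (Suc m) + d) \<longlonglongrightarrow> d" by real_asymp
  ultimately have "(\<lambda>m. (k / real (Suc m) + d) + (\<integral>y. (1 - exp (- (real (Suc m) * y))) \<partial>\<pi>) / real (Suc m)) \<longlonglongrightarrow> d + 0"
    by (intro tendsto_add)
  then show ?thesis by (simp add: add_divide_distrib del: of_nat_Suc)
qed

section \<open>Law of the process on the event of being at the supremum\<close>

context spec_neg
begin

lemma ladder_time_measurable:
  assumes L: "sup_local_time M X L" shows "ladder_time L u \<in> borel_measurable M"
proof (rule borel_measurableI_less)
  fix z :: ereal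
  have m: "mono_on {0..} (\<lambda>t. L t w)" if "w \<in> space M" for w using L that by (auto simp: sup_local_time_def)
  have "{w \<in> space M. ladder_time L u w < z} = (\<Union>r\<in>{r. r \<in> \<rat> \<and> 0 \<le> r \<and> ereal r < z}. {w \<in> space M. u < L r w})"
  proof (intro set_eqI iffI)
    fix w assume "w \<in> {w \<in> space M. ladder_time L u w < z}"
    then obtain s where s: "w \<in> space M" "0 \<le> s" "u < L s w" "ereal s < z"
      by (auto simp: ladder_time_def INF_less_iff)
    obtain v where v: "s < v" "ereal v < z" using ereal_dense2[OF s(4)] by auto
    obtain r where r: "r \<in> \<rat>" "s < r" "r < v" using Rats_dense_in_real[OF v(1)] by auto
    have "L s w \<le> L r w" using m[OF s(1)] s r by (auto intro: mono_onD)
    moreover have "ereal r < z" using r v by (auto intro: less_trans[of "ereal r" "ereal v"])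
    ultimately show "w \<in> (\<Union>r\<in>{r. r \<in> \<rat> \<and> 0 \<le> r \<and> ereal r < z}. {w \<in> space M. u < L r w})"
      using r s by (auto intro!: bexI[of _ r])
  qed (auto simp: ladder_time_def INF_less_iff)
  also have "\<dots> \<in> sets M"
  proof (intro sets.countable_UN''[OF countable_rat_set])
    show "{w \<in> space M. u < L r w} \<in> sets M" if "r \<in> {r. r \<in> \<rat> \<and> 0 \<le> r \<and> ereal r < z}" for r
      using that L measurable_filt[of "L r" r borel] by (intro borel_measurable_less) (auto simp: sup_local_time_def)
  qed
  finally show "{w \<in> space M. ladder_time L u w < z} \<in> sets M" .
qed

text \<open>The occupation identity and Kendall's identity yield equality for almost every time
  only. Times \<open>s j\<close> with equality tend to \<open>t\<close> from below; the reversed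
  left side converges because \<open>stays_nonneg\<close> decreases and \<open>X\<close> has no jump
  at \<open>t\<close>, the right side because its integrand is continuous in the time and the value
  of \<open>X\<close>.\<close>

lemma d_term_exp:
  assumes a: "0 \<le> a" "AE w in M. \<forall>t\<ge>0. occupation t w = a * running_sup X t w" and t: "0 < t" and k: "0 < k"
  shows "(\<E> w. expm (k * X t w) * ind {0} (reflected X t w)) =
    (\<E> w. ennreal (max 0 (X t w) / t * (a * exp (- (k * X t w)))))"
proof -
  define f where "f s w = expm (k * X s w) * ind {0} (reflected X s w)" for s w
  define g where "g s w = ennreal (max 0 (X s w) / s * (a * exp (- (k * X s w))))" for s w
  define F where "F s = (\<E> w. f (max 0 s) w * ind {0<..} s)" for s
  define G where "G s = (\<E> w. g (max 0 s) w * ind {0<..} s)" for s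
  have rm[measurable]: "(\<lambda>z. reflected X (max 0 (fst z)) (snd z)) \<in> borel_measurable LM"
    using reflected_joint_measurable by (simp add: case_prod_beta')
  have fm[measurable]: "(\<lambda>z. f (max 0 (fst z)) (snd z)) \<in> borel_measurable LM"
    and gm[measurable]: "(\<lambda>z. g (max 0 (fst z)) (snd z)) \<in> borel_measurable LM"
    unfolding f_def g_def by measurable
  have F[measurable]: "F \<in> borel_measurable lborel" and G[measurable]: "G \<in> borel_measurable lborel"
    unfolding F_def G_def by (rule borel_measurable_nn_integral, simp add: case_prod_beta')+
  have "density lborel F = density lborel G"
  proof (rule measure_eqI)
    fix E assume "E \<in> sets (density lborel F)"
    then have E[measurable]: "E \<in> sets borel" by simp
    define h :: "real \<times> real => ennreal" where "h z = expm (k * snd z) * ind E (fst z)" for z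
    have h[measurable]: "h \<in> borel_measurable borel2" unfolding h_def by measurable
    have [measurable]: "(\<lambda>z. ennreal a * h z) \<in> borel_measurable borel2" by measurable
    have fs[measurable]: "(\<lambda>w. f (max 0 s) w) \<in> borel_measurable M" "(\<lambda>w. g (max 0 s) w) \<in> borel_measurable M" for s
      unfolding f_def g_def using X_measurable[of "max 0 s"] reflected_measurable[of "max 0 s"] by measurable
    have "emeasure (density lborel F) E = (\<L> t. (\<E> w. h (t, X (max 0 t) w) * ind {0} (reflected X (max 0 t) w) * ind {0<..} t))"
    proof (subst emeasure_density)
      show "(\<integral>\<^sup>+s\<in>E. F s \<partial>lborel) = (\<L> t. (\<E> w. h (t, X (max 0 t) w) * ind {0} (reflected X (max 0 t) w) * ind {0<..} t))"
        unfolding F_def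
        by (intro nn_integral_cong) (auto simp: h_def f_def indicator_def)
    qed (use E in auto)
    also have "\<dots> = (\<L> x. (\<E> w. (ennreal a * h (\<tau> x w, x)) * hit x w))"
      using occupation_identity[OF a h] by (simp add: mult.assoc)
    also have "\<dots> = (\<L> s. (\<E> w. ennreal (max 0 (X (max 0 s) w) / s) * (ennreal a * h (s, X (max 0 s) w)) * ind {0<..} s))"
      by (rule kendall[symmetric]) measurable
    also have "\<dots> = (\<integral>\<^sup>+s\<in>E. G s \<partial>lborel)" unfolding G_def
    proof (intro nn_integral_cong)
      fix s :: real
      have "(\<E> w. ennreal (max 0 (X (max 0 s) w) / s) * (ennreal a * h (s, X (max 0 s) w)) * ind {0<..} s) =
        (\<E> w. g (max 0 s) w * ind {0<..} s * ind E s)"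
      proof (intro nn_integral_cong)
        fix w
        show "ennreal (max 0 (X (max 0 s) w) / s) * (ennreal a * h (s, X (max 0 s) w)) * ind {0<..} s = g (max 0 s) w * ind {0<..} s * ind E s"
        proof (cases "0 < s \<and> s \<in> E")
          case True
          have "ennreal y * (ennreal a * ennreal (exp z)) = ennreal (y * (a * exp z))" for y z
            using a(1) by (simp add: ennreal_mult'')
          then show ?thesis using True by (simp add: h_def g_def max_absorb2)
        qed (auto simp: h_def indicator_def)
      qed
      also have "\<dots> = (\<E> w. g (max 0 s) w * ind {0<..} s) * ind E s"
        by (rule nn_integral_multc) measurable
      finally show "(\<E> w. ennreal (max 0 (X (max 0 s) w) / s) * (ennreal a * h (s, X (max 0 s) w)) * ind {0<..} s) =
        (\<E> w. g (max 0 s) w * ind {0<..} s) * ind E s" .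
    qed
    also have "\<dots> = emeasure (density lborel G) E" using E by (subst emeasure_density) auto
    finally show "emeasure (density lborel F) E = emeasure (density lborel G) E" .
  qed simp
  then have ae: "AE s in lborel. F s = G s"
    using sigma_finite_measure.density_unique[OF lborel.sigma_finite_measure_axioms F G] by blast
  \<comment> \<open>The lower bound \<open>t / 2\<close> keeps \<open>1 / s j\<close> below
    \<open>2 / t\<close>, which dominates the right side.\<close>
  have "\<exists>s. max (t / 2) (t - 1 / real (Suc j)) < s \<and> s < t \<and> F s = G s" for j
    by (rule AE_lborel_interval[OF ae, of "max (t / 2) (t - 1 / real (Suc j))" t]) (use t in auto)
  then obtain s where s: "\<And>j. max (t / 2) (t - 1 / real (Suc j)) < s j" "\<And>j. s j < t" "\<And>j. F (s j) = G (s j)" by metis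
  have s0: "0 < s j" "t / 2 < s j" for j using s(1)[of j] t by auto
  have slim: "s \<longlonglongrightarrow> t"
  proof (rule tendsto_sandwich[OF _ _ _ tendsto_const])
    show "(\<lambda>j. t - 1 / real (Suc j)) \<longlonglongrightarrow> t" by real_asymp
    show "\<forall>\<^sub>F j in sequentially. t - 1 / real (Suc j) \<le> s j" using s(1) by (auto intro!: always_eventually simp: less_imp_le simp del: of_nat_Suc)
    show "\<forall>\<^sub>F j in sequentially. s j \<le> t" using s(2) by (auto intro!: always_eventually simp: less_imp_le)
  qed
  then have sl: "filterlim s (at_left t) sequentially"
    unfolding filterlim_at using s(2) less_imp_neq[OF s(2)] by (auto intro!: always_eventually)
  have FG: "(\<E> w. f (s j) w) = (\<E> w. g (s j) w)" for j
    using s(3)[of j] s0[of j] by (simp add: F_def G_def max_absorb2)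
  have Xm: "X u \<in> borel_measurable M" if "0 < u" for u using that by (intro X_measurable) simp
  have conv: "AE w in M. (\<lambda>j. X (s j) w) \<longlonglongrightarrow> X t w"
    using left_cont_AE[OF t] AE_space
  proof eventually_elim
    case (elim w)
    show ?case using filterlim_compose[OF cadlag_left[OF cadlag_X[OF elim(2)] t] sl] elim(1) by simp
  qed
  let ?f = "\<lambda>u w. expm (k * X u w) * ind (stays_nonneg u) w"
  have ff: "(\<E> w. f u w) = (\<E> w. ?f u w)" if "0 < u" for u
    unfolding f_def by (rule time_reversal_nn[OF that]) measurable
  have fmeas: "?f u \<in> borel_measurable M" if "0 < u" for u
    using Xm[OF that] time_reversal(2)[OF that] by measurable
  have fl: "(\<lambda>j. \<integral>\<^sup>+w. ?f (s j) w \<partial>M) \<longlonglongrightarrow> (\<E> w. ?f t w)"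
  proof (rule nn_integral_dominated_convergence[where w="\<lambda>_. 1"])
    show "?f (s j) \<in> borel_measurable M" "?f t \<in> borel_measurable M" for j using fmeas s0(1) t by blast+
    show "AE w in M. ?f (s j) w \<le> 1" for j
    proof (rule AE_I2)
      fix w assume "w \<in> space M"
      show "?f (s j) w \<le> 1"
        using s0(1)[of j] k by (auto simp: stays_nonneg_def indicator_def ennreal_le_1)
    qed
    show "AE w in M. (\<lambda>j. ?f (s j) w) \<longlonglongrightarrow> ?f t w"
      using conv AE_space
    proof eventually_elim
      case (elim w)
      show ?case
      proof (cases "w \<in> stays_nonneg t")
        case True
        then have "w \<in> stays_nonneg (s j)" for j using s(2)[of j] by (auto simp: stays_nonneg_def)
        then show ?thesis using True elim(1) by (simp, intro tendsto_ennrealI tendsto_intros)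
      next
        \<comment> \<open>A negative value before \<open>t\<close> lies in \<open>[0, s j]\<close>
          for large \<open>j\<close>; a negative value at \<open>t\<close> itself makes
          \<open>X (s j)\<close> negative eventually.\<close>
        case False
        have "\<forall>\<^sub>F j in sequentially. w \<notin> stays_nonneg (s j)"
        proof -
          obtain u where u: "0 \<le> u" "u \<le> t" "X u w < 0" using False elim(2) by (auto simp: stays_nonneg_def not_le)
          show ?thesis
          proof (cases "u = t")
            case True
            then have "\<forall>\<^sub>F j in sequentially. X (s j) w < 0" using order_tendstoD(2)[OF elim(1)] u by auto
            then show ?thesis
            proof eventually_elim
              case (elim j)
              then show ?case using s0(1)[of j] by (auto simp: stays_nonneg_def intro!: bexI[of _ "s j"])
            qed
          next
            case False
            then have "\<forall>\<^sub>F j in sequentially. u < s j" using order_tendstoD(1)[OF slim, of u] u by auto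
            then show ?thesis
            proof eventually_elim
              case (elim j)
              then show ?case using u by (auto simp: stays_nonneg_def intro!: bexI[of _ u])
            qed
          qed
        qed
        then have "\<forall>\<^sub>F j in sequentially. ?f (s j) w = 0" by eventually_elim simp
        then show ?thesis using False by (auto intro: tendsto_eventually)
      qed
    qed
  qed (simp_all add: emeasure_space_1)
  have gl: "(\<lambda>j. \<integral>\<^sup>+w. g (s j) w \<partial>M) \<longlonglongrightarrow> (\<E> w. g t w)"
  proof (rule nn_integral_dominated_convergence[where w="\<lambda>_. ennreal (2 / t * (a * (1 / k)))"])
    show "g (s j) \<in> borel_measurable M" "g t \<in> borel_measurable M" for j
      unfolding g_def using Xm[OF s0(1)[of j]] Xm[OF t] by measurable
    show "AE w in M. g (s j) w \<le> ennreal (2 / t * (a * (1 / k)))" for j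
    proof (rule AE_I2)
      fix w
      define x where "x = X (s j) w"
      have "max 0 x * exp (- (k * x)) \<le> 1 / k" using mult_exp_le[OF k, of x] k by (cases "0 \<le> x") auto
      then have A: "max 0 x * exp (- (k * x)) * a \<le> 1 / k * a" using a(1) by (rule mult_right_mono)
      have B: "1 / s j \<le> 2 / t" using s0[of j] t by (simp add: field_simps)
      have "(max 0 x * exp (- (k * x)) * a) * (1 / s j) \<le> (1 / k * a) * (2 / t)"
        by (rule mult_mono[OF A B]) (use a(1) k s0[of j] in auto)
      then show "g (s j) w \<le> ennreal (2 / t * (a * (1 / k)))" unfolding g_def x_def[symmetric]
        by (intro ennreal_leI) (simp add: mult_ac)
    qed
    show "AE w in M. (\<lambda>j. g (s j) w) \<longlonglongrightarrow> g t w"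
      using conv
    proof eventually_elim
      case (elim w)
      show ?case unfolding g_def using t by (intro tendsto_ennrealI tendsto_intros elim slim) simp
    qed
  qed (simp_all add: emeasure_space_1 ennreal_mult_less_top)
  have "(\<lambda>j. \<integral>\<^sup>+w. g (s j) w \<partial>M) \<longlonglongrightarrow> (\<E> w. f t w)"
    using fl unfolding ff[OF t] FG[symmetric] ff[OF s0(1)] .
  from LIMSEQ_unique[OF this gl] show ?thesis unfolding f_def g_def .
qed

text \<open>Exponential test functions determine a finite measure. At its supremum \<open>X\<close>
  is nonnegative almost surely, so the weight \<open>exp (- X t)\<close> bounds the masses by 1; it
  is divided out at the end.\<close>

lemma d_term:
  fixes \<phi> :: "real => ennreal"
  assumes a: "0 \<le> a" "AE w in M. \<forall>t\<ge>0. occupation t w = a * running_sup X t w" and t: "0 < t"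
    and \<phi>[measurable]: "\<phi> \<in> borel_measurable borel"
  shows "(\<E> w. \<phi> (X t w) * ind {0} (reflected X t w)) = (\<E> w. ennreal (a * max 0 (X t w) / t) * \<phi> (X t w))"
proof -
  note [measurable] = X_measurable[OF less_imp_le[OF t]] reflected_measurable[OF less_imp_le[OF t]]
  define u where "u w = expm (X t w) * ind {0} (reflected X t w)" for w
  define v where "v w = ennreal (max 0 (X t w) / t * (a * exp (- X t w)))" for w
  have [measurable]: "u \<in> borel_measurable M" "v \<in> borel_measurable M" unfolding u_def v_def by measurable
  define P where "P = distr (density M u) borel (X t)"
  define Q where "Q = distr (density M v) borel (X t)"
  have nnP: "(\<integral>\<^sup>+x. ww x \<partial>P) = (\<E> w. u w * ww (X t w))" and nnQ: "(\<integral>\<^sup>+x. ww x \<partial>Q) = (\<E> w. v w * ww (X t w))"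
    if [measurable]: "ww \<in> borel_measurable borel" for ww
    unfolding P_def Q_def by (auto simp: nn_integral_distr nn_integral_density)
  have P0: "AE w in M. u w * ind {..<0} (X t w) = 0"
    using X0_AE AE_space
  proof eventually_elim
    case (elim w)
    then show ?case using reflected_zero_iff[OF elim(2), of t] t by (auto simp: u_def indicator_def dest: bspec[of _ _ 0])
  qed
  have "P = Q"
  proof (rule finite_measure_eqI_laplace)
    have eu: "(\<E> w. u w * expm (real m * X t w)) = (\<E> w. v w * expm (real m * X t w))" for m
    proof -
      have e: "exp (- x) * exp (- (real m * x)) = exp (- (real (Suc m) * x))" for x :: real
        by (simp add: exp_add[symmetric] algebra_simps)
      have "u w * expm (real m * X t w) = expm (real (Suc m) * X t w) * ind {0} (reflected X t w)" for w
        unfolding u_def e[symmetric] by (simp add: ennreal_mult' mult_ac)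
      moreover have "v w * expm (real m * X t w) = ennreal (max 0 (X t w) / t * (a * exp (- (real (Suc m) * X t w))))" for w
        unfolding v_def e[symmetric] by (subst ennreal_mult''[symmetric]) (auto simp: mult_ac)
      ultimately show ?thesis using d_term_exp[OF a t, of "real (Suc m)"] by simp
    qed
    have fin: "emeasure P (space P) \<le> 1"
    proof -
      have "emeasure P (space P) = (\<E> w. u w * 1)" using nnP[of "\<lambda>_. 1"] by simp
      also have "\<dots> \<le> (\<E> w. 1)"
      proof (rule nn_integral_mono_AE)
        show "AE w in M. u w * 1 \<le> 1" using P0
          by eventually_elim (auto simp: u_def indicator_def not_less ennreal_le_1 split: if_splits)
      qed
      finally show ?thesis by (simp add: emeasure_space_1)
    qed
    then show "finite_measure P" by (intro finite_measureI) (auto simp: top_unique)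
    show "finite_measure Q"
    proof (rule finite_measureI)
      have "emeasure Q (space Q) = emeasure P (space P)" using eu[of 0] nnP[of "\<lambda>_. 1"] nnQ[of "\<lambda>_. 1"] by simp
      then show "emeasure Q (space Q) \<noteq> \<infinity>" using fin by (auto simp: top_unique)
    qed
    show "sets P = sets borel" "sets Q = sets borel" by (auto simp: P_def Q_def)
    have "emeasure P {..<0} = (\<integral>\<^sup>+x. ind {..<0} x \<partial>P)" by (subst nn_integral_indicator) (auto simp: P_def)
    also have "\<dots> = (\<E> w. u w * ind {..<0} (X t w))" by (rule nnP) simp
    also have "\<dots> = 0" by (subst nn_integral_0_iff_AE) (use P0 in auto)
    finally show "emeasure P {..<0} = 0" .
    have "emeasure Q {..<0} = (\<integral>\<^sup>+x. ind {..<0} x \<partial>Q)" by (subst nn_integral_indicator) (auto simp: Q_def)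
    also have "\<dots> = (\<E> w. v w * ind {..<0} (X t w))" by (rule nnQ) simp
    also have "\<dots> = (\<E> w. 0)" by (intro nn_integral_cong) (auto simp: v_def indicator_def)
    finally show "emeasure Q {..<0} = 0" by simp
    show "(\<integral>s. exp (- (real m * s)) \<partial>P) = (\<integral>s. exp (- (real m * s)) \<partial>Q)" for m
    proof -
      have "(\<integral>s. exp (- (real m * s)) \<partial>P) = enn2real (\<integral>\<^sup>+s. expm (real m * s) \<partial>P)"
        by (rule integral_eq_nn_integral) (auto simp: P_def)
      also have "\<dots> = enn2real (\<integral>\<^sup>+s. expm (real m * s) \<partial>Q)" using eu by (subst nnP, simp, subst nnQ) auto
      also have "\<dots> = (\<integral>s. exp (- (real m * s)) \<partial>Q)"
        by (rule integral_eq_nn_integral[symmetric]) (auto simp: Q_def)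
      finally show ?thesis .
    qed
  qed
  have [measurable]: "(\<lambda>x. ennreal (exp x) * \<phi> x) \<in> borel_measurable borel" by measurable
  have e1: "expm x * ennreal (exp x) = 1" for x :: real
    by (simp add: ennreal_mult'[symmetric] exp_add[symmetric])
  have "(\<E> w. \<phi> (X t w) * ind {0} (reflected X t w)) = (\<E> w. u w * (ennreal (exp (X t w)) * \<phi> (X t w)))"
  proof (intro nn_integral_cong)
    fix w
    have "u w * (ennreal (exp (X t w)) * \<phi> (X t w)) = (expm (X t w) * ennreal (exp (X t w))) * (\<phi> (X t w) * ind {0} (reflected X t w))"
      by (simp add: u_def mult_ac)
    then show "\<phi> (X t w) * ind {0} (reflected X t w) = u w * (ennreal (exp (X t w)) * \<phi> (X t w))" by (simp add: e1)
  qed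
  also have "\<dots> = (\<E> w. v w * (ennreal (exp (X t w)) * \<phi> (X t w)))"
    using nnP[of "\<lambda>x. ennreal (exp x) * \<phi> x"] nnQ[of "\<lambda>x. ennreal (exp x) * \<phi> x"] \<open>P = Q\<close> by simp
  also have "\<dots> = (\<E> w. ennreal (a * max 0 (X t w) / t) * \<phi> (X t w))"
  proof (intro nn_integral_cong)
    fix w
    have "v w = ennreal (a * max 0 (X t w) / t) * expm (X t w)"
      unfolding v_def by (subst ennreal_mult''[symmetric]) (auto simp: mult_ac)
    then have "v w * (ennreal (exp (X t w)) * \<phi> (X t w)) = (expm (X t w) * ennreal (exp (X t w))) * (ennreal (a * max 0 (X t w) / t) * \<phi> (X t w))"
      by (simp add: mult_ac)
    then show "v w * (ennreal (exp (X t w)) * \<phi> (X t w)) = ennreal (a * max 0 (X t w) / t) * \<phi> (X t w)" by (simp add: e1)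
  qed
  finally show ?thesis .
qed

end

lemma UNIV_borel_pair: "UNIV \<in> sets (borel \<Otimes>\<^sub>M borel :: (real \<times> real) measure)"
  using sets.top[of "borel \<Otimes>\<^sub>M borel :: (real \<times> real) measure"] by (simp add: space_pair_measure)

section \<open>Identification of the drift coefficient\<close>

context spec_neg
begin

lemma discounted_level_integral:
  assumes q: "0 < q"
  shows "(\<L> x. (\<E> w. expm (q * \<tau> x w) * hit x w)) = ennreal (1 / \<Phi> q)"
proof -
  have "(\<E> w. expm (q * \<tau> x w) * hit x w) =
      expm (x * \<Phi> q) * ind {0..} x" for x
  proof (cases "0 \<le> x")
    case True
    have "(\<E> w. expm (q * \<tau> x w) * hit x w) =
      (\<E> w. ennreal (exp_time q (first_passage X x w)))"
      using True by (intro nn_integral_cong) (auto simp: exp_time_def indicator_def)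
    then show ?thesis using nn_laplace_T[OF q True] True by simp
  qed simp
  then show ?thesis using nn_integral_exp_half_line[OF \<Phi>_pos[OF q]] by simp
qed

lemma tail_shift:
  assumes ns: "sets n = sets excursion_space" and r: "0 < r"
  shows "(\<L> t. expm (q * t) * (ind {0<..} t * (ind {0<..t} r * lifetime_tail n (t - r)))) =
    expm (q * r) * (\<L> u. expm (q * u) * (ind {0..} u * lifetime_tail n u))"
proof -
  note [measurable] = lifetime_tail_measurable[OF ns]
  have ind: "ind {0<..t} r = (ind {0<..} r * ind {r..} t :: ennreal)" for t by (auto simp: indicator_def)
  have "(\<L> t. expm (q * t) * (ind {0<..} t * (ind {0<..t} r * lifetime_tail n (t - r)))) =
    (\<L> u. expm (q * (r + 1 * u)) * (ind {0<..} (r + 1 * u) * (ind {0<..r + 1 * u} r * lifetime_tail n (r + 1 * u - r))))"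
    by (subst nn_integral_real_affine[of _ 1 r]) (auto simp: ind)
  also have "\<dots> = (\<L> u. expm (q * r) * (expm (q * u) * (ind {0..} u * lifetime_tail n u)))"
  proof (intro nn_integral_cong)
    fix u
    have "expm (q * (r + 1 * u)) = expm (q * r) * expm (q * u)"
      by (simp add: ennreal_mult'[symmetric] exp_add[symmetric] algebra_simps)
    then show "expm (q * (r + 1 * u)) * (ind {0<..} (r + 1 * u) * (ind {0<..r + 1 * u} r * lifetime_tail n (r + 1 * u - r))) =
      expm (q * r) * (expm (q * u) * (ind {0..} u * lifetime_tail n u))"
      using r by (cases "0 \<le> u") (auto simp: mult_ac)
  qed
  also have "\<dots> = expm (q * r) * (\<L> u. expm (q * u) * (ind {0..} u * lifetime_tail n u))"
    by (rule nn_integral_cmult) measurable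
  finally show ?thesis .
qed

lemma first_passage_positive_AE: "0 < x ==> AE w in M. 0 < first_passage X x w"
  using snp_AE by eventually_elim (rule T_pos)

text \<open>The total mass one of \<open>sup_law M X t\<close> is decomposed and integrated against \<open>exp (- q t) dt\<close>.\<close>

lemma exponent_identity:
  assumes L: "sup_local_time M X L" and n: "excursion_measure M X L n"
    and a: "0 \<le> a" "AE w in M. \<forall>t\<ge>0. occupation t w = a * running_sup X t w" and q: "0 < q"
  shows "ennreal (\<Phi> q / q) = ennreal (\<Phi> 1) * (\<L> u. expm (q * u) * (ind {0..} u * lifetime_tail n u)) + ennreal a"
    (is "_ = _ * ?N + _")
proof -
  have ns: "sets n = sets excursion_space" using n by (simp add: excursion_measure_def)
  note [measurable] = lifetime_tail_measurable[OF ns]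
  have rm[measurable]: "(\<lambda>z. reflected X (max 0 (fst z)) (snd z)) \<in> borel_measurable LM"
    using reflected_joint_measurable by (simp add: case_prod_beta')
  let ?T = "\<lambda>z. \<tau> (fst z) (snd z)"
  define ww where "ww t = expm (q * t) * ind {0<..} t" for t
  have [measurable]: "ww \<in> borel_measurable borel" unfolding ww_def by measurable
  define H where "H t z = ennreal (\<Phi> 1) * (ind {0<..t} (?T z) * lifetime_tail n (t - ?T z) *
    (ind {0..} (fst z) * ind {z. first_passage X (fst z) (snd z) < \<infinity>} z))" for t and z :: "real \<times> 'a"
  have Hm[measurable]: "(\<lambda>y. H (fst y) (snd y)) \<in> borel_measurable (lborel \<Otimes>\<^sub>M LM)"
  proof -
    have "ind {0<..t} r = (ind {0<..} r * ind {..0} (r - t) :: ennreal)" for t r :: real by (auto simp: indicator_def)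
    then show ?thesis unfolding H_def by simp
  qed
  have Hm'[measurable]: "H t \<in> borel_measurable LM" for t unfolding H_def by measurable
  define J where "J t = (\<E> w. ind {0} (reflected X (max 0 t) w))" for t
  have Jm[measurable]: "J \<in> borel_measurable lborel" unfolding J_def
    by (rule borel_measurable_nn_integral) (simp add: case_prod_beta')
  interpret LM: pair_sigma_finite lborel M by unfold_locales
  have Z: "sigma_finite_measure LM" by unfold_locales
  have [measurable]: "(\<lambda>t. \<integral>\<^sup>+z. H t z \<partial>LM) \<in> borel_measurable lborel"
    by (rule sigma_finite_measure.borel_measurable_nn_integral[OF Z]) (simp add: case_prod_beta')
  interpret W: pair_sigma_finite lborel "lborel \<Otimes>\<^sub>M M" by unfold_locales
  have one: "ww t * (\<integral>\<^sup>+z. H t z \<partial>LM) + ww t * J t = ww t" for t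
  proof (cases "0 < t")
    case True
    have "prob_space (sup_law M X t)" unfolding sup_law_def
      using last_sup_time_measurable[of t] running_sup_measurable[of t] True by (intro prob_space_distr) simp
    then have "1 = emeasure (sup_law M X t) UNIV"
      using prob_space.emeasure_space_1[of "sup_law M X t"] by (simp add: sup_law_def space_pair_measure)
    also have "\<dots> = (\<L> x. (\<E> w. H t (x, w))) + J t"
      using compensation[OF L n UNIV_borel_pair True] True by (simp add: H_def J_def indicator_def max_absorb2)
    also have "(\<L> x. (\<E> w. H t (x, w))) = (\<integral>\<^sup>+z. H t z \<partial>LM)"
      by (rule nn_integral_fst) measurable
    finally show ?thesis by (metis distrib_left mult.right_neutral)
  qed (simp add: ww_def)
  have "ennreal (1 / q) = (\<L> t. ww t)"
  proof -
    have "(\<L> t. ww t) = (\<L> t. expm (q * t) * ind {0..} t)"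
      using AE_lborel_singleton[of "0::real"] by (intro nn_integral_cong_AE) (auto simp: ww_def indicator_def)
    then show ?thesis using exp_discount[OF q] by simp
  qed
  also have "\<dots> = (\<L> t. ww t * (\<integral>\<^sup>+z. H t z \<partial>LM) + ww t * J t)" unfolding one ..
  also have "\<dots> = (\<L> t. ww t * (\<integral>\<^sup>+z. H t z \<partial>LM)) + (\<L> t. ww t * J t)"
    by (rule nn_integral_add) measurable
  also have "(\<L> t. ww t * J t) = ennreal a * ennreal (1 / \<Phi> q)"
  proof -
    have [measurable]: "(\<lambda>w. ind {0} (reflected X (max 0 t) w) :: ennreal) \<in> borel_measurable M" for t
      using reflected_measurable[of "max 0 t"] by measurable
    have "(\<L> t. ww t * J t) = (\<L> t. (\<E> w. expm (q * fst (t, X (max 0 t) w)) * ind {0} (reflected X (max 0 t) w) * ind {0<..} t))"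
      unfolding J_def by (subst nn_integral_cmult[symmetric]) (auto simp: ww_def mult_ac)
    also have "\<dots> = (\<L> x. (\<E> w. ennreal a * (expm (q * fst (\<tau> x w, x)) * hit x w)))"
      by (rule occupation_identity[OF a]) measurable
    also have "\<dots> = (\<L> x. ennreal a * (\<E> w. expm (q * \<tau> x w) * hit x w))"
      by (intro nn_integral_cong) (simp add: nn_integral_cmult)
    also have "\<dots> = ennreal a * (\<L> x. (\<E> w. expm (q * \<tau> x w) * hit x w))"
    proof (rule nn_integral_cmult)
      have "(\<lambda>z. expm (q * ?T z) * (ind {0..} (fst z) * ind {z. first_passage X (fst z) (snd z) < \<infinity>} z)) \<in> borel_measurable LM"
        by measurable
      from borel_measurable_nn_integral_fst[OF this]
      show "(\<lambda>x. \<integral>\<^sup>+w. expm (q * \<tau> x w) * hit x w \<partial>M) \<in> borel_measurable lborel"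
        by (simp add: indicator_def)
    qed
    finally show ?thesis unfolding discounted_level_integral[OF q] .
  qed
  also have "(\<L> t. ww t * (\<integral>\<^sup>+z. H t z \<partial>LM)) = ennreal (\<Phi> 1) * ?N * ennreal (1 / \<Phi> q)"
  proof -
    have "(\<L> t. ww t * (\<integral>\<^sup>+z. H t z \<partial>LM)) = (\<L> t. (\<integral>\<^sup>+z. ww t * H t z \<partial>LM))"
      by (simp add: nn_integral_cmult)
    also have "\<dots> = (\<integral>\<^sup>+z. (\<L> t. ww t * H t z) \<partial>LM)"
      using W.Fubini'[of "\<lambda>t z. ww t * H t z"] by (simp add: case_prod_beta')
    also have "\<dots> = (\<integral>\<^sup>+z. ennreal (\<Phi> 1) * ?N * (ind {0<..} (?T z) * (expm (q * ?T z) * (ind {0..} (fst z) * ind {z. first_passage X (fst z) (snd z) < \<infinity>} z))) \<partial>LM)"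
    proof (intro nn_integral_cong)
      fix z :: "real \<times> 'a"
      define k :: ennreal where "k = ind {0..} (fst z) * ind {z. first_passage X (fst z) (snd z) < \<infinity>} z"
      define r where "r = ?T z"
      have "(\<L> t. ww t * H t z) = (\<L> t. (ennreal (\<Phi> 1) * k) * (expm (q * t) * (ind {0<..} t * (ind {0<..t} r * lifetime_tail n (t - r)))))"
        by (intro nn_integral_cong) (simp add: ww_def H_def k_def r_def mult_ac)
      also have "\<dots> = (ennreal (\<Phi> 1) * k) * (\<L> t. expm (q * t) * (ind {0<..} t * (ind {0<..t} r * lifetime_tail n (t - r))))"
      proof (rule nn_integral_cmult)
        have "ind {0<..t} r = (ind {0<..} r * ind {r..} t :: ennreal)" for t by (auto simp: indicator_def)
        then show "(\<lambda>t. expm (q * t) * (ind {0<..} t * (ind {0<..t} r * lifetime_tail n (t - r)))) \<in> borel_measurable lborel" by simp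
      qed
      \<comment> \<open>Passage at time 0 is cut off here; almost surely it concerns level 0 alone,
        so it is restored below up to a null set of levels.\<close>
      also have "(\<L> t. expm (q * t) * (ind {0<..} t * (ind {0<..t} r * lifetime_tail n (t - r)))) = ind {0<..} r * (expm (q * r) * ?N)"
        using tail_shift[OF ns, of r q] by (cases "0 < r") auto
      finally show "(\<L> t. ww t * H t z) = ennreal (\<Phi> 1) * ?N * (ind {0<..} (?T z) * (expm (q * ?T z) * (ind {0..} (fst z) * ind {z. first_passage X (fst z) (snd z) < \<infinity>} z)))"
        unfolding k_def[symmetric] r_def[symmetric] by (simp add: mult_ac)
    qed
    also have "\<dots> = ennreal (\<Phi> 1) * ?N * (\<integral>\<^sup>+z. ind {0<..} (?T z) * (expm (q * ?T z) * (ind {0..} (fst z) * ind {z. first_passage X (fst z) (snd z) < \<infinity>} z)) \<partial>LM)"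
      by (rule nn_integral_cmult) measurable
    also have "(\<integral>\<^sup>+z. ind {0<..} (?T z) * (expm (q * ?T z) * (ind {0..} (fst z) * ind {z. first_passage X (fst z) (snd z) < \<infinity>} z)) \<partial>LM) =
      (\<L> x. (\<E> w. ind {0<..} (?T (x, w)) * (expm (q * ?T (x, w)) * (ind {0..} (fst (x, w)) * ind {z. first_passage X (fst z) (snd z) < \<infinity>} (x, w)))))"
      by (rule nn_integral_fst[symmetric]) measurable
    also have "\<dots> = (\<L> x. (\<E> w. expm (q * \<tau> x w) * hit x w))"
    proof (rule nn_integral_cong_AE)
      show "AE x in lborel. (\<E> w. ind {0<..} (?T (x, w)) * (expm (q * ?T (x, w)) * (ind {0..} (fst (x, w)) * ind {z. first_passage X (fst z) (snd z) < \<infinity>} (x, w)))) =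
        (\<E> w. expm (q * \<tau> x w) * hit x w)"
        using AE_lborel_singleton[of "0::real"]
      proof eventually_elim
        case (elim x)
        show ?case
        proof (cases "0 < x")
          case True
          show ?thesis
          proof (rule nn_integral_cong_AE)
            show "AE w in M. ind {0<..} (?T (x, w)) * (expm (q * ?T (x, w)) * (ind {0..} (fst (x, w)) * ind {z. first_passage X (fst z) (snd z) < \<infinity>} (x, w))) =
              expm (q * \<tau> x w) * hit x w"
              using first_passage_positive_AE[OF True]
            proof eventually_elim
              case (elim w)
              then show ?case by (cases "first_passage X x w") (auto simp: indicator_def)
            qed
          qed
        next
          case False
          then show ?thesis using elim by (intro nn_integral_cong) (auto simp: indicator_def)
        qed
      qed
    qed
    finally show ?thesis unfolding discounted_level_integral[OF q] .
  qed
  finally have "ennreal (1 / q) = (ennreal (\<Phi> 1) * ?N + ennreal a) * ennreal (1 / \<Phi> q)" by (simp add: distrib_right)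
  then have "ennreal (1 / q) * ennreal (\<Phi> q) = (ennreal (\<Phi> 1) * ?N + ennreal a) * (ennreal (1 / \<Phi> q) * ennreal (\<Phi> q))" by (simp add: mult_ac)
  moreover have "ennreal (1 / \<Phi> q) * ennreal (\<Phi> q) = 1" "ennreal (1 / q) * ennreal (\<Phi> q) = ennreal (\<Phi> q / q)"
    using \<Phi>_pos[OF q] q by (simp_all add: ennreal_mult'[symmetric])
  ultimately show ?thesis by simp
qed

lemma drift_eq:
  assumes L: "sup_local_time M X L" and n: "excursion_measure M X L n" and d: "drift_coefficient M (ladder_time L) d"
    and a: "0 \<le> a" "AE w in M. \<forall>t\<ge>0. occupation t w = a * running_sup X t w"
  shows "a = \<Phi> 1 * d"
proof -
  have ns: "sets n = sets excursion_space" using n by (simp add: excursion_measure_def)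
  note [measurable] = lifetime_tail_measurable[OF ns] ladder_time_measurable[OF L]
  have c: "0 < \<Phi> 1" by (rule \<Phi>_pos) simp
  obtain k and \<pi> :: "real measure" where \<pi>: "sets \<pi> = sets borel" "emeasure \<pi> {..0} = 0" "(\<integral>\<^sup>+y. ennreal (min 1 y) \<partial>\<pi>) < \<infinity>"
    and le: "laplace_exponent M (ladder_time L) (\<lambda>q. k + d * q + (\<integral>y. (1 - exp (- (q * y))) \<partial>\<pi>))"
    using d unfolding drift_coefficient_def by blast
  define \<psi> where "\<psi> q = k + d * q + (\<integral>y. (1 - exp (- (q * y))) \<partial>\<pi>)" for q
  \<comment> \<open>The ladder time at \<open>\<Phi> 1\<close> is the passage time of level 1;
    comparing their Laplace transforms relates the two exponents.\<close>
  have \<Phi>\<psi>: "\<Phi> q = \<Phi> 1 * \<psi> q" if q: "0 < q" for q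
  proof -
    have "exp (- (\<Phi> 1 * \<psi> q)) = (\<integral>w. exp_time q (ladder_time L (\<Phi> 1) w) \<partial>M)"
      using le q c unfolding laplace_exponent_def \<psi>_def by simp
    also have "\<dots> = (\<integral>w. exp_time q (first_passage X 1 w) \<partial>M)"
    proof (rule integral_cong_AE)
      show "AE w in M. exp_time q (ladder_time L (\<Phi> 1) w) = exp_time q (first_passage X 1 w)"
        using ladder_time_eq[OF L]
      proof eventually_elim
        case (elim w)
        then show ?case using elim[rule_format, of 1] by simp
      qed
    qed measurable
    also have "\<dots> = exp (- \<Phi> q)" using laplace_T[OF q, of 1] by simp
    finally show ?thesis by simp
  qed
  have "(\<lambda>m. \<psi> (real (Suc m)) / real (Suc m)) \<longlonglongrightarrow> d"
    unfolding \<psi>_def by (rule subordinator_exponent_limit[OF \<pi>])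
  then have "(\<lambda>m. \<Phi> 1 * (\<psi> (real (Suc m)) / real (Suc m))) \<longlonglongrightarrow> \<Phi> 1 * d" by (intro tendsto_mult tendsto_const)
  moreover have "\<Phi> 1 * (\<psi> (real (Suc m)) / real (Suc m)) = \<Phi> (real (Suc m)) / real (Suc m)" for m
    unfolding \<Phi>\<psi>[of "real (Suc m)", OF of_nat_0_less_iff[THEN iffD2, OF zero_less_Suc]] by (rule times_divide_eq_right)
  ultimately have lim1: "(\<lambda>m. ennreal (\<Phi> (real (Suc m)) / real (Suc m))) \<longlonglongrightarrow> ennreal (\<Phi> 1 * d)"
    by (intro tendsto_ennrealI) (simp only:)
  define N where "N q = (\<L> u. expm (q * u) * (ind {0..} u * lifetime_tail n u))" for q
  note ei = exponent_identity[OF L n a, folded N_def]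
  \<comment> \<open>The left side of \<open>exponent_identity\<close> at \<open>q = 1\<close> is
    finite and \<open>\<Phi> 1\<close> positive, so the tail integral is finite and can dominate
    those for larger \<open>q\<close>.\<close>
  have N1: "N 1 < \<infinity>"
  proof (rule ccontr)
    assume "\<not> N 1 < \<infinity>"
    then have "ennreal (\<Phi> 1 / 1) = \<infinity>" using ei[of 1] c by (simp add: not_less top_unique ennreal_mult_top)
    then show False by simp
  qed
  have tf: "AE u in lborel. expm (1 * u) * (ind {0..} u * lifetime_tail n u) \<noteq> \<infinity>"
    using N1 unfolding N_def by (intro nn_integral_PInf_AE) auto
  have "(\<lambda>m. N (real (Suc m))) \<longlonglongrightarrow> (\<integral>\<^sup>+u. 0 \<partial>(lborel :: real measure))" unfolding N_def
  proof (rule nn_integral_dominated_convergence[where w="\<lambda>u. expm (1 * u) * (ind {0..} u * lifetime_tail n u)"])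
    show "AE u in lborel. expm (real (Suc m) * u) * (ind {0..} u * lifetime_tail n u) \<le> expm (1 * u) * (ind {0..} u * lifetime_tail n u)" for m
    proof (rule AE_I2)
      fix u :: real
      show "expm (real (Suc m) * u) * (ind {0..} u * lifetime_tail n u) \<le> expm (1 * u) * (ind {0..} u * lifetime_tail n u)"
      proof (cases "0 \<le> u")
        case True
        then have "1 * u \<le> real (Suc m) * u" by (intro mult_right_mono) auto
        then show ?thesis by (intro mult_right_mono ennreal_leI) auto
      qed simp
    qed
    show "AE u in lborel. (\<lambda>m. expm (real (Suc m) * u) * (ind {0..} u * lifetime_tail n u)) \<longlonglongrightarrow> 0"
      using tf AE_lborel_singleton[of "0::real"]
    proof eventually_elim
      case (elim u)
      show ?case
      proof (cases "0 < u")
        case True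
        then have "lifetime_tail n u \<noteq> \<infinity>" using elim(1) by (auto simp: ennreal_mult_eq_top_iff)
        then obtain b where b: "0 \<le> b" "lifetime_tail n u = ennreal b" by (cases "lifetime_tail n u") auto
        have "(\<lambda>m. exp (- (real (Suc m) * u)) * b) \<longlonglongrightarrow> 0" using True by real_asymp
        then have "(\<lambda>m. ennreal (exp (- (real (Suc m) * u)) * b)) \<longlonglongrightarrow> ennreal 0" by (rule tendsto_ennrealI)
        then show ?thesis using True b by (simp add: ennreal_mult' del: of_nat_Suc)
      next
        case False
        then show ?thesis using elim(2) by simp
      qed
    qed
  qed (use N1 in \<open>auto simp: N_def\<close>)
  then have "(\<lambda>m. ennreal (\<Phi> 1) * N (real (Suc m)) + ennreal a) \<longlonglongrightarrow> ennreal (\<Phi> 1) * 0 + ennreal a"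
    by (intro tendsto_add tendsto_const ennreal_tendsto_cmult) auto
  moreover have "ennreal (\<Phi> (real (Suc m)) / real (Suc m)) = ennreal (\<Phi> 1) * N (real (Suc m)) + ennreal a" for m
    by (rule ei) simp
  ultimately have "(\<lambda>m. ennreal (\<Phi> (real (Suc m)) / real (Suc m))) \<longlonglongrightarrow> ennreal a"
    by (simp only: mult_zero_right add_0)
  then have "ennreal (\<Phi> 1 * d) = ennreal a" using lim1 by (rule LIMSEQ_unique[rotated])
  moreover have "0 \<le> \<Phi> 1 * d" using c d by (simp add: drift_coefficient_def)
  ultimately show ?thesis using a(1) by (simp add: ennreal_inj)
qed

end

section \<open>The joint law\<close>

context spec_neg
begin

lemma finite_law_integral:
  fixes g :: "real => ennreal"
  assumes L: "sup_local_time M X L" and x: "0 \<le> x" and [measurable]: "g \<in> borel_measurable borel"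
  shows "(\<integral>\<^sup>+s. g s \<partial>finite_law M (ladder_time L (\<Phi> 1 * x))) =
    (\<E> w. g (\<tau> x w) * ind {w. first_passage X x w < \<infinity>} w)"
proof -
  note [measurable] = ladder_time_measurable[OF L]
  let ?A = "{w \<in> space M. ladder_time L (\<Phi> 1 * x) w < \<infinity>}"
  have A: "?A \<in> sets M" by measurable
  have m: "(\<lambda>w. real_of_ereal (ladder_time L (\<Phi> 1 * x) w)) \<in> borel_measurable (restrict_space M ?A)"
    by (rule measurable_restrict_space1) measurable
  have "(\<integral>\<^sup>+s. g s \<partial>finite_law M (ladder_time L (\<Phi> 1 * x))) =
      (\<integral>\<^sup>+w. g (real_of_ereal (ladder_time L (\<Phi> 1 * x) w)) \<partial>restrict_space M ?A)"
    unfolding finite_law_def using m by (intro nn_integral_distr) auto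
  also have "\<dots> = (\<E> w. g (real_of_ereal (ladder_time L (\<Phi> 1 * x) w)) * ind ?A w)"
    using A by (intro nn_integral_restrict_space) (simp add: Int_absorb2 Int_commute sets.sets_into_space)
  also have "\<dots> = (\<E> w. g (\<tau> x w) * ind {w. first_passage X x w < \<infinity>} w)"
  proof (rule nn_integral_cong_AE)
    show "AE w in M. g (real_of_ereal (ladder_time L (\<Phi> 1 * x) w)) * ind ?A w =
        g (\<tau> x w) * ind {w. first_passage X x w < \<infinity>} w"
      using ladder_time_eq[OF L] AE_space
    proof eventually_elim
      case (elim w)
      then have "ladder_time L (\<Phi> 1 * x) w = first_passage X x w" using x by blast
      then show ?case using elim(2) by (auto simp: indicator_def)
    qed
  qed
  finally show ?thesis .
qed

lemma pos_law_integral: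
  fixes g :: "real => ennreal"
  assumes s: "0 \<le> s" and [measurable]: "g \<in> borel_measurable borel"
  shows "(\<integral>\<^sup>+x. g x \<partial>pos_law M X s) = (\<E> w. ind {0..} (X s w) * g (X s w))"
  unfolding pos_law_def using X_measurable[OF s] by (subst nn_integral_density) (auto simp: nn_integral_distr)

definition passage_term :: "(real => real) measure => (real \<times> real) set => real => ennreal" where
  "passage_term n A t = (\<L> x. (\<E> w. passage_density n A t x w))"

lemma passage_term_ladder_level:
  assumes L: "sup_local_time M X L" and ns: "sets n = sets excursion_space" and A[measurable]: "A \<in> sets borel2"
  shows "(\<E> w. passage_density n A t x w) =
    (\<integral>\<^sup>+s\<in>{0<..t}. ennreal (\<Phi> 1) * lifetime_tail n (t - s) * ind A (s, x) \<partial>finite_law M (ladder_time L (\<Phi> 1 * x))) * ind {0..} x"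
proof (cases "0 \<le> x")
  case True
  note [measurable] = lifetime_tail_measurable[OF ns]
  have "(\<lambda>s. ennreal (\<Phi> 1) * lifetime_tail n (t - s) * ind A (s, x) * ind {0<..t} s) \<in> borel_measurable borel" by measurable
  then show ?thesis using finite_law_integral[OF L True] True by (auto intro!: nn_integral_cong simp: mult_ac)
qed simp

lemma passage_term_ladder:
  assumes "sup_local_time M X L" "sets n = sets excursion_space" "A \<in> sets borel2"
  shows "passage_term n A t = (\<integral>\<^sup>+x\<in>{0..}. (\<integral>\<^sup>+s\<in>{0<..t}. ennreal (\<Phi> 1) * lifetime_tail n (t - s) *
                 ind A (s, x) \<partial>finite_law M (ladder_time L (\<Phi> 1 * x))) \<partial>lborel)"
  unfolding passage_term_def passage_term_ladder_level[OF assms] ..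

text \<open>The integrand depends on the passage time and the level alone, as \<open>kendall\<close>
  requires; the factor \<open>max 0\<close> there takes over the restriction of
  \<open>pos_law\<close> to nonnegative values.\<close>

lemma passage_term_kendall:
  assumes ns: "sets n = sets excursion_space" and A[measurable]: "A \<in> sets borel2"
  shows "passage_term n A t = (\<integral>\<^sup>+s\<in>{0<..t}. (\<integral>\<^sup>+x. ennreal (\<Phi> 1 * x / s) * lifetime_tail n (t - s) *
                 ind A (s, x) \<partial>pos_law M X s) \<partial>lborel)"
proof -
  note [measurable] = lifetime_tail_measurable[OF ns]
  have c: "0 \<le> \<Phi> 1" using \<Phi>_pos[of 1] by simp
  define h :: "real \<times> real => ennreal" where
    "h z = ennreal (\<Phi> 1) * (ind A z * ind {0<..t} (fst z) * lifetime_tail n (t - fst z))" for z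
  have [measurable]: "h \<in> borel_measurable borel2" unfolding h_def by measurable
  have "passage_term n A t = (\<L> x. (\<E> w. h (\<tau> x w, x) * hit x w))"
    unfolding passage_term_def h_def by (simp add: mult_ac)
  also have "\<dots> = (\<L> s. (\<E> w. ennreal (max 0 (X (max 0 s) w) / s) * h (s, X (max 0 s) w) * ind {0<..} s))"
    by (rule kendall[symmetric]) measurable
  also have "\<dots> = (\<integral>\<^sup>+s\<in>{0<..t}. (\<integral>\<^sup>+x. ennreal (\<Phi> 1 * x / s) * lifetime_tail n (t - s) *
                 ind A (s, x) \<partial>pos_law M X s) \<partial>lborel)"
  proof (intro nn_integral_cong)
    fix s :: real
    show "(\<E> w. ennreal (max 0 (X (max 0 s) w) / s) * h (s, X (max 0 s) w) * ind {0<..} s) =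
      (\<integral>\<^sup>+x. ennreal (\<Phi> 1 * x / s) * lifetime_tail n (t - s) * ind A (s, x) \<partial>pos_law M X s) * ind {0<..t} s"
    proof (cases "0 < s \<and> s \<le> t")
      case True
      have "(\<integral>\<^sup>+x. ennreal (\<Phi> 1 * x / s) * lifetime_tail n (t - s) * ind A (s, x) \<partial>pos_law M X s) =
        (\<E> w. ind {0..} (X s w) * (ennreal (\<Phi> 1 * X s w / s) * lifetime_tail n (t - s) * ind A (s, X s w)))"
        using True by (intro pos_law_integral) auto
      also have "\<dots> = (\<E> w. ennreal (max 0 (X (max 0 s) w) / s) * h (s, X (max 0 s) w) * ind {0<..} s)"
      proof (intro nn_integral_cong)
        fix w
        have "ennreal (\<Phi> 1 * X s w / s) = ennreal (X s w / s) * ennreal (\<Phi> 1)"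
          using c by (subst ennreal_mult''[symmetric]) (auto simp: mult_ac)
        then show "ind {0..} (X s w) * (ennreal (\<Phi> 1 * X s w / s) * lifetime_tail n (t - s) * ind A (s, X s w)) =
          ennreal (max 0 (X (max 0 s) w) / s) * h (s, X (max 0 s) w) * ind {0<..} s"
          using True by (cases "0 \<le> X s w") (auto simp: h_def max_absorb1 max_absorb2 mult_ac)
      qed
      finally show ?thesis using True by simp
    qed (auto simp: h_def)
  qed
  finally show ?thesis .
qed

lemma sup_law_emeasure:
  assumes "sup_local_time M X L" "excursion_measure M X L n" "A \<in> sets borel2" "0 < t"
  shows "emeasure (sup_law M X t) A = passage_term n A t + (\<E> w. ind A (t, X t w) * ind {0} (reflected X t w))"
  using compensation[OF assms] unfolding passage_term_def .

text \<open>Regularity produces negative values at arbitrarily small times, incompatible with the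
  reversed event \<open>stays_nonneg t\<close>.\<close>

lemma not_at_sup_of_regular:
  assumes r: "regular_for M X {..<0}" and A[measurable]: "A \<in> sets borel2" and t: "0 < t"
  shows "(\<E> w. ind A (t, X t w) * ind {0} (reflected X t w)) = 0"
proof -
  have "(\<E> w. ind A (t, X t w) * ind {0} (reflected X t w)) = (\<E> w. ind A (t, X t w) * ind (stays_nonneg t) w)"
    by (rule time_reversal_nn[OF t, of "\<lambda>x. ind A (t, x)"]) measurable
  also have "\<dots> = (\<E> w. 0)"
  proof (rule nn_integral_cong_AE)
    show "AE w in M. ind A (t, X t w) * ind (stays_nonneg t) w = (0 :: ennreal)"
      using r unfolding regular_for_def
    proof eventually_elim
      case (elim w)
      then have "(INF u\<in>{u. 0 < u \<and> X u w \<in> {..<0}}. ereal u) < ereal t" using t by simp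
      then obtain u where "0 < u" "X u w < 0" "u < t" by (auto simp: INF_less_iff)
      then have "w \<notin> stays_nonneg t" by (auto simp: stays_nonneg_def intro!: bexI[of _ u])
      then show ?case by simp
    qed
  qed
  finally show ?thesis by simp
qed

lemma at_sup_term:
  assumes L: "sup_local_time M X L" and n: "excursion_measure M X L n" and d: "drift_coefficient M (ladder_time L) d"
    and t: "0 < t" and \<phi>[measurable]: "\<phi> \<in> borel_measurable borel"
  shows "(\<E> w. \<phi> (X t w) * ind {0} (reflected X t w)) = (\<E> w. ennreal (d * \<Phi> 1 * max 0 (X t w) / t) * \<phi> (X t w))"
proof -
  obtain a where a: "0 \<le> a" "AE w in M. \<forall>t\<ge>0. occupation t w = a * running_sup X t w"
    by (rule occupation_proportional)
  show ?thesis using d_term[OF a t \<phi>] unfolding drift_eq[OF L n d a] by (simp add: mult.commute)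
qed

lemma at_sup_term_pos_law:
  assumes L: "sup_local_time M X L" and n: "excursion_measure M X L n" and d: "drift_coefficient M (ladder_time L) d"
    and t: "0 < t" and A[measurable]: "A \<in> sets borel2"
  shows "(\<E> w. ind A (t, X t w) * ind {0} (reflected X t w)) = (\<integral>\<^sup>+x. ennreal (d * \<Phi> 1 * x / t) * ind A (t, x) \<partial>pos_law M X t)"
proof -
  have "(\<E> w. ind A (t, X t w) * ind {0} (reflected X t w)) = (\<E> w. ennreal (d * \<Phi> 1 * max 0 (X t w) / t) * ind A (t, X t w))"
    by (rule at_sup_term[OF L n d t, of "\<lambda>x. ind A (t, x)"]) measurable
  also have "\<dots> = (\<E> w. ind {0..} (X t w) * (ennreal (d * \<Phi> 1 * X t w / t) * ind A (t, X t w)))"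
    by (intro nn_integral_cong) (auto simp: indicator_def max_def)
  also have "\<dots> = (\<integral>\<^sup>+x. ennreal (d * \<Phi> 1 * x / t) * ind A (t, x) \<partial>pos_law M X t)"
    using t by (intro pos_law_integral[symmetric]) auto
  finally show ?thesis .
qed

lemma running_sup_distributed:
  assumes L: "sup_local_time M X L" and n: "excursion_measure M X L n" and r: "regular_for M X {..<0}" and t: "0 < t"
  shows "distributed M lborel (running_sup X t)
    (\<lambda>x. (\<integral>\<^sup>+s\<in>{0<..t}. ennreal (\<Phi> 1) * lifetime_tail n (t - s) \<partial>finite_law M (ladder_time L (\<Phi> 1 * x))) * ind {0..} x)"
    (is "distributed _ _ _ ?f")
proof -
  have ns: "sets n = sets excursion_space" using n by (simp add: excursion_measure_def)
  note [measurable] = lifetime_tail_measurable[OF ns] last_sup_time_measurable[OF less_imp_le[OF t]] running_sup_measurable[OF less_imp_le[OF t]]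
  have f: "?f = (\<lambda>x. \<integral>\<^sup>+w. ennreal (\<Phi> 1) * (ind {0<..t} (\<tau> x w) *
        lifetime_tail n (t - \<tau> x w) * hit x w) \<partial>M)"
    using passage_term_ladder_level[OF L ns UNIV_borel_pair, of _ t] by simp
  have fm: "?f \<in> borel_measurable lborel"
  proof -
    let ?T = "\<lambda>z. \<tau> (fst z) (snd z)"
    have "(\<lambda>z. ennreal (\<Phi> 1) * (ind {0<..t} (?T z) *
        lifetime_tail n (t - ?T z) * (ind {0..} (fst z) * ind {z. first_passage X (fst z) (snd z) < \<infinity>} z))) \<in> borel_measurable LM"
      by measurable
    from borel_measurable_nn_integral_fst[OF this] show ?thesis unfolding f by (simp add: indicator_def)
  qed
  have "distr M lborel (running_sup X t) = density lborel ?f"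
  proof (rule measure_eqI)
    fix B assume "B \<in> sets (distr M lborel (running_sup X t))"
    then have B[measurable]: "B \<in> sets borel" by simp
    have UB: "UNIV \<times> B \<in> sets (borel \<Otimes>\<^sub>M (borel :: real measure))" by (intro pair_measureI) auto
    have "emeasure (distr M lborel (running_sup X t)) B = emeasure M (running_sup X t -` B \<inter> space M)"
      by (rule emeasure_distr) auto
    also have "\<dots> = emeasure (sup_law M X t) (UNIV \<times> B)"
      unfolding sup_law_def using UB by (subst emeasure_distr) (auto intro!: arg_cong[where f="emeasure M"])
    also have "\<dots> = passage_term n (UNIV \<times> B) t"
      using sup_law_emeasure[OF L n UB t] not_at_sup_of_regular[OF r UB t] by simp
    also have "\<dots> = (\<L> x. ?f x * ind B x)"
      unfolding passage_term_ladder[OF L ns UB]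
      by (intro nn_integral_cong) (auto simp: indicator_def)
    also have "\<dots> = emeasure (density lborel ?f) B" using fm B by (subst emeasure_density) auto
    finally show "emeasure (distr M lborel (running_sup X t)) B = emeasure (density lborel ?f) B" .
  qed simp
  then show ?thesis using fm by (simp add: distributed_def)
qed

text \<open>Each law splits into an excursion part and a part at the supremum. Integrated over
  \<open>t\<close>, the latter is one side of Kendall's identity, which transfers it to the law of
  the ladder time.\<close>

lemma sup_law_time_integral:
  assumes L: "sup_local_time M X L" and n: "excursion_measure M X L n" and d: "drift_coefficient M (ladder_time L) d"
    and A[measurable]: "A \<in> sets (borel \<Otimes>\<^sub>M borel \<Otimes>\<^sub>M borel)"
  shows "(\<integral>\<^sup>+t\<in>{0..}. (\<integral>\<^sup>+(s, x). ind A (s, x, t) \<partial>sup_law M X t) \<partial>lborel) =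
    (\<integral>\<^sup>+t\<in>{0..}. (\<integral>\<^sup>+x\<in>{0..}. (\<integral>\<^sup>+s\<in>{0<..t}. ennreal (\<Phi> 1) * lifetime_tail n (t - s) *
               ind A (s, x, t) \<partial>finite_law M (ladder_time L (\<Phi> 1 * x))) \<partial>lborel) \<partial>lborel) +
    (\<integral>\<^sup>+x\<in>{0..}. (\<integral>\<^sup>+t. ennreal (d * \<Phi> 1) * ind A (t, x, t)
               \<partial>finite_law M (ladder_time L (\<Phi> 1 * x))) \<partial>lborel)"
proof -
  have ns: "sets n = sets excursion_space" using n by (simp add: excursion_measure_def)
  note [measurable] = lifetime_tail_measurable[OF ns]
  have dc: "0 \<le> d * \<Phi> 1" using d \<Phi>_pos[of 1] by (simp add: drift_coefficient_def)
  define At where "At t = {z :: real \<times> real. (fst z, snd z, t) \<in> A}" for t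
  have At: "At t \<in> sets borel2" for t
  proof -
    have "{z \<in> space borel2. (fst z, snd z, t) \<in> A} \<in> sets borel2" by measurable
    then show ?thesis by (simp add: At_def space_pair_measure)
  qed
  have iAt: "ind (At t) (s, x) = (ind A (s, x, t) :: ennreal)" for s x t by (simp add: At_def indicator_def)
  define J where "J t = (\<E> w. ennreal (max 0 (X (max 0 t) w) / t) * (ennreal (d * \<Phi> 1) * ind A (t, X (max 0 t) w, t)) * ind {0<..} t)" for t
  have J: "(\<E> w. ind (At t) (t, X t w) * ind {0} (reflected X t w)) = J t" if t: "0 < t" for t
  proof -
    have "(\<E> w. ind A (t, X t w, t) * ind {0} (reflected X t w)) = (\<E> w. ennreal (d * \<Phi> 1 * max 0 (X t w) / t) * ind A (t, X t w, t))"
      by (rule at_sup_term[OF L n d t, of "\<lambda>x. ind A (t, x, t)"]) measurable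
    also have "\<dots> = J t" unfolding J_def
    proof (intro nn_integral_cong)
      fix w
      have "ennreal (d * \<Phi> 1 * max 0 (X t w) / t) = ennreal (max 0 (X t w) / t) * ennreal (d * \<Phi> 1)"
        using dc by (subst ennreal_mult''[symmetric]) (auto simp: mult_ac)
      then show "ennreal (d * \<Phi> 1 * max 0 (X t w) / t) * ind A (t, X t w, t) =
          ennreal (max 0 (X (max 0 t) w) / t) * (ennreal (d * \<Phi> 1) * ind A (t, X (max 0 t) w, t)) * ind {0<..} t"
        using t by (simp add: max_absorb2 mult_ac)
    qed
    finally show ?thesis unfolding iAt .
  qed
  have Jm[measurable]: "J \<in> borel_measurable lborel"
  proof -
    have "(\<lambda>z. ennreal (max 0 (X (max 0 (fst z)) (snd z)) / fst z) * (ennreal (d * \<Phi> 1) * ind A (fst z, X (max 0 (fst z)) (snd z), fst z)) * ind {0<..} (fst z)) \<in> borel_measurable LM"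
      by measurable
    from borel_measurable_nn_integral_fst[OF this] show ?thesis unfolding J_def by simp
  qed
  \<comment> \<open>Joint measurability in time, level and path: the condition that passage happens
    in \<open>{0<..t}\<close> is written as a product of conditions on the passage time and on its
    difference with \<open>t\<close>.\<close>
  have Im[measurable]: "(\<lambda>t. passage_term n (At t) t) \<in> borel_measurable lborel"
  proof -
    have T3[measurable]: "(\<lambda>z. first_passage X (snd (fst z)) (snd z)) \<in> borel_measurable ((lborel \<Otimes>\<^sub>M lborel) \<Otimes>\<^sub>M M)"
    proof -
      have "(\<lambda>z. (snd (fst z), snd z)) \<in> measurable ((lborel \<Otimes>\<^sub>M lborel) \<Otimes>\<^sub>M M) LM" by measurable
      from measurable_compose[OF this T_pair_measurable] show ?thesis by simp
    qed
    let ?T = "\<lambda>z. \<tau> (snd (fst z)) (snd z)"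
    let ?G = "\<lambda>z. ennreal (\<Phi> 1) * (ind A (?T z, snd (fst z), fst (fst z)) * (ind {0<..} (?T z) * ind {..0} (?T z - fst (fst z))) *
        lifetime_tail n (fst (fst z) - ?T z) * (ind {0..} (snd (fst z)) * ind {z. first_passage X (snd (fst z)) (snd z) < \<infinity>} z))"
    have "?G \<in> borel_measurable ((lborel \<Otimes>\<^sub>M lborel) \<Otimes>\<^sub>M M)" by measurable
    from borel_measurable_nn_integral_fst[OF this]
    have "(\<lambda>y. \<integral>\<^sup>+w. ?G (y, w) \<partial>M) \<in> borel_measurable (lborel \<Otimes>\<^sub>M lborel)" .
    from lborel.borel_measurable_nn_integral_fst[OF this]
    have "(\<lambda>t. \<integral>\<^sup>+x. (\<E> w. ?G ((t, x), w)) \<partial>lborel) \<in> borel_measurable lborel" .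
    moreover have "ind {0<..t} r = (ind {0<..} r * ind {..0} (r - t) :: ennreal)" for t r :: real by (auto simp: indicator_def)
    then have "passage_term n (At t) t = (\<L> x. (\<E> w. ?G ((t, x), w)))" for t
      unfolding passage_term_def iAt by (intro nn_integral_cong) (simp add: indicator_def)
    ultimately show ?thesis by simp
  qed
  have "(\<integral>\<^sup>+t\<in>{0..}. (\<integral>\<^sup>+(s, x). ind A (s, x, t) \<partial>sup_law M X t) \<partial>lborel) =
      (\<L> t. passage_term n (At t) t * ind {0..} t + J t)"
  proof (rule nn_integral_cong_AE)
    show "AE t in lborel. (\<integral>\<^sup>+(s, x). ind A (s, x, t) \<partial>sup_law M X t) * ind {0..} t = passage_term n (At t) t * ind {0..} t + J t"
      using AE_lborel_singleton[of "0::real"]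
    proof eventually_elim
      case (elim t)
      show ?case
      proof (cases "0 < t")
        case True
        have "(\<integral>\<^sup>+(s, x). ind A (s, x, t) \<partial>sup_law M X t) = (\<integral>\<^sup>+z. ind (At t) z \<partial>sup_law M X t)"
          by (intro nn_integral_cong) (auto simp: iAt)
        also have "\<dots> = emeasure (sup_law M X t) (At t)" using At by (intro nn_integral_indicator) (simp add: sup_law_def)
        also have "\<dots> = passage_term n (At t) t + J t" using sup_law_emeasure[OF L n At True] J[OF True] by simp
        finally show ?thesis using True by simp
      next
        case False
        then show ?thesis using elim by (simp add: J_def)
      qed
    qed
  qed
  also have "\<dots> = (\<integral>\<^sup>+t\<in>{0..}. passage_term n (At t) t \<partial>lborel) + (\<L> t. J t)"
    by (rule nn_integral_add) measurable
  also have "(\<L> t. J t) = (\<L> x. (\<E> w. (ennreal (d * \<Phi> 1) * ind A (\<tau> x w, x, \<tau> x w)) * hit x w))"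
    unfolding J_def using kendall[of "\<lambda>z. ennreal (d * \<Phi> 1) * ind A (fst z, snd z, fst z)"] by simp
  also have "\<dots> = (\<integral>\<^sup>+x\<in>{0..}. (\<integral>\<^sup>+t. ennreal (d * \<Phi> 1) * ind A (t, x, t) \<partial>finite_law M (ladder_time L (\<Phi> 1 * x))) \<partial>lborel)"
  proof (intro nn_integral_cong)
    fix x :: real
    show "(\<E> w. (ennreal (d * \<Phi> 1) * ind A (\<tau> x w, x, \<tau> x w)) * hit x w) =
      (\<integral>\<^sup>+t. ennreal (d * \<Phi> 1) * ind A (t, x, t) \<partial>finite_law M (ladder_time L (\<Phi> 1 * x))) * ind {0..} x"
    proof (cases "0 \<le> x")
      case True
      have "(\<integral>\<^sup>+t. ennreal (d * \<Phi> 1) * ind A (t, x, t) \<partial>finite_law M (ladder_time L (\<Phi> 1 * x))) =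
        (\<E> w. (ennreal (d * \<Phi> 1) * ind A (\<tau> x w, x, \<tau> x w)) * ind {w. first_passage X x w < \<infinity>} w)"
        by (rule finite_law_integral[OF L True]) measurable
      then show ?thesis using True by simp
    qed simp
  qed
  finally show ?thesis unfolding passage_term_ladder[OF L ns At] iAt .
qed

end

theorem proposition2:
  fixes M :: "'a measure" and X L :: "real \<Rightarrow> 'a \<Rightarrow> real"
    and \<Phi> :: "real \<Rightarrow> real" and c d :: real and n :: "(real \<Rightarrow> real) measure"
  assumes "prob_space M"
    and "levy_process M X"
    and "\<not> subordinator M X"
    and "\<not> subordinator M (\<lambda>t \<omega>. - X t \<omega>)"
    and "\<not> compound_poisson M X"
    and "no_positive_jumps M X"
    and "laplace_exponent M (first_passage X) \<Phi>"
    and "c = \<Phi> 1"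
    and "sup_local_time M X L"
    and "drift_coefficient M (ladder_time L) d"
    and "excursion_measure M X L n"
  shows
    "(regular_for M X {..<0} \<longrightarrow>
       (\<forall>t>0.
         (\<forall>A\<in>sets (borel \<Otimes>\<^sub>M borel).
            emeasure (sup_law M X t) A =
              (\<integral>\<^sup>+s\<in>{0<..t}. (\<integral>\<^sup>+x. ennreal (c * x / s) * lifetime_tail n (t - s) *
                 indicator A (s, x) \<partial>pos_law M X s) \<partial>lborel) \<and>
            emeasure (sup_law M X t) A =
              (\<integral>\<^sup>+x\<in>{0..}. (\<integral>\<^sup>+s\<in>{0<..t}. ennreal c * lifetime_tail n (t - s) *
                 indicator A (s, x) \<partial>finite_law M (ladder_time L (c * x))) \<partial>lborel)) \<and>
         distributed M lborel (running_sup X t)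
           (\<lambda>x. (\<integral>\<^sup>+s\<in>{0<..t}. ennreal c * lifetime_tail n (t - s)
                    \<partial>finite_law M (ladder_time L (c * x))) * indicator {0..} x))) \<and>
     (\<not> regular_for M X {..<0} \<longrightarrow>
       (\<forall>t>0. \<forall>A\<in>sets (borel \<Otimes>\<^sub>M borel).
          emeasure (sup_law M X t) A =
            (\<integral>\<^sup>+s\<in>{0<..t}. (\<integral>\<^sup>+x. ennreal (c * x / s) * lifetime_tail n (t - s) *
               indicator A (s, x) \<partial>pos_law M X s) \<partial>lborel) +
            (\<integral>\<^sup>+x. ennreal (d * c * x / t) * indicator A (t, x) \<partial>pos_law M X t)) \<and>
       (\<forall>A\<in>sets (borel \<Otimes>\<^sub>M borel \<Otimes>\<^sub>M borel).
          (\<integral>\<^sup>+t\<in>{0..}. (\<integral>\<^sup>+(s, x). indicator A (s, x, t) \<partial>sup_law M X t) \<partial>lborel) =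
            (\<integral>\<^sup>+t\<in>{0..}. (\<integral>\<^sup>+x\<in>{0..}. (\<integral>\<^sup>+s\<in>{0<..t}. ennreal c * lifetime_tail n (t - s) *
               indicator A (s, x, t) \<partial>finite_law M (ladder_time L (c * x))) \<partial>lborel) \<partial>lborel) +
            (\<integral>\<^sup>+x\<in>{0..}. (\<integral>\<^sup>+t. ennreal (d * c) * indicator A (t, x, t)
               \<partial>finite_law M (ladder_time L (c * x))) \<partial>lborel)))"
proof -
  interpret prob_space M by fact
  interpret spec_neg M X \<Phi> by unfold_locales (fact assms)+
  note L = \<open>sup_local_time M X L\<close> and n = \<open>excursion_measure M X L n\<close> and d = \<open>drift_coefficient M (ladder_time L) d\<close>
  have ns: "sets n = sets excursion_space" using n by (simp add: excursion_measure_def)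
  show ?thesis unfolding \<open>c = \<Phi> 1\<close>
  proof (intro conjI impI allI ballI)
    fix t :: real and A :: "(real \<times> real) set"
    assume r: "regular_for M X {..<0}" and t: "0 < t" and A: "A \<in> sets (borel \<Otimes>\<^sub>M borel)"
    have "emeasure (sup_law M X t) A = passage_term n A t"
      using sup_law_emeasure[OF L n A t] not_at_sup_of_regular[OF r A t] by simp
    then show "emeasure (sup_law M X t) A =
        (\<integral>\<^sup>+s\<in>{0<..t}. (\<integral>\<^sup>+x. ennreal (\<Phi> 1 * x / s) * lifetime_tail n (t - s) * indicator A (s, x) \<partial>pos_law M X s) \<partial>lborel)"
      and "emeasure (sup_law M X t) A =
        (\<integral>\<^sup>+x\<in>{0..}. (\<integral>\<^sup>+s\<in>{0<..t}. ennreal (\<Phi> 1) * lifetime_tail n (t - s) * indicator A (s, x) \<partial>finite_law M (ladder_time L (\<Phi> 1 * x))) \<partial>lborel)"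
      using passage_term_kendall[OF ns A, of t] passage_term_ladder[OF L ns A, of t] by simp_all
  next
    fix t :: real and A :: "(real \<times> real) set"
    assume t: "0 < t" and A: "A \<in> sets (borel \<Otimes>\<^sub>M borel)"
    show "emeasure (sup_law M X t) A =
        (\<integral>\<^sup>+s\<in>{0<..t}. (\<integral>\<^sup>+x. ennreal (\<Phi> 1 * x / s) * lifetime_tail n (t - s) * indicator A (s, x) \<partial>pos_law M X s) \<partial>lborel) +
        (\<integral>\<^sup>+x. ennreal (d * \<Phi> 1 * x / t) * indicator A (t, x) \<partial>pos_law M X t)"
      unfolding sup_law_emeasure[OF L n A t] passage_term_kendall[OF ns A] at_sup_term_pos_law[OF L n d t A] ..
  qed (rule running_sup_distributed[OF L n] sup_law_time_integral[OF L n d]; assumption)+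
qed

end
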